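(* Let $k$ be a field of characteristic $0$. Let $\pi:\mathfrak{g}\rightarrow\mathfrak{so}_{\epsilon}(V,(\ ,\ ))$ be a finite-dimensional $\epsilon$-orthogonal representation, with $\dim V\ge 2$, of colour Lie type of a finite-dimensional $\epsilon$-quadratic colour Lie algebra $(\mathfrak{g},B_{\mathfrak{g}})$. Let $\tilde{\mathfrak{g}}=\mathfrak{g}\oplus V$ be the associated colour Lie algebra, let $\tilde{D}$ be the cubic Dirac operator and let $d$ be its induced differential on $(U_{\epsilon}(\tilde{\mathfrak{g}})\otimes C_{\epsilon}(V,(\ ,\ )))^{\mathfrak{g}}$. Then (kernel and image being those of $d$ on this invariant subspace) $$Ker(d)=\mathcal{Z}_{\epsilon}(\Delta(\mathfrak{g}))\oplus Im(d).$$
   Context: Graded conventions. $\Gamma$ is an abelian group (additive) and $\epsilon:\Gamma\times\Gamma\to k^{\times}$ is a commutation factor: $\epsilon(a,b)\epsilon(b,a)=1$, $\epsilon(a+b,c)=\epsilon(a,c)\epsilon(b,c)$, $\epsilon(a,b+c)=\epsilon(a,b)\epsilon(a,c)$. For homogeneous $v,w$ write $\epsilon(v,w)=\epsilon(|v|,|w|)$, $\epsilon(v)=\epsilon(|v|,|v|)$. Formulas involving degrees are for homogeneous elements and extended by linearity; bases are homogeneous; bilinear forms are of degree $0$ ($B(V_a,V_b)=0$ unless $a+b=0$). A bilinear map $B$ is $\epsilon$-symmetric if $B(v,w)=\epsilon(v,w)B(w,v)$, $\epsilon$-antisymmetric if $B(v,w)=-\epsilon(v,w)B(w,v)$. For a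 basis $\{e_i\}$ of a finite-dimensional space with a non-degenerate $\epsilon$-symmetric form, the dual basis $\{e^i\}$ is defined by $(e_i,e^j)=\delta_{ij}$. Colour Lie algebra: a $\Gamma$-graded space with bilinear bracket satisfying $\{\mathfrak{g}_a,\mathfrak{g}_b\}\subseteq\mathfrak{g}_{a+b}$, $\{x,y\}=-\epsilon(x,y)\{y,x\}$, $\epsilon(z,x)\{x,\{y,z\}\}+\epsilon(x,y)\{y,\{z,x\}\}+\epsilon(y,z)\{z,\{x,y\}\}=0$. It is $\epsilon$-quadratic if equipped with a non-degenerate $\epsilon$-symmetric form $B$ with $B(\{x,y\},z)=-\epsilon(x,y)B(y,\{x,z\})$. $\mathfrak{so}_\epsilon(V,(\ ,\ ))$ is the colour Lie algebra spanned by homogeneous $f\in\mathrm{End}(V)$ with $(f(v),w)+\epsilon(f,v)(v,f(w))=0$, with bracket $fg-\epsilon(f,g)gf$. An $\epsilon$-orthogonal representation is a $\Gamma$-graded space $V$ with a non-degenerate $\epsilon$-symmetric form and a degree $0$ morphism of colour Lie algebras $\pi:\mathfrak{g}\to\mathfrak{so}_\epsilon(V,(\ ,\ ))$. $U_\epsilon(\mathfrak{g})=T(\mathfrak{g})/\langle x\otimes y-\epsilon(x,y)y\otimes x-\{x,y\}\rangle$; its $\epsilon$-centre is $\mathcal{Z}_\epsilon(\mathfrak{g})=\{x\in U_\epsilon(\mathfrak{g})\mid xy=\epsilon(x,y)yx\ \forall y\in U_\epsilon(\mathfrak{g})\}$. $C_\epsilon(V,(\ ,\ ))=T(V)/\langle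 x\otimes y+\epsilon(x,y)y\otimes x-2(x,y)1\rangle$, which is $\mathbb{Z}_2\times\Gamma$-graded; $\Lambda_\epsilon(V)=T(V)/\langle x\otimes y+\epsilon(x,y)y\otimes x\rangle$. Moment map: $\mu:\Lambda^2_\epsilon(V)\to\mathfrak{g}$ is given by $B_{\mathfrak{g}}(x,\mu(v,w))=(\pi(x)(v),w)$. Colour Lie type: $\pi$ is of colour Lie type if there is a degree $0$ $\epsilon$-antisymmetric bilinear map $\phi:V\times V\to V$ with $\pi(x)(\phi(v,w))=\phi(\pi(x)(v),w)+\epsilon(x,v)\phi(v,\pi(x)(w))$ and $(\phi(u,v),w)=-\epsilon(u,v)(v,\phi(u,w))$, such that $\tilde{\mathfrak{g}}=\mathfrak{g}\oplus V$, with the $\epsilon$-antisymmetric bracket extending that of $\mathfrak{g}$, $\{x,v\}=\pi(x)(v)$ and $\{v,w\}=\mu(v,w)+\phi(v,w)$ ($x\in\mathfrak{g}$, $v,w\in V$), and with $B_{\tilde{\mathfrak{g}}}=B_{\mathfrak{g}}\perp(\ ,\ )$, is an $\epsilon$-quadratic colour Lie algebra. Such a $\phi$ is fixed, and $(\tilde{\mathfrak{g}},B_{\tilde{\mathfrak{g}}})$ is the associated colour Lie algebra. The corresponding cubic term is $$\psi=\frac{1}{12}\sum_{i,j,l}(e^i,\phi(e^j,e^l))\,e_le_je_i\in C_\epsilon(V,(\ ,\ ))$$ for a basis $\{e_i\}$ of $V$ with dual basis $\{e^i\}$ (independent of the basis). Let $\tilde\epsilon((a_1,\gamma_1),(a_2,\gamma_2))=(-1)^{a_1a_2}\epsilon(\gamma_1,\gamma_2)$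 on $\mathbb{Z}_2\times\Gamma$. The space $A=U_\epsilon(\tilde{\mathfrak{g}})\otimes C_\epsilon(V,(\ ,\ ))$ (with $U_\epsilon(\tilde{\mathfrak{g}})$ of $\mathbb{Z}_2$-degree $0$) is $\mathbb{Z}_2\times\Gamma$-graded, with product $(a\otimes b)(c\otimes d)=\tilde\epsilon(b,c)\,ac\otimes bd$ and bracket $\{x,y\}=xy-\tilde\epsilon(x,y)yx$. Let $\pi_*:\mathfrak{g}\to C_\epsilon(V,(\ ,\ ))$, $\pi_*(x)=\frac14\sum_i\pi(x)(e^i)e_i$. The map $\Delta:\mathfrak{g}\to A$, $\Delta(x)=x\otimes1+1\otimes\pi_*(x)$, is a colour Lie algebra morphism and is extended to an algebra morphism $\Delta:U_\epsilon(\mathfrak{g})\to A$. Set $\mathcal{Z}_\epsilon(\Delta(\mathfrak{g})):=\Delta(\mathcal{Z}_\epsilon(\mathfrak{g}))$ and $A^{\mathfrak{g}}=\{a\in A\mid\{\Delta(x),a\}=0\ \forall x\in\mathfrak{g}\}$. Cubic Dirac operator: $\tilde D=\sum_ie^i\otimes e_i+1\otimes\psi\in A$. Induced differential: $d(a)=\{\tilde D,a\}$ for $a\in A$, restricted to $A^{\mathfrak{g}}$ (which it preserves and on which $d^2=0$). *)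

theory Defs
  imports
    Complex_Main
    "HOL-Algebra.QuotRing"
    "HOL-Algebra.Module"
    "HOL-Library.Poly_Mapping"
    "HOL-Library.Product_Plus"
    "HOL-Library.Z2"
begin

section \<open>Graded vector spaces and forms\<close>

definition commutation_factor :: "('c::ab_group_add \<Rightarrow> 'c \<Rightarrow> 'k::field) \<Rightarrow> bool" where
  "commutation_factor \<epsilon> \<longleftrightarrow>
     (\<forall>a b. \<epsilon> a b * \<epsilon> b a = 1) \<and>
     (\<forall>a b c. \<epsilon> (a + b) c = \<epsilon> a c * \<epsilon> b c) \<and>
     (\<forall>a b c. \<epsilon> a (b + c) = \<epsilon> a b * \<epsilon> a c)"

definition homog_decomp :: "('c \<Rightarrow> 'v::ab_group_add set) \<Rightarrow> 'v \<Rightarrow> ('c \<Rightarrow> 'v) \<Rightarrow> bool" where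
  "homog_decomp gr v f \<longleftrightarrow>
     (\<forall>a. f a \<in> gr a) \<and> finite {a. f a \<noteq> 0} \<and> v = (\<Sum>a | f a \<noteq> 0. f a)"

definition hcomp :: "('c \<Rightarrow> 'v::ab_group_add set) \<Rightarrow> 'v \<Rightarrow> 'c \<Rightarrow> 'v" where
  "hcomp gr v = (THE f. homog_decomp gr v f)"

locale graded_space = vector_space scale
  for scale :: "'k::field \<Rightarrow> 'v::ab_group_add \<Rightarrow> 'v" +
  fixes gr :: "'c \<Rightarrow> 'v set"
  assumes subspace_gr: "subspace (gr a)"
    and ex1_homog_decomp: "\<exists>!f. homog_decomp gr v f"
begin

definition finite_dim :: bool where
  "finite_dim \<longleftrightarrow> (\<exists>S. finite S \<and> span S = UNIV)"

definition homogeneous_basis :: "'v set \<Rightarrow> bool" where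
  "homogeneous_basis E \<longleftrightarrow> independent E \<and> span E = UNIV \<and> (\<forall>e\<in>E. \<exists>a. e \<in> gr a)"

end

definition bilinear_map ::
  "('k::field \<Rightarrow> 'a::ab_group_add \<Rightarrow> 'a) \<Rightarrow> ('k \<Rightarrow> 'b::ab_group_add \<Rightarrow> 'b) \<Rightarrow>
   ('k \<Rightarrow> 'd::ab_group_add \<Rightarrow> 'd) \<Rightarrow> ('a \<Rightarrow> 'b \<Rightarrow> 'd) \<Rightarrow> bool" where
  "bilinear_map s1 s2 s3 f \<longleftrightarrow>
     (\<forall>y. Vector_Spaces.linear s1 s3 (\<lambda>x. f x y)) \<and> (\<forall>x. Vector_Spaces.linear s2 s3 (f x))"

definition nondegenerate_eps_symmetric_form ::
  "('c::ab_group_add \<Rightarrow> 'c \<Rightarrow> 'k::field) \<Rightarrow> ('k \<Rightarrow> 'v::ab_group_add \<Rightarrow> 'v) \<Rightarrow> ('c \<Rightarrow> 'v set) \<Rightarrow>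
   ('v \<Rightarrow> 'v \<Rightarrow> 'k) \<Rightarrow> bool" where
  "nondegenerate_eps_symmetric_form \<epsilon> s gr B \<longleftrightarrow>
     bilinear_map s s (*) B \<and>
     (\<forall>a b. \<forall>v\<in>gr a. \<forall>w\<in>gr b. a + b \<noteq> 0 \<longrightarrow> B v w = 0) \<and>
     (\<forall>a b. \<forall>v\<in>gr a. \<forall>w\<in>gr b. B v w = \<epsilon> a b * B w v) \<and>
     (\<forall>v. (\<forall>w. B v w = 0) \<longrightarrow> v = 0)"

definition dual_vector :: "('v \<Rightarrow> 'v \<Rightarrow> 'k::field) \<Rightarrow> 'v set \<Rightarrow> 'v \<Rightarrow> 'v" where
  "dual_vector B E e = (THE w. \<forall>e'\<in>E. B e' w = (if e' = e then 1 else 0))"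


section \<open>Colour Lie algebras and their orthogonal representations\<close>

definition colour_lie_algebra ::
  "('c::ab_group_add \<Rightarrow> 'c \<Rightarrow> 'k::field) \<Rightarrow> ('k \<Rightarrow> 'g::ab_group_add \<Rightarrow> 'g) \<Rightarrow> ('c \<Rightarrow> 'g set) \<Rightarrow>
   ('g \<Rightarrow> 'g \<Rightarrow> 'g) \<Rightarrow> bool" where
  "colour_lie_algebra \<epsilon> s gr br \<longleftrightarrow>
     graded_space s gr \<and>
     bilinear_map s s s br \<and>
     (\<forall>a b. \<forall>x\<in>gr a. \<forall>y\<in>gr b. br x y \<in> gr (a + b)) \<and>
     (\<forall>a b. \<forall>x\<in>gr a. \<forall>y\<in>gr b. br x y = - s (\<epsilon> a b) (br y x)) \<and>
     (\<forall>a b c. \<forall>x\<in>gr a. \<forall>y\<in>gr b. \<forall>z\<in>gr c.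
        s (\<epsilon> c a) (br x (br y z)) + s (\<epsilon> a b) (br y (br z x)) + s (\<epsilon> b c) (br z (br x y)) = 0)"

definition quadratic_colour_lie_algebra ::
  "('c::ab_group_add \<Rightarrow> 'c \<Rightarrow> 'k::field) \<Rightarrow> ('k \<Rightarrow> 'g::ab_group_add \<Rightarrow> 'g) \<Rightarrow> ('c \<Rightarrow> 'g set) \<Rightarrow>
   ('g \<Rightarrow> 'g \<Rightarrow> 'g) \<Rightarrow> ('g \<Rightarrow> 'g \<Rightarrow> 'k) \<Rightarrow> bool" where
  "quadratic_colour_lie_algebra \<epsilon> s gr br B \<longleftrightarrow>
     colour_lie_algebra \<epsilon> s gr br \<and>
     nondegenerate_eps_symmetric_form \<epsilon> s gr B \<and>
     (\<forall>a b. \<forall>x\<in>gr a. \<forall>y\<in>gr b. \<forall>z. B (br x y) z = - \<epsilon> a b * B y (br x z))"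

text \<open>The homogeneous component of degree \<open>a\<close> of the colour Lie algebra
  \<open>\<ss>\<oo>\<^sub>\<epsilon>(V, B)\<close>.\<close>

definition so_eps ::
  "('c::ab_group_add \<Rightarrow> 'c \<Rightarrow> 'k::field) \<Rightarrow> ('k \<Rightarrow> 'v::ab_group_add \<Rightarrow> 'v) \<Rightarrow> ('c \<Rightarrow> 'v set) \<Rightarrow>
   ('v \<Rightarrow> 'v \<Rightarrow> 'k) \<Rightarrow> 'c \<Rightarrow> ('v \<Rightarrow> 'v) set" where
  "so_eps \<epsilon> s gr B a =
     {f. Vector_Spaces.linear s s f \<and>
         (\<forall>b. \<forall>v\<in>gr b. f v \<in> gr (a + b)) \<and>
         (\<forall>b. \<forall>v\<in>gr b. \<forall>w. B (f v) w + \<epsilon> a b * B v (f w) = 0)}"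

definition orthogonal_representation ::
  "('c::ab_group_add \<Rightarrow> 'c \<Rightarrow> 'k::field) \<Rightarrow> ('k \<Rightarrow> 'g::ab_group_add \<Rightarrow> 'g) \<Rightarrow> ('c \<Rightarrow> 'g set) \<Rightarrow>
   ('g \<Rightarrow> 'g \<Rightarrow> 'g) \<Rightarrow> ('k \<Rightarrow> 'v::ab_group_add \<Rightarrow> 'v) \<Rightarrow> ('c \<Rightarrow> 'v set) \<Rightarrow> ('v \<Rightarrow> 'v \<Rightarrow> 'k) \<Rightarrow>
   ('g \<Rightarrow> 'v \<Rightarrow> 'v) \<Rightarrow> bool" where
  "orthogonal_representation \<epsilon> sg gg br sV gV B \<pi> \<longleftrightarrow>
     graded_space sV gV \<and>
     nondegenerate_eps_symmetric_form \<epsilon> sV gV B \<and>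
     (\<forall>v. Vector_Spaces.linear sg sV (\<lambda>x. \<pi> x v)) \<and>
     (\<forall>a. \<forall>x\<in>gg a. \<pi> x \<in> so_eps \<epsilon> sV gV B a) \<and>
     (\<forall>a b. \<forall>x\<in>gg a. \<forall>y\<in>gg b. \<forall>v.
        \<pi> (br x y) v = \<pi> x (\<pi> y v) - sV (\<epsilon> a b) (\<pi> y (\<pi> x v)))"

definition moment_map ::
  "('g \<Rightarrow> 'g \<Rightarrow> 'k) \<Rightarrow> ('v \<Rightarrow> 'v \<Rightarrow> 'k) \<Rightarrow> ('g \<Rightarrow> 'v \<Rightarrow> 'v) \<Rightarrow> 'v \<Rightarrow> 'v \<Rightarrow> 'g" where
  "moment_map Bg B \<pi> v w = (THE u. \<forall>x. Bg x u = B (\<pi> x v) w)"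

definition dsum_scale ::
  "('k \<Rightarrow> 'g \<Rightarrow> 'g) \<Rightarrow> ('k \<Rightarrow> 'v \<Rightarrow> 'v) \<Rightarrow> 'k \<Rightarrow> 'g \<times> 'v \<Rightarrow> 'g \<times> 'v" where
  "dsum_scale sg sV c p = (sg c (fst p), sV c (snd p))"

definition dsum_grading :: "('c \<Rightarrow> 'g set) \<Rightarrow> ('c \<Rightarrow> 'v set) \<Rightarrow> 'c \<Rightarrow> ('g \<times> 'v) set" where
  "dsum_grading gg gV a = gg a \<times> gV a"

definition dsum_form ::
  "('g \<Rightarrow> 'g \<Rightarrow> 'k::field) \<Rightarrow> ('v \<Rightarrow> 'v \<Rightarrow> 'k) \<Rightarrow> 'g \<times> 'v \<Rightarrow> 'g \<times> 'v \<Rightarrow> 'k" where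
  "dsum_form Bg B p q = Bg (fst p) (fst q) + B (snd p) (snd q)"

text \<open>The bracket of \<open>\<gg> \<oplus> V\<close>. The double sum is the bilinear extension of
  \<open>(v, y) \<mapsto> \<epsilon>(v, y) \<pi>(y)(v)\<close>, that is, of \<open>- {v, y}\<close> for \<open>v \<in> V\<close> and \<open>y \<in> \<gg>\<close>.\<close>

definition dsum_bracket ::
  "('c::ab_group_add \<Rightarrow> 'c \<Rightarrow> 'k::field) \<Rightarrow> ('c \<Rightarrow> 'g::ab_group_add set) \<Rightarrow> ('g \<Rightarrow> 'g \<Rightarrow> 'g) \<Rightarrow>
   ('g \<Rightarrow> 'g \<Rightarrow> 'k) \<Rightarrow> ('k \<Rightarrow> 'v::ab_group_add \<Rightarrow> 'v) \<Rightarrow> ('c \<Rightarrow> 'v set) \<Rightarrow> ('v \<Rightarrow> 'v \<Rightarrow> 'k) \<Rightarrow>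
   ('g \<Rightarrow> 'v \<Rightarrow> 'v) \<Rightarrow> ('v \<Rightarrow> 'v \<Rightarrow> 'v) \<Rightarrow> 'g \<times> 'v \<Rightarrow> 'g \<times> 'v \<Rightarrow> 'g \<times> 'v" where
  "dsum_bracket \<epsilon> gg br Bg sV gV B \<pi> \<phi> = (\<lambda>(x, v) (y, w).
     (br x y + moment_map Bg B \<pi> v w,
      \<pi> x w
      - (\<Sum>a | hcomp gV v a \<noteq> 0. \<Sum>b | hcomp gg y b \<noteq> 0.
           sV (\<epsilon> a b) (\<pi> (hcomp gg y b) (hcomp gV v a)))
      + \<phi> v w))"

definition colour_lie_type ::
  "('c::ab_group_add \<Rightarrow> 'c \<Rightarrow> 'k::field) \<Rightarrow> ('k \<Rightarrow> 'g::ab_group_add \<Rightarrow> 'g) \<Rightarrow> ('c \<Rightarrow> 'g set) \<Rightarrow>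
   ('g \<Rightarrow> 'g \<Rightarrow> 'g) \<Rightarrow> ('g \<Rightarrow> 'g \<Rightarrow> 'k) \<Rightarrow> ('k \<Rightarrow> 'v::ab_group_add \<Rightarrow> 'v) \<Rightarrow> ('c \<Rightarrow> 'v set) \<Rightarrow>
   ('v \<Rightarrow> 'v \<Rightarrow> 'k) \<Rightarrow> ('g \<Rightarrow> 'v \<Rightarrow> 'v) \<Rightarrow> ('v \<Rightarrow> 'v \<Rightarrow> 'v) \<Rightarrow> bool" where
  "colour_lie_type \<epsilon> sg gg br Bg sV gV B \<pi> \<phi> \<longleftrightarrow>
     bilinear_map sV sV sV \<phi> \<and>
     (\<forall>a b. \<forall>v\<in>gV a. \<forall>w\<in>gV b. \<phi> v w \<in> gV (a + b)) \<and>
     (\<forall>a b. \<forall>v\<in>gV a. \<forall>w\<in>gV b. \<phi> v w = - sV (\<epsilon> a b) (\<phi> w v)) \<and>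
     (\<forall>a b. \<forall>x\<in>gg a. \<forall>v\<in>gV b. \<forall>w.
        \<pi> x (\<phi> v w) = \<phi> (\<pi> x v) w + sV (\<epsilon> a b) (\<phi> v (\<pi> x w))) \<and>
     (\<forall>a b. \<forall>u\<in>gV a. \<forall>v\<in>gV b. \<forall>w. B (\<phi> u v) w = - \<epsilon> a b * B v (\<phi> u w)) \<and>
     quadratic_colour_lie_algebra \<epsilon> (dsum_scale sg sV) (dsum_grading gg gV)
       (dsum_bracket \<epsilon> gg br Bg sV gV B \<pi> \<phi>) (dsum_form Bg B)"


section \<open>Algebras over a field\<close>

text \<open>Algebras over the field \<open>'k\<close> are records of type \<open>('k, 'a) module\<close>, which carry a
  multiplication and a unit.\<close>

definition lin_span :: "('k, 'a, 'm) module_scheme \<Rightarrow> 'a set \<Rightarrow> 'a set" where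
  "lin_span M S = {(\<Oplus>\<^bsub>M\<^esub>x\<in>F. c x \<odot>\<^bsub>M\<^esub> x) | c F. finite F \<and> F \<subseteq> S}"

definition quot_algebra :: "('k, 'a, 'm) module_scheme \<Rightarrow> 'a set \<Rightarrow> ('k, 'a set) module" where
  "quot_algebra R I =
     ring.extend (R Quot I) (module.fields (\<lambda>c X. \<Union>x\<in>X. I +>\<^bsub>R\<^esub> (c \<odot>\<^bsub>R\<^esub> x)))"

definition alg_hom ::
  "('k, 'a, 'm) module_scheme \<Rightarrow> ('k, 'b, 'n) module_scheme \<Rightarrow> ('a \<Rightarrow> 'b) set" where
  "alg_hom M N =
     {h \<in> ring_hom M N. \<forall>c. \<forall>x\<in>carrier M. h (c \<odot>\<^bsub>M\<^esub> x) = c \<odot>\<^bsub>N\<^esub> h x}"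

definition homog_decomp_in ::
  "('k, 'a, 'm) module_scheme \<Rightarrow> ('i \<Rightarrow> 'a set) \<Rightarrow> 'a \<Rightarrow> ('i \<Rightarrow> 'a) \<Rightarrow> bool" where
  "homog_decomp_in M gr x f \<longleftrightarrow>
     (\<forall>i. f i \<in> gr i) \<and> finite {i. f i \<noteq> \<zero>\<^bsub>M\<^esub>} \<and> x = (\<Oplus>\<^bsub>M\<^esub>i\<in>{i. f i \<noteq> \<zero>\<^bsub>M\<^esub>}. f i)"

definition hcomp_in ::
  "('k, 'a, 'm) module_scheme \<Rightarrow> ('i \<Rightarrow> 'a set) \<Rightarrow> 'a \<Rightarrow> 'i \<Rightarrow> 'a" where
  "hcomp_in M gr x = (THE f. homog_decomp_in M gr x f)"

definition hsupp :: "('k, 'a, 'm) module_scheme \<Rightarrow> ('i \<Rightarrow> 'a set) \<Rightarrow> 'a \<Rightarrow> 'i set" where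
  "hsupp M gr x = {i. hcomp_in M gr x i \<noteq> \<zero>\<^bsub>M\<^esub>}"

text \<open>The bilinear extension of \<open>(x, y) \<mapsto> \<chi>(x, y) y x\<close>.\<close>

definition twisted_flip ::
  "('i \<Rightarrow> 'i \<Rightarrow> 'k) \<Rightarrow> ('k, 'a, 'm) module_scheme \<Rightarrow> ('i \<Rightarrow> 'a set) \<Rightarrow> 'a \<Rightarrow> 'a \<Rightarrow> 'a" where
  "twisted_flip \<chi> M gr x y =
     (\<Oplus>\<^bsub>M\<^esub>i\<in>hsupp M gr x. \<Oplus>\<^bsub>M\<^esub>j\<in>hsupp M gr y.
        \<chi> i j \<odot>\<^bsub>M\<^esub> (hcomp_in M gr y j \<otimes>\<^bsub>M\<^esub> hcomp_in M gr x i))"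

definition colour_bracket ::
  "('i \<Rightarrow> 'i \<Rightarrow> 'k) \<Rightarrow> ('k, 'a, 'm) module_scheme \<Rightarrow> ('i \<Rightarrow> 'a set) \<Rightarrow> 'a \<Rightarrow> 'a \<Rightarrow> 'a" where
  "colour_bracket \<chi> M gr x y = x \<otimes>\<^bsub>M\<^esub> y \<ominus>\<^bsub>M\<^esub> twisted_flip \<chi> M gr x y"

definition eps_centre ::
  "('i \<Rightarrow> 'i \<Rightarrow> 'k) \<Rightarrow> ('k, 'a, 'm) module_scheme \<Rightarrow> ('i \<Rightarrow> 'a set) \<Rightarrow> 'a set" where
  "eps_centre \<chi> M gr =
     {x \<in> carrier M. \<forall>y\<in>carrier M. x \<otimes>\<^bsub>M\<^esub> y = twisted_flip \<chi> M gr x y}"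

text \<open>For an algebra generated by the image of \<open>\<iota>\<close>, where the elements of \<open>D i\<close> have degree
  \<open>i\<close>: the component of degree \<open>i\<close> is spanned by the monomials of total degree \<open>i\<close>.\<close>

definition generated_grading ::
  "('k, 'a, 'm) module_scheme \<Rightarrow> ('v \<Rightarrow> 'a) \<Rightarrow> ('i::monoid_add \<Rightarrow> 'v set) \<Rightarrow> 'i \<Rightarrow> 'a set" where
  "generated_grading M \<iota> D i =
     lin_span M {foldr (\<lambda>v p. \<iota> v \<otimes>\<^bsub>M\<^esub> p) vs \<one>\<^bsub>M\<^esub> | vs ds.
       list_all2 (\<lambda>v d. v \<in> D d) vs ds \<and> sum_list ds = i}"


section \<open>Tensor, enveloping and Clifford algebras\<close>

datatype 'v fword = FWord (letters: "'v list")

instantiation fword :: (type) monoid_add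
begin

definition "0 = FWord []"

definition "u + w = FWord (letters u @ letters w)"

instance
  by standard (simp_all add: zero_fword_def plus_fword_def)

end

definition free_algebra :: "('k::field, 'v fword \<Rightarrow>\<^sub>0 'k) module" where
  "free_algebra =
     \<lparr>carrier = UNIV, mult = (*), one = 1, zero = 0, add = (+),
      smult = (\<lambda>c. Poly_Mapping.map ((*) c))\<rparr>"

definition free_gen :: "'v \<Rightarrow> 'v fword \<Rightarrow>\<^sub>0 'k::field" where
  "free_gen v = Poly_Mapping.single (FWord [v]) 1"

text \<open>\<open>T(V)\<close> is the free algebra on the set \<open>V\<close> modulo the relations making
  \<open>V \<rightarrow> T(V)\<close> linear.\<close>

definition tensor_ideal ::
  "('k::field \<Rightarrow> 'v::ab_group_add \<Rightarrow> 'v) \<Rightarrow> ('v fword \<Rightarrow>\<^sub>0 'k) set" where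
  "tensor_ideal s = Idl\<^bsub>free_algebra :: ('k, 'v fword \<Rightarrow>\<^sub>0 'k) module\<^esub>
     ({free_gen (v + w) - free_gen v - free_gen w | v w. True} \<union>
      {free_gen (s c v) - Poly_Mapping.map ((*) c) (free_gen v) | c v. True})"

definition tensor_algebra ::
  "('k::field \<Rightarrow> 'v::ab_group_add \<Rightarrow> 'v) \<Rightarrow> ('k, ('v fword \<Rightarrow>\<^sub>0 'k) set) module" where
  "tensor_algebra s = quot_algebra free_algebra (tensor_ideal s)"

definition tensor_gen ::
  "('k::field \<Rightarrow> 'v::ab_group_add \<Rightarrow> 'v) \<Rightarrow> 'v \<Rightarrow> ('v fword \<Rightarrow>\<^sub>0 'k) set" where
  "tensor_gen s v =
     tensor_ideal s +>\<^bsub>free_algebra :: ('k, 'v fword \<Rightarrow>\<^sub>0 'k) module\<^esub> free_gen v"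

type_synonym ('k, 'v) tquot = "('v fword \<Rightarrow>\<^sub>0 'k) set set"

definition enveloping_ideal ::
  "('c \<Rightarrow> 'c \<Rightarrow> 'k::field) \<Rightarrow> ('k \<Rightarrow> 'g::ab_group_add \<Rightarrow> 'g) \<Rightarrow> ('c \<Rightarrow> 'g set) \<Rightarrow>
   ('g \<Rightarrow> 'g \<Rightarrow> 'g) \<Rightarrow> ('k, 'g) tquot" where
  "enveloping_ideal \<epsilon> s gr br = (let T = tensor_algebra s; \<iota> = tensor_gen s in
     Idl\<^bsub>T\<^esub> {(\<iota> x \<otimes>\<^bsub>T\<^esub> \<iota> y \<ominus>\<^bsub>T\<^esub> \<epsilon> a b \<odot>\<^bsub>T\<^esub> (\<iota> y \<otimes>\<^bsub>T\<^esub> \<iota> x)) \<ominus>\<^bsub>T\<^esub> \<iota> (br x y) | a b x y.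
       x \<in> gr a \<and> y \<in> gr b})"

definition enveloping_algebra ::
  "('c \<Rightarrow> 'c \<Rightarrow> 'k::field) \<Rightarrow> ('k \<Rightarrow> 'g::ab_group_add \<Rightarrow> 'g) \<Rightarrow> ('c \<Rightarrow> 'g set) \<Rightarrow>
   ('g \<Rightarrow> 'g \<Rightarrow> 'g) \<Rightarrow> ('k, ('k, 'g) tquot) module" where
  "enveloping_algebra \<epsilon> s gr br = quot_algebra (tensor_algebra s) (enveloping_ideal \<epsilon> s gr br)"

definition enveloping_gen ::
  "('c \<Rightarrow> 'c \<Rightarrow> 'k::field) \<Rightarrow> ('k \<Rightarrow> 'g::ab_group_add \<Rightarrow> 'g) \<Rightarrow> ('c \<Rightarrow> 'g set) \<Rightarrow>
   ('g \<Rightarrow> 'g \<Rightarrow> 'g) \<Rightarrow> 'g \<Rightarrow> ('k, 'g) tquot" where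
  "enveloping_gen \<epsilon> s gr br x =
     enveloping_ideal \<epsilon> s gr br +>\<^bsub>tensor_algebra s\<^esub> tensor_gen s x"

definition enveloping_grading ::
  "('c::ab_group_add \<Rightarrow> 'c \<Rightarrow> 'k::field) \<Rightarrow> ('k \<Rightarrow> 'g::ab_group_add \<Rightarrow> 'g) \<Rightarrow> ('c \<Rightarrow> 'g set) \<Rightarrow>
   ('g \<Rightarrow> 'g \<Rightarrow> 'g) \<Rightarrow> 'c \<Rightarrow> ('k, 'g) tquot set" where
  "enveloping_grading \<epsilon> s gr br =
     generated_grading (enveloping_algebra \<epsilon> s gr br) (enveloping_gen \<epsilon> s gr br) gr"

definition clifford_ideal ::
  "('c \<Rightarrow> 'c \<Rightarrow> 'k::field) \<Rightarrow> ('k \<Rightarrow> 'v::ab_group_add \<Rightarrow> 'v) \<Rightarrow> ('c \<Rightarrow> 'v set) \<Rightarrow>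
   ('v \<Rightarrow> 'v \<Rightarrow> 'k) \<Rightarrow> ('k, 'v) tquot" where
  "clifford_ideal \<epsilon> s gr B = (let T = tensor_algebra s; \<iota> = tensor_gen s in
     Idl\<^bsub>T\<^esub> {(\<iota> x \<otimes>\<^bsub>T\<^esub> \<iota> y \<oplus>\<^bsub>T\<^esub> \<epsilon> a b \<odot>\<^bsub>T\<^esub> (\<iota> y \<otimes>\<^bsub>T\<^esub> \<iota> x)) \<ominus>\<^bsub>T\<^esub> (2 * B x y) \<odot>\<^bsub>T\<^esub> \<one>\<^bsub>T\<^esub> | a b x y.
       x \<in> gr a \<and> y \<in> gr b})"

definition clifford_algebra ::
  "('c \<Rightarrow> 'c \<Rightarrow> 'k::field) \<Rightarrow> ('k \<Rightarrow> 'v::ab_group_add \<Rightarrow> 'v) \<Rightarrow> ('c \<Rightarrow> 'v set) \<Rightarrow>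
   ('v \<Rightarrow> 'v \<Rightarrow> 'k) \<Rightarrow> ('k, ('k, 'v) tquot) module" where
  "clifford_algebra \<epsilon> s gr B = quot_algebra (tensor_algebra s) (clifford_ideal \<epsilon> s gr B)"

definition clifford_gen ::
  "('c \<Rightarrow> 'c \<Rightarrow> 'k::field) \<Rightarrow> ('k \<Rightarrow> 'v::ab_group_add \<Rightarrow> 'v) \<Rightarrow> ('c \<Rightarrow> 'v set) \<Rightarrow>
   ('v \<Rightarrow> 'v \<Rightarrow> 'k) \<Rightarrow> 'v \<Rightarrow> ('k, 'v) tquot" where
  "clifford_gen \<epsilon> s gr B v = clifford_ideal \<epsilon> s gr B +>\<^bsub>tensor_algebra s\<^esub> tensor_gen s v"

definition clifford_grading ::
  "('c::ab_group_add \<Rightarrow> 'c \<Rightarrow> 'k::field) \<Rightarrow> ('k \<Rightarrow> 'v::ab_group_add \<Rightarrow> 'v) \<Rightarrow> ('c \<Rightarrow> 'v set) \<Rightarrow>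
   ('v \<Rightarrow> 'v \<Rightarrow> 'k) \<Rightarrow> bit \<times> 'c \<Rightarrow> ('k, 'v) tquot set" where
  "clifford_grading \<epsilon> s gr B =
     generated_grading (clifford_algebra \<epsilon> s gr B) (clifford_gen \<epsilon> s gr B)
       (\<lambda>(p, a). if p = 1 then gr a else {})"


section \<open>Graded tensor product of algebras\<close>

text \<open>The free vector space on \<open>M \<times> N\<close>, with the bilinear extension of
  \<open>(a, b) (c, d) = \<chi>(b, c) (a c, b d)\<close> for homogeneous \<open>b\<close> and \<open>c\<close>. This product only becomes
  associative and unital after dividing by the relations of the tensor product.\<close>

definition pretensor_mult ::
  "('i \<Rightarrow> 'i \<Rightarrow> 'k::field) \<Rightarrow> ('k, 'a, 'm) module_scheme \<Rightarrow> ('i \<Rightarrow> 'a set) \<Rightarrow>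
   ('k, 'b, 'n) module_scheme \<Rightarrow> ('i \<Rightarrow> 'b set) \<Rightarrow>
   ('a \<times> 'b \<Rightarrow>\<^sub>0 'k) \<Rightarrow> ('a \<times> 'b \<Rightarrow>\<^sub>0 'k) \<Rightarrow> ('a \<times> 'b \<Rightarrow>\<^sub>0 'k)" where
  "pretensor_mult \<chi> M grM N grN p q =
     (\<Sum>(a, b)\<in>Poly_Mapping.keys p. \<Sum>(c, d)\<in>Poly_Mapping.keys q.
        \<Sum>i\<in>hsupp N grN b. \<Sum>j\<in>hsupp M grM c.
          Poly_Mapping.single (a \<otimes>\<^bsub>M\<^esub> hcomp_in M grM c j, hcomp_in N grN b i \<otimes>\<^bsub>N\<^esub> d)
            (Poly_Mapping.lookup p (a, b) * Poly_Mapping.lookup q (c, d) * \<chi> i j))"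

definition pretensor ::
  "('i \<Rightarrow> 'i \<Rightarrow> 'k::field) \<Rightarrow> ('k, 'a, 'm) module_scheme \<Rightarrow> ('i \<Rightarrow> 'a set) \<Rightarrow>
   ('k, 'b, 'n) module_scheme \<Rightarrow> ('i \<Rightarrow> 'b set) \<Rightarrow> ('k, 'a \<times> 'b \<Rightarrow>\<^sub>0 'k) module" where
  "pretensor \<chi> M grM N grN =
     \<lparr>carrier = {p. Poly_Mapping.keys p \<subseteq> carrier M \<times> carrier N},
      mult = pretensor_mult \<chi> M grM N grN,
      one = Poly_Mapping.single (\<one>\<^bsub>M\<^esub>, \<one>\<^bsub>N\<^esub>) 1,
      zero = 0, add = (+), smult = (\<lambda>c. Poly_Mapping.map ((*) c))\<rparr>"

definition bilinearity_relations ::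
  "('k::field, 'a, 'm) module_scheme \<Rightarrow> ('k, 'b, 'n) module_scheme \<Rightarrow> ('a \<times> 'b \<Rightarrow>\<^sub>0 'k) set" where
  "bilinearity_relations M N = (let t = (\<lambda>a b. Poly_Mapping.single (a, b) (1::'k)) in
     {t (a \<oplus>\<^bsub>M\<^esub> a') b - t a b - t a' b | a a' b.
        a \<in> carrier M \<and> a' \<in> carrier M \<and> b \<in> carrier N} \<union>
     {t a (b \<oplus>\<^bsub>N\<^esub> b') - t a b - t a b' | a b b'.
        a \<in> carrier M \<and> b \<in> carrier N \<and> b' \<in> carrier N} \<union>
     {t (c \<odot>\<^bsub>M\<^esub> a) b - Poly_Mapping.map ((*) c) (t a b) | c a b.
        a \<in> carrier M \<and> b \<in> carrier N} \<union>
     {t a (c \<odot>\<^bsub>N\<^esub> b) - Poly_Mapping.map ((*) c) (t a b) | c a b.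
        a \<in> carrier M \<and> b \<in> carrier N})"

definition tensor_product ::
  "('i \<Rightarrow> 'i \<Rightarrow> 'k::field) \<Rightarrow> ('k, 'a, 'm) module_scheme \<Rightarrow> ('i \<Rightarrow> 'a set) \<Rightarrow>
   ('k, 'b, 'n) module_scheme \<Rightarrow> ('i \<Rightarrow> 'b set) \<Rightarrow> ('k, ('a \<times> 'b \<Rightarrow>\<^sub>0 'k) set) module" where
  "tensor_product \<chi> M grM N grN = (let P = pretensor \<chi> M grM N grN in
     quot_algebra P (lin_span P (bilinearity_relations M N)))"

definition tensor_elem ::
  "('i \<Rightarrow> 'i \<Rightarrow> 'k::field) \<Rightarrow> ('k, 'a, 'm) module_scheme \<Rightarrow> ('i \<Rightarrow> 'a set) \<Rightarrow>
   ('k, 'b, 'n) module_scheme \<Rightarrow> ('i \<Rightarrow> 'b set) \<Rightarrow> 'a \<Rightarrow> 'b \<Rightarrow> ('a \<times> 'b \<Rightarrow>\<^sub>0 'k) set" where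
  "tensor_elem \<chi> M grM N grN a b = (let P = pretensor \<chi> M grM N grN in
     lin_span P (bilinearity_relations M N) +>\<^bsub>P\<^esub> Poly_Mapping.single (a, b) 1)"

definition tensor_grading ::
  "('i::monoid_add \<Rightarrow> 'i \<Rightarrow> 'k::field) \<Rightarrow> ('k, 'a, 'm) module_scheme \<Rightarrow> ('i \<Rightarrow> 'a set) \<Rightarrow>
   ('k, 'b, 'n) module_scheme \<Rightarrow> ('i \<Rightarrow> 'b set) \<Rightarrow> 'i \<Rightarrow> ('a \<times> 'b \<Rightarrow>\<^sub>0 'k) set set" where
  "tensor_grading \<chi> M grM N grN i =
     lin_span (tensor_product \<chi> M grM N grN)
       {tensor_elem \<chi> M grM N grN a b | a b j l. a \<in> grM j \<and> b \<in> grN l \<and> j + l = i}"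


section \<open>The cubic Dirac operator\<close>

record ('k, 'c, 'g, 'v) colour_rep =
  eps :: "'c \<Rightarrow> 'c \<Rightarrow> 'k"
  g_scale :: "'k \<Rightarrow> 'g \<Rightarrow> 'g"
  g_grading :: "'c \<Rightarrow> 'g set"
  g_bracket :: "'g \<Rightarrow> 'g \<Rightarrow> 'g"
  g_form :: "'g \<Rightarrow> 'g \<Rightarrow> 'k"
  V_scale :: "'k \<Rightarrow> 'v \<Rightarrow> 'v"
  V_grading :: "'c \<Rightarrow> 'v set"
  V_form :: "'v \<Rightarrow> 'v \<Rightarrow> 'k"
  action :: "'g \<Rightarrow> 'v \<Rightarrow> 'v"
  V_mult :: "'v \<Rightarrow> 'v \<Rightarrow> 'v"

type_synonym ('k, 'g, 'v) dirac_elem =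
  "(('k, 'g \<times> 'v) tquot \<times> ('k, 'v) tquot \<Rightarrow>\<^sub>0 'k) set"

definition super_eps :: "('c \<Rightarrow> 'c \<Rightarrow> 'k::field) \<Rightarrow> bit \<times> 'c \<Rightarrow> bit \<times> 'c \<Rightarrow> 'k" where
  "super_eps \<epsilon> = (\<lambda>(p, a) (q, b). (if p = 1 \<and> q = 1 then - 1 else 1) * \<epsilon> a b)"

context
  fixes X :: "('k::field, 'c::ab_group_add, 'g::ab_group_add, 'v::ab_group_add) colour_rep"
begin

definition env_g :: "('k, ('k, 'g) tquot) module" where
  "env_g = enveloping_algebra (eps X) (g_scale X) (g_grading X) (g_bracket X)"

definition env_g_gen :: "'g \<Rightarrow> ('k, 'g) tquot" where
  "env_g_gen = enveloping_gen (eps X) (g_scale X) (g_grading X) (g_bracket X)"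

definition env_g_grading :: "'c \<Rightarrow> ('k, 'g) tquot set" where
  "env_g_grading = enveloping_grading (eps X) (g_scale X) (g_grading X) (g_bracket X)"

definition tilde_scale :: "'k \<Rightarrow> 'g \<times> 'v \<Rightarrow> 'g \<times> 'v" where
  "tilde_scale = dsum_scale (g_scale X) (V_scale X)"

definition tilde_grading :: "'c \<Rightarrow> ('g \<times> 'v) set" where
  "tilde_grading = dsum_grading (g_grading X) (V_grading X)"

definition tilde_bracket :: "'g \<times> 'v \<Rightarrow> 'g \<times> 'v \<Rightarrow> 'g \<times> 'v" where
  "tilde_bracket = dsum_bracket (eps X) (g_grading X) (g_bracket X) (g_form X)
     (V_scale X) (V_grading X) (V_form X) (action X) (V_mult X)"

definition env_tilde :: "('k, ('k, 'g \<times> 'v) tquot) module" where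
  "env_tilde = enveloping_algebra (eps X) tilde_scale tilde_grading tilde_bracket"

definition env_tilde_gen :: "'g \<times> 'v \<Rightarrow> ('k, 'g \<times> 'v) tquot" where
  "env_tilde_gen = enveloping_gen (eps X) tilde_scale tilde_grading tilde_bracket"

definition env_tilde_grading :: "bit \<times> 'c \<Rightarrow> ('k, 'g \<times> 'v) tquot set" where
  "env_tilde_grading = (\<lambda>(p, a).
     if p = 0 then enveloping_grading (eps X) tilde_scale tilde_grading tilde_bracket a
     else {\<zero>\<^bsub>env_tilde\<^esub>})"

definition cliff :: "('k, ('k, 'v) tquot) module" where
  "cliff = clifford_algebra (eps X) (V_scale X) (V_grading X) (V_form X)"

definition cliff_gen :: "'v \<Rightarrow> ('k, 'v) tquot" where
  "cliff_gen = clifford_gen (eps X) (V_scale X) (V_grading X) (V_form X)"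

definition cliff_grading :: "bit \<times> 'c \<Rightarrow> ('k, 'v) tquot set" where
  "cliff_grading = clifford_grading (eps X) (V_scale X) (V_grading X) (V_form X)"

definition dirac_algebra :: "('k, ('k, 'g, 'v) dirac_elem) module" where
  "dirac_algebra =
     tensor_product (super_eps (eps X)) env_tilde env_tilde_grading cliff cliff_grading"

definition dirac_tensor ::
  "('k, 'g \<times> 'v) tquot \<Rightarrow> ('k, 'v) tquot \<Rightarrow> ('k, 'g, 'v) dirac_elem" where
  "dirac_tensor =
     tensor_elem (super_eps (eps X)) env_tilde env_tilde_grading cliff cliff_grading"

definition dirac_grading :: "bit \<times> 'c \<Rightarrow> ('k, 'g, 'v) dirac_elem set" where
  "dirac_grading =
     tensor_grading (super_eps (eps X)) env_tilde env_tilde_grading cliff cliff_grading"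

definition dirac_bracket ::
  "('k, 'g, 'v) dirac_elem \<Rightarrow> ('k, 'g, 'v) dirac_elem \<Rightarrow> ('k, 'g, 'v) dirac_elem" where
  "dirac_bracket = colour_bracket (super_eps (eps X)) dirac_algebra dirac_grading"

text \<open>In the following, \<open>E\<close> is a homogeneous basis of \<open>V\<close>; the dual basis vector of \<open>e \<in> E\<close> is
  \<open>dual_vector (V_form X) E e\<close>.\<close>

definition pi_star :: "'v set \<Rightarrow> 'g \<Rightarrow> ('k, 'v) tquot" where
  "pi_star E x = (1 / 4) \<odot>\<^bsub>cliff\<^esub>
     (\<Oplus>\<^bsub>cliff\<^esub>e\<in>E. cliff_gen (action X x (dual_vector (V_form X) E e)) \<otimes>\<^bsub>cliff\<^esub> cliff_gen e)"

definition Delta_gen :: "'v set \<Rightarrow> 'g \<Rightarrow> ('k, 'g, 'v) dirac_elem" where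
  "Delta_gen E x =
     dirac_tensor (env_tilde_gen (x, 0)) \<one>\<^bsub>cliff\<^esub> \<oplus>\<^bsub>dirac_algebra\<^esub>
     dirac_tensor \<one>\<^bsub>env_tilde\<^esub> (pi_star E x)"

definition Delta :: "'v set \<Rightarrow> ('k, 'g) tquot \<Rightarrow> ('k, 'g, 'v) dirac_elem" where
  "Delta E = (THE h. h \<in> alg_hom env_g dirac_algebra \<and> h \<in> extensional (carrier env_g) \<and>
     (\<forall>x. h (env_g_gen x) = Delta_gen E x))"

definition centre_Delta :: "'v set \<Rightarrow> ('k, 'g, 'v) dirac_elem set" where
  "centre_Delta E = Delta E ` eps_centre (eps X) env_g env_g_grading"

definition invariants :: "'v set \<Rightarrow> ('k, 'g, 'v) dirac_elem set" where
  "invariants E =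
     {a \<in> carrier dirac_algebra. \<forall>x. dirac_bracket (Delta_gen E x) a = \<zero>\<^bsub>dirac_algebra\<^esub>}"

definition cubic_term :: "'v set \<Rightarrow> ('k, 'v) tquot" where
  "cubic_term E = (let e' = dual_vector (V_form X) E in
     (1 / 12) \<odot>\<^bsub>cliff\<^esub>
     (\<Oplus>\<^bsub>cliff\<^esub>i\<in>E. \<Oplus>\<^bsub>cliff\<^esub>j\<in>E. \<Oplus>\<^bsub>cliff\<^esub>l\<in>E.
        V_form X (e' i) (V_mult X (e' j) (e' l)) \<odot>\<^bsub>cliff\<^esub>
          (cliff_gen l \<otimes>\<^bsub>cliff\<^esub> cliff_gen j \<otimes>\<^bsub>cliff\<^esub> cliff_gen i)))"

definition cubic_dirac :: "'v set \<Rightarrow> ('k, 'g, 'v) dirac_elem" where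
  "cubic_dirac E =
     (\<Oplus>\<^bsub>dirac_algebra\<^esub>e\<in>E.
        dirac_tensor (env_tilde_gen (0, dual_vector (V_form X) E e)) (cliff_gen e))
     \<oplus>\<^bsub>dirac_algebra\<^esub> dirac_tensor \<one>\<^bsub>env_tilde\<^esub> (cubic_term E)"

definition dirac_diff :: "'v set \<Rightarrow> ('k, 'g, 'v) dirac_elem \<Rightarrow> ('k, 'g, 'v) dirac_elem" where
  "dirac_diff E a = dirac_bracket (cubic_dirac E) a"

definition ker_diff :: "'v set \<Rightarrow> ('k, 'g, 'v) dirac_elem set" where
  "ker_diff E = {a \<in> invariants E. dirac_diff E a = \<zero>\<^bsub>dirac_algebra\<^esub>}"

definition im_diff :: "'v set \<Rightarrow> ('k, 'g, 'v) dirac_elem set" where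
  "im_diff E = dirac_diff E ` invariants E"

end

end

theory Submission
  imports Defs
begin

text \<open>
  Write \<open>D\<close> for the cubic Dirac operator. A linear map \<open>h\<close> of degree \<open>-1\<close>, built from the
  symmetrization of the enveloping algebra of \<open>\<gg> \<oplus> V\<close>, replaces one letter \<open>v \<in> V\<close> at a time by the
  Clifford generator \<open>v\<close>. It commutes with the action of \<open>\<gg>\<close>, and on a monomial with \<open>p\<close> letters
  from \<open>V\<close> and \<open>q\<close> Clifford letters the operator \<open>T = d h + h d\<close> is multiplication by \<open>2 (p + q)\<close>
  up to lower terms. So every element is mapped into \<open>\<Delta>(U(\<gg>))\<close> by a product of operators
  \<open>T - 2 k\<close> with \<open>k > 0\<close>, while \<open>T\<close> and \<open>d\<close> vanish on \<open>\<Delta>(U(\<gg>))\<close>. On invariants \<open>d\<^sup>2 = 0\<close>,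
  because \<open>D\<^sup>2 + \<Delta>(Cas)\<close> is central; a cocycle is therefore an element of \<open>\<Delta>(U(\<gg>))\<close>, necessarily
  invariant, plus a coboundary, and no nonzero element of \<open>\<Delta>(U(\<gg>))\<close> is a coboundary. Finally
  \<open>\<Delta>\<close> is injective, which identifies its invariant values with the image of the centre.
\<close>

text \<open>A value \<open>eps a a\<close> may be 1 or -1, so letters behave partly as in a
  symmetric and partly as in an exterior algebra, and bases of ordered monomials would need case
  distinctions. The proof uses only spanning monomials: linear maps are given on words in basis
  letters and shown to respect the relations. To make such maps, letters get distinct labels, words
  are sorted by label, and the result is averaged over all labellings; this is the symmetrization,
  and it divides by factorials.

  Expanding D^2 would need long multiple sums. Only its bracket with one Clifford generator is
  computed. Once the Casimir term is added, what remains is an odd Clifford element that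
  anticommutes, up to \<epsilon>-signs, with all generators; the number operator, whose eigenvalues
  on odd words are nonzero, forces it to vanish. The same argument shows that the cubic term is
  invariant.

  The algebras of the statement are records with carriers. Each is embedded in a ring type of linear
  operators, where calculations are ordinary ring arithmetic; the unit of the algebra becomes an
  idempotent, called \<open>ee\<close> in the main computation.\<close>

abbreviation lin where "lin == Vector_Spaces.linear"
lemmas lin_iff = Vector_Spaces.linear_iff
lemmas fin_induct = infinite_finite_induct
abbreviation car where "car == carrier"
abbreviation psing where "psing == Poly_Mapping.single"
abbreviation keys where "keys == Poly_Mapping.keys"

abbreviation mult_in ("_ \<otimes>[_] _" [70, 0, 71] 70) where "x \<otimes>[R] y == x \<otimes>\<^bsub>R\<^esub> y"
abbreviation add_in ("_ \<oplus>[_] _" [65, 0, 66] 65) where "x \<oplus>[R] y == x \<oplus>\<^bsub>R\<^esub> y"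
abbreviation minus_in ("_ \<ominus>[_] _" [65, 0, 66] 65) where "x \<ominus>[R] y == x \<ominus>\<^bsub>R\<^esub> y"
abbreviation smult_in ("_ \<odot>[_] _" [70, 0, 71] 70) where "c \<odot>[R] x == c \<odot>\<^bsub>R\<^esub> x"
abbreviation zero_in ("\<zero>[_]" [0] 1000) where "\<zero>[R] == \<zero>\<^bsub>R\<^esub>"
abbreviation one_in ("\<one>[_]" [0] 1000) where "\<one>[R] == \<one>\<^bsub>R\<^esub>"
abbreviation coset_in ("_ +>[_] _" [60, 0, 61] 60) where "I +>[R] x == I +>\<^bsub>R\<^esub> x"

section \<open>Linear algebra\<close>

definition pscale :: "'k::field => ('a \<Rightarrow>\<^sub>0 'k) => 'a \<Rightarrow>\<^sub>0 'k" where
  "pscale c = Poly_Mapping.map ((*) c)"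

lemma lookup_pscale: "Poly_Mapping.lookup (pscale c p) k = c * Poly_Mapping.lookup p k"
  by (simp add: pscale_def Poly_Mapping.map.rep_eq when_def)

lemma pscale_single [simp]: "pscale c (psing k x) = psing k (c * x)"
  by (simp add: pscale_def)

lemma pscale_conv_mult: "pscale c p = psing 0 c * p"
  unfolding pscale_def by (rule mult_map_scale_conv_mult)

interpretation pm: vector_space pscale
  by unfold_locales (auto intro!: poly_mapping_eqI simp: lookup_pscale lookup_add algebra_simps)

definition lext :: "('k::field => 'z::ab_group_add => 'z) => ('a => 'z) => ('a \<Rightarrow>\<^sub>0 'k) => 'z" where
  "lext s D p = (SUM k:keys p. s (Poly_Mapping.lookup p k) (D k))"

lemma keys_pscale_subset: "keys (pscale c p) <= keys p"
  by (auto simp: in_keys_iff lookup_pscale)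

lemma poly_mapping_eq_sum_single:
  "p = (SUM k:keys p. psing k (Poly_Mapping.lookup p k))"
proof (rule poly_mapping_eqI)
  fix k
  have "(SUM x:keys p. Poly_Mapping.lookup p x when x = k) =
      (SUM x:keys p. if x = k then Poly_Mapping.lookup p x else 0)"
    by (simp add: when_def)
  thus "Poly_Mapping.lookup p k = Poly_Mapping.lookup
      (SUM k:keys p. psing k (Poly_Mapping.lookup p k)) k"
    by (simp add: lookup_sum lookup_single in_keys_iff)
qed

context vector_space
begin

lemma lext_superset:
  "finite A ==> keys p <= A ==> lext scale D p = (SUM k:A. scale (Poly_Mapping.lookup p k) (D k))"
  unfolding lext_def by (rule sum.mono_neutral_left) (auto simp: in_keys_iff)

lemma lext_single [simp]: "lext scale D (psing k c) = scale c (D k)"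
  by (simp add: lext_def)

lemma lext_zero [simp]: "lext scale D 0 = 0"
  by (simp add: lext_def)

lemma lext_add: "lext scale D (p + q) = lext scale D p + lext scale D q"
proof -
  let ?A = "keys p \<union> keys q"
  have "keys (p + q) <= ?A" by (rule keys_add)
  thus ?thesis
    by (simp add: lext_superset[where A = ?A] lookup_add scale_left_distrib sum.distrib)
qed

lemma lext_scale: "lext scale D (pscale c p) = scale c (lext scale D p)"
  using lext_superset[of "keys p" "pscale c p" D] keys_pscale_subset[of c p]
  by (simp add: lookup_pscale lext_def scale_sum_right)

lemma lext_uminus: "lext scale D (- p) = - lext scale D p"
  using lext_add[of D p "- p"] by (simp add: add_eq_0_iff)

lemma lext_diff: "lext scale D (p - q) = lext scale D p - lext scale D q"
  using lext_add[of D p "- q"] by (simp add: lext_uminus)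

text \<open>Extend a basis of \<open>K\<close> to a basis of the whole space and kill the part in
  \<open>K\<close>. The values of \<open>r\<close> are linear normal forms modulo \<open>K\<close>,
  and \<open>x - r x\<close> is a projection onto \<open>K\<close>; later uses are a section of an
  evaluation map, normal forms for tensor products, and extension of maps from a carrier.\<close>

lemma exists_projection_along:
  assumes "subspace K"
  obtains r where "lin scale scale r" "!!x. r x = 0 \<longleftrightarrow> x : K" "!!x. x - r x : K"
proof -
  interpret vector_space_pair scale scale by unfold_locales
  obtain B where B: "B <= K" "independent B" "K <= span B"
    using maximal_independent_subset[of K] by metis
  obtain C where C: "B <= C" "independent C" "UNIV <= span C"
    using maximal_independent_subset_extend[OF subset_UNIV B(2)] by metis
  define r where "r = construct C (%c. if c : B then 0 else c)"
  have lin: "lin scale scale r" unfolding r_def by (rule linear_construct[OF C(2)])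
  have rc: "r c = (if c : B then 0 else c)" if "c : C" for c
    unfolding r_def using construct_basis[OF C(2) that] by simp
  have d: "x - r x : K" for x
  proof -
    have "x : span C" using C(3) by auto
    thus ?thesis
    proof (induction rule: span_induct_alt)
      case base
      thus ?case using lin subspace_0[OF assms] by (simp add: linear_0)
    next
      case (step c x y)
      have eq: "scale c x + y - r (scale c x + y) = scale c (x - r x) + (y - r y)"
        using lin by (simp add: linear_add linear_scale scale_right_diff_distrib)
      have "x - r x : K" using rc[OF step(1)] B(1) subspace_0[OF assms] by auto
      thus ?case unfolding eq using step assms by (auto intro: subspace_add subspace_scale)
    qed
  qed
  have "r x = 0" if "x : K" for x
  proof -
    have "x : span B" using B(3) that by auto
    thus ?thesis
      by (induction rule: span_induct_alt)
        (use lin rc C(1) in \<open>auto simp: linear_0 linear_add linear_scale\<close>)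
  qed
  moreover have "x : K" if "r x = 0" for x using d[of x] that by simp
  ultimately show thesis using that lin d by blast
qed

end

section \<open>Algebras over a field, quotients and embeddings into rings of operators\<close>

locale kalg = ring M for M :: "('k::field, 'a, 'm) module_scheme" (structure) +
  assumes smult_closed [simp, intro]: "x : car M ==> a \<odot>[M] x : car M"
    and smult_l_distr: "x : car M ==> (a + b) \<odot>[M] x = a \<odot>[M] x \<oplus> b \<odot>[M] x"
    and smult_r_distr: "x : car M ==> y : car M ==> a \<odot>[M] (x \<oplus> y) = a \<odot>[M] x \<oplus> a \<odot>[M] y"
    and smult_assoc: "x : car M ==> a \<odot>[M] (b \<odot>[M] x) = (a * b) \<odot>[M] x"
    and smult_one [simp]: "x : car M ==> 1 \<odot>[M] x = x"
    and smult_mult_l: "x : car M ==> y : car M ==> (a \<odot>[M] x) \<otimes> y = a \<odot>[M] (x \<otimes> y)"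
    and smult_mult_r: "x : car M ==> y : car M ==> x \<otimes> (a \<odot>[M] y) = a \<odot>[M] (x \<otimes> y)"
begin

lemma smult_zero_left [simp]: "x : car M ==> 0 \<odot>[M] x = \<zero>"
  using smult_l_distr[of x 0 0] by (metis add.r_cancel_one' add.r_inv_ex smult_closed add_0)

lemma smult_zero_right [simp]: "a \<odot>[M] \<zero> = \<zero>"
  using smult_r_distr[of \<zero> \<zero> a] by (metis add.r_cancel_one' smult_closed zero_closed r_zero)

lemma smult_minus_one: "x : car M ==> (- 1) \<odot>[M] x = \<ominus> x"
  using smult_l_distr[of x "- 1" 1] by (simp add: minus_equality)

end

text \<open>The product of \<open>P\<close> is associative, unital and compatible with scalars only
  modulo \<open>L\<close>. This is the situation of \<open>pretensor\<close>, whose product becomes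
  associative after division by the bilinearity relations; ideals of genuine algebras are the
  special case \<open>prequot_ideal\<close>.\<close>

locale prequot = abelian_subgroup L P
  for P :: "('k::field, 'a, 'm) module_scheme" (structure) and L +
  assumes p_smult_closed [simp, intro]: "x : car P ==> a \<odot>[P] x : car P"
    and p_smult_l_distr: "x : car P ==> (a + b) \<odot>[P] x = a \<odot>[P] x \<oplus> b \<odot>[P] x"
    and p_smult_r_distr: "x : car P ==> y : car P ==> a \<odot>[P] (x \<oplus> y) = a \<odot>[P] x \<oplus> a \<odot>[P] y"
    and p_smult_assoc: "x : car P ==> a \<odot>[P] (b \<odot>[P] x) = (a * b) \<odot>[P] x"
    and p_smult_one [simp]: "x : car P ==> 1 \<odot>[P] x = x"
    and p_mult_closed [simp, intro]: "x : car P ==> y : car P ==> x \<otimes> y : car P"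
    and p_one_closed [simp, intro]: "\<one> : car P"
    and p_l_distr: "x : car P ==> y : car P ==> z : car P ==> (x \<oplus> y) \<otimes> z = x \<otimes> z \<oplus> y \<otimes> z"
    and p_r_distr: "x : car P ==> y : car P ==> z : car P ==> z \<otimes> (x \<oplus> y) = z \<otimes> x \<oplus> z \<otimes> y"
    and L_smult: "x : L ==> a \<odot>[P] x : L"
    and L_mult_l: "x : L ==> y : car P ==> x \<otimes> y : L"
    and L_mult_r: "x : L ==> y : car P ==> y \<otimes> x : L"
    and p_assoc: "x : car P ==> y : car P ==> z : car P ==> L +> (x \<otimes> y) \<otimes> z = L +> x \<otimes> (y \<otimes> z)"
    and p_l_one: "x : car P ==> L +> \<one> \<otimes> x = L +> x"
    and p_r_one: "x : car P ==> L +> x \<otimes> \<one> = L +> x"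
    and p_smult_mult_l: "x : car P ==> y : car P ==> L +> (a \<odot>[P] x) \<otimes> y = L +> a \<odot>[P] (x \<otimes> y)"
    and p_smult_mult_r: "x : car P ==> y : car P ==> L +> x \<otimes> (a \<odot>[P] y) = L +> a \<odot>[P] (x \<otimes> y)"
begin

abbreviation "Q == quot_algebra P L"

lemma mem_coset: "y : L +> x \<longleftrightarrow> (EX l:L. y = l \<oplus> x)"
  by (auto simp: a_r_coset_def r_coset_def)

lemma coset_shift: "l : L ==> x : car P ==> L +> (l \<oplus> x) = L +> x"
  by (rule a_repr_independence'[symmetric]) (auto simp: mem_coset)

lemma coset_eq_iff: "x : car P ==> y : car P ==> L +> x = L +> y \<longleftrightarrow> x \<ominus> y : L"
  by (metis a_rcos_self a_repr_independence' a_rcos_module minus_eq)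

lemma Q_carrier: "car Q = {L +> x | x. x : car P}"
  by (auto simp: quot_algebra_def ring.defs module.defs FactRing_def A_RCOSETS_def' )

lemma Q_add: "x : car P ==> y : car P ==> (L +> x) \<oplus>[Q] (L +> y) = L +> (x \<oplus> y)"
  by (simp add: quot_algebra_def ring.defs module.defs FactRing_def a_rcos_sum)

lemma Q_zero: "\<zero>[Q] = L +> \<zero>"
  by (simp add: quot_algebra_def ring.defs module.defs FactRing_def a_coset_add_zero a_subset)

lemma Q_one: "\<one>[Q] = L +> \<one>"
  by (simp add: quot_algebra_def ring.defs module.defs FactRing_def)

lemma Q_mult:
  assumes "x : car P" "y : car P"
  shows "(L +> x) \<otimes>[Q] (L +> y) = L +> (x \<otimes> y)"
proof -
  have "L +> (a \<otimes> b) = L +> (x \<otimes> y)" if ab: "a : L +> x" "b : L +> y" for a b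
  proof -
    obtain l m where l: "l : L" "a = l \<oplus> x" and m: "m : L" "b = m \<oplus> y"
      using ab by (auto simp: mem_coset)
    have c: "l : car P" "m : car P" using l m a_subset by auto
    have "a \<otimes> b = (l \<otimes> (m \<oplus> y) \<oplus> x \<otimes> m) \<oplus> x \<otimes> y"
      using assms c by (simp add: l m p_l_distr p_r_distr a_ac)
    moreover have "l \<otimes> (m \<oplus> y) \<oplus> x \<otimes> m : L"
      using l m assms c additive_subgroup.a_closed[OF additive_subgroup_axioms] L_mult_l L_mult_r by simp
    ultimately show ?thesis using assms by (simp add: coset_shift)
  qed
  moreover have "x : L +> x" "y : L +> y" using assms a_rcos_self by auto
  ultimately have "(\<Union>a\<in>L +> x. \<Union>b\<in>L +> y. L +> (a \<otimes> b)) = L +> (x \<otimes> y)" by blast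
  thus ?thesis
    by (simp add: quot_algebra_def ring.defs module.defs FactRing_def rcoset_mult_def)
qed

lemma Q_smult:
  assumes "x : car P"
  shows "a \<odot>[Q] (L +> x) = L +> (a \<odot>[P] x)"
proof -
  have "L +> (a \<odot>[P] y) = L +> (a \<odot>[P] x)" if y: "y : L +> x" for y
  proof -
    obtain l where l: "l : L" "y = l \<oplus> x" using y by (auto simp: mem_coset)
    have "a \<odot>[P] y = a \<odot>[P] l \<oplus> a \<odot>[P] x" using l assms a_subset by (auto simp: p_smult_r_distr)
    moreover have "a \<odot>[P] l : L" using l L_smult by auto
    ultimately show ?thesis using assms by (simp add: coset_shift)
  qed
  hence "(\<Union>y\<in>L +> x. L +> (a \<odot>[P] y)) = L +> (a \<odot>[P] x)" using a_rcos_self[OF assms] by blast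
  thus ?thesis
    by (simp add: quot_algebra_def ring.defs module.defs FactRing_def)
qed

lemma Q_elim: "X : car Q ==> (!!x. x : car P ==> X = L +> x ==> thesis) ==> thesis"
  by (auto simp: Q_carrier)

lemma Q_closed: "x : car P ==> L +> x : car Q"
  by (auto simp: Q_carrier)

lemma Q_kalg: "kalg Q"
proof -
  note S = Q_add Q_mult Q_smult Q_zero Q_one Q_closed
  have "abelian_group Q"
  proof (rule abelian_groupI)
    fix X assume "X : car Q"
    then obtain x where "x : car P" "X = L +> x" by (rule Q_elim)
    thus "EX Y:car Q. Y \<oplus>[Q] X = \<zero>[Q]"
      by (intro bexI[of _ "L +> (\<ominus> x)"]) (simp_all add: S l_neg)
  qed (auto elim!: Q_elim simp: S a_ac)
  moreover have "Group.monoid Q"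
    by (rule monoidI) (auto elim!: Q_elim simp: S p_assoc p_l_one p_r_one)
  ultimately have "ring Q"
    by (rule ringI) (auto elim!: Q_elim simp: S p_l_distr p_r_distr)
  thus ?thesis
    by (rule kalg.intro, unfold_locales)
      (auto elim!: Q_elim simp: S p_smult_l_distr p_smult_r_distr p_smult_assoc p_smult_mult_l p_smult_mult_r)
qed

lemma Q_lift:
  fixes vp :: "'a => 'z::ab_group_add"
  assumes add: "!!x y. x : car P ==> y : car P ==> vp (x \<oplus> y) = vp x + vp y"
    and L: "!!x. x : L ==> vp x = 0"
  obtains vp' where "!!x. x : car P ==> vp' (L +> x) = vp x"
proof
  fix x assume x: "x : car P"
  define y where "y = (SOME y. y : L +> x)"
  have "y : L +> x" unfolding y_def using a_rcos_self[OF x] by (rule someI)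
  then obtain l where "l : L" "y = l \<oplus> x" by (auto simp: mem_coset)
  hence "vp y = vp x" using add[of l x] L[of l] x a_subset by auto
  thus "vp (SOME y. y : L +> x) = vp x" by (simp add: y_def)
qed

end

lemma (in kalg) prequot_ideal:
  assumes "ideal I M" "!!x a. x : I ==> a \<odot>[M] x : I"
  shows "prequot M I"
proof -
  interpret I: ideal I M by fact
  show ?thesis
    by unfold_locales
      (auto simp: smult_l_distr smult_r_distr smult_assoc l_distr r_distr assms(2) I.I_l_closed I.I_r_closed m_assoc smult_mult_l smult_mult_r)
qed

lemma (in kalg) smult_genideal:
  assumes "S <= car M" "x : Idl S"
  shows "a \<odot>[M] x : Idl S"
proof -
  interpret I: ideal "Idl S" M by (rule genideal_ideal[OF assms(1)])
  have x: "x : car M" using assms(2) I.a_subset by auto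
  have "(a \<odot>[M] \<one>) \<otimes> x : Idl S" using assms(2) by (intro I.I_l_closed) auto
  thus ?thesis using x by (simp add: smult_mult_l)
qed

lemma (in kalg) prequot_genideal: "S <= car M ==> prequot M (Idl S)"
  by (rule prequot_ideal) (auto intro: genideal_ideal smult_genideal)

text \<open>The elements killed by \<open>vp\<close> in every two-sided context form an ideal, and
  it contains \<open>S\<close>. Only additivity of \<open>vp\<close> is assumed, so the principle
  serves maps that are not multiplicative.\<close>

lemma (in ring) genideal_vanish:
  fixes vp :: "'a => 'z::ab_group_add"
  assumes S: "S <= car R"
    and add: "!!x y. x : car R ==> y : car R ==> vp (x \<oplus> y) = vp x + vp y"
    and van: "!!a s b. a : car R ==> b : car R ==> s : S ==> vp (a \<otimes> s \<otimes> b) = 0"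
    and x: "x : Idl S"
  shows "vp x = 0"
proof -
  define J where "J = {x : car R. ALL a:car R. ALL b:car R. vp (a \<otimes> x \<otimes> b) = 0}"
  have z: "vp \<zero> = 0" using add[of \<zero> \<zero>] by simp
  have "ideal J R"
  proof (rule idealI[OF ring_axioms])
    show "subgroup J (add_monoid R)"
    proof (rule add.subgroupI)
      show "J ~= {}" using z by (auto simp: J_def intro!: exI[of _ \<zero>])
    next
      fix a assume a: "a : J"
      have "vp (c \<otimes> (\<ominus> a) \<otimes> b) = 0" if "c : car R" "b : car R" for b c
        using that a add[of "c \<otimes> (\<ominus> a) \<otimes> b" "c \<otimes> a \<otimes> b"] z
        by (auto simp: J_def l_minus r_minus l_neg)
      thus "\<ominus> a : J" using a by (auto simp: J_def)
    qed (auto simp: J_def l_distr r_distr add)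
  next
    fix a x assume ax: "a : J" "x : car R"
    have "vp (c \<otimes> (x \<otimes> a) \<otimes> b) = 0" if "c : car R" "b : car R" for b c
      using ax that unfolding J_def by (simp add: m_assoc[symmetric])
    thus "x \<otimes> a : J" using ax by (auto simp: J_def)
    have "vp (c \<otimes> (a \<otimes> x) \<otimes> b) = 0" if "c : car R" "b : car R" for b c
    proof -
      have "vp (c \<otimes> a \<otimes> (x \<otimes> b)) = 0" using ax that by (auto simp: J_def)
      thus ?thesis using ax that by (simp add: m_assoc J_def)
    qed
    thus "a \<otimes> x : J" using ax by (auto simp: J_def)
  qed
  moreover have "S <= J" using S van by (auto simp: J_def)
  ultimately have "Idl S <= J" by (rule genideal_minimal)
  hence "x : J" using x by auto
  thus ?thesis using z by (auto simp: J_def dest!: bspec[of _ _ \<one>])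
qed

section \<open>Rings of linear operators\<close>

typedef (overloaded) ('a, 'k::field) lend =
  "{f :: ('a \<Rightarrow>\<^sub>0 'k) => ('a \<Rightarrow>\<^sub>0 'k). (ALL p q. f (p + q) = f p + f q) & (ALL c p. f (pscale c p) = pscale c (f p))}"
  morphisms lapp Abs_lend
  by (rule exI[of _ "%_. 0"]) auto

lemma lapp_add: "lapp f (p + q) = lapp f p + lapp f q"
  and lapp_scale: "lapp f (pscale c p) = pscale c (lapp f p)"
  using lapp[of f] by auto

lemma lend_eqI: "(!!p. lapp f p = lapp g p) ==> f = g"
  by (metis lapp_inject ext)

instantiation lend :: (type, field) ring
begin

definition "0 = Abs_lend (%_. 0)"
definition "f + g = Abs_lend (%p. lapp f p + lapp g p)"
definition "f - g = Abs_lend (%p. lapp f p - lapp g p)"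
definition "- f = Abs_lend (%p. - lapp f p)"
definition "f * g = Abs_lend (%p. lapp f (lapp g p))"

lemma lapp_simps [simp]:
  "lapp 0 p = 0" "lapp (f + g) p = lapp f p + lapp g p" "lapp (f - g) p = lapp f p - lapp g p"
  "lapp (- f) p = - lapp f p" "lapp (f * g) p = lapp f (lapp g p)"
  by (simp_all add: zero_lend_def plus_lend_def minus_lend_def uminus_lend_def times_lend_def
      Abs_lend_inverse lapp_add lapp_scale pm.scale_right_distrib pm.scale_right_diff_distrib)

instance
  by standard (auto intro!: lend_eqI simp: lapp_add algebra_simps)

end

definition lscale :: "'k::field => ('a, 'k) lend => ('a, 'k) lend" where
  "lscale c f = Abs_lend (%p. pscale c (lapp f p))"

lemma lapp_lscale [simp]: "lapp (lscale c f) p = pscale c (lapp f p)"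
  by (simp add: lscale_def Abs_lend_inverse lapp_add lapp_scale pm.scale_right_distrib pm.scale_left_commute)

locale typed_algebra = vector_space scale for scale :: "'k::field => 'r::ring => 'r" +
  assumes scale_mult_left: "scale c a * b = scale c (a * b)"
    and scale_mult_right: "a * scale c b = scale c (a * b)"

lemma typed_algebra_lscale: "typed_algebra lscale"
  by unfold_locales (auto intro!: lend_eqI simp: pm.scale_right_distrib pm.scale_left_distrib lapp_scale)

text \<open>The target ring is not assumed to have a unit: the unit of \<open>M\<close> becomes an
  idempotent that is neutral only on the image, as \<open>emb_one_mult\<close> records.\<close>

locale embedding = kalg M + typed_algebra scale
  for M :: "('k::field, 'a, 'm) module_scheme" (structure)
    and scale :: "'k => 'r::ring => 'r" +
  fixes \<Phi> :: "'a => 'r"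
  assumes inj: "inj_on \<Phi> (car M)"
    and emb_add: "x : car M ==> y : car M ==> \<Phi> (x \<oplus> y) = \<Phi> x + \<Phi> y"
    and emb_mult: "x : car M ==> y : car M ==> \<Phi> (x \<otimes> y) = \<Phi> x * \<Phi> y"
    and emb_smult: "x : car M ==> \<Phi> (c \<odot>[M] x) = scale c (\<Phi> x)"
begin

lemma emb_zero: "\<Phi> \<zero> = 0"
  using emb_add[of \<zero> \<zero>] by simp

lemma emb_uminus: "x : car M ==> \<Phi> (\<ominus> x) = - \<Phi> x"
  using emb_add[of "\<ominus> x" x] by (simp add: emb_zero l_neg eq_neg_iff_add_eq_0)

lemma emb_minus: "x : car M ==> y : car M ==> \<Phi> (x \<ominus> y) = \<Phi> x - \<Phi> y"
  by (simp add: a_minus_def emb_add emb_uminus)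

lemma emb_finsum: "(!!i. i : A ==> f i : car M) ==> \<Phi> (\<Oplus>i\<in>A. f i) = (SUM i:A. \<Phi> (f i))"
  by (induction A rule: fin_induct) (auto simp: emb_zero emb_add finsum_infinite)

lemma emb_eq_zero: "x : car M ==> \<Phi> x = 0 \<longleftrightarrow> x = \<zero>"
  using inj emb_zero by (metis inj_on_eq_iff zero_closed)

lemma emb_eq: "x : car M ==> y : car M ==> \<Phi> x = \<Phi> y \<longleftrightarrow> x = y"
  using inj by (metis inj_on_eq_iff)

lemma emb_one_mult: "x : car M ==> \<Phi> \<one> * \<Phi> x = \<Phi> x" "x : car M ==> \<Phi> x * \<Phi> \<one> = \<Phi> x"
  by (simp_all flip: emb_mult)

end

text \<open>A linear section \<open>j\<close> of the evaluation map from the free vector space on the underlying type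
  turns left multiplication into operators on a genuine type.\<close>

lemma (in kalg) embedding_exists:
  obtains \<Phi> :: "'a => ('a, 'k) lend" where "embedding M lscale \<Phi>"
proof -
  define ev where "ev p = (\<Oplus>a\<in>keys p. if a : car M then Poly_Mapping.lookup p a \<odot>[M] a else \<zero>)"
    for p :: "'a \<Rightarrow>\<^sub>0 'k"
  have ev_superset: "ev p = (\<Oplus>a\<in>A. if a : car M then Poly_Mapping.lookup p a \<odot>[M] a else \<zero>)"
    if "finite A" "keys p <= A" for A and p :: "'a \<Rightarrow>\<^sub>0 'k"
    unfolding ev_def using that
    by (intro add.finprod_mono_neutral_cong_left) (auto simp: in_keys_iff)
  have ev_closed [simp]: "ev p : car M" for p
    unfolding ev_def by (intro finsum_closed) auto
  have ev_add: "ev (p + q) = ev p \<oplus> ev q" for p q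
  proof -
    let ?A = "keys p \<union> keys q"
    have "keys (p + q) <= ?A" by (rule keys_add)
    hence "ev (p + q) = (\<Oplus>a\<in>?A. (if a : car M then Poly_Mapping.lookup p a \<odot>[M] a else \<zero>) \<oplus>
        (if a : car M then Poly_Mapping.lookup q a \<odot>[M] a else \<zero>))"
      by (subst ev_superset[where A = ?A]) (auto intro!: add.finprod_cong' simp del: finsum_addf simp: lookup_add smult_l_distr)
    also have "... = ev p \<oplus> ev q"
      by (subst finsum_addf) (auto simp: ev_superset[where A = ?A and p = p] ev_superset[where A = ?A and p = q])
    finally show ?thesis .
  qed
  have smult_finsum: "c \<odot>[M] (\<Oplus>a\<in>A. f a) = (\<Oplus>a\<in>A. c \<odot>[M] f a)" if "!!a. f a : car M" for c A and f :: "'a => 'a"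
    by (induction A rule: fin_induct) (auto simp: that smult_r_distr finsum_infinite)
  have ev_scale: "ev (pscale c p) = c \<odot>[M] ev p" for c p
    unfolding ev_superset[OF finite_keys keys_pscale_subset, of c p] unfolding ev_def
    by (subst smult_finsum) (auto intro!: finsum_cong' simp: lookup_pscale smult_assoc)
  have ev_single: "x : car M ==> ev (psing x c) = c \<odot>[M] x" for x c
    by (auto simp: ev_def)
  define K where "K = {p. ev p = \<zero>}"
  have ev0: "ev 0 = \<zero>" by (simp add: ev_def)
  have "pm.subspace K"
    by (auto simp: pm.subspace_def K_def ev_add ev_scale ev0)
  then obtain r where r: "lin pscale pscale r" "!!p. r p = 0 \<longleftrightarrow> p : K" "!!p. p - r p : K"
    by (rule pm.exists_projection_along) blast
  have r_add: "r (p + q) = r p + r q" and r_scale: "r (pscale c p) = pscale c (r p)" for p q c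
    using r(1) by (simp_all add: lin_iff)
  have ev_minus: "ev (p - q) = ev p \<ominus> ev q" for p q
    using ev_add[of "p - q" q] by (simp add: minus_eq a_assoc r_neg)
  have r_eq: "r p = r q" if "ev p = ev q" for p q
  proof -
    have "p - q : K" using that by (simp add: K_def ev_minus minus_eq r_neg)
    hence "r (p - q) = 0" using r(2) by blast
    thus ?thesis using r_add[of "p - q" q] by simp
  qed
  have ev_r: "ev (r p) = ev p" for p
  proof -
    have "ev (p - r p) = \<zero>" using r(3)[of p] by (simp add: K_def)
    thus ?thesis using ev_add[of "p - r p" "r p"] by simp
  qed
  \<comment> \<open>\<open>r p\<close> depends only on \<open>ev p\<close>, so this is a linear
    right inverse of \<open>ev\<close> on the carrier.\<close>
  define j where "j x = r (psing x 1)" for x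
  have ev_j: "ev (j x) = x" if "x : car M" for x
    using that by (simp add: j_def ev_r ev_single)
  have j_add: "j (x \<oplus> y) = j x + j y" if "x : car M" "y : car M" for x y
    using that unfolding j_def r_add[symmetric] by (intro r_eq) (simp add: ev_add ev_single)
  have j_scale: "j (c \<odot>[M] x) = pscale c (j x)" if "x : car M" for x c
    using that unfolding j_def r_scale[symmetric] by (intro r_eq) (simp add: ev_scale ev_single)
  define \<Phi> where "\<Phi> m = Abs_lend (%p. j (m \<otimes> ev p))" for m
  have app: "lapp (\<Phi> m) p = j (m \<otimes> ev p)" if "m : car M" for m p
    unfolding \<Phi>_def using that
    by (subst Abs_lend_inverse) (auto simp: ev_add ev_scale r_distr j_add smult_mult_r j_scale)
  interpret L: typed_algebra lscale by (rule typed_algebra_lscale)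
  have "embedding M lscale \<Phi>"
  proof unfold_locales
    show "inj_on \<Phi> (car M)"
    proof (rule inj_onI)
      fix x y assume xy: "x : car M" "y : car M" "\<Phi> x = \<Phi> y"
      hence "j (x \<otimes> ev (psing \<one> 1)) = j (y \<otimes> ev (psing \<one> 1))"
        by (metis app)
      thus "x = y" using xy ev_j by (metis ev_single one_closed smult_one r_one)
    qed
  qed (auto intro!: lend_eqI simp: app l_distr j_add ev_j m_assoc smult_mult_l j_scale)
  thus thesis by (rule that)
qed

section \<open>A Poincare--Birkhoff--Witt theorem by averaging\<close>

locale based_space = vector_space s for s :: "'k::field => 'l::ab_group_add => 'l" +
  fixes B :: "'l set" and co :: "'l => 'l => 'k"
  assumes finite_B: "finite B"
    and co_add: "co (v + w) b = co v b + co w b"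
    and co_scale: "co (s c v) b = c * co v b"
    and co_basis: "b : B ==> b' : B ==> co b b' = (if b = b' then 1 else 0)"
    and co_expand: "v = (SUM b:B. s (co v b) b)"
begin

lemma co_zero [simp]: "co 0 b = 0"
  using co_scale[of 0 0 b] by simp

lemma co_sum: "co (SUM i:A. f i) b = (SUM i:A. co (f i) b)"
  by (induction A rule: fin_induct) (auto simp: co_add)

lemma sum_co_basis:
  "vector_space sz ==> b : B ==> (SUM c:B. sz (co b c) (F c)) = (F b :: 'z::ab_group_add)"
proof -
  assume "vector_space sz" and b: "b : B"
  then interpret z: vector_space sz by simp
  have "(SUM c:B. sz (co b c) (F c)) = (SUM c:B. if c = b then F c else 0)"
    using b by (intro sum.cong) (auto simp: co_basis)
  thus ?thesis using b finite_B by simp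
qed

end

text \<open>Letters carry numerical labels and only labels are compared. Repeated letters thus stay
  distinguishable, and the basis needs no order.\<close>

primrec inversions :: "(nat \<times> 'l) list => nat" where
  "inversions [] = 0"
| "inversions (a # W) = length (filter (%b. fst b < fst a) W) + inversions W"

lemma inversions_swap:
  "fst b < fst a ==> inversions (u @ a # b # v) = Suc (inversions (u @ b # a # v))"
  by (induction u) auto

lemma inversions_eq_0:
  "inversions W ~= 0 ==> EX u a b v. W = u @ a # b # v & fst b < fst a"
proof (induction W)
  case (Cons x W)
  show ?case
  proof (cases "inversions W = 0")
    case False
    then obtain u a b v where "W = u @ a # b # v" "fst b < fst a" using Cons.IH by blast
    hence "x # W = (x # u) @ a # b # v & fst b < fst a" by simp
    thus ?thesis by blast
  next
    case True
    hence "filter (%b. fst b < fst x) W ~= []" using Cons.prems by auto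
    then obtain z where z: "z : set W" "fst z < fst x" by (auto simp: filter_empty_conv)
    then obtain y V where W: "W = y # V" by (cases W) auto
    have "fst y < fst x"
    proof (rule ccontr)
      assume n: "\<not> fst y < fst x"
      hence "z : set V" "fst z < fst y" using z W by auto
      hence "filter (%b. fst b < fst y) V ~= []" by (auto simp: filter_empty_conv)
      thus False using True W by auto
    qed
    hence "x # W = [] @ x # y # V & fst y < fst x" using W by simp
    thus ?thesis by blast
  qed
qed simp

section \<open>Colour Lie algebras in a homogeneous basis\<close>

locale lie_basis = based_space s B co for s :: "'k::field_char_0 => 'l::ab_group_add => 'l" and B co +
  fixes dg :: "'l => 'c::ab_group_add" and eps :: "'c => 'c => 'k" and br :: "'l => 'l => 'l"
  assumes comm_factor: "commutation_factor eps"
    and br_bilinear: "bilinear_map s s s br"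
    and br_dg: "x : B ==> y : B ==> b : B ==> co (br x y) b ~= 0 ==> dg b = dg x + dg y"
    and br_antisym: "x : B ==> y : B ==> br x y = - s (eps (dg x) (dg y)) (br y x)"
    and br_jacobi: "x : B ==> y : B ==> z : B ==>
      br x (br y z) = br (br x y) z + s (eps (dg x) (dg y)) (br y (br x z))"
begin

lemma eps_inv [simp]: "eps a b * eps b a = 1"
  and eps_add_l: "eps (a + b) c = eps a c * eps b c"
  and eps_add_r: "eps a (b + c) = eps a b * eps a c"
  using comm_factor by (auto simp: commutation_factor_def)

lemma br_add_l: "br (x + x') y = br x y + br x' y"
  and br_add_r: "br x (y + y') = br x y + br x y'"
  and br_scale_l: "br (s c x) y = s c (br x y)"
  and br_scale_r: "br x (s c y) = s c (br x y)"
  using br_bilinear by (auto simp: bilinear_map_def lin_iff)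

lemma br_sum_l: "br (SUM i:A. f i) y = (SUM i:A. br (f i) y)"
  by (induction A rule: fin_induct)
    (use br_add_l br_scale_l[of 0 0 y] in auto)

lemma br_sum_r: "br x (SUM i:A. f i) = (SUM i:A. br x (f i))"
  by (induction A rule: fin_induct)
    (use br_add_r br_scale_r[of x 0 0] in auto)

end

text \<open>\<open>K\<close> is an arbitrary function on words. The construction turns it into a
  function \<open>D\<close> that satisfies the relations of the enveloping algebra, and hence
  defines a linear map on it. If \<open>K\<close> respects interchanges of letters up to lower
  terms, it is the leading term of \<open>D\<close>. Three instances matter in spirit: a homotopy
  (\<open>K\<close> replaces letters of \<open>V\<close>), a retraction onto \<open>U(\<gg>)\<close>
  (\<open>K\<close> discards them), and everything that is proved for a general
  \<open>K\<close>.\<close>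

locale pbw = lie_basis s B co dg eps br + z: vector_space sz
  for s :: "'k::field_char_0 => 'l::ab_group_add => 'l" and B co and dg :: "'l => 'c::ab_group_add" and eps br
    and sz :: "'k => 'z::ab_group_add => 'z" +
  fixes K :: "'l list => 'z"
begin

definition ins :: "('l list => 'z) => 'l list => 'l => 'l list => 'z" where
  "ins G u t v = (SUM b:B. sz (co t b) (G (u @ b # v)))"

lemma ins_add: "ins G u (t + t') v = ins G u t v + ins G u t' v"
  by (simp add: ins_def co_add z.scale_left_distrib sum.distrib)

lemma ins_scale: "ins G u (s c t) v = sz c (ins G u t v)"
  by (simp add: ins_def co_scale z.scale_sum_right)

lemma ins_uminus: "ins G u (- t) v = - ins G u t v"
  using ins_scale[of G u "- 1" t v] by simp

definition good :: "nat => ('l list => 'z) => bool" where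
  "good n G \<longleftrightarrow> (ALL u:lists B. ALL v:lists B. ALL x:B. ALL y:B. length (u @ x # y # v) <= n -->
     G (u @ x # y # v) = sz (eps (dg x) (dg y)) (G (u @ y # x # v)) + ins G u (br x y) v)"

abbreviation chi :: "'l => 'l => 'k" where "chi x y == eps (dg x) (dg y)"

text \<open>\<open>fs G m W\<close> sorts the labelled word \<open>W\<close>, which has \<open>m\<close> inversions, by adjacent
  transpositions and adds up the resulting bracket terms, evaluated with \<open>G\<close>.\<close>

primrec fs :: "('l list => 'z) => nat => (nat \<times> 'l) list => 'z" where
  "fs G 0 W = K (map snd W)"
| "fs G (Suc m) W = (if EX u a b v. W = u @ a # b # v & fst b < fst a
     then (let (u, a, b, v) = (SOME (u, a, b, v). W = u @ a # b # v & fst b < fst a)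
       in sz (chi (snd a) (snd b)) (fs G m (u @ b # a # v)) + ins G (map snd u) (br (snd a) (snd b)) (map snd v))
     else K (map snd W))"

text \<open>The descent is picked by Hilbert choice from \<open>W\<close> alone, hence is the same
  for every \<open>G\<close>. The quantifier over \<open>G\<close> inside the existential records
  this, and \<open>fs_cong\<close> depends on it.\<close>

lemma fs_Suc_cases:
  "(EX u a b v. W = u @ a # b # v & fst b < fst a &
      (ALL G. fs G (Suc m) W = sz (chi (snd a) (snd b)) (fs G m (u @ b # a # v)) +
        ins G (map snd u) (br (snd a) (snd b)) (map snd v)))
   \<or> ((ALL G. fs G (Suc m) W = K (map snd W)) & \<not> (EX u a b v. W = u @ a # b # v & fst b < fst a))"
proof (cases "EX u a b v. W = u @ a # b # v & fst b < fst a")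
  case True
  obtain u a b v where x: "(SOME (u, a, b, v). W = u @ a # b # v & fst b < fst a) = (u, a, b, v)"
    by (rule prod_cases4)
  have "EX q. case q of (u, a, b, v) => W = u @ a # b # v & fst b < fst a" using True by auto
  from someI_ex[OF this] have "W = u @ a # b # v & fst b < fst a" unfolding x by simp
  hence "fs G (Suc m) W = sz (chi (snd a) (snd b)) (fs G m (u @ b # a # v)) +
        ins G (map snd u) (br (snd a) (snd b)) (map snd v)" for G
    using True x by (simp only: fs.simps if_True Let_def split)
  hence "W = u @ a # b # v & fst b < fst a & (ALL G. fs G (Suc m) W = sz (chi (snd a) (snd b)) (fs G m (u @ b # a # v)) +
        ins G (map snd u) (br (snd a) (snd b)) (map snd v))"
    using \<open>W = u @ a # b # v & fst b < fst a\<close> by (auto simp del: fs.simps)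
  thus ?thesis by (intro disjI1 exI)
next
  case False
  hence "fs G (Suc m) W = K (map snd W)" for G by (simp only: fs.simps if_False)
  thus ?thesis using False by (intro disjI2 conjI allI)
qed

declare fs.simps(2) [simp del]

lemma chi_mult [simp]: "chi x y * chi y x = 1" by simp

text \<open>The relations between basis letters, extended linearly to an inserted vector
  \<open>t\<close> whose support has the single degree \<open>a\<close>. In the applications
  \<open>t\<close> is a bracket.\<close>

lemma ins_rel:
  assumes G: "good n G" and u: "u : lists B" and v: "v : lists B" and z: "z : B"
    and t: "!!b. b : B ==> co t b ~= 0 ==> dg b = a" and n: "Suc (Suc (length u + length v)) <= n"
  shows "ins G u t (z # v) = sz (eps a (dg z)) (ins G (u @ [z]) t v) + ins G u (br t z) v"
    and "ins G (u @ [z]) t v = sz (eps (dg z) a) (ins G u t (z # v)) + ins G u (br z t) v"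
proof -
  have g: "G (u @ b # z # v) = sz (chi b z) (G (u @ z # b # v)) + ins G u (br b z) v"
    "G (u @ z # b # v) = sz (chi z b) (G (u @ b # z # v)) + ins G u (br z b) v" if "b : B" for b
    using u v z n that by (auto intro!: G[unfolded good_def, rule_format])
  have e: "br t z = (SUM b:B. s (co t b) (br b z))" "br z t = (SUM b:B. s (co t b) (br z b))"
    using arg_cong[OF co_expand[of t], of "%t. br t z"] arg_cong[OF co_expand[of t], of "%t. br z t"]
    by (simp_all only: br_sum_l br_scale_l br_sum_r br_scale_r)
  have insum: "ins G u (SUM b:B. s (co t b) (F b)) v = (SUM b:B. sz (co t b) (ins G u (F b) v))" for F
    by (simp add: ins_def co_sum co_scale z.scale_sum_left z.scale_sum_right) (rule sum.swap)
  have "ins G u t (z # v) = (SUM b:B. sz (eps a (dg z)) (sz (co t b) (G (u @ z # b # v))) + sz (co t b) (ins G u (br b z) v))"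
    unfolding ins_def[of G u t]
  proof (rule sum.cong[OF refl])
    fix b assume b: "b : B"
    show "sz (co t b) (G (u @ b # z # v)) =
        sz (eps a (dg z)) (sz (co t b) (G (u @ z # b # v))) + sz (co t b) (ins G u (br b z) v)"
      using t[OF b] g(1)[OF b] by (cases "co t b = 0") (auto simp: z.scale_right_distrib mult.commute)
  qed
  thus "ins G u t (z # v) = sz (eps a (dg z)) (ins G (u @ [z]) t v) + ins G u (br t z) v"
    by (simp add: e insum sum.distrib ins_def[of G "u @ [z]" t] z.scale_sum_right)
  have "ins G (u @ [z]) t v = (SUM b:B. sz (eps (dg z) a) (sz (co t b) (G (u @ b # z # v))) + sz (co t b) (ins G u (br z b) v))"
    unfolding ins_def[of G "u @ [z]" t]
  proof (rule sum.cong[OF refl])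
    fix b assume b: "b : B"
    show "sz (co t b) (G ((u @ [z]) @ b # v)) =
        sz (eps (dg z) a) (sz (co t b) (G (u @ b # z # v))) + sz (co t b) (ins G u (br z b) v)"
      using t[OF b] g(2)[OF b] by (cases "co t b = 0") (auto simp: z.scale_right_distrib mult.commute)
  qed
  thus "ins G (u @ [z]) t v = sz (eps (dg z) a) (ins G u t (z # v)) + ins G u (br z t) v"
    by (simp add: e insum sum.distrib ins_def[of G u t] z.scale_sum_right)
qed

text \<open>Interchanging one pair inserts its bracket. Doing so while the bracket of the other pair
  is already inserted gives, from either side, the same double sum over basis vectors.\<close>

lemma ins_far:
  assumes G: "good n G" and l: "u : lists B" "t : lists B" "v : lists B"
    and B: "a : B" "b : B" "c : B" "d : B" and n: "length u + length t + length v + 3 <= n"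
  shows "ins G u (br a b) (t @ c # d # v) + sz (chi a b) (ins G (u @ b # a # t) (br c d) v) =
    sz (chi c d) (ins G u (br a b) (t @ d # c # v)) + ins G (u @ a # b # t) (br c d) v"
proof -
  have g1: "G ((u @ p # t) @ c # d # v) = sz (chi c d) (G ((u @ p # t) @ d # c # v)) + ins G (u @ p # t) (br c d) v"
    if "p : B" for p
    using that assms by (intro G[unfolded good_def, rule_format]) auto
  have g2: "G (u @ a # b # (t @ p # v)) = sz (chi a b) (G (u @ b # a # (t @ p # v))) + ins G u (br a b) (t @ p # v)"
    if "p : B" for p
    using that assms by (intro G[unfolded good_def, rule_format]) auto
  have "ins G u (br a b) (t @ c # d # v) - sz (chi c d) (ins G u (br a b) (t @ d # c # v)) =
    (SUM p:B. sz (co (br a b) p) (ins G (u @ p # t) (br c d) v))"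
    using g1 by (simp add: ins_def[of G u] z.scale_sum_right z.scale_right_distrib sum.distrib mult.commute)
  also have "... = (SUM q:B. sz (co (br c d) q) (ins G u (br a b) (t @ q # v)))"
    unfolding ins_def by (simp add: z.scale_sum_right mult.commute) (rule sum.swap)
  also have "... = ins G (u @ a # b # t) (br c d) v - sz (chi a b) (ins G (u @ b # a # t) (br c d) v)"
    using g2 by (simp add: ins_def[of G "_ @ _"] z.scale_sum_right z.scale_right_distrib sum.distrib mult.commute)
  finally show ?thesis by (simp add: algebra_simps)
qed

text \<open>The two sides collect the bracket terms of the two ways to reverse three adjacent
  letters: interchange \<open>x y\<close>, then \<open>x z\<close>, then \<open>y z\<close>, or in
  the opposite order. After moving the remaining letter past each bracket, the difference is the
  Jacobi identity.\<close>

lemma ins_near: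
  assumes G: "good n G" and l: "u : lists B" "v : lists B"
    and B: "x : B" "y : B" "z : B" and n: "length u + length v + 2 <= n"
  shows "ins G u (br x y) (z # v) + sz (chi x y) (ins G (u @ [y]) (br x z) v) +
      sz (chi x y * chi x z) (ins G u (br y z) (x # v)) =
    ins G (u @ [x]) (br y z) v + sz (chi y z) (ins G u (br x z) (y # v)) +
      sz (chi y z * chi x z) (ins G (u @ [z]) (br x y) v)"
proof -
  have d: "eps (dg x + dg y) (dg z) = chi x z * chi y z" "eps (dg y) (dg x + dg z) = chi y x * chi y z"
    "eps (dg x) (dg y + dg z) = chi x y * chi x z" by (simp_all add: eps_add_l eps_add_r)
  have n': "Suc (Suc (length u + length v)) <= n" using n by simp
  have 1: "ins G u (br x y) (z # v) = sz (chi x z * chi y z) (ins G (u @ [z]) (br x y) v) + ins G u (br (br x y) z) v"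
    using ins_rel(1)[OF G l B(3) br_dg[OF B(1,2)] n'] by (simp add: d)
  have 2: "ins G (u @ [y]) (br x z) v = sz (chi y x * chi y z) (ins G u (br x z) (y # v)) + ins G u (br y (br x z)) v"
    using ins_rel(2)[OF G l B(2) br_dg[OF B(1,3)] n'] by (simp add: d)
  have 3: "ins G (u @ [x]) (br y z) v = sz (chi x y * chi x z) (ins G u (br y z) (x # v)) + ins G u (br x (br y z)) v"
    using ins_rel(2)[OF G l B(1) br_dg[OF B(2,3)] n'] by (simp add: d)
  have 4: "ins G u (br x (br y z)) v = ins G u (br (br x y) z) v + sz (chi x y) (ins G u (br y (br x z)) v)"
    by (simp add: br_jacobi[OF B] ins_add ins_scale)
  show ?thesis
    unfolding 1 2 3 4 by (simp add: z.scale_right_distrib mult.assoc[symmetric] mult.commute)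
qed

definition val :: "('l list => 'z) => nat => (nat \<times> 'l) list => nat \<times> 'l => nat \<times> 'l => (nat \<times> 'l) list => 'z" where
  "val G m u a b v = sz (chi (snd a) (snd b)) (fs G m (u @ b # a # v)) + ins G (map snd u) (br (snd a) (snd b)) (map snd v)"

text \<open>Local confluence: two descents at a distance commute, two overlapping ones are
  reconciled by the Jacobi identity.\<close>

lemma fs_descent:
  assumes G: "good n G"
  shows "map snd W : lists B ==> length W <= Suc n ==> inversions W = Suc m ==> W = u @ a # b # v ==> fst b < fst a ==>
    fs G (Suc m) W = val G m u a b v"
proof (induction m arbitrary: W u a b v rule: less_induct)
  case (less m W u a b v)
  \<comment> \<open>It suffices to compare two descents with the first strictly further left: equal
    positions give equal factorizations, and the other case is symmetric.\<close>
  have lt: "val G m u a b v = val G m u' a' b' v'"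
    if W: "W = u @ a # b # v" "fst b < fst a" "W = u' @ a' # b' # v'" "fst b' < fst a'" and l: "length u < length u'"
    for u a b v u' a' b' v'
  proof -
    have inv: "inversions (u @ b # a # v) = m" "inversions (u' @ b' # a' # v') = m"
      using less.prems(3) W inversions_swap by (metis old.nat.inject)+
    have "u @ a # b # v = u' @ a' # b' # v'" using W by simp
    then obtain t where t: "u' = u @ a # t" "b # v = t @ a' # b' # v'"
      using l by (auto simp: append_eq_append_conv2 append_eq_Cons_conv Cons_eq_append_conv)
    have lB: "map snd u : lists B" "map snd v : lists B" "snd a : B" "snd b : B"
      "map snd u' : lists B" "map snd v' : lists B" "snd a' : B" "snd b' : B"
      using less.prems(1) W(1) less.prems(1)[unfolded W(3)] by auto
    show ?thesis
    proof (cases t)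
      case Nil
      \<comment> \<open>Overlapping descents: the labels satisfy c < b < a, and after two further
        interchanges both routes reach the order c, b, a.\<close>
      hence e: "a' = b" "v = b' # v'" "u' = u @ [a]" using t by auto
      define c where "c = b'"
      have i2: "inversions (u @ b # c # a # v') = m - 1" "inversions (u @ c # a # b # v') = m - 1" "m ~= 0"
        using inv e W(2,4) inversions_swap[of c a "u @ [b]" v'] inversions_swap[of c a u "b # v'"]
        by (auto simp: c_def)
      have i3: "inversions (u @ c # b # a # v') = m - 2" "m - 1 ~= 0"
        using i2 e W(2,4) inversions_swap[of c b u "a # v'"] by (auto simp: c_def)
      obtain k where k: "m = Suc (Suc k)" using i2(3) i3(2) by (cases m; cases "m - 1") auto
      have IH: "fs G (Suc (Suc k)) (u @ b # a # c # v') = val G (Suc k) (u @ [b]) a c v'"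
        "fs G (Suc k) (u @ b # c # a # v') = val G k u b c (a # v')"
        "fs G (Suc (Suc k)) (u @ a # c # b # v') = val G (Suc k) u a c (b # v')"
        "fs G (Suc k) (u @ c # a # b # v') = val G k (u @ [c]) a b v'"
        using less.prems(1,2) W e inv i2 i3 k unfolding c_def
        by - (rule less.IH; auto)+
      note N = ins_near[OF G lB(1,6,3,4,8)]
      have len: "length (map snd u) + length (map snd v') + 2 <= n"
        using less.prems(2) W(1) e by simp
      have x1: "val G m u a b v = sz (chi (snd a) (snd b)) (sz (chi (snd a) (snd c)) (sz (chi (snd b) (snd c)) (fs G k (u @ c # b # a # v')) +
            ins G (map snd u) (br (snd b) (snd c)) (snd a # map snd v')) + ins G (map snd u @ [snd b]) (br (snd a) (snd c)) (map snd v'))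
          + ins G (map snd u) (br (snd a) (snd b)) (snd c # map snd v')"
        using IH(1,2) e k by (simp add: val_def c_def)
      have x2: "val G m u' a' b' v' = sz (chi (snd b) (snd c)) (sz (chi (snd a) (snd c)) (sz (chi (snd a) (snd b)) (fs G k (u @ c # b # a # v')) +
            ins G (map snd u @ [snd c]) (br (snd a) (snd b)) (map snd v')) + ins G (map snd u) (br (snd a) (snd c)) (snd b # map snd v'))
          + ins G (map snd u @ [snd a]) (br (snd b) (snd c)) (map snd v')"
        using IH(3,4) e k by (simp add: val_def c_def)
      show ?thesis unfolding x1 x2 using N[OF len]
        by (simp add: z.scale_right_distrib c_def algebra_simps)
    next
      case (Cons b0 t')
      hence e: "v = t' @ a' # b' # v'" "u' = u @ a # b # t'" using t by auto
      have i2: "inversions (u @ b # a # t' @ b' # a' # v') = m - 1" "m ~= 0"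
        using inv e W(2,4) inversions_swap[of b' a' "u @ b # a # t'" v'] by auto
      obtain k where k: "m = Suc k" using i2(2) by (cases m) auto
      have IH: "fs G (Suc k) (u @ b # a # t' @ a' # b' # v') = val G k (u @ b # a # t') a' b' v'"
        "fs G (Suc k) (u @ a # b # t' @ b' # a' # v') = val G k u a b (t' @ b' # a' # v')"
        using less.prems(1,2) W e inv i2 k
        by - (rule less.IH; auto)+
      have tB: "map snd t' : lists B" using less.prems(1) W(1) e by (auto simp: in_lists_conv_set)
      have len: "length (map snd u) + length (map snd t') + length (map snd v') + 3 <= n"
        using less.prems(2) W(1) e by simp
      note N = ins_far[OF G lB(1) tB lB(6,3,4,7,8) len]
      have x1: "val G m u a b v = sz (chi (snd a) (snd b)) (sz (chi (snd a') (snd b')) (fs G k (u @ b # a # t' @ b' # a' # v')) +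
          ins G (map snd u @ snd b # snd a # map snd t') (br (snd a') (snd b')) (map snd v'))
         + ins G (map snd u) (br (snd a) (snd b)) (map snd t' @ snd a' # snd b' # map snd v')"
        using IH(1) e k by (simp add: val_def)
      have x2: "val G m u' a' b' v' = sz (chi (snd a') (snd b')) (sz (chi (snd a) (snd b)) (fs G k (u @ b # a # t' @ b' # a' # v')) +
          ins G (map snd u) (br (snd a) (snd b)) (map snd t' @ snd b' # snd a' # map snd v'))
         + ins G (map snd u @ snd a # snd b # map snd t') (br (snd a') (snd b')) (map snd v')"
        using IH(2) e k by (simp add: val_def)
      show ?thesis unfolding x1 x2 using N
        by (simp add: z.scale_right_distrib algebra_simps)
    qed
  qed
  obtain u' a' b' v' where c: "W = u' @ a' # b' # v'" "fst b' < fst a'" "fs G (Suc m) W = val G m u' a' b' v'"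
    using fs_Suc_cases[of W m] less.prems(4,5) unfolding val_def by blast
  consider "length u < length u'" | "length u' < length u" | "length u = length u'" by linarith
  hence "val G m u a b v = val G m u' a' b' v'"
  proof cases
    case 3
    thus ?thesis using c(1) less.prems(4) by simp
  qed (use lt c less.prems(4,5) in metis)+
  thus ?case using c by simp
qed

section \<open>Averaging over all labellings\<close>

definition labs :: "nat => nat list set" where
  "labs n = {p. length p = n & distinct p & set p <= {..<n}}"

lemma finite_labs: "finite (labs n)"
  by (rule finite_subset[OF _ finite_lists_length_eq[of "{..<n}" n]]) (auto simp: labs_def)

lemma card_labs: "of_nat (card (labs n)) ~= (0::'k)"
proof -
  have "[0..<n] : labs n" by (auto simp: labs_def)
  thus ?thesis using finite_labs[of n] by (auto simp: card_eq_0_iff)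
qed

text \<open>Each labelling prescribes one target order of the positions; the sum over all
  permutations prefers none of them. Characteristic 0 makes their number invertible.\<close>

definition avg :: "('l list => 'z) => 'l list => 'z" where
  "avg G w = sz (1 / of_nat (card (labs (length w))))
     (SUM p:labs (length w). fs G (inversions (zip p w)) (zip p w))"

text \<open>A bracket term is one letter shorter than its word, so the value at length n + 1 needs
  only values at length n. The values of \<open>Dn n\<close> on words longer than n have no meaning;
  \<open>Dn_eq\<close> and \<open>good\<close> avoid them.\<close>

primrec Dn :: "nat => 'l list => 'z" where
  "Dn 0 w = avg (%_. 0) w"
| "Dn (Suc n) w = (if length w = Suc n then avg (Dn n) w else Dn n w)"

definition D :: "'l list => 'z" where
  "D w = Dn (length w) w"

lemma Dn_eq: "length w <= n ==> Dn n w = D w"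
  by (induction n) (auto simp: D_def le_Suc_eq)

text \<open>A descent is resolved by \<open>fs_descent\<close>. An ascent is the same relation read
  backwards, the bracket changing by \<epsilon>-antisymmetry.\<close>

lemma fs_rel:
  assumes G: "good n G" and B: "map snd (u @ a # b # v) : lists B" and n: "length (u @ a # b # v) <= Suc n"
    and ab: "fst a ~= fst b"
  shows "fs G (inversions (u @ a # b # v)) (u @ a # b # v) =
    val G (inversions (u @ b # a # v)) u a b v"
proof (cases "fst b < fst a")
  case True
  thus ?thesis using fs_descent[OF G B n] inversions_swap[OF True] by metis
next
  case False
  hence lt: "fst a < fst b" using ab by simp
  have "fs G (inversions (u @ b # a # v)) (u @ b # a # v) = val G (inversions (u @ a # b # v)) u b a v"
    using fs_descent[OF G, of "u @ b # a # v" "inversions (u @ a # b # v)" u b a v] B n inversions_swap[OF lt, of u v] lt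
    by simp
  thus ?thesis
    using B br_antisym[of "snd a" "snd b"]
    by (simp add: val_def z.scale_right_distrib ins_uminus ins_scale)
qed

text \<open>Interchanging two adjacent labels is an involution \<open>sw\<close> of the set of
  labellings. It pairs the summands of the two words so that each pair satisfies
  \<open>fs_rel\<close>. The labels differ even if \<open>x = y\<close>, so repeated letters are no
  exception.\<close>

lemma good_avg:
  assumes G: "good n G" and B: "u : lists B" "v : lists B" "x : B" "y : B" and n: "length (u @ x # y # v) <= Suc n"
  shows "avg G (u @ x # y # v) = sz (chi x y) (avg G (u @ y # x # v)) + ins G u (br x y) v"
proof -
  define k where "k = length u"
  define N where "N = length (u @ x # y # v)"
  define sw where "sw p = take k p @ p ! Suc k # p ! k # drop (Suc (Suc k)) p" for p :: "nat list"
  have split: "p = take k p @ p ! k # p ! Suc k # drop (Suc (Suc k)) p" if "length p = N" for p :: "nat list"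
    using that by (simp add: N_def k_def Cons_nth_drop_Suc)
  have sw_labs: "sw p : labs N" "sw (sw p) = p" if p: "p : labs N" for p
  proof -
    have l: "length p = N" using p by (simp add: labs_def)
    have "distinct p" "set p <= {..<N}" using p by (auto simp: labs_def)
    hence "distinct (take k p @ p ! k # p ! Suc k # drop (Suc (Suc k)) p)"
      "set (take k p @ p ! k # p ! Suc k # drop (Suc (Suc k)) p) <= {..<N}" using split[OF l] by auto
    thus "sw p : labs N" using l by (auto simp: sw_def labs_def N_def k_def)
    have [simp]: "min (length p) k = k" "min k (length p) = k" using l by (auto simp: N_def k_def)
    have "sw (sw p) = take k p @ p ! k # p ! Suc k # drop (Suc (Suc k)) p"
      by (simp add: sw_def nth_append)
    thus "sw (sw p) = p" using split[OF l] by simp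
  qed
  have bij: "bij_betw sw (labs N) (labs N)"
    by (rule bij_betwI[of _ _ _ sw]) (use sw_labs in auto)
  have one: "fs G (inversions (zip p (u @ x # y # v))) (zip p (u @ x # y # v)) =
     sz (chi x y) (fs G (inversions (zip (sw p) (u @ y # x # v))) (zip (sw p) (u @ y # x # v))) + ins G u (br x y) v"
    if p: "p : labs N" for p
  proof -
    have l: "length p = N" and dp: "distinct p" using p by (auto simp: labs_def)
    have kl: "length (take k p) = length u" using l by (simp add: N_def k_def)
    have z1: "zip p (u @ x # y # v) = zip (take k p) u @ (p ! k, x) # (p ! Suc k, y) # zip (drop (Suc (Suc k)) p) v"
      using arg_cong[OF split[OF l], of "%p. zip p (u @ x # y # v)"] by (simp add: zip_append[OF kl])
    have z2: "zip (sw p) (u @ y # x # v) = zip (take k p) u @ (p ! Suc k, y) # (p ! k, x) # zip (drop (Suc (Suc k)) p) v"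
      by (simp add: sw_def zip_append[OF kl])
    have ne: "p ! k ~= p ! Suc k" using dp l by (simp add: N_def k_def nth_eq_iff_index_eq)
    have m: "map snd (zip (take k p) u) = u" "map snd (zip (drop (Suc (Suc k)) p) v) = v"
      using l by (simp_all add: N_def k_def)
    have "map snd (zip p (u @ x # y # v)) : lists B" using B l by (simp add: N_def)
    thus ?thesis
      unfolding z1 z2 using fs_rel[OF G, of "zip (take k p) u" "(p ! k, x)" "(p ! Suc k, y)" "zip (drop (Suc (Suc k)) p) v"] ne n l
      by (simp add: val_def m N_def k_def)
  qed
  have "(SUM p:labs N. fs G (inversions (zip p (u @ x # y # v))) (zip p (u @ x # y # v))) =
    (SUM p:labs N. sz (chi x y) (fs G (inversions (zip (sw p) (u @ y # x # v))) (zip (sw p) (u @ y # x # v))) + ins G u (br x y) v)"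
    by (rule sum.cong[OF refl one])
  also have "... = sz (chi x y) (SUM p:labs N. fs G (inversions (zip (sw p) (u @ y # x # v))) (zip (sw p) (u @ y # x # v)))
      + sz (of_nat (card (labs N))) (ins G u (br x y) v)"
    by (simp add: sum.distrib z.scale_sum_right z.sum_constant_scale)
  also have "(SUM p:labs N. fs G (inversions (zip (sw p) (u @ y # x # v))) (zip (sw p) (u @ y # x # v))) =
    (SUM p:labs N. fs G (inversions (zip p (u @ y # x # v))) (zip p (u @ y # x # v)))"
    by (rule sum.reindex_bij_betw[OF bij])
  finally show ?thesis
    using card_labs[of N] by (simp add: avg_def N_def z.scale_right_distrib mult.commute)
qed

lemma ins_cong: "(!!b. b : B ==> G (u @ b # v) = G' (u @ b # v)) ==> ins G u t v = ins G' u t v"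
  by (auto simp: ins_def intro!: sum.cong)

lemma good_Dn: "good n (Dn n)"
proof (induction n)
  case 0
  thus ?case by (simp add: good_def)
next
  case (Suc n)
  show ?case unfolding good_def
  proof (intro ballI impI)
    fix u v x y assume a: "u : lists B" "v : lists B" "x : B" "y : B" "length (u @ x # y # v) <= Suc n"
    have i: "ins (Dn (Suc n)) u (br x y) v = ins (Dn n) u (br x y) v"
      using a by (intro ins_cong) auto
    show "Dn (Suc n) (u @ x # y # v) = sz (chi x y) (Dn (Suc n) (u @ y # x # v)) + ins (Dn (Suc n)) u (br x y) v"
    proof (cases "length (u @ x # y # v) = Suc n")
      case True
      thus ?thesis unfolding i using good_avg[OF Suc a(1-5)] by simp
    next
      case False
      thus ?thesis unfolding i using a by (auto intro!: Suc[unfolded good_def, rule_format])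
    qed
  qed
qed

lemma good_D: "good n D"
  unfolding good_def
proof (intro ballI impI)
  fix u v x y assume a: "u : lists B" "v : lists B" "x : B" "y : B" "length (u @ x # y # v) <= n"
  have "ins D u (br x y) v = ins (Dn n) u (br x y) v"
    using a by (intro ins_cong) (simp add: Dn_eq)
  moreover have "Dn n (u @ x # y # v) = sz (chi x y) (Dn n (u @ y # x # v)) + ins (Dn n) u (br x y) v"
    using a by (auto intro!: good_Dn[of n, unfolded good_def, rule_format])
  moreover have "Dn n (u @ x # y # v) = D (u @ x # y # v)" "Dn n (u @ y # x # v) = D (u @ y # x # v)"
    using a by (auto intro!: Dn_eq)
  ultimately show "D (u @ x # y # v) = sz (chi x y) (D (u @ y # x # v)) + ins D u (br x y) v"
    by simp
qed

theorem D_rel: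
  "u : lists B ==> v : lists B ==> x : B ==> y : B ==>
    D (u @ x # y # v) = sz (chi x y) (D (u @ y # x # v)) + (SUM b:B. sz (co (br x y) b) (D (u @ b # v)))"
  by (rule good_D[of "length (u @ x # y # v)", unfolded good_def ins_def, rule_format]) auto

lemma fs_cong:
  "(!!w. Suc (length w) = length W ==> G w = G' w) ==> fs G m W = fs G' m W"
proof (induction m arbitrary: W)
  case (Suc m)
  from fs_Suc_cases[of W m] show ?case
  proof (elim disjE exE conjE)
    fix u a b v assume W: "W = u @ a # b # v" and
      f: "ALL G. fs G (Suc m) W = sz (chi (snd a) (snd b)) (fs G m (u @ b # a # v)) + ins G (map snd u) (br (snd a) (snd b)) (map snd v)"
    have "fs G m (u @ b # a # v) = fs G' m (u @ b # a # v)" using Suc.prems W by (intro Suc.IH) auto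
    moreover have "ins G (map snd u) (br (snd a) (snd b)) (map snd v) = ins G' (map snd u) (br (snd a) (snd b)) (map snd v)"
      using Suc.prems W by (intro ins_cong) auto
    ultimately show ?thesis using f by simp
  qed simp
qed simp

text \<open>\<open>fs\<close> evaluates its function only on words with exactly one letter fewer,
  where the stages have already stabilized. The recursion thus becomes a fixed-point
  equation.\<close>

lemma D_avg: "D w = avg D w"
proof (cases "length w")
  case 0
  thus ?thesis by (simp add: D_def avg_def)
next
  case (Suc n)
  have "fs (Dn n) m (zip p w) = fs D m (zip p w)" if "p : labs (length w)" for p m
    using that Suc by (intro fs_cong) (auto simp: labs_def Dn_eq)
  thus ?thesis using Suc by (simp add: D_def avg_def)
qed

section \<open>Subspaces, filtrations and derivations under averaging\<close>

lemma avg_mem: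
  assumes "z.subspace S" and "!!p. p : labs (length w) ==> fs G (inversions (zip p w)) (zip p w) - c : S"
  shows "avg G w - c : S"
proof -
  let ?n = "of_nat (card (labs (length w))) :: 'k"
  have "avg G w - c = sz (1 / ?n) (SUM p:labs (length w). fs G (inversions (zip p w)) (zip p w) - c)"
    using card_labs[of "length w"]
    by (simp add: avg_def sum_subtractf z.scale_right_diff_distrib z.sum_constant_scale)
  also have "... : S" using assms by (intro z.subspace_scale z.subspace_sum) auto
  finally show ?thesis .
qed

lemma zip_lists:
  assumes "p : labs (length w)" "w : lists B"
  shows "map snd (zip p w) : lists B" "map snd (zip p w) = w" "length (zip p w) = length w" "distinct (map fst (zip p w))"
  using assms by (auto simp: labs_def dest: set_zip_rightD)

text \<open>Sorting only interchanges letters and replaces two letters by a basis letter of their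
  bracket. A family of subspaces that is monotone under both operations and contains
  \<open>K\<close> therefore contains \<open>D\<close>. This yields filtration bounds, degrees and
  vanishing statements alike.\<close>

lemma D_mem:
  assumes S: "!!w. w : lists B ==> z.subspace (S w)" and K: "!!w. w : lists B ==> K w : S w"
    and sw: "!!u x y v. u : lists B ==> v : lists B ==> x : B ==> y : B ==> S (u @ y # x # v) <= S (u @ x # y # v)"
    and br: "!!u x y v b. u : lists B ==> v : lists B ==> x : B ==> y : B ==> b : B ==> co (br x y) b ~= 0 ==>
      S (u @ b # v) <= S (u @ x # y # v)"
  shows "w : lists B ==> D w : S w"
proof (induction "length w" arbitrary: w rule: less_induct)
  case less
  have f: "fs D m W : S (map snd W)" if "map snd W : lists B" "length W = length w" for m W
    using that
  proof (induction m arbitrary: W)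
    case (Suc m)
    have WB: "map snd W : lists B" using Suc.prems by auto
    from fs_Suc_cases[of W m] show ?case
    proof (elim disjE exE conjE)
      fix u a b v assume W: "W = u @ a # b # v" and
        f: "ALL G. fs G (Suc m) W = sz (chi (snd a) (snd b)) (fs G m (u @ b # a # v)) + ins G (map snd u) (br (snd a) (snd b)) (map snd v)"
      have B: "map snd u : lists B" "map snd v : lists B" "snd a : B" "snd b : B" using Suc.prems W by auto
      have "fs D m (u @ b # a # v) : S (map snd (u @ b # a # v))" using Suc.prems W by (intro Suc.IH) auto
      hence 1: "fs D m (u @ b # a # v) : S (map snd W)" using sw[OF B] W by auto
      have "sz (co (br (snd a) (snd b)) c) (D (map snd u @ c # map snd v)) : S (map snd W)" if c: "c : B" for c
      proof (cases "co (br (snd a) (snd b)) c = 0")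
        case True
        thus ?thesis using S[OF WB] by (simp add: z.subspace_0)
      next
        case False
        have "D (map snd u @ c # map snd v) : S (map snd u @ c # map snd v)"
          using B c Suc.prems W by (intro less.hyps) auto
        thus ?thesis using br[OF B c False] W by (intro z.subspace_scale[OF S[OF WB]]) auto
      qed
      hence "ins D (map snd u) (br (snd a) (snd b)) (map snd v) : S (map snd W)"
        unfolding ins_def by (rule z.subspace_sum[OF S[OF WB]])
      thus ?thesis unfolding f[rule_format]
        by (intro z.subspace_add[OF S[OF WB]] z.subspace_scale[OF S[OF WB]] 1)
    qed (use K WB in simp)
  qed (use K in auto)
  have "avg D w - 0 : S w"
  proof (rule avg_mem[OF S[OF less.prems]])
    fix p assume p: "p : labs (length w)"
    show "fs D (inversions (zip p w)) (zip p w) - 0 : S w"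
      using f[of "zip p w"] zip_lists[OF p less.prems] by simp
  qed
  thus ?case using D_avg[of w] by simp
qed

text \<open>Each interchange changes \<open>K\<close> by an element of the next lower piece, by
  \<open>K2\<close>, and the bracket terms are values on shorter words. So every sorted value has
  leading term \<open>K w\<close>, and the average inherits it.\<close>

lemma D_filtration:
  assumes Z: "!!n. z.subspace (Z n)" "!!n. Z n <= Z (Suc n)" and K: "!!w. w : lists B ==> K w : Z (length w)"
    and K2: "!!u x y v. u : lists B ==> v : lists B ==> x : B ==> y : B ==>
      K (u @ x # y # v) - sz (chi x y) (K (u @ y # x # v)) : Z (Suc (length u + length v))"
    and w: "w : lists B"
  shows "D w : Z (length w)" "length w = Suc n ==> D w - K w : Z n"
proof -
  have D: "D w : Z (length w)" if "w : lists B" for w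
    by (rule D_mem[where S = "%w. Z (length w)"]) (use Z K that in auto)
  show "D w : Z (length w)" by (rule D[OF w])
  show "D w - K w : Z n" if n: "length w = Suc n"
  proof -
    have f: "fs D m W - K (map snd W) : Z n" if "map snd W : lists B" "length W = length w" for m W
      using that
    proof (induction m arbitrary: W)
      case 0
      thus ?case using Z by (simp add: z.subspace_0)
    next
      case (Suc m)
      from fs_Suc_cases[of W m] show ?case
      proof (elim disjE exE conjE)
        fix u a b v assume W: "W = u @ a # b # v" and
          f: "ALL G. fs G (Suc m) W = sz (chi (snd a) (snd b)) (fs G m (u @ b # a # v)) + ins G (map snd u) (br (snd a) (snd b)) (map snd v)"
        have B: "map snd u : lists B" "map snd v : lists B" "snd a : B" "snd b : B" using Suc.prems W by auto
        have 1: "fs D m (u @ b # a # v) - K (map snd (u @ b # a # v)) : Z n" using Suc.prems W by (intro Suc.IH) auto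
        have 2: "K (map snd W) - sz (chi (snd a) (snd b)) (K (map snd (u @ b # a # v))) : Z n"
          using K2[OF B] W n Suc.prems by simp
        have 3: "ins D (map snd u) (br (snd a) (snd b)) (map snd v) : Z n"
          unfolding ins_def
        proof (intro z.subspace_sum z.subspace_scale Z(1))
          fix c assume "c : B"
          thus "D (map snd u @ c # map snd v) : Z n"
            using D[of "map snd u @ c # map snd v"] B W n Suc.prems by simp
        qed
        have "fs D (Suc m) W - K (map snd W) = sz (chi (snd a) (snd b)) (fs D m (u @ b # a # v) - K (map snd (u @ b # a # v)))
          + ins D (map snd u) (br (snd a) (snd b)) (map snd v)
          - (K (map snd W) - sz (chi (snd a) (snd b)) (K (map snd (u @ b # a # v))))"
          using f by (simp add: z.scale_right_diff_distrib)
        also have "... : Z n"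
          by (rule z.subspace_diff[OF Z(1) z.subspace_add[OF Z(1) z.subspace_scale[OF Z(1) 1] 3] 2])
        finally show ?thesis .
      qed (use Z in \<open>simp add: z.subspace_0\<close>)
    qed
    have "avg D w - K w : Z n"
    proof (rule avg_mem[OF Z(1)])
      fix p assume p: "p : labs (length w)"
      show "fs D (inversions (zip p w)) (zip p w) - K w : Z n"
        using f[of "zip p w"] zip_lists[OF p w] by simp
    qed
    thus ?thesis using D_avg[of w] by simp
  qed
qed

text \<open>The extension of a homogeneous letterwise derivation \<open>dl\<close> of degree \<open>d\<close> to words, followed
  by \<open>F\<close>; labels are carried along unchanged.\<close>

primrec dsub :: "('l => 'l) => 'c => ((nat \<times> 'l) list => 'z) => (nat \<times> 'l) list => 'z" where
  "dsub dl d F [] = 0"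
| "dsub dl d F (b # W) = (SUM c:B. sz (co (dl (snd b)) c) (F ((fst b, c) # W))) +
     sz (eps d (dg (snd b))) (dsub dl d (%W'. F (b # W')) W)"

abbreviation wdeg :: "(nat \<times> 'l) list => 'c" where
  "wdeg W == sum_list (map (%b. dg (snd b)) W)"

definition psub :: "('l => 'l) => 'c => ('l list => 'z) => 'l list => 'z" where
  "psub dl d H w = dsub dl d (%W. H (map snd W)) (map (Pair 0) w)"

lemma eps_zero [simp]: "eps d 0 = 1"
  using eps_add_r[of d 0 0] eps_inv[of d 0] by (metis mult_cancel_right1 mult_zero_left zero_neq_one add_0)

lemma psub_Nil [simp]: "psub dl d H [] = 0"
  by (simp add: psub_def)

lemma psub_Cons: "psub dl d H (b # w) = (SUM c:B. sz (co (dl b) c) (H (c # w))) +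
    sz (eps d (dg b)) (psub dl d (%w'. H (b # w')) w)"
  by (simp add: psub_def o_def)

lemma dsub_append:
  "dsub dl d F (U @ W) = dsub dl d (%U'. F (U' @ W)) U + sz (eps d (wdeg U)) (dsub dl d (%W'. F (U @ W')) W)"
  by (induction U arbitrary: F) (simp_all add: z.scale_right_distrib eps_add_r add.assoc)

lemma dsub_cong:
  "(!!W'. map fst W' = map fst W ==> map snd W' : lists B ==> F W' = F' W') ==> map snd W : lists B ==>
    dsub dl d F W = dsub dl d F' W"
proof (induction W arbitrary: F F')
  case (Cons b W)
  have "dsub dl d (%W'. F (b # W')) W = dsub dl d (%W'. F' (b # W')) W"
    using Cons.prems by (intro Cons.IH) auto
  moreover have "(SUM c:B. sz (co (dl (snd b)) c) (F ((fst b, c) # W))) = (SUM c:B. sz (co (dl (snd b)) c) (F' ((fst b, c) # W)))"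
    using Cons.prems by (intro sum.cong refl) simp
  ultimately show ?case by simp
qed simp

lemma dsub_add: "dsub dl d (%W. F W + F' W) W = dsub dl d F W + dsub dl d F' W"
  by (induction W arbitrary: F F') (simp_all add: z.scale_right_distrib sum.distrib algebra_simps)

lemma dsub_scale: "dsub dl d (%W. sz c (F W)) W = sz c (dsub dl d F W)"
  by (induction W arbitrary: F) (simp_all add: z.scale_right_distrib z.scale_sum_right mult.commute)

lemma dsub_zero [simp]: "dsub dl d (%_. 0) W = 0"
  by (induction W) simp_all

lemma dsub_sum: "dsub dl d (%W. SUM i:A. F i W) W = (SUM i:A. dsub dl d (F i) W)"
  by (induction A rule: fin_induct) (simp_all add: dsub_add)

lemma dsub_psub: "dsub dl d (%W. H (map snd W)) W = psub dl d H (map snd W)"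
proof (induction W arbitrary: H)
  case (Cons a W)
  thus ?case using Cons.IH[of "%w. H (snd a # w)"] by (simp add: psub_Cons)
qed simp

lemma dsub_zip: "length p = length w ==> dsub dl d F (zip p w) = psub dl d (%w. F (zip p w)) w"
  by (induction p w arbitrary: F rule: list_induct2) (simp_all add: psub_Cons)

lemma inversions_labels: "map fst W = map fst W' ==> inversions W = inversions W'"
proof (induction W arbitrary: W')
  case (Cons a W)
  then obtain a' V where W': "W' = a' # V" "fst a = fst a'" "map fst W = map fst V" by (cases W') auto
  have "length (filter (%b. fst b < fst a) W) = length (filter (%l. l < fst a) (map fst W))"
    by (simp add: filter_map o_def)
  also have "... = length (filter (%b. fst b < fst a) V)" unfolding W'(3) by (simp add: filter_map o_def)
  finally show ?case using Cons.IH[OF W'(3)] W' by simp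
qed simp

text \<open>A derivation substitutes letters and leaves labels alone, so it acts on each stage of
  the sorting of a fixed labelled word. The bracket terms match because \<open>dl\<close> is a
  derivation of the bracket. Equivariance thus passes from \<open>K\<close> to \<open>D\<close>,
  which later makes the homotopy commute with the action of \<open>\<gg>\<close>.\<close>

lemma D_equivariant:
  assumes L: "lin sz sz L" and dl: "lin s s dl"
    and dd: "!!b c. b : B ==> c : B ==> co (dl b) c ~= 0 ==> dg c = d + dg b"
    and der: "!!x y. x : B ==> y : B ==> dl (br x y) = br (dl x) y + s (eps d (dg x)) (br x (dl y))"
    and K: "!!w. w : lists B ==> L (K w) = psub dl d K w"
  shows "w : lists B ==> L (D w) = psub dl d D w"
proof (induction "length w" arbitrary: w rule: less_induct)
  case less
  have L_add: "L (x + y) = L x + L y" and L_scale: "L (sz c x) = sz c (L x)" for x y c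
    using L by (simp_all add: lin_iff)
  have L_sum: "L (SUM i:A. f i) = (SUM i:A. L (f i))" for A and f :: "'i => 'z"
    by (induction A rule: fin_induct) (use L_add L_scale[of 0 0] in auto)
  have dl_add: "dl (x + y) = dl x + dl y" and dl_scale: "dl (s c x) = s c (dl x)" for x y c
    using dl by (simp_all add: lin_iff)
  have dl_sum: "dl (SUM i:A. f i) = (SUM i:A. dl (f i))" for A and f :: "'l => 'l"
    by (induction A rule: fin_induct) (use dl_add dl_scale[of 0 0] in auto)
  define f where "f W = fs D (inversions W) W" for W
  have ins_sum: "(SUM p:B. sz (co t p) (ins D u (F p) v)) = ins D u (SUM p:B. s (co t p) (F p)) v" for t u F v
    by (simp add: ins_def co_sum co_scale z.scale_sum_left z.scale_sum_right) (rule sum.swap)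
  have rel: "f (u @ (la, x) # (lb, y) # v) = sz (chi x y) (f (u @ (lb, y) # (la, x) # v)) + ins D (map snd u) (br x y) (map snd v)"
    if "map snd u : lists B" "map snd v : lists B" "x : B" "y : B" "la ~= lb" for u v la lb x y
    using that fs_rel[OF good_D, of u "(la, x)" "(lb, y)" v "length (u @ (la, x) # (lb, y) # v)"]
    by (simp add: f_def val_def)
  \<comment> \<open>Induction on the inversions of one labelled word. Bracket terms are shorter
    words and fall under the outer induction on length.\<close>
  have eq: "L (f W) = dsub dl d f W" if "map snd W : lists B" "length W = length w" "inversions W = m" for m W
    using that
  proof (induction m arbitrary: W)
    case 0
    have "dsub dl d f W = dsub dl d (%W. K (map snd W)) W"
    proof (rule dsub_cong[OF _ 0(1)])
      fix W' :: "(nat \<times> 'l) list" assume "map fst W' = map fst W"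
      thus "f W' = K (map snd W')" using 0(3) inversions_labels[of W' W] by (simp add: f_def)
    qed
    moreover have "f W = K (map snd W)" by (simp add: f_def 0)
    ultimately show ?case using 0 K by (simp add: dsub_psub)
  next
    case (Suc m)
    obtain u a b v where W: "W = u @ a # b # v" "fst b < fst a"
      using inversions_eq_0[of W] Suc.prems(3) by auto
    obtain la x lb y where ab: "a = (la, x)" "b = (lb, y)" by fastforce
    have B: "map snd u : lists B" "map snd v : lists B" "x : B" "y : B" using Suc.prems(1) W ab by auto
    have ne: "la ~= lb" using W ab by simp
    have IH: "L (f (u @ (lb, y) # (la, x) # v)) = dsub dl d f (u @ (lb, y) # (la, x) # v)"
      using Suc.prems W ab inversions_swap[OF W(2), of u v] by (intro Suc.IH) auto
    have IH2: "L (D (map snd u @ p # map snd v)) = psub dl d D (map snd u @ p # map snd v)" if "p : B" for p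
      using that B Suc.prems W by (intro less.hyps) auto
    define eu where "eu = eps d (wdeg u)"
    \<comment> \<open>\<open>P\<close> and \<open>Q\<close> are the contributions of substitutions
      to the left and to the right of the inserted bracket.\<close>
    define P where "P = (SUM p:B. sz (co (br x y) p) (dsub dl d (%u'. D (map snd u' @ p # map snd v)) u))"
    define Q where "Q = (SUM p:B. sz (co (br x y) p) (dsub dl d (%v'. D (map snd u @ p # map snd v')) v))"
    have low: "(SUM p:B. sz (co (br x y) p) (psub dl d D (map snd u @ p # map snd v))) =
       P + sz eu (ins D (map snd u) (dl (br x y)) (map snd v)) + sz (eu * (eps d (dg x) * eps d (dg y))) Q"
    proof -
      have "psub dl d D (map snd u @ p # map snd v) = dsub dl d (%u'. D (map snd u' @ p # map snd v)) u +
          sz eu (ins D (map snd u) (dl p) (map snd v) + sz (eps d (dg p)) (dsub dl d (%v'. D (map snd u @ p # map snd v')) v))" for p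
        using dsub_psub[of dl d D "u @ (0, p) # v"] by (simp add: dsub_append eu_def ins_def)
      hence "(SUM p:B. sz (co (br x y) p) (psub dl d D (map snd u @ p # map snd v))) =
        (SUM p:B. sz (co (br x y) p) (dsub dl d (%u'. D (map snd u' @ p # map snd v)) u) +
          sz eu (sz (co (br x y) p) (ins D (map snd u) (dl p) (map snd v))) +
          sz (eu * (eps d (dg x) * eps d (dg y))) (sz (co (br x y) p) (dsub dl d (%v'. D (map snd u @ p # map snd v')) v)))"
        using br_dg[OF B(3,4)]
        by (intro sum.cong refl) (case_tac "co (br x y) xa = 0"; simp add: z.scale_right_distrib eps_add_r mult_ac add_ac)
      also have "... = P + sz eu (SUM p:B. sz (co (br x y) p) (ins D (map snd u) (dl p) (map snd v))) + sz (eu * (eps d (dg x) * eps d (dg y))) Q"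
        by (simp add: sum.distrib P_def Q_def z.scale_sum_right)
      also have "(SUM p:B. sz (co (br x y) p) (ins D (map snd u) (dl p) (map snd v))) = ins D (map snd u) (dl (br x y)) (map snd v)"
        using arg_cong[OF co_expand[of "br x y"], of dl] by (simp add: ins_sum dl_sum dl_scale)
      finally show ?thesis .
    qed
    have tu: "dsub dl d (%u'. f (u' @ (la, x) # (lb, y) # v)) u = sz (chi x y) (dsub dl d (%u'. f (u' @ (lb, y) # (la, x) # v)) u) + P"
    proof -
      have "dsub dl d (%u'. f (u' @ (la, x) # (lb, y) # v)) u =
          dsub dl d (%u'. sz (chi x y) (f (u' @ (lb, y) # (la, x) # v)) + ins D (map snd u') (br x y) (map snd v)) u"
        using B ne by (intro dsub_cong rel) auto
      thus ?thesis by (simp add: dsub_add dsub_scale P_def ins_def dsub_sum)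
    qed
    have tv: "dsub dl d (%v'. f (u @ (la, x) # (lb, y) # v')) v = sz (chi x y) (dsub dl d (%v'. f (u @ (lb, y) # (la, x) # v')) v) + Q"
    proof -
      have "dsub dl d (%v'. f (u @ (la, x) # (lb, y) # v')) v =
          dsub dl d (%v'. sz (chi x y) (f (u @ (lb, y) # (la, x) # v')) + ins D (map snd u) (br x y) (map snd v')) v"
        using B ne by (intro dsub_cong rel) auto
      thus ?thesis by (simp add: dsub_add dsub_scale Q_def ins_def dsub_sum)
    qed
    \<comment> \<open>The substituted letter has degree \<open>d + dg x\<close>; interchanging it
      with \<open>y\<close> costs the additional factor \<open>eps d (dg y)\<close>.\<close>
    have tx: "(SUM c:B. sz (co (dl x) c) (f (u @ (la, c) # (lb, y) # v))) =
        sz (chi x y * eps d (dg y)) (SUM c:B. sz (co (dl x) c) (f (u @ (lb, y) # (la, c) # v))) + ins D (map snd u) (br (dl x) y) (map snd v)"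
    proof -
      have "(SUM c:B. sz (co (dl x) c) (f (u @ (la, c) # (lb, y) # v))) =
        (SUM c:B. sz (chi x y * eps d (dg y)) (sz (co (dl x) c) (f (u @ (lb, y) # (la, c) # v))) + sz (co (dl x) c) (ins D (map snd u) (br c y) (map snd v)))"
      proof (rule sum.cong[OF refl])
        fix c assume c: "c : B"
        show "sz (co (dl x) c) (f (u @ (la, c) # (lb, y) # v)) =
          sz (chi x y * eps d (dg y)) (sz (co (dl x) c) (f (u @ (lb, y) # (la, c) # v))) + sz (co (dl x) c) (ins D (map snd u) (br c y) (map snd v))"
          using dd[OF B(3) c] rel[OF B(1,2) c B(4) ne]
          by (cases "co (dl x) c = 0") (simp_all add: z.scale_right_distrib eps_add_l mult_ac)
      qed
      thus ?thesis using arg_cong[OF co_expand[of "dl x"], of "%t. br t y"]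
        by (simp add: sum.distrib z.scale_sum_right ins_sum br_sum_l br_scale_l)
    qed
    have ty: "sz (eps d (dg x)) (SUM c:B. sz (co (dl y) c) (f (u @ (la, x) # (lb, c) # v))) =
        sz (chi x y) (SUM c:B. sz (co (dl y) c) (f (u @ (lb, c) # (la, x) # v))) + sz (eps d (dg x)) (ins D (map snd u) (br x (dl y)) (map snd v))"
    proof -
      have "(SUM c:B. sz (co (dl y) c) (f (u @ (la, x) # (lb, c) # v))) =
        (SUM c:B. sz (eps (dg x) d * chi x y) (sz (co (dl y) c) (f (u @ (lb, c) # (la, x) # v))) + sz (co (dl y) c) (ins D (map snd u) (br x c) (map snd v)))"
      proof (rule sum.cong[OF refl])
        fix c assume c: "c : B"
        show "sz (co (dl y) c) (f (u @ (la, x) # (lb, c) # v)) =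
          sz (eps (dg x) d * chi x y) (sz (co (dl y) c) (f (u @ (lb, c) # (la, x) # v))) + sz (co (dl y) c) (ins D (map snd u) (br x c) (map snd v))"
          using dd[OF B(4) c] rel[OF B(1,2,3) c ne]
          by (cases "co (dl y) c = 0") (simp_all add: z.scale_right_distrib eps_add_r mult_ac)
      qed
      hence "(SUM c:B. sz (co (dl y) c) (f (u @ (la, x) # (lb, c) # v))) =
         sz (eps (dg x) d * chi x y) (SUM c:B. sz (co (dl y) c) (f (u @ (lb, c) # (la, x) # v))) + ins D (map snd u) (br x (dl y)) (map snd v)"
        using arg_cong[OF co_expand[of "dl y"], of "%t. br x t"]
        by (simp add: sum.distrib z.scale_sum_right ins_sum br_sum_r br_scale_r)
      thus ?thesis by (simp add: z.scale_right_distrib mult.assoc[symmetric])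
    qed
    have "L (f W) = sz (chi x y) (dsub dl d f (u @ (lb, y) # (la, x) # v)) + (SUM p:B. sz (co (br x y) p) (psub dl d D (map snd u @ p # map snd v)))"
      using rel[OF B ne] IH IH2 by (simp add: W ab L_add L_scale L_sum ins_def)
    also have "... = dsub dl d f (u @ (la, x) # (lb, y) # v)"
      unfolding low der[OF B(3,4)] ins_add ins_scale
      by (simp add: dsub_append tu tv tx z.scale_right_distrib ty flip: eu_def)
        (simp add: z.scale_right_distrib mult_ac add_ac)
    finally show ?case using W ab by simp
  qed
  have "L (D w) = sz (1 / of_nat (card (labs (length w)))) (SUM p:labs (length w). L (f (zip p w)))"
    by (subst D_avg) (simp add: avg_def L_scale L_sum f_def)
  also have "(SUM p:labs (length w). L (f (zip p w))) = (SUM p:labs (length w). psub dl d (%w. f (zip p w)) w)"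
  proof (rule sum.cong[OF refl])
    fix p assume p: "p : labs (length w)"
    have "L (f (zip p w)) = dsub dl d f (zip p w)" using eq zip_lists[OF p less.prems] by blast
    thus "L (f (zip p w)) = psub dl d (%w. f (zip p w)) w" using p by (simp add: dsub_zip labs_def)
  qed
  also have "sz (1 / of_nat (card (labs (length w)))) (SUM p:labs (length w). psub dl d (%w. f (zip p w)) w) =
     psub dl d (%w'. sz (1 / of_nat (card (labs (length w)))) (SUM p:labs (length w). f (zip p w'))) w"
    by (simp add: psub_def dsub_scale dsub_sum)
  also have "... = psub dl d D w"
    unfolding psub_def
  proof (rule dsub_cong)
    fix W' :: "(nat \<times> 'l) list" assume "map fst W' = map fst (map (Pair (0::nat)) w)"
    hence "length W' = length w" by (metis length_map)
    thus "sz (1 / of_nat (card (labs (length w)))) (SUM p:labs (length w). f (zip p (map snd W'))) = D (map snd W')"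
      by (subst D_avg) (simp add: avg_def f_def)
  qed (use less.prems in \<open>simp add: o_def\<close>)
  finally show ?case .
qed

end

section \<open>Graded algebras\<close>

context embedding
begin

lemma lin_span_iff:
  assumes S: "S <= car M"
  shows "x : lin_span M S \<longleftrightarrow> x : car M & \<Phi> x : span (\<Phi> ` S)"
proof
  assume "x : lin_span M S"
  then obtain c F where x: "x = (\<Oplus>y\<in>F. c y \<odot>[M] y)" and F: "finite F" "F <= S" by (auto simp: lin_span_def)
  have cl: "c y \<odot>[M] y : car M" if "y : F" for y using that F S by auto
  have "\<Phi> x = (SUM y:F. scale (c y) (\<Phi> y))"
    unfolding x using F S by (subst emb_finsum[OF cl]) (auto intro!: sum.cong simp: emb_smult)
  also have "... : span (\<Phi> ` S)" using F by (intro span_sum span_scale span_base) auto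
  finally show "x : car M & \<Phi> x : span (\<Phi> ` S)" using cl x by (auto intro!: finsum_closed)
next
  assume x: "x : car M & \<Phi> x : span (\<Phi> ` S)"
  then obtain t r where t: "finite t" "t <= \<Phi> ` S" "\<Phi> x = (SUM a:t. scale (r a) a)"
    unfolding span_explicit by auto
  obtain F where F: "F <= S" "finite F" "t = \<Phi> ` F" by (rule finite_subset_image[OF t(1,2), THEN exE]) auto
  have cl: "r (\<Phi> y) \<odot>[M] y : car M" if "y : F" for y using that F S by auto
  have "inj_on \<Phi> F" using inj F S by (meson inj_on_subset order_trans)
  hence "\<Phi> x = (SUM y:F. scale (r (\<Phi> y)) (\<Phi> y))" using t(3) F(3) by (simp add: sum.reindex)
  also have "... = \<Phi> (\<Oplus>y\<in>F. r (\<Phi> y) \<odot>[M] y)"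
    using F S by (subst emb_finsum[OF cl]) (auto intro!: sum.cong simp: emb_smult)
  finally have "x = (\<Oplus>y\<in>F. r (\<Phi> y) \<odot>[M] y)" using x cl by (subst (asm) emb_eq) (auto intro!: finsum_closed)
  thus "x : lin_span M S" using F by (auto simp: lin_span_def intro!: exI[of _ "%y. r (\<Phi> y)"])
qed

lemma subspace_image_lin_span:
  assumes S: "S <= car M"
  shows "\<Phi> ` lin_span M S = span (\<Phi> ` S)"
proof
  show "\<Phi> ` lin_span M S <= span (\<Phi> ` S)" using lin_span_iff[OF S] by auto
  show "span (\<Phi> ` S) <= \<Phi> ` lin_span M S"
  proof
    fix a assume a: "a : span (\<Phi> ` S)"
    hence "EX x:car M. \<Phi> x = a"
    proof (induction rule: span_induct_alt)
      case base
      thus ?case using emb_zero by auto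
    next
      case (step c b a)
      then obtain x y where "x : car M" "\<Phi> x = b" "y : car M" "\<Phi> y = a" using S by auto
      thus ?case by (intro bexI[of _ "c \<odot>[M] x \<oplus> y"]) (auto simp: emb_add emb_smult)
    qed
    thus "a : \<Phi> ` lin_span M S" using a lin_span_iff[OF S] by auto
  qed
qed

lemma subspace_image_carrier: "subspace (\<Phi> ` car M)"
  unfolding subspace_def
proof (intro conjI ballI allI)
  show "0 : \<Phi> ` car M" using emb_zero by (metis imageI zero_closed)
  fix a b assume "a : \<Phi> ` car M"
  thus "b : \<Phi> ` car M ==> a + b : \<Phi> ` car M" by (auto simp flip: emb_add)
  show "scale c a : \<Phi> ` car M" for c using \<open>a : \<Phi> ` car M\<close> by (auto simp flip: emb_smult)
qed

end

text \<open>The projections \<open>pr\<close> certify that the sum of the pieces \<open>gr i\<close>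
  is direct. Without uniqueness of components the definite description in \<open>hcomp_in\<close>
  would say nothing.\<close>

locale graded_alg = embedding M scale \<Phi>
  for M :: "('k::field, 'a, 'm) module_scheme" (structure) and scale :: "'k => 'r::ring => 'r" and \<Phi> +
  fixes gr :: "'i::comm_monoid_add => 'a set" and pr :: "'i => 'a => 'r"
  assumes gr_carrier: "gr i <= car M"
    and gr_subspace: "subspace (\<Phi> ` gr i)"
    and gr_span: "x : car M ==> \<Phi> x : span (\<Union>i. \<Phi> ` gr i)"
    and pr_add: "x : car M ==> y : car M ==> pr i (x \<oplus> y) = pr i x + pr i y"
    and pr_smult: "x : car M ==> pr i (c \<odot>[M] x) = scale c (pr i x)"
    and pr_gr: "x : gr i ==> pr j x = (if j = i then \<Phi> x else 0)"
    and gr_mult: "x : gr i ==> y : gr j ==> x \<otimes> y : gr (i + j)"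
    and gr_one: "\<one> : gr 0"
begin

abbreviation "hc == hcomp_in M gr"
abbreviation "hs == hsupp M gr"

lemma gr_closed [intro]: "x : gr i ==> x : car M"
  using gr_carrier by auto

lemma gr_iff: "x : car M ==> x : gr i \<longleftrightarrow> \<Phi> x : \<Phi> ` gr i"
  using emb_eq gr_closed by (metis image_iff)

lemma gr_zero: "\<zero> : gr i"
  by (rule gr_iff[THEN iffD2]) (simp_all add: emb_zero subspace_0[OF gr_subspace])

lemma gr_add: "x : gr i ==> y : gr i ==> x \<oplus> y : gr i"
  by (rule gr_iff[THEN iffD2]) (simp_all add: emb_add[OF gr_closed gr_closed] gr_closed subspace_add[OF gr_subspace])

lemma gr_smult: "x : gr i ==> c \<odot>[M] x : gr i"
  by (rule gr_iff[THEN iffD2]) (simp_all add: emb_smult[OF gr_closed] gr_closed subspace_scale[OF gr_subspace])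

lemma pr_zero: "pr i \<zero> = 0"
  using pr_gr[OF gr_zero, of i i] emb_zero by simp

lemma pr_finsum: "(!!i. i : A ==> f i : car M) ==> pr j (\<Oplus>i\<in>A. f i) = (SUM i:A. pr j (f i))"
  by (induction A rule: fin_induct) (auto simp: pr_zero pr_add finsum_infinite)

lemma homog_decomp_pr:
  assumes "homog_decomp_in M gr x f"
  shows "\<Phi> (f j) = pr j x"
proof -
  have f: "!!i. f i : gr i" "finite {i. f i ~= \<zero>}" "x = (\<Oplus>i\<in>{i. f i ~= \<zero>}. f i)"
    using assms by (auto simp: homog_decomp_in_def)
  have "pr j x = (SUM i:{i. f i ~= \<zero>}. pr j (f i))"
    unfolding f(3) using f(1) gr_closed by (intro pr_finsum) auto
  also have "... = (SUM i:{i. f i ~= \<zero>}. if j = i then \<Phi> (f i) else 0)"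
    using f(1) by (intro sum.cong refl) (simp add: pr_gr)
  also have "... = (if f j ~= \<zero> then \<Phi> (f j) else 0)" using f(2) by simp
  also have "... = \<Phi> (f j)" using emb_zero by auto
  finally show ?thesis by simp
qed

lemma homog_decomp_exists:
  assumes x: "x : car M"
  shows "EX f. homog_decomp_in M gr x f"
proof -
  define W where "W = {a. EX f. (ALL i. f i : gr i) & finite {i. f i ~= \<zero>} & a = (SUM i | f i ~= \<zero>. \<Phi> (f i))}"
  have "subspace W"
    unfolding subspace_def
  proof (intro conjI ballI allI)
    show "0 : W" by (auto simp: W_def intro!: exI[of _ "%_. \<zero>"] gr_zero)
    fix a assume "a : W"
    then obtain f where f: "!!i. f i : gr i" "finite {i. f i ~= \<zero>}" "a = (SUM i | f i ~= \<zero>. \<Phi> (f i))"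
      unfolding W_def by blast
    { fix b assume "b : W"
      then obtain g where g: "!!i. g i : gr i" "finite {i. g i ~= \<zero>}" "b = (SUM i | g i ~= \<zero>. \<Phi> (g i))"
        unfolding W_def by blast
      let ?A = "{i. f i ~= \<zero>} \<union> {i. g i ~= \<zero>}"
      have sub: "{i. f i \<oplus> g i ~= \<zero>} <= ?A" by auto
      have "a = (SUM i:?A. \<Phi> (f i))" "b = (SUM i:?A. \<Phi> (g i))"
        unfolding f(3) g(3) using f(2) g(2) emb_zero by (intro sum.mono_neutral_left; auto)+
      hence "a + b = (SUM i:?A. \<Phi> (f i \<oplus> g i))"
        by (simp add: emb_add[OF gr_closed[OF f(1)] gr_closed[OF g(1)]] sum.distrib)
      also have "... = (SUM i | f i \<oplus> g i ~= \<zero>. \<Phi> (f i \<oplus> g i))"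
        using f(2) g(2) sub emb_zero by (intro sum.mono_neutral_right) auto
      finally show "a + b : W"
        unfolding W_def using f g sub by (auto intro!: exI[of _ "%i. f i \<oplus> g i"] gr_add elim: finite_subset) }
    fix c
    have sub: "{i. c \<odot>[M] f i ~= \<zero>} <= {i. f i ~= \<zero>}" by auto
    have "scale c a = (SUM i | f i ~= \<zero>. \<Phi> (c \<odot>[M] f i))"
      by (simp add: f(3) emb_smult[OF gr_closed[OF f(1)]] scale_sum_right)
    also have "... = (SUM i | c \<odot>[M] f i ~= \<zero>. \<Phi> (c \<odot>[M] f i))"
      using f(2) sub emb_zero by (intro sum.mono_neutral_right) auto
    finally show "scale c a : W"
      unfolding W_def using f sub by (auto intro!: exI[of _ "%i. c \<odot>[M] f i"] gr_smult elim: finite_subset)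
  qed
  moreover have "(\<Union>i. \<Phi> ` gr i) <= W"
  proof safe
    fix i y assume y: "y : gr i"
    show "\<Phi> y : W"
      unfolding W_def
    proof (intro CollectI exI[of _ "%j. if j = i then y else \<zero>"] conjI)
      show "finite {j. (if j = i then y else \<zero>) ~= \<zero>}" by (rule finite_subset[of _ "{i}"]) auto
      have "(SUM j:{i}. \<Phi> (if j = i then y else \<zero>)) = (SUM j | (if j = i then y else \<zero>) ~= \<zero>. \<Phi> (if j = i then y else \<zero>))"
        using emb_zero by (intro sum.mono_neutral_right) auto
      thus "\<Phi> y = (SUM j | (if j = i then y else \<zero>) ~= \<zero>. \<Phi> (if j = i then y else \<zero>))" by simp
    qed (use y gr_zero in auto)
  qed
  ultimately have "\<Phi> x : W" using gr_span[OF x] span_minimal by blast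
  then obtain f where f: "!!i. f i : gr i" "finite {i. f i ~= \<zero>}" "\<Phi> x = (SUM i | f i ~= \<zero>. \<Phi> (f i))"
    unfolding W_def by blast
  have "\<Phi> x = \<Phi> (\<Oplus>i\<in>{i. f i ~= \<zero>}. f i)" unfolding f(3) using f(1) gr_closed by (subst emb_finsum) auto
  hence "x = (\<Oplus>i\<in>{i. f i ~= \<zero>}. f i)" using x f(1) gr_closed by (subst (asm) emb_eq) (auto intro!: finsum_closed)
  thus ?thesis using f by (auto simp: homog_decomp_in_def)
qed

text \<open>Every decomposition has the components prescribed by \<open>pr\<close>, so two of them
  agree after the injective \<open>\<Phi>\<close>.\<close>

lemma homog_decomp_hc:
  assumes x: "x : car M"
  shows "homog_decomp_in M gr x (hc x)"
proof -
  obtain f where f: "homog_decomp_in M gr x f" using homog_decomp_exists[OF x] by blast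
  have "g = f" if "homog_decomp_in M gr x g" for g
  proof
    fix j
    have "\<Phi> (g j) = \<Phi> (f j)" using homog_decomp_pr[OF f] homog_decomp_pr[OF that] by simp
    thus "g j = f j" using f that by (subst (asm) emb_eq) (auto simp: homog_decomp_in_def)
  qed
  hence "hc x = f" unfolding hcomp_in_def using f by (intro the_equality)
  thus ?thesis using f by simp
qed

lemma hc_gr: "x : car M ==> hc x i : gr i"
  using homog_decomp_hc by (auto simp: homog_decomp_in_def)

lemma hc_closed [simp, intro]: "x : car M ==> hc x i : car M"
  using hc_gr gr_closed by blast

lemma emb_hc: "x : car M ==> \<Phi> (hc x i) = pr i x"
  using homog_decomp_pr[OF homog_decomp_hc] .

lemma finite_hs: "x : car M ==> finite (hs x)"
  using homog_decomp_hc by (auto simp: homog_decomp_in_def hsupp_def)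

lemma decompose: "x : car M ==> x = (\<Oplus>i\<in>hs x. hc x i)"
  using homog_decomp_hc[of x] by (auto simp: homog_decomp_in_def hsupp_def)

lemma hc_add: "x : car M ==> y : car M ==> hc (x \<oplus> y) i = hc x i \<oplus> hc y i"
  by (subst emb_eq[symmetric]) (auto simp: emb_hc emb_add pr_add)

lemma hc_smult: "x : car M ==> hc (c \<odot>[M] x) i = c \<odot>[M] hc x i"
  by (subst emb_eq[symmetric]) (auto simp: emb_hc emb_smult pr_smult)

lemma hc_of_gr: "x : gr i ==> hc x j = (if j = i then x else \<zero>)"
  using emb_hc[of x j] pr_gr[of x i j] emb_zero gr_closed
  by (subst emb_eq[symmetric]) auto

lemma hs_of_gr: "x : gr i ==> hs x <= {i}"
  by (auto simp: hsupp_def hc_of_gr split: if_splits)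

lemma homog_induct [consumes 1, case_names hom add]:
  assumes x: "x : car M" and hom: "!!i x. x : gr i ==> P x"
    and add: "!!x y. x : car M ==> y : car M ==> P x ==> P y ==> P (x \<oplus> y)"
  shows "P x"
proof -
  have "P (\<Oplus>i\<in>A. hc x i)" for A
    by (induction A rule: fin_induct)
      (use hom[OF gr_zero] hom[OF hc_gr[OF x]] x in \<open>auto simp: finsum_infinite intro!: add finsum_closed\<close>)
  thus ?thesis using decompose[OF x] by metis
qed

lemma emb_twisted_flip:
  assumes "x : car M" "y : car M"
  shows "\<Phi> (twisted_flip \<chi> M gr x y) = (SUM i:hs x. SUM j:hs y. scale (\<chi> i j) (pr j y * pr i x))"
  unfolding twisted_flip_def using assms
  by (simp add: emb_finsum emb_smult emb_mult emb_hc)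

lemma twisted_flip_closed:
  "x : car M ==> y : car M ==> twisted_flip \<chi> M gr x y : car M"
  unfolding twisted_flip_def by (auto intro!: finsum_closed)

end

section \<open>Algebras presented by quadratic relations\<close>

lemma pm_additive_zero:
  fixes g :: "('b \<Rightarrow>\<^sub>0 'k::field) => 'z::ab_group_add"
  assumes "!!p q. g (p + q) = g p + g q" "!!k c. g (psing k c) = 0"
  shows "g p = 0"
proof -
  have 0: "g 0 = 0" using assms(1)[of 0 0] by simp
  have "g (SUM k:A. psing k (Poly_Mapping.lookup p k)) = 0" for A
    by (induction A rule: fin_induct) (simp_all add: 0 assms)
  thus ?thesis using poly_mapping_eq_sum_single[of p] by metis
qed

lemma single_zero_commute: "p * psing 0 c = psing 0 c * (p :: 'b::monoid_add \<Rightarrow>\<^sub>0 'k::field)"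
proof -
  have "p * psing 0 c - psing 0 c * p = 0"
    by (rule pm_additive_zero[where p = p]) (simp_all add: algebra_simps mult_single)
  thus ?thesis by simp
qed

lemma free_algebra_simps [simp]:
  "car (free_algebra :: ('k::field, 'v fword \<Rightarrow>\<^sub>0 'k) module) = UNIV"
  "mult (free_algebra :: ('k, 'v fword \<Rightarrow>\<^sub>0 'k) module) = (*)"
  "one (free_algebra :: ('k, 'v fword \<Rightarrow>\<^sub>0 'k) module) = 1"
  "zero (free_algebra :: ('k, 'v fword \<Rightarrow>\<^sub>0 'k) module) = 0"
  "add (free_algebra :: ('k, 'v fword \<Rightarrow>\<^sub>0 'k) module) = (+)"
  "smult (free_algebra :: ('k, 'v fword \<Rightarrow>\<^sub>0 'k) module) = pscale"
  by (simp_all add: free_algebra_def pscale_def fun_eq_iff)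

lemma kalg_free_algebra: "kalg (free_algebra :: ('k::field, 'v fword \<Rightarrow>\<^sub>0 'k) module)"
proof -
  have "abelian_group (free_algebra :: ('k, 'v fword \<Rightarrow>\<^sub>0 'k) module)"
    by (rule abelian_groupI) (auto simp: algebra_simps intro: exI[of _ "- x" for x])
  moreover have "Group.monoid (free_algebra :: ('k, 'v fword \<Rightarrow>\<^sub>0 'k) module)"
    by (rule monoidI) (auto simp: mult.assoc)
  ultimately have "ring (free_algebra :: ('k, 'v fword \<Rightarrow>\<^sub>0 'k) module)"
    by (rule ringI) (auto simp: algebra_simps)
  thus ?thesis
  proof (rule kalg.intro, unfold_locales)
    fix a :: 'k and x y :: "'v fword \<Rightarrow>\<^sub>0 'k"
    show "x \<otimes>[free_algebra] (a \<odot>[free_algebra] y) = a \<odot>[free_algebra] (x \<otimes>[free_algebra] y)"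
      by (simp add: pscale_conv_mult single_zero_commute flip: mult.assoc)
    show "(a \<odot>[free_algebra] x) \<otimes>[free_algebra] y = a \<odot>[free_algebra] (x \<otimes>[free_algebra] y)"
      by (simp add: pscale_conv_mult mult.assoc)
  qed (auto simp: pm.scale_left_distrib pm.scale_right_distrib)
qed

section \<open>Multilinear extension from basis words to arbitrary words\<close>

context based_space
begin

primrec extD :: "('k => 'z::ab_group_add => 'z) => ('l list => 'z) => 'l list => 'z" where
  "extD sz D [] = D []"
| "extD sz D (v # vs) = (SUM b:B. sz (co v b) (extD sz (%w. D (b # w)) vs))"

lemma extD_append: "extD sz D (u @ w) = extD sz (%u'. extD sz (%w'. D (u' @ w')) w) u"
  by (induction u arbitrary: D) simp_all

lemma extD_cong: "(!!w. w : lists B ==> D w = D' w) ==> extD sz D vs = extD sz D' vs"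
proof (induction vs arbitrary: D D')
  case (Cons v vs)
  have "extD sz (%w. D (b # w)) vs = extD sz (%w. D' (b # w)) vs" if "b : B" for b
    using that by (intro Cons.IH Cons.prems) simp
  thus ?case by simp
qed simp

end

locale based_target = based_space s B co + z: vector_space sz
  for s :: "'k::field => 'l::ab_group_add => 'l" and B co and sz :: "'k => 'z::ab_group_add => 'z"
begin

lemma extD_basis: "vs : lists B ==> extD sz D vs = D vs"
  by (induction vs arbitrary: D) (simp_all add: sum_co_basis[OF z.vector_space_axioms])

lemma extD_add: "extD sz (%w. D w + D' w) vs = extD sz D vs + extD sz D' vs"
  by (induction vs arbitrary: D D') (simp_all add: z.scale_right_distrib sum.distrib)

lemma extD_scale: "extD sz (%w. sz c (D w)) vs = sz c (extD sz D vs)"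
  by (induction vs arbitrary: D) (simp_all add: z.scale_sum_right mult.commute)

lemma extD_zero: "extD sz (%w. 0) vs = 0"
  by (induction vs) simp_all

lemma extD_sum: "extD sz (%w. SUM i:A. D i w) vs = (SUM i:A. extD sz (D i) vs)"
  by (induction A rule: fin_induct) (simp_all add: extD_add extD_zero)

lemma extD_vector_add: "extD sz D (u @ (v + v') # w) = extD sz D (u @ v # w) + extD sz D (u @ v' # w)"
  by (simp add: extD_append co_add z.scale_left_distrib sum.distrib extD_add)

lemma extD_vector_scale: "extD sz D (u @ s c v # w) = sz c (extD sz D (u @ v # w))"
  by (simp add: extD_append co_scale extD_scale flip: z.scale_scale z.scale_sum_right)

lemma extD_mem_span: "extD sz D vs : z.span (D ` lists B)"
proof (induction vs arbitrary: D)
  case Nil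
  thus ?case by (auto intro: z.span_base)
next
  case (Cons v vs)
  have "extD sz (%w. D (b # w)) vs : z.span (D ` lists B)" if "b : B" for b
  proof -
    have "(%w. D (b # w)) ` lists B <= D ` lists B"
    proof
      fix a assume "a : (%w. D (b # w)) ` lists B"
      then obtain w where "w : lists B" "a = D (b # w)" by blast
      thus "a : D ` lists B" using that by (intro image_eqI[of _ _ "b # w"]) auto
    qed
    thus ?thesis using Cons[of "%w. D (b # w)"] z.span_mono by blast
  qed
  thus ?case by (auto intro!: z.span_sum z.span_scale)
qed

end

text \<open>One presentation covers all three algebras: the tensor algebra divided by
  \<open>x y - chi y x - (br x y + om x y)\<close> for homogeneous \<open>x\<close> and
  \<open>y\<close>. Enveloping algebras have \<open>om = 0\<close>. The Clifford algebra has
  \<open>br = 0\<close>, twice the form as \<open>om\<close>, and a parity sign inside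
  \<open>chi\<close>.\<close>

locale presented = based_space s B co
  for s :: "'k::field => 'l::ab_group_add => 'l" and B co +
  fixes Dm :: "'i::comm_monoid_add => 'l set" and dg :: "'l => 'i" and chi :: "'i => 'i => 'k"
    and br :: "'l => 'l => 'l" and om :: "'l => 'l => 'k"
  assumes Dm_basis: "b : B ==> b : Dm (dg b)"
    and Dm_co: "v : Dm i ==> b : B ==> co v b ~= 0 ==> dg b = i"
    and br_bil: "bilinear_map s s s br" and om_bil: "bilinear_map s s (*) om"
    and br_deg: "x : B ==> y : B ==> b : B ==> co (br x y) b ~= 0 ==> dg b = dg x + dg y"
    and om_deg: "x : B ==> y : B ==> om x y ~= 0 ==> dg x + dg y = 0"
begin

abbreviation "FF == free_algebra :: ('k, 'l fword \<Rightarrow>\<^sub>0 'k) module"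
abbreviation "TT == tensor_algebra s"
abbreviation "iT == tensor_gen s"

definition relF :: "'i => 'i => 'l => 'l => 'l fword \<Rightarrow>\<^sub>0 'k" where
  "relF i j x y = free_gen x * free_gen y - pscale (chi i j) (free_gen y * free_gen x) - (free_gen (br x y) + pscale (om x y) 1)"

definition rels :: "('l fword \<Rightarrow>\<^sub>0 'k) set set" where
  "rels = {(iT x \<otimes>[TT] iT y \<ominus>[TT] chi i j \<odot>[TT] (iT y \<otimes>[TT] iT x)) \<ominus>[TT] (iT (br x y) \<oplus>[TT] om x y \<odot>[TT] \<one>[TT]) | i j x y.
      x : Dm i & y : Dm j}"

definition linrels :: "('l fword \<Rightarrow>\<^sub>0 'k) set" where
  "linrels = {free_gen (v + w) - free_gen v - free_gen w | v w. True} \<union>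
      {free_gen (s c v) - pscale c (free_gen v) | c v. True}"

abbreviation "II == Idl\<^bsub>TT\<^esub> rels"
abbreviation "QQ == quot_algebra TT II"

definition iQ :: "'l => ('k, 'l) tquot" where
  "iQ x = II +>[TT] iT x"

definition mon :: "'l list => ('k, 'l) tquot" where
  "mon w = foldr (%v p. iQ v \<otimes>[QQ] p) w \<one>[QQ]"

sublocale F: kalg FF by (rule kalg_free_algebra)

lemma tensor_ideal_eq: "tensor_ideal s = Idl\<^bsub>FF\<^esub> linrels"
  by (simp add: tensor_ideal_def linrels_def pscale_def)

sublocale FT: prequot FF "tensor_ideal s"
  unfolding tensor_ideal_eq by (rule F.prequot_genideal) simp

sublocale T: kalg TT
  unfolding tensor_algebra_def by (rule FT.Q_kalg)

lemma TT_eq: "TT = quot_algebra FF (tensor_ideal s)"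
  by (simp add: tensor_algebra_def)

abbreviation cT :: "('l fword \<Rightarrow>\<^sub>0 'k) => ('l fword \<Rightarrow>\<^sub>0 'k) set" where
  "cT p == tensor_ideal s +>[FF] p"

lemma cT_hom:
  "cT p : car TT" "cT p \<oplus>[TT] cT q = cT (p + q)" "cT p \<otimes>[TT] cT q = cT (p * q)"
  "c \<odot>[TT] cT p = cT (pscale c p)" "\<one>[TT] = cT 1" "\<zero>[TT] = cT 0"
  using FT.Q_closed[of p] FT.Q_add[of p q] FT.Q_mult[of p q] FT.Q_smult[of p c] FT.Q_one FT.Q_zero
  by (simp_all add: TT_eq)

lemma cT_minus: "cT p \<ominus>[TT] cT q = cT (p - q)"
proof -
  have "cT p = cT (p - q) \<oplus>[TT] cT q" by (simp add: cT_hom)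
  thus ?thesis using T.minus_eq T.a_assoc T.r_neg cT_hom(1) by (metis T.a_inv_closed T.r_zero)
qed

lemma TT_elim: "a : car TT ==> (!!p. a = cT p ==> thesis) ==> thesis"
  unfolding TT_eq by (erule FT.Q_elim) blast

lemma iT_eq: "iT x = cT (free_gen x)"
  by (simp add: tensor_gen_def)

lemma rels_eq: "rels = {cT (relF i j x y) | i j x y. x : Dm i & y : Dm j}"
  by (simp add: rels_def iT_eq cT_hom cT_minus relF_def)

lemma rels_closed: "rels <= car TT"
  by (auto simp: rels_eq cT_hom)

sublocale TQ: prequot TT II
  by (rule T.prequot_genideal[OF rels_closed])

sublocale Q: kalg QQ
  by (rule TQ.Q_kalg)

definition qF :: "('l fword \<Rightarrow>\<^sub>0 'k) => ('k, 'l) tquot" where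
  "qF p = II +>[TT] cT p"

lemma qF_hom:
  "qF p : car QQ" "qF p \<oplus>[QQ] qF q = qF (p + q)" "qF p \<otimes>[QQ] qF q = qF (p * q)"
  "c \<odot>[QQ] qF p = qF (pscale c p)" "\<one>[QQ] = qF 1" "\<zero>[QQ] = qF 0"
  by (simp_all add: qF_def TQ.Q_closed TQ.Q_add TQ.Q_mult TQ.Q_smult TQ.Q_one TQ.Q_zero cT_hom)

lemma QQ_elim: "a : car QQ ==> (!!p. a = qF p ==> thesis) ==> thesis"
  by (erule TQ.Q_elim, erule TT_elim) (simp add: qF_def)

lemma iQ_eq: "iQ x = qF (free_gen x)"
  by (simp add: iQ_def qF_def iT_eq)

lemma iQ_closed [simp, intro]: "iQ x : car QQ"
  by (simp add: iQ_eq qF_hom)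

lemma cT_linrels: "p : linrels ==> cT p = cT 0"
  using F.genideal_self[of linrels] FT.coset_shift[of p 0] by (auto simp: tensor_ideal_eq)

lemma iQ_add: "iQ (v + w) = iQ v \<oplus>[QQ] iQ w"
proof -
  have "qF (free_gen (v + w) - free_gen v - free_gen w) = qF 0"
    unfolding qF_def by (subst cT_linrels) (auto simp: linrels_def)
  hence "qF ((free_gen (v + w) - free_gen v - free_gen w) + (free_gen v + free_gen w)) = qF (0 + (free_gen v + free_gen w))"
    by (metis qF_hom(2))
  thus ?thesis by (simp add: iQ_eq qF_hom)
qed

lemma iQ_scale: "iQ (s c v) = c \<odot>[QQ] iQ v"
proof -
  have "qF (free_gen (s c v) - pscale c (free_gen v)) = qF 0"
    unfolding qF_def by (subst cT_linrels) (auto simp: linrels_def)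
  hence "qF ((free_gen (s c v) - pscale c (free_gen v)) + pscale c (free_gen v)) = qF (0 + pscale c (free_gen v))"
    by (metis qF_hom(2))
  thus ?thesis by (simp add: iQ_eq qF_hom)
qed

lemma iQ_rel:
  assumes "x : Dm i" "y : Dm j"
  shows "iQ x \<otimes>[QQ] iQ y = chi i j \<odot>[QQ] (iQ y \<otimes>[QQ] iQ x) \<oplus>[QQ] (iQ (br x y) \<oplus>[QQ] om x y \<odot>[QQ] \<one>[QQ])"
proof -
  have "cT (relF i j x y) : II" using assms T.genideal_self[OF rels_closed] rels_eq by blast
  hence "qF (relF i j x y) = qF 0"
    unfolding qF_def using TQ.coset_eq_iff[of "cT (relF i j x y)" "cT 0"] by (simp add: cT_hom cT_minus)
  hence "qF (relF i j x y + (pscale (chi i j) (free_gen y * free_gen x) + (free_gen (br x y) + pscale (om x y) 1))) =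
      qF (0 + (pscale (chi i j) (free_gen y * free_gen x) + (free_gen (br x y) + pscale (om x y) 1)))"
    by (metis qF_hom(2))
  thus ?thesis by (simp add: iQ_eq qF_hom relF_def)
qed

lemma mon_closed [simp, intro]: "mon w : car QQ"
  by (induction w) (simp_all add: mon_def)

lemma mon_simps [simp]: "mon [] = \<one>[QQ]" "mon (v # w) = iQ v \<otimes>[QQ] mon w"
  by (simp_all add: mon_def)

lemma mon_append: "mon (u @ w) = mon u \<otimes>[QQ] mon w"
  by (induction u) (simp_all add: Q.m_assoc)

lemma qF_single: "qF (psing (FWord w) c) = c \<odot>[QQ] mon w"
proof (induction w)
  case Nil
  have "psing (FWord []) c = pscale c (1 :: 'l fword \<Rightarrow>\<^sub>0 'k)"
    by (simp flip: single_one add: zero_fword_def)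
  thus ?case by (simp add: qF_hom)
next
  case (Cons v w)
  have "psing (FWord (v # w)) c = free_gen v * psing (FWord w) c"
    by (simp add: free_gen_def mult_single plus_fword_def)
  thus ?case using Cons by (simp add: iQ_eq Q.smult_mult_r qF_hom flip: qF_hom(3))
qed

text \<open>A universal property for linear maps: only relations between basis letters inside basis
  words have to be checked. Multiplicativity is not asked for, since degree projections,
  symmetrizations and the homotopy are not algebra morphisms.\<close>

lemma linear_ext:
  fixes D :: "'l list => 'z::ab_group_add"
  assumes sz: "vector_space sz"
    and rel: "!!u v x y. u : lists B ==> v : lists B ==> x : B ==> y : B ==>
      D (u @ x # y # v) = sz (chi (dg x) (dg y)) (D (u @ y # x # v)) +
        (SUM b:B. sz (co (br x y) b) (D (u @ b # v))) + sz (om x y) (D (u @ v))"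
  obtains vp where "!!a b. a : car QQ ==> b : car QQ ==> vp (a \<oplus>[QQ] b) = vp a + vp b"
    "!!c a. a : car QQ ==> vp (c \<odot>[QQ] a) = sz c (vp a)"
    "!!w. vp (mon w) = extD sz D w"
proof -
  interpret z0: vector_space sz by fact
  interpret z: based_target s B co sz by unfold_locales
  define L where "L = lext sz (%W. extD sz D (letters W))"
  have L_add: "L (p + q) = L p + L q" and L_scale: "L (pscale c p) = sz c (L p)" and L_diff: "L (p - q) = L p - L q"
    and L_single: "L (psing W c) = sz c (extD sz D (letters W))" for p q c W
    by (simp_all add: L_def z0.lext_add z0.lext_scale z0.lext_diff)
  \<comment> \<open>By bilinearity it is enough to multiply a relation by single words on both
    sides.\<close>
  have van: "L (p * r * q) = 0"
    if r: "!!u w. L (psing u 1 * r * psing w 1) = 0" for p q r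
  proof -
    have sc: "psing k c = pscale c (psing k (1::'k))" for k :: "'l fword" and c by simp
    have ps: "pscale c p * q = pscale c (p * q)" "p * pscale c q = pscale c (p * q)" for c and p q :: "'l fword \<Rightarrow>\<^sub>0 'k"
      using F.smult_mult_l[of p q c] F.smult_mult_r[of p q c] by simp_all
    have "L (psing u c * r * q) = 0" for u c
    proof (rule pm_additive_zero[where p = q and g = "%q. L (psing u c * r * q)"])
      fix k c'
      show "L (psing u c * r * psing k c') = 0"
        by (subst sc, subst (2) sc, simp only: ps L_scale r z0.scale_zero_right)
    qed (simp add: distrib_left L_add)
    thus ?thesis
      using pm_additive_zero[where p = p and g = "%p. L (p * r * q)"] by (simp add: distrib_right L_add)
  qed
  have LT: "L r = 0" if "r : tensor_ideal s" for r
  proof (rule F.genideal_vanish[of linrels L])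
    fix p x q assume "x : linrels"
    show "L (p \<otimes>[FF] x \<otimes>[FF] q) = 0"
    proof (simp only: free_algebra_simps, rule van)
      fix u w
      have e: "psing u 1 * free_gen v * psing w 1 =
          psing (FWord (letters u @ v # letters w)) (1::'k)" for v :: 'l
        by (simp add: free_gen_def mult_single plus_fword_def)
      show "L (psing u 1 * x * psing w 1) = 0"
        using \<open>x : linrels\<close> F.smult_mult_l F.smult_mult_r
        by (auto simp: linrels_def right_diff_distrib left_diff_distrib e L_diff L_scale L_single z.extD_vector_add z.extD_vector_scale)
    qed
  qed (use that in \<open>simp_all add: L_add tensor_ideal_eq\<close>)
  \<comment> \<open>\<open>L\<close> descends in two stages: here to the tensor algebra, below to
    its quotient by the quadratic relations.\<close>
  obtain LT where LT': "!!p. LT (cT p) = L p"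
    using FT.Q_lift[of L] LT L_add by auto
  have LT_add: "LT (a \<oplus>[TT] b) = LT a + LT b" if "a : car TT" "b : car TT" for a b
    using that by (elim TT_elim) (simp add: cT_hom LT' L_add)
  \<comment> \<open>Expand \<open>x\<close> and \<open>y\<close> in the basis. Only basis letters of
    degrees \<open>i\<close> and \<open>j\<close> occur, so the scalar \<open>chi i j\<close> is
    common to all terms.\<close>
  have relz: "extD sz D (u @ x # y # w) = sz (chi i j) (extD sz D (u @ y # x # w)) + extD sz D (u @ br x y # w) + sz (om x y) (extD sz D (u @ w))"
    if xy: "x : Dm i" "y : Dm j" for u x y w i j
  proof -
    have bl: "br x y = (SUM b:B. SUM c:B. s (co x b * co y c) (br b c))" "om x y = (SUM b:B. SUM c:B. co x b * co y c * om b c)"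
    proof -
      have l: "br (SUM i:A. s (f i) (g i)) y = (SUM i:A. s (f i) (br (g i) y))" "br y (SUM i:A. s (f i) (g i)) = (SUM i:A. s (f i) (br y (g i)))"
        "om (SUM i:A. s (f i) (g i)) y = (SUM i:A. f i * om (g i) y)" "om y (SUM i:A. s (f i) (g i)) = (SUM i:A. f i * om y (g i))"
        for f and g :: "'l => 'l" and y and A
      proof -
        interpret k: vector_space "(*) :: 'k => 'k => 'k" by unfold_locales (auto simp: algebra_simps)
        interpret p1: vector_space_pair s s by unfold_locales
        interpret p2: vector_space_pair s "(*) :: 'k => 'k => 'k" by unfold_locales
        have b: "lin s s (%x. br x y)" "lin s s (br y)"
          "lin s (*) (%x. om x y)" "lin s (*) (om y)"
          using br_bil om_bil by (simp_all add: bilinear_map_def)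
        show "br (SUM i:A. s (f i) (g i)) y = (SUM i:A. s (f i) (br (g i) y))" "br y (SUM i:A. s (f i) (g i)) = (SUM i:A. s (f i) (br y (g i)))"
          by (simp_all add: p1.linear_sum[OF b(1)] p1.linear_sum[OF b(2)] p1.linear_scale[OF b(1)] p1.linear_scale[OF b(2)])
        show "om (SUM i:A. s (f i) (g i)) y = (SUM i:A. f i * om (g i) y)" "om y (SUM i:A. s (f i) (g i)) = (SUM i:A. f i * om y (g i))"
          by (simp_all add: p2.linear_sum[OF b(3)] p2.linear_sum[OF b(4)] p2.linear_scale[OF b(3)] p2.linear_scale[OF b(4)])
      qed
      have "br x y = br (SUM b:B. s (co x b) b) (SUM c:B. s (co y c) c)" "om x y = om (SUM b:B. s (co x b) b) (SUM c:B. s (co y c) c)"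
        using co_expand[of x] co_expand[of y] by simp_all
      thus "br x y = (SUM b:B. SUM c:B. s (co x b * co y c) (br b c))" "om x y = (SUM b:B. SUM c:B. co x b * co y c * om b c)"
        by (simp_all add: l scale_sum_right sum_distrib_left mult.assoc)
          (subst sum.swap, simp add: mult_ac)+
    qed
    have inner: "extD sz (%w'. D (u' @ w')) (x # y # w) = sz (chi i j) (extD sz (%w'. D (u' @ w')) (y # x # w)) +
        extD sz (%w'. D (u' @ w')) (br x y # w) + sz (om x y) (extD sz (%w'. D (u' @ w')) w)" if u': "u' : lists B" for u'
    proof -
      define X where "X v = extD sz (%w'. D (u' @ v @ w')) w" for v
      have t: "sz (co x b) (sz (co y c) (X [b, c])) = sz (chi i j) (sz (co x b) (sz (co y c) (X [c, b]))) +
          sz (co x b * co y c) (SUM p:B. sz (co (br b c) p) (X [p])) + sz (co x b * co y c * om b c) (X [])"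
        if b: "b : B" "c : B" for b c
      proof (cases "co x b = 0 \<or> co y c = 0")
        case False
        hence d: "dg b = i" "dg c = j" using Dm_co xy b by auto
        have "X [b, c] = extD sz (%w'. sz (chi i j) (D (u' @ [c, b] @ w')) + (SUM p:B. sz (co (br b c) p) (D (u' @ [p] @ w'))) + sz (om b c) (D (u' @ [] @ w'))) w"
          unfolding X_def using rel[OF u' _ b] d by (intro extD_cong) simp
        hence "X [b, c] = sz (chi i j) (X [c, b]) + (SUM p:B. sz (co (br b c) p) (X [p])) + sz (om b c) (X [])"
          by (simp add: z.extD_add z.extD_scale z.extD_sum X_def)
        thus ?thesis by (simp add: z0.scale_right_distrib mult_ac)
      qed auto
      have "extD sz (%w'. D (u' @ w')) (x # y # w) = (SUM b:B. SUM c:B. sz (co x b) (sz (co y c) (X [b, c])))"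
        by (simp add: X_def z0.scale_sum_right)
      also have "... = (SUM b:B. SUM c:B. sz (chi i j) (sz (co x b) (sz (co y c) (X [c, b]))) +
          sz (co x b * co y c) (SUM p:B. sz (co (br b c) p) (X [p])) + sz (co x b * co y c * om b c) (X []))"
        by (intro sum.cong refl t)
      also have "... = sz (chi i j) (SUM b:B. SUM c:B. sz (co x b) (sz (co y c) (X [c, b]))) +
         (SUM b:B. SUM c:B. sz (co x b * co y c) (SUM p:B. sz (co (br b c) p) (X [p]))) + sz (om x y) (X [])"
        by (simp add: sum.distrib z0.scale_sum_right z0.scale_sum_left bl(2))
      also have "(SUM b:B. SUM c:B. sz (co x b) (sz (co y c) (X [c, b]))) = extD sz (%w'. D (u' @ w')) (y # x # w)"
        by (subst sum.swap) (simp add: X_def z0.scale_sum_right mult.commute)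
      also have "(SUM b:B. SUM c:B. sz (co x b * co y c) (SUM p:B. sz (co (br b c) p) (X [p]))) = (SUM p:B. sz (co (br x y) p) (X [p]))"
        by (simp add: bl(1) co_sum co_scale z0.scale_sum_left z0.scale_sum_right)
          (subst (2) sum.swap, subst sum.swap, simp)
      finally show ?thesis by (simp add: X_def)
    qed
    have "extD sz D (u @ x # y # w) = extD sz (%u'. sz (chi i j) (extD sz (%w'. D (u' @ w')) (y # x # w)) +
        extD sz (%w'. D (u' @ w')) (br x y # w) + sz (om x y) (extD sz (%w'. D (u' @ w')) w)) u"
      unfolding extD_append by (intro extD_cong inner)
    thus ?thesis by (simp only: z.extD_add z.extD_scale extD_append[of sz D u])
  qed
  have LI: "LT a = 0" if "a : II" for a
  proof (rule T.genideal_vanish[of rels LT])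
    fix a r b assume ab: "a : car TT" "b : car TT" and "r : rels"
    then obtain i j x y where r: "r = cT (relF i j x y)" "x : Dm i" "y : Dm j" by (auto simp: rels_eq)
    have "L (p * relF i j x y * q) = 0" for p q
    proof (rule van)
      fix u w
      have e: "psing u 1 * (free_gen v * free_gen v') * psing w 1 =
          psing (FWord (letters u @ v # v' # letters w)) (1::'k)"
        "psing u 1 * free_gen v * psing w 1 =
          psing (FWord (letters u @ v # letters w)) (1::'k)"
        "psing u 1 * 1 * psing w 1 =
          psing (FWord (letters u @ letters w)) (1::'k)" for v v' :: 'l
        by (simp_all add: free_gen_def mult_single plus_fword_def)
      have ps: "pscale c p * q = pscale c (p * q)" "p * pscale c q = pscale c (p * q)" for c and p q :: "'l fword \<Rightarrow>\<^sub>0 'k"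
        using F.smult_mult_l[of p q c] F.smult_mult_r[of p q c] by simp_all
      show "L (psing u 1 * relF i j x y * psing w 1) = 0"
        unfolding relF_def distrib_left distrib_right right_diff_distrib left_diff_distrib ps e L_diff L_add L_scale L_single
        using relz[OF r(2,3), of "letters u" "letters w"] by simp
    qed
    thus "LT (a \<otimes>[TT] r \<otimes>[TT] b) = 0" using ab r by (elim TT_elim) (simp add: cT_hom LT')
  qed (use that LT_add in \<open>auto simp: rels_eq cT_hom\<close>)
  obtain vp where vp: "!!a. a : car TT ==> vp (II +>[TT] a) = LT a"
    using TQ.Q_lift[of LT] LT_add LI by auto
  have vpq: "vp (qF p) = L p" for p by (simp add: qF_def vp cT_hom LT')
  show thesis
  proof (rule that[of vp])
    show "vp (a \<oplus>[QQ] b) = vp a + vp b" if "a : car QQ" "b : car QQ" for a b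
      using that by (elim QQ_elim) (simp add: qF_hom vpq L_add)
    show "vp (c \<odot>[QQ] a) = sz c (vp a)" if "a : car QQ" for c a
      using that by (elim QQ_elim) (simp add: qF_hom vpq L_scale)
    show "vp (mon w) = extD sz D w" for w
      using vpq[of "psing (FWord w) 1"] by (simp add: qF_single L_single)
  qed
qed

definition PhiQ :: "('k, 'l) tquot => (('k, 'l) tquot, 'k) lend" where
  "PhiQ = (SOME \<Phi>. embedding QQ lscale \<Phi>)"

sublocale E: embedding QQ lscale PhiQ
  unfolding PhiQ_def by (rule Q.embedding_exists, rule someI[where P = "embedding QQ lscale"])

lemma emb_iQ_sum: "PhiQ (iQ (SUM b:A. s (c b) (f b))) = (SUM b:A. lscale (c b) (PhiQ (iQ (f b))))"
proof (induction A rule: fin_induct)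
  case empty
  thus ?case using iQ_scale[of 0 0] by (simp add: E.emb_zero)
next
  case (infinite A)
  thus ?case using iQ_scale[of 0 0] by (simp add: E.emb_zero)
qed (simp add: iQ_add iQ_scale E.emb_add E.emb_smult)

lemma emb_iQ: "PhiQ (iQ v) = (SUM b:B. lscale (co v b) (PhiQ (iQ b)))"
  using emb_iQ_sum[of "co v" "%b. b" B] by (simp only: co_expand[of v, symmetric])

lemma emb_mon_insert: "PhiQ (mon (u @ v # w)) = (SUM b:B. lscale (co v b) (PhiQ (mon (u @ b # w))))"
proof -
  have "PhiQ (mon (u @ v # w)) = PhiQ (mon u) * (PhiQ (iQ v) * PhiQ (mon w))" for v
    by (simp add: mon_append E.emb_mult)
  thus ?thesis
    using emb_iQ[of v] by (simp add: sum_distrib_left sum_distrib_right E.scale_mult_left E.scale_mult_right)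
qed

sublocale EB: based_target s B co "lscale :: 'k => (('k, 'l) tquot, 'k) lend => (('k, 'l) tquot, 'k) lend"
  by (intro based_target.intro based_space_axioms E.vector_space_axioms)

lemma extD_mon: "extD lscale (%w. PhiQ (mon (u @ w))) vs = PhiQ (mon (u @ vs))"
proof (induction vs arbitrary: u)
  case (Cons v vs)
  show ?case using Cons[of "u @ [b]" for b] by (simp add: emb_mon_insert[of u v])
qed simp

lemma emb_mon_rel:
  assumes "x : Dm i" "y : Dm j"
  shows "PhiQ (mon (u @ x # y # v)) = lscale (chi i j) (PhiQ (mon (u @ y # x # v))) + PhiQ (mon (u @ br x y # v)) +
    lscale (om x y) (PhiQ (mon (u @ v)))"
proof -
  have "PhiQ (iQ x) * PhiQ (iQ y) = lscale (chi i j) (PhiQ (iQ y) * PhiQ (iQ x)) + (PhiQ (iQ (br x y)) + lscale (om x y) (PhiQ \<one>[QQ]))"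
    using arg_cong[OF iQ_rel[OF assms], of PhiQ] by (simp add: E.emb_add E.emb_smult E.emb_mult)
  hence "PhiQ (iQ x) * (PhiQ (iQ y) * PhiQ (mon v)) = lscale (chi i j) (PhiQ (iQ y) * (PhiQ (iQ x) * PhiQ (mon v))) +
      (PhiQ (iQ (br x y)) * PhiQ (mon v) + lscale (om x y) (PhiQ (mon v)))"
    by (simp flip: mult.assoc add: distrib_right E.scale_mult_left E.emb_one_mult)
  thus ?thesis
    by (simp add: mon_append E.emb_mult distrib_left E.scale_mult_right)
qed

lemma carrier_span:
  assumes "x : car QQ"
  shows "PhiQ x : E.span (PhiQ ` mon ` lists B)"
proof -
  obtain p where x: "x = qF p" using assms by (rule QQ_elim)
  have m: "PhiQ (mon w) : E.span (PhiQ ` mon ` lists B)" for w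
    using EB.extD_mem_span[of "%w. PhiQ (mon w)" w] extD_mon[of "[]" w] by (simp add: image_image)
  have "PhiQ (qF (SUM k:A. psing k (Poly_Mapping.lookup p k))) : E.span (PhiQ ` mon ` lists B)" for A
  proof (induction A rule: fin_induct)
    case (insert W A)
    have "PhiQ (qF (psing W (Poly_Mapping.lookup p W))) : E.span (PhiQ ` mon ` lists B)"
      using m E.span_scale by (cases W) (simp add: qF_single E.emb_smult)
    thus ?case using insert by (auto simp: E.emb_add qF_hom(1) intro: E.span_add simp flip: qF_hom(2))
  qed (simp_all add: E.emb_zero E.span_zero flip: qF_hom(6))
  thus ?thesis using poly_mapping_eq_sum_single[of p] x by metis
qed

lemma carrier_induct [consumes 1, case_names mon add smult]:
  assumes x: "x : car QQ" and mon: "!!w. w : lists B ==> P (mon w)"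
    and add: "!!x y. x : car QQ ==> y : car QQ ==> P x ==> P y ==> P (x \<oplus>[QQ] y)"
    and smult: "!!c x. x : car QQ ==> P x ==> P (c \<odot>[QQ] x)"
  shows "P x"
proof -
  have "x : lin_span QQ (mon ` lists B)"
    using carrier_span[OF x] x by (subst E.lin_span_iff) auto
  then obtain c F where F: "finite F" "F <= mon ` lists B" "x = (\<Oplus>\<^bsub>QQ\<^esub>y\<in>F. c y \<odot>[QQ] y)" by (auto simp: lin_span_def)
  have z: "P \<zero>[QQ]" using smult[OF _ mon[of "[]"], of 0] by simp
  from F(1,2) have "P (\<Oplus>\<^bsub>QQ\<^esub>y\<in>F. c y \<odot>[QQ] y)"
  proof (induction F)
    case (insert y F)
    then obtain w where w: "w : lists B" "y = mon w" by auto
    have "P (c y \<odot>[QQ] y \<oplus>[QQ] (\<Oplus>\<^bsub>QQ\<^esub>y\<in>F. c y \<odot>[QQ] y))"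
      using insert w mon[OF w(1)] by (intro add smult Q.finsum_closed) auto
    moreover have "(\<Oplus>\<^bsub>QQ\<^esub>y\<in>insert y F. c y \<odot>[QQ] y) = c y \<odot>[QQ] y \<oplus>[QQ] (\<Oplus>\<^bsub>QQ\<^esub>y\<in>F. c y \<odot>[QQ] y)"
      using insert w by (intro Q.finsum_insert) auto
    ultimately show ?case by simp
  qed (simp add: z)
  thus ?thesis using F(3) by simp
qed

abbreviation "wd w == sum_list (map dg w)"

lemma extD_cong_deg:
  assumes "vector_space sz"
  shows "list_all2 (%v d. v : Dm d) vs ds ==> (!!w. w : lists B ==> map dg w = ds ==> D w = D' w) ==> extD sz D vs = extD sz D' vs"
proof (induction vs ds arbitrary: D D' rule: list_all2_induct)
  case (Cons v vs d ds)
  interpret z: vector_space sz by fact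
  have "sz (co v b) (extD sz (%w. D (b # w)) vs) = sz (co v b) (extD sz (%w. D' (b # w)) vs)" if b: "b : B" for b
  proof (cases "co v b = 0")
    case False
    hence "dg b = d" using Dm_co Cons.hyps b by auto
    hence "extD sz (%w. D (b # w)) vs = extD sz (%w. D' (b # w)) vs" using b by (intro Cons.IH Cons.prems) auto
    thus ?thesis by simp
  qed simp
  hence "(SUM b:B. sz (co v b) (extD sz (%w. D (b # w)) vs)) = (SUM b:B. sz (co v b) (extD sz (%w. D' (b # w)) vs))"
    by (rule sum.cong[OF refl])
  thus ?case by simp
qed simp

text \<open>The relations are homogeneous, so the function that keeps words of degree
  \<open>i\<close> and sends all others to 0 respects them. The resulting maps are the projections
  required by \<open>graded_alg\<close>.\<close>

lemma prQ_exists: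
  "EX vp :: ('k, 'l) tquot => (('k, 'l) tquot, 'k) lend. (ALL a:car QQ. ALL b:car QQ. vp (a \<oplus>[QQ] b) = vp a + vp b) &
    (ALL c. ALL a:car QQ. vp (c \<odot>[QQ] a) = lscale c (vp a)) &
    (ALL w. vp (mon w) = extD lscale (%w. if wd w = i then PhiQ (mon w) else 0) w)"
proof -
  let ?D = "%w. if wd w = i then PhiQ (mon w) else 0"
  have relD: "?D (u @ x # y # v) = lscale (chi (dg x) (dg y)) (?D (u @ y # x # v)) +
        (SUM b:B. lscale (co (br x y) b) (?D (u @ b # v))) + lscale (om x y) (?D (u @ v))"
    if B: "u : lists B" "v : lists B" "x : B" "y : B" for u v x y
  proof -
    have b: "lscale (co (br x y) b) (?D (u @ b # v)) = (if wd (u @ x # y # v) = i then lscale (co (br x y) b) (PhiQ (mon (u @ b # v))) else 0)"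
      if "b : B" for b
      using br_deg[OF B(3,4) that] by (cases "co (br x y) b = 0") (auto simp: add_ac)
    have o: "lscale (om x y) (?D (u @ v)) = (if wd (u @ x # y # v) = i then lscale (om x y) (PhiQ (mon (u @ v))) else 0)"
    proof (cases "om x y = 0")
      case False
      have "wd (u @ x # y # v) = wd u + ((dg x + dg y) + wd v)" by (simp add: add.assoc)
      thus ?thesis using om_deg[OF B(3,4) False] by simp
    qed simp
    have "(SUM b:B. lscale (co (br x y) b) (?D (u @ b # v))) = (if wd (u @ x # y # v) = i then PhiQ (mon (u @ br x y # v)) else 0)"
      using b by (simp add: emb_mon_insert[of u "br x y" v] cong: sum.cong)
    thus ?thesis unfolding o using emb_mon_rel[OF Dm_basis[OF B(3)] Dm_basis[OF B(4)], of u v] by (simp add: add_ac)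
  qed
  obtain vp where "!!a b. a : car QQ ==> b : car QQ ==> vp (a \<oplus>[QQ] b) = vp a + vp b"
    "!!c a. a : car QQ ==> vp (c \<odot>[QQ] a) = lscale c (vp a)" "!!w. vp (mon w) = extD lscale ?D w"
    by (rule linear_ext[OF E.vector_space_axioms relD]) (assumption+, rule that)
  thus ?thesis by (intro exI[of _ vp] conjI ballI allI)
qed

definition prQ :: "'i => ('k, 'l) tquot => (('k, 'l) tquot, 'k) lend" where
  "prQ i = (SOME vp. (ALL a:car QQ. ALL b:car QQ. vp (a \<oplus>[QQ] b) = vp a + vp b) &
    (ALL c. ALL a:car QQ. vp (c \<odot>[QQ] a) = lscale c (vp a)) &
    (ALL w. vp (mon w) = extD lscale (%w. if wd w = i then PhiQ (mon w) else 0) w))"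

lemma prQ: "a : car QQ ==> b : car QQ ==> prQ i (a \<oplus>[QQ] b) = prQ i a + prQ i b"
  "a : car QQ ==> prQ i (c \<odot>[QQ] a) = lscale c (prQ i a)"
  "prQ i (mon w) = extD lscale (%w. if wd w = i then PhiQ (mon w) else 0) w"
  using someI_ex[OF prQ_exists[of i]] unfolding prQ_def[symmetric] by blast+

lemma prQ_mon:
  assumes "list_all2 (%v d. v : Dm d) vs ds"
  shows "prQ j (mon vs) = (if j = sum_list ds then PhiQ (mon vs) else 0)"
proof (cases "j = sum_list ds")
  case True
  have "prQ j (mon vs) = extD lscale (%w. PhiQ (mon w)) vs"
    unfolding prQ(3) by (rule extD_cong_deg[OF E.vector_space_axioms assms]) (simp add: True)
  thus ?thesis using extD_mon[of "[]" vs] True by simp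
next
  case False
  have "prQ j (mon vs) = extD lscale (%w. 0) vs"
    unfolding prQ(3) by (rule extD_cong_deg[OF E.vector_space_axioms assms]) (use False in auto)
  thus ?thesis using EB.extD_zero False by simp
qed

definition grQ :: "'i => ('k, 'l) tquot set" where
  "grQ = generated_grading QQ iQ Dm"

definition homons :: "'i => ('k, 'l) tquot set" where
  "homons i = {mon vs | vs ds. list_all2 (%v d. v : Dm d) vs ds & sum_list ds = i}"

lemma grQ_eq: "grQ i = lin_span QQ (homons i)"
  by (simp add: grQ_def generated_grading_def homons_def mon_def)

lemma homons_closed: "homons i <= car QQ"
  by (auto simp: homons_def)

lemma basis_mon_homons: "w : lists B ==> mon w : homons (wd w)"
  unfolding homons_def
  by (auto intro!: exI[of _ w] exI[of _ "map dg w"] simp: list_all2_map2 list_all2_same Dm_basis)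

lemma homons_grQ: "x : homons i ==> x : grQ i"
  unfolding grQ_eq using homons_closed by (subst E.lin_span_iff) (auto intro: E.span_base)

sublocale G: graded_alg QQ lscale PhiQ grQ prQ
proof unfold_locales
  show grc: "grQ i <= car QQ" for i
    using E.lin_span_iff[OF homons_closed] by (auto simp: grQ_eq)
  show "E.subspace (PhiQ ` grQ i)" for i
    unfolding grQ_eq by (simp add: E.subspace_image_lin_span[OF homons_closed])
  show "PhiQ x : E.span (\<Union>i. PhiQ ` grQ i)" if "x : car QQ" for x
  proof -
    have "PhiQ ` mon ` lists B <= (\<Union>i. PhiQ ` grQ i)" using basis_mon_homons homons_grQ by blast
    thus ?thesis using carrier_span[OF that] E.span_mono by blast
  qed
  show "prQ j x = (if j = i then PhiQ x else 0)" if x: "x : grQ i" for x i j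
  proof -
    obtain c F where F: "finite F" "F <= homons i" "x = (\<Oplus>\<^bsub>QQ\<^esub>y\<in>F. c y \<odot>[QQ] y)" using x by (auto simp: grQ_eq lin_span_def)
    have z: "prQ j \<zero>[QQ] = 0" using prQ(1)[of "\<zero>[QQ]" "\<zero>[QQ]" j] by simp
    from F(1,2) have "prQ j (\<Oplus>\<^bsub>QQ\<^esub>y\<in>F. c y \<odot>[QQ] y) = (if j = i then PhiQ (\<Oplus>\<^bsub>QQ\<^esub>y\<in>F. c y \<odot>[QQ] y) else 0)"
    proof (induction F)
      case (insert y F)
      have y: "y : car QQ" "prQ j y = (if j = i then PhiQ y else 0)"
        using insert.prems homons_closed prQ_mon by (auto simp: homons_def)
      have cl: "c y \<odot>[QQ] y : car QQ" if "y : F" for y using that insert.prems homons_closed by auto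
      have "(\<Oplus>\<^bsub>QQ\<^esub>y\<in>insert y F. c y \<odot>[QQ] y) = c y \<odot>[QQ] y \<oplus>[QQ] (\<Oplus>\<^bsub>QQ\<^esub>y\<in>F. c y \<odot>[QQ] y)"
        using insert y cl by (intro Q.finsum_insert) auto
      moreover have "(\<Oplus>\<^bsub>QQ\<^esub>y\<in>F. c y \<odot>[QQ] y) : car QQ" using cl by (intro Q.finsum_closed) auto
      ultimately show ?case using y insert by (simp add: prQ E.emb_add E.emb_smult)
    qed (simp add: z E.emb_zero)
    thus ?thesis using F(3) by simp
  qed
  show "x \<otimes>[QQ] y : grQ (i + j)" if xy: "x : grQ i" "y : grQ j" for x y i j
  proof -
    have "PhiQ x : E.span (PhiQ ` homons i)" "PhiQ y : E.span (PhiQ ` homons j)" "x : car QQ" "y : car QQ"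
      using xy E.lin_span_iff[OF homons_closed] by (auto simp: grQ_eq)
    moreover have "a * b : E.span (PhiQ ` homons (i + j))" if "a : E.span (PhiQ ` homons i)" "b : E.span (PhiQ ` homons j)" for a b
      using that(1)
    proof (induction rule: E.span_induct_alt)
      case (step c a a')
      then obtain vs ds where vs: "a = PhiQ (mon vs)" "list_all2 (%v d. v : Dm d) vs ds" "sum_list ds = i" by (auto simp: homons_def)
      from that(2) have "a * b : E.span (PhiQ ` homons (i + j))"
      proof (induction rule: E.span_induct_alt)
        case (step c b b')
        then obtain us es where us: "b = PhiQ (mon us)" "list_all2 (%v d. v : Dm d) us es" "sum_list es = j" by (auto simp: homons_def)
        have "mon (vs @ us) : homons (i + j)" unfolding homons_def using vs us
          by (auto intro!: exI[of _ "vs @ us"] exI[of _ "ds @ es"] list_all2_appendI)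
        moreover have "a * b = PhiQ (mon (vs @ us))" unfolding vs us by (simp add: mon_append E.emb_mult)
        ultimately have "a * b : E.span (PhiQ ` homons (i + j))" by (metis E.span_base imageI)
        thus ?case using step by (auto simp: distrib_left E.scale_mult_right intro: E.span_add E.span_scale)
      qed (simp add: E.span_zero)
      thus ?case using step by (auto simp: distrib_right E.scale_mult_left intro: E.span_add E.span_scale)
    qed (simp add: E.span_zero)
    ultimately show ?thesis unfolding grQ_eq E.lin_span_iff[OF homons_closed] by (auto simp: E.emb_mult)
  qed
  show "\<one>[QQ] : grQ 0"
    using homons_grQ[OF basis_mon_homons[of "[]"]] by simp
qed (simp_all add: prQ)

lemma iQ_gr: "v : Dm i ==> iQ v : grQ i"
  by (rule homons_grQ) (auto simp: homons_def intro!: exI[of _ "[v]"] exI[of _ "[i]"])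

text \<open>\<open>e\<close> plays the role of the unit; it need not be a unit of the ambient ring.\<close>

lemma hom_ext:
  fixes G :: "'l => 'r::ring"
  assumes sr: "typed_algebra sr"
    and G: "lin s sr G" and e: "!!v. e * G v = G v" "!!v. G v * e = G v" "e * e = e"
    and rel: "!!x y. x : B ==> y : B ==> G x * G y = sr (chi (dg x) (dg y)) (G y * G x) + G (br x y) + sr (om x y) e"
  obtains vp where "!!a b. a : car QQ ==> b : car QQ ==> vp (a \<oplus>[QQ] b) = vp a + vp b"
    "!!c a. a : car QQ ==> vp (c \<odot>[QQ] a) = sr c (vp a)"
    "!!a b. a : car QQ ==> b : car QQ ==> vp (a \<otimes>[QQ] b) = vp a * vp b"
    "vp \<one>[QQ] = e" "!!v. vp (iQ v) = G v"
proof -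
  interpret r: typed_algebra sr by fact
  interpret rb: based_target s B co sr by unfold_locales
  interpret p: vector_space_pair s sr by unfold_locales
  define D where "D w = foldr (%b p. G b * p) w e" for w
  have D_simps: "D [] = e" "D (b # w) = G b * D w" for b w by (simp_all add: D_def)
  have eD: "e * D w = D w" for w by (cases w) (simp_all add: D_simps e flip: mult.assoc)
  have D_app: "D (u @ w) = D u * D w" for u w by (induction u) (simp_all add: D_simps eD mult.assoc)
  have G_exp: "G v = (SUM b:B. sr (co v b) (G b))" for v
    using arg_cong[OF co_expand[of v], of G] by (simp add: p.linear_sum[OF G] p.linear_scale[OF G])
  have relD: "D (u @ x # y # v) = sr (chi (dg x) (dg y)) (D (u @ y # x # v)) +
        (SUM b:B. sr (co (br x y) b) (D (u @ b # v))) + sr (om x y) (D (u @ v))"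
    if B: "u : lists B" "v : lists B" "x : B" "y : B" for u v x y
  proof -
    have "(SUM b:B. sr (co (br x y) b) (D (u @ b # v))) = D u * (G (br x y) * D v)"
      by (subst G_exp[of "br x y"]) (simp add: D_app D_simps sum_distrib_left sum_distrib_right r.scale_mult_left r.scale_mult_right)
    moreover have "D (u @ x # y # v) = D u * ((G x * G y) * D v)" by (simp add: D_app D_simps mult.assoc)
    ultimately show ?thesis
      by (simp add: rel[OF B(3,4)] D_app D_simps distrib_left distrib_right r.scale_mult_left r.scale_mult_right eD mult.assoc)
  qed
  obtain vp where vp: "!!a b. a : car QQ ==> b : car QQ ==> vp (a \<oplus>[QQ] b) = vp a + vp b"
    "!!c a. a : car QQ ==> vp (c \<odot>[QQ] a) = sr c (vp a)"
    "!!w. vp (mon w) = extD sr D w"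
    by (rule linear_ext[OF r.vector_space_axioms relD]) (assumption+, rule that)
  have vp_mon: "vp (mon w) = D w" if "w : lists B" for w using vp(3) rb.extD_basis[OF that] by simp
  show thesis
  proof (rule that[of vp])
    show "vp (a \<otimes>[QQ] b) = vp a * vp b" if a: "a : car QQ" and b: "b : car QQ" for a b
      using a
    proof (induction rule: carrier_induct)
      case (mon u)
      from b show ?case
      proof (induction rule: carrier_induct)
        case (mon w)
        hence "u @ w : lists B" using \<open>u : lists B\<close> by simp
        thus ?case using mon \<open>u : lists B\<close> by (simp add: vp_mon D_app flip: mon_append)
      qed (simp_all add: Q.r_distr vp distrib_left Q.smult_mult_r r.scale_mult_right)
    qed (simp_all add: Q.l_distr vp distrib_right Q.smult_mult_l r.scale_mult_left b)
    show "vp \<one>[QQ] = e" using vp_mon[of "[]"] by (simp add: D_simps)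
    show "vp (iQ v) = G v" for v
    proof -
      have "vp (iQ v) = extD sr D [v]" using vp(3)[of "[v]"] by simp
      also have "... = G v" using G_exp[of v] by (simp add: D_simps e)
      finally show ?thesis .
    qed
  qed (use vp in auto)
qed

end

section \<open>Graded tensor products\<close>

context graded_alg
begin

lemma hsum_superset:
  fixes F :: "'i => 'a => 'z::ab_group_add"
  assumes "finite I" "hs x <= I" "!!i. F i \<zero> = 0"
  shows "(SUM i:hs x. F i (hc x i)) = (SUM i:I. F i (hc x i))"
proof (rule sum.mono_neutral_left[OF assms(1,2)], rule ballI)
  fix i assume "i : I - hs x"
  hence "hc x i = \<zero>" by (auto simp: hsupp_def)
  thus "F i (hc x i) = 0" using assms(3) by simp
qed

text \<open>The index set \<open>hs x\<close> varies with \<open>x\<close>. Over a common finite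
  superset the sum is additive because the components are.\<close>

lemma hsum_add:
  fixes F :: "'i => 'a => 'z::ab_group_add"
  assumes x: "x : car M" "y : car M"
    and F: "!!i x y. x : car M ==> y : car M ==> F i (x \<oplus> y) = F i x + F i y"
  shows "(SUM i:hs (x \<oplus> y). F i (hc (x \<oplus> y) i)) = (SUM i:hs x. F i (hc x i)) + (SUM i:hs y. F i (hc y i))"
proof -
  let ?I = "hs (x \<oplus> y) \<union> hs x \<union> hs y"
  have fin: "finite ?I" using x by (simp add: finite_hs)
  have z: "F i \<zero> = 0" for i using F[of \<zero> \<zero> i] by simp
  have "(SUM i:hs x. F i (hc x i)) = (SUM i:?I. F i (hc x i))" "(SUM i:hs y. F i (hc y i)) = (SUM i:?I. F i (hc y i))"
    "(SUM i:hs (x \<oplus> y). F i (hc (x \<oplus> y) i)) = (SUM i:?I. F i (hc (x \<oplus> y) i))"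
    by (rule hsum_superset[where F = F]; use fin z in blast)+
  thus ?thesis using x by (simp only: hc_add F hc_closed sum.distrib)
qed

lemma hsum_smult:
  fixes F :: "'i => 'a => 'z::ab_group_add"
  assumes x: "x : car M" and sz: "vector_space sz" and z: "!!i. F i \<zero> = 0"
    and F: "!!i x. x : car M ==> F i (c \<odot>[M] x) = sz c (F i x)"
  shows "(SUM i:hs (c \<odot>[M] x). F i (hc (c \<odot>[M] x) i)) = sz c (SUM i:hs x. F i (hc x i))"
proof -
  interpret z: vector_space sz by fact
  have "hs (c \<odot>[M] x) <= hs x" using x by (auto simp: hsupp_def hc_smult)
  hence "(SUM i:hs (c \<odot>[M] x). F i (hc (c \<odot>[M] x) i)) = (SUM i:hs x. F i (hc (c \<odot>[M] x) i))"
    by (intro hsum_superset finite_hs x z)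
  thus ?thesis using x by (simp add: hc_smult F z.scale_sum_right)
qed

lemma hsum_gr:
  fixes F :: "'i => 'a => 'z::ab_group_add"
  assumes "x : gr i" "!!i. F i \<zero> = 0"
  shows "(SUM i:hs x. F i (hc x i)) = F i x"
  using hsum_superset[of "{i}" x F] hs_of_gr[OF assms(1)] assms by (simp add: hc_of_gr)

end

lemma pm_additive_zero_on:
  fixes g :: "('b \<Rightarrow>\<^sub>0 'k::field) => 'z::ab_group_add"
  assumes add: "!!p q. g (p + q) = g p + g q" and single: "!!k c. k : S ==> g (psing k c) = 0"
    and p: "keys p <= S"
  shows "g p = 0"
proof -
  have 0: "g 0 = 0" using add[of 0 0] by simp
  have "g (SUM k:A. psing k (Poly_Mapping.lookup p k)) = 0" if "A <= S" for A
    using that by (induction A rule: fin_induct) (simp_all add: 0 add single)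
  thus ?thesis using poly_mapping_eq_sum_single[of p] p by metis
qed

lemma pm_linear_zero_on:
  fixes g :: "('b \<Rightarrow>\<^sub>0 'k::field) => ('c \<Rightarrow>\<^sub>0 'k)"
  assumes add: "!!p q. g (p + q) = g p + g q" and sc: "!!c p. g (pscale c p) = pscale c (g p)"
    and single: "!!k. k : S ==> g (psing k 1) = 0" and p: "keys p <= S"
  shows "g p = 0"
proof (rule pm_additive_zero_on[OF add _ p])
  fix k c assume "k : S"
  thus "g (psing k c) = 0" using sc[of c "psing k 1"] single by simp
qed

locale tensor = M: graded_alg M sM PhiM grM prM + N: graded_alg N sN PhiN grN prN
  for M :: "('k::field, 'a) module" and sM :: "'k => 'rm::ring => 'rm" and PhiM and grM :: "'i::comm_monoid_add => 'a set" and prM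
    and N :: "('k, 'b) module" and sN :: "'k => 'rn::ring => 'rn" and PhiN and grN :: "'i => 'b set" and prN +
  fixes \<chi> :: "'i => 'i => 'k"
  assumes chi_add_l: "\<chi> (i + j) l = \<chi> i l * \<chi> j l" and chi_add_r: "\<chi> i (j + l) = \<chi> i j * \<chi> i l"
    and chi_0_l [simp]: "\<chi> 0 j = 1" and chi_0_r [simp]: "\<chi> i 0 = 1"
begin

abbreviation "PP == pretensor \<chi> M grM N grN"
abbreviation "BR == bilinearity_relations M N"
abbreviation "AA == tensor_product \<chi> M grM N grN"
abbreviation "cMN == car M \<times> car N"
abbreviation "LL == lin_span PP BR"
abbreviation "sg a b == psing (a, b) (1::'k)"

lemma P_simps [simp]: "car PP = {p. keys p <= cMN}" "mult PP = pretensor_mult \<chi> M grM N grN"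
  "one PP = sg \<one>[M] \<one>[N]" "zero PP = 0" "add PP = (+)" "smult PP = pscale"
  by (simp_all add: pretensor_def pscale_def fun_eq_iff)

lemma BR_eq: "BR = {sg (a \<oplus>[M] a') b - sg a b - sg a' b | a a' b. a : car M & a' : car M & b : car N} \<union>
     {sg a (b \<oplus>[N] b') - sg a b - sg a b' | a b b'. a : car M & b : car N & b' : car N} \<union>
     {sg (c \<odot>[M] a) b - pscale c (sg a b) | c a b. a : car M & b : car N} \<union>
     {sg a (c \<odot>[N] b) - pscale c (sg a b) | c a b. a : car M & b : car N}"
  by (simp add: bilinearity_relations_def Let_def pscale_def)

lemma AA_eq: "AA = quot_algebra PP LL"
  by (simp add: tensor_product_def Let_def)

lemma keys_plus: "keys p <= cMN ==> keys q <= cMN ==> keys (p + q) <= cMN"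
  by (rule order_trans[OF keys_add]) simp

lemma keys_uminus': "keys (- p) = keys (p :: _ \<Rightarrow>\<^sub>0 'k)"
  by (auto simp: in_keys_iff)

lemma keys_diff': "keys p <= cMN ==> keys q <= cMN ==> keys (p - q) <= (cMN :: ('a * 'b) set)"
  for p q :: "_ \<Rightarrow>\<^sub>0 'k"
  using keys_plus[of p "- q"] by (simp add: keys_uminus')

lemma keys_scale: "keys p <= cMN ==> keys (pscale c p) <= cMN"
  by (rule order_trans[OF keys_pscale_subset])

lemma keys_sum: "(!!i. i : A ==> keys (f i) <= cMN) ==> keys (SUM i:A. f i) <= cMN"
  by (induction A rule: fin_induct) (simp_all add: keys_plus)

lemma keys_sg: "a : car M ==> b : car N ==> keys (psing (a, b) c) <= cMN"
  by auto

sublocale P: abelian_group PP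
proof (rule abelian_groupI)
  fix p assume "p : car PP"
  thus "EX q:car PP. q \<oplus>[PP] p = \<zero>[PP]"
    by (intro bexI[of _ "- p"]) (auto simp: keys_uminus')
qed (simp_all add: keys_plus add_ac)

lemma P_finsum: "(!!x. x : F ==> f x : car PP) ==> finsum PP f F = sum f F"
proof (induction F rule: fin_induct)
  case (insert x F)
  thus ?case by (subst P.finsum_insert) auto
qed (auto simp: P.finsum_infinite)

lemma BR_keys: "r : BR ==> keys r <= cMN"
proof -
  have k: "keys (p - q) <= cMN" if "keys p <= cMN" "keys q <= cMN" for p q :: "'a * 'b \<Rightarrow>\<^sub>0 'k"
    using that by (rule keys_diff')
  assume "r : BR"
  then consider a a' b where "r = sg (a \<oplus>[M] a') b - sg a b - sg a' b" "a : car M" "a' : car M" "b : car N"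
    | a b b' where "r = sg a (b \<oplus>[N] b') - sg a b - sg a b'" "a : car M" "b : car N" "b' : car N"
    | c a b where "r = sg (c \<odot>[M] a) b - pscale c (sg a b)" "a : car M" "b : car N"
    | c a b where "r = sg a (c \<odot>[N] b) - pscale c (sg a b)" "a : car M" "b : car N"
    unfolding BR_eq by blast
  thus ?thesis by cases (simp_all add: k keys_scale del: pscale_single)
qed

lemma LL_eq: "LL = pm.span BR"
proof -
  have fs: "finsum PP (%x. c x \<odot>[PP] x) F = (SUM x:F. pscale (c x) x)" if "F <= BR" for c F
    using that BR_keys by (subst P_finsum) (simp_all add: keys_scale subsetD)
  show ?thesis
  proof (intro equalityI subsetI)
    fix x assume "x : LL"
    then obtain c F where F: "finite F" "F <= BR" "x = finsum PP (%x. c x \<odot>[PP] x) F" unfolding lin_span_def by blast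
    have "x = (SUM x:F. pscale (c x) x)" unfolding F(3) by (rule fs[OF F(2)])
    moreover have "... : pm.span BR" using F(2) by (intro pm.span_sum pm.span_scale pm.span_base) blast
    ultimately show "x : pm.span BR" by simp
  next
    fix x assume "x : pm.span BR"
    then obtain F c where F: "finite F" "F <= BR" "x = (SUM x:F. pscale (c x) x)" unfolding pm.span_explicit by blast
    have "x = finsum PP (%x. c x \<odot>[PP] x) F" unfolding F(3) by (rule fs[OF F(2), symmetric])
    thus "x : LL" unfolding lin_span_def using F(1,2) by blast
  qed
qed

lemma LL_keys: "p : LL ==> keys p <= cMN"
proof -
  have "pm.subspace {p. keys p <= cMN}"
    unfolding pm.subspace_def by (simp add: keys_plus keys_scale)
  moreover have "BR <= {p. keys p <= cMN}" using BR_keys by auto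
  ultimately show "p : LL ==> keys p <= cMN" unfolding LL_eq using pm.span_minimal by blast
qed

text \<open>A linear normal form modulo the bilinearity relations: equality of cosets becomes
  equality of values of \<open>rL\<close>, so that the quotient can be studied by sums and scalars
  of a genuine type.\<close>

definition rL :: "('a * 'b \<Rightarrow>\<^sub>0 'k) => ('a * 'b \<Rightarrow>\<^sub>0 'k)" where
  "rL = (SOME r. lin pscale pscale r & (ALL x. r x = 0 \<longleftrightarrow> x : LL) & (ALL x. x - r x : LL))"

lemma rL: "rL (p + q) = rL p + rL q" "rL (pscale c p) = pscale c (rL p)" "rL p = 0 \<longleftrightarrow> p : LL" "p - rL p : LL"
proof -
  have "pm.subspace LL" by (simp add: LL_eq)
  then obtain r where "lin pscale pscale r" "!!x. r x = 0 \<longleftrightarrow> x : LL" "!!x. x - r x : LL"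
    by (rule pm.exists_projection_along) blast
  hence "EX r. lin pscale pscale r & (ALL x. r x = 0 \<longleftrightarrow> x : LL) & (ALL x. x - r x : LL)" by blast
  from someI_ex[OF this] have "lin pscale pscale rL & (ALL x. rL x = 0 \<longleftrightarrow> x : LL) & (ALL x. x - rL x : LL)"
    unfolding rL_def .
  thus "rL (p + q) = rL p + rL q" "rL (pscale c p) = pscale c (rL p)" "rL p = 0 \<longleftrightarrow> p : LL" "p - rL p : LL"
    by (auto simp: lin_iff)
qed

lemma rL_diff: "rL (p - q) = rL p - rL q"
  using rL(1)[of "p - q" q] by simp

lemma rL_eq: "rL p = rL q \<longleftrightarrow> p - q : LL"
  by (simp add: rL_diff flip: rL(3))

lemma rL_sum: "rL (SUM i:A. f i) = (SUM i:A. rL (f i))"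
  by (induction A rule: fin_induct) (use rL(1) rL(2)[of 0 0] in auto)

definition t :: "'a => 'b => ('a * 'b \<Rightarrow>\<^sub>0 'k)" where
  "t a b = rL (sg a b)"

lemma t_bilinear:
  assumes "a : car M" "b : car N"
  shows "a' : car M ==> t (a \<oplus>[M] a') b = t a b + t a' b"
    "b' : car N ==> t a (b \<oplus>[N] b') = t a b + t a b'"
    "t (c \<odot>[M] a) b = pscale c (t a b)" "t a (c \<odot>[N] b) = pscale c (t a b)"
proof -
  have z: "rL x = 0" if "x : BR" for x using that rL(3) by (simp add: LL_eq pm.span_base)
  show "t (a \<oplus>[M] a') b = t a b + t a' b" if "a' : car M"
  proof -
    have "sg (a \<oplus>[M] a') b - sg a b - sg a' b : BR" unfolding BR_eq using assms that by blast
    from z[OF this, unfolded rL_diff] show ?thesis by (simp add: t_def algebra_simps)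
  qed
  show "t a (b \<oplus>[N] b') = t a b + t a b'" if "b' : car N"
  proof -
    have "sg a (b \<oplus>[N] b') - sg a b - sg a b' : BR" unfolding BR_eq using assms that by blast
    from z[OF this, unfolded rL_diff] show ?thesis by (simp add: t_def algebra_simps)
  qed
  have "sg (c \<odot>[M] a) b - pscale c (sg a b) : BR" unfolding BR_eq using assms by blast
  thus "t (c \<odot>[M] a) b = pscale c (t a b)" unfolding t_def rL(2)[symmetric] rL_eq LL_eq by (rule pm.span_base)
  have "sg a (c \<odot>[N] b) - pscale c (sg a b) : BR" unfolding BR_eq using assms by blast
  thus "t a (c \<odot>[N] b) = pscale c (t a b)" unfolding t_def rL(2)[symmetric] rL_eq LL_eq by (rule pm.span_base)
qed

definition m1 :: "'a => 'b => 'a => 'b => ('a * 'b \<Rightarrow>\<^sub>0 'k)" where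
  "m1 a b c d = (SUM i:N.hs b. SUM j:M.hs c. psing (a \<otimes>[M] M.hc c j, N.hc b i \<otimes>[N] d) (\<chi> i j))"

abbreviation "pmul == pretensor_mult \<chi> M grM N grN"

lemma pmul_eq: "pmul p q = lext pscale (%x. lext pscale (%y. m1 (fst x) (snd x) (fst y) (snd y)) q) p"
  by (simp add: pretensor_mult_def lext_def m1_def case_prod_unfold pm.scale_sum_right mult_ac)

lemma pmul_bilinear: "pmul (p + p') q = pmul p q + pmul p' q" "pmul p (q + q') = pmul p q + pmul p q'"
  "pmul (pscale c p) q = pscale c (pmul p q)" "pmul p (pscale c q) = pscale c (pmul p q)"
  by (simp_all add: pmul_eq pm.lext_add pm.lext_scale)
    (simp_all add: lext_def pm.scale_right_distrib sum.distrib pm.scale_sum_right mult_ac)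

lemma pmul_diff: "pmul (p - p') q = pmul p q - pmul p' q" "pmul p (q - q') = pmul p q - pmul p q'"
  using pmul_bilinear(1)[of "p - p'" p' q] pmul_bilinear(2)[of p "q - q'" q'] by (simp_all add: eq_diff_eq)

lemma pmul_sg: "pmul (sg a b) (sg c d) = m1 a b c d"
  by (simp add: pmul_eq)

lemma m1_keys: "a : car M ==> b : car N ==> c : car M ==> d : car N ==> keys (m1 a b c d) <= cMN"
  unfolding m1_def by (intro keys_sum keys_sg) auto

lemma pmul_keys: "keys p <= cMN ==> keys q <= cMN ==> keys (pmul p q) <= cMN"
  unfolding pmul_eq lext_def by (intro keys_sum keys_scale m1_keys) auto

definition \<beta> :: "'a => 'b => 'a => 'b => ('a * 'b \<Rightarrow>\<^sub>0 'k)" where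
  "\<beta> a b c d = (SUM i:N.hs b. SUM j:M.hs c. pscale (\<chi> i j) (t (a \<otimes>[M] M.hc c j) (N.hc b i \<otimes>[N] d)))"

lemma rL_m1: "rL (m1 a b c d) = \<beta> a b c d"
proof -
  have "psing k (\<chi> i j) = pscale (\<chi> i j) (psing k 1)" for k :: "'a * 'b" and i j by simp
  thus ?thesis unfolding m1_def \<beta>_def t_def rL(2)[symmetric] rL_sum by simp
qed

lemma t_zero: "a : car M ==> t a \<zero>[N] = 0" "b : car N ==> t \<zero>[M] b = 0"
  using t_bilinear(4)[of a "\<zero>[N]" 0] t_bilinear(3)[of "\<zero>[M]" b 0] by simp_all

lemma \<beta>_add:
  assumes "a : car M" "b : car N" "c : car M" "d : car N"
  shows "a' : car M ==> \<beta> (a \<oplus>[M] a') b c d = \<beta> a b c d + \<beta> a' b c d"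
    "b' : car N ==> \<beta> a (b \<oplus>[N] b') c d = \<beta> a b c d + \<beta> a b' c d"
    "c' : car M ==> \<beta> a b (c \<oplus>[M] c') d = \<beta> a b c d + \<beta> a b c' d"
    "d' : car N ==> \<beta> a b c (d \<oplus>[N] d') = \<beta> a b c d + \<beta> a b c d'"
proof -
  show "a' : car M ==> \<beta> (a \<oplus>[M] a') b c d = \<beta> a b c d + \<beta> a' b c d"
    using assms by (simp add: \<beta>_def M.l_distr t_bilinear pm.scale_right_distrib sum.distrib)
  show "d' : car N ==> \<beta> a b c (d \<oplus>[N] d') = \<beta> a b c d + \<beta> a b c d'"
    using assms by (simp add: \<beta>_def N.r_distr t_bilinear pm.scale_right_distrib sum.distrib)
  show "\<beta> a (b \<oplus>[N] b') c d = \<beta> a b c d + \<beta> a b' c d" if "b' : car N"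
    unfolding \<beta>_def
    by (rule N.hsum_add[OF assms(2) that, of "%i b. SUM j:M.hs c. pscale (\<chi> i j) (t (a \<otimes>[M] M.hc c j) (b \<otimes>[N] d))"])
      (use assms in \<open>simp add: N.l_distr t_bilinear pm.scale_right_distrib sum.distrib\<close>)
  show "\<beta> a b (c \<oplus>[M] c') d = \<beta> a b c d + \<beta> a b c' d" if "c' : car M"
  proof -
    have "(SUM j:M.hs (c \<oplus>[M] c'). pscale (\<chi> i j) (t (a \<otimes>[M] M.hc (c \<oplus>[M] c') j) (N.hc b i \<otimes>[N] d))) =
      (SUM j:M.hs c. pscale (\<chi> i j) (t (a \<otimes>[M] M.hc c j) (N.hc b i \<otimes>[N] d))) +
      (SUM j:M.hs c'. pscale (\<chi> i j) (t (a \<otimes>[M] M.hc c' j) (N.hc b i \<otimes>[N] d)))" for i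
      by (rule M.hsum_add[OF assms(3) that, of "%j c. pscale (\<chi> i j) (t (a \<otimes>[M] c) (N.hc b i \<otimes>[N] d))"])
        (use assms in \<open>simp add: M.r_distr t_bilinear pm.scale_right_distrib\<close>)
    thus ?thesis by (simp add: \<beta>_def sum.distrib)
  qed
qed

lemma \<beta>_gr:
  assumes "a : car M" "b : grN i" "c : grM j" "d : car N"
  shows "\<beta> a b c d = pscale (\<chi> i j) (t (a \<otimes>[M] c) (b \<otimes>[N] d))"
proof -
  have "\<beta> a b c d = (SUM j:M.hs c. pscale (\<chi> i j) (t (a \<otimes>[M] M.hc c j) (b \<otimes>[N] d)))"
    unfolding \<beta>_def
    by (rule N.hsum_gr[OF assms(2), of "%i b. SUM j:M.hs c. pscale (\<chi> i j) (t (a \<otimes>[M] M.hc c j) (b \<otimes>[N] d))"])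
      (use assms M.gr_closed[OF assms(3)] in \<open>simp add: t_zero\<close>)
  also have "... = pscale (\<chi> i j) (t (a \<otimes>[M] c) (b \<otimes>[N] d))"
    by (rule M.hsum_gr[OF assms(3), of "%j c. pscale (\<chi> i j) (t (a \<otimes>[M] c) (b \<otimes>[N] d))"])
      (use assms N.gr_closed[OF assms(2)] in \<open>simp add: t_zero\<close>)
  finally show ?thesis .
qed

text \<open>Additivity in each variable reduces identities between iterated products to homogeneous
  elements.\<close>

lemma \<beta>_smult:
  assumes "a : car M" "b : car N" "c : car M" "d : car N"
  shows "\<beta> (x \<odot>[M] a) b c d = pscale x (\<beta> a b c d)" "\<beta> a (x \<odot>[N] b) c d = pscale x (\<beta> a b c d)"
    "\<beta> a b (x \<odot>[M] c) d = pscale x (\<beta> a b c d)" "\<beta> a b c (x \<odot>[N] d) = pscale x (\<beta> a b c d)"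
proof -
  have *: "\<beta> (x \<odot>[M] a) b c d = pscale x (\<beta> a b c d) & \<beta> a (x \<odot>[N] b) c d = pscale x (\<beta> a b c d) &
    \<beta> a b (x \<odot>[M] c) d = pscale x (\<beta> a b c d) & \<beta> a b c (x \<odot>[N] d) = pscale x (\<beta> a b c d)"
    using assms(2)
  proof (induction rule: N.homog_induct)
    case (hom i b)
    from assms(3) show ?case
    proof (induction rule: M.homog_induct)
      case (hom j c)
      thus ?case using \<open>b : grN i\<close> assms M.gr_closed[OF hom] N.gr_closed[OF \<open>b : grN i\<close>] M.gr_smult[OF hom, of x] N.gr_smult[OF \<open>b : grN i\<close>, of x]
        by (simp add: \<beta>_gr M.smult_mult_l M.smult_mult_r N.smult_mult_l N.smult_mult_r t_bilinear mult.commute)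
    next
      case (add c c')
      thus ?case using assms N.gr_closed[OF \<open>b : grN i\<close>] by (simp add: \<beta>_add M.smult_r_distr pm.scale_right_distrib)
    qed
  next
    case (add b b')
    thus ?case using assms by (simp add: \<beta>_add N.smult_r_distr pm.scale_right_distrib)
  qed
  show "\<beta> (x \<odot>[M] a) b c d = pscale x (\<beta> a b c d)" "\<beta> a (x \<odot>[N] b) c d = pscale x (\<beta> a b c d)"
    "\<beta> a b (x \<odot>[M] c) d = pscale x (\<beta> a b c d)" "\<beta> a b c (x \<odot>[N] d) = pscale x (\<beta> a b c d)"
    using * by auto
qed

lemma rL_pmul: "rL (pmul p q) = lext pscale (%x. lext pscale (%y. \<beta> (fst x) (snd x) (fst y) (snd y)) q) p"
  by (simp add: pmul_eq lext_def rL_sum rL(2) rL_m1)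

lemma BR_cases:
  fixes g :: "('a * 'b \<Rightarrow>\<^sub>0 'k) => 'z::ab_group_add"
  assumes r: "r : BR" and add: "!!p q. g (p + q) = g p + g q" and sc: "!!c p. g (pscale c p) = sz c (g p)"
    and h: "!!a b. a : car M ==> b : car N ==> g (sg a b) = h a b"
    and h1: "!!a a' b. a : car M ==> a' : car M ==> b : car N ==> h (a \<oplus>[M] a') b = h a b + h a' b"
    and h2: "!!a b b'. a : car M ==> b : car N ==> b' : car N ==> h a (b \<oplus>[N] b') = h a b + h a b'"
    and h3: "!!a b c. a : car M ==> b : car N ==> h (c \<odot>[M] a) b = sz c (h a b)"
    and h4: "!!a b c. a : car M ==> b : car N ==> h a (c \<odot>[N] b) = sz c (h a b)"
  shows "g r = 0"
proof -
  have d: "g (p - q) = g p - g q" for p q using add[of "p - q" q] by simp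
  show ?thesis using r unfolding BR_eq
    by (elim UnE; clarify) (simp_all only: d sc h h1 h2 h3 h4 M.add.m_closed N.add.m_closed M.smult_closed N.smult_closed, simp_all)
qed

lemma LL_vanish:
  fixes g :: "('a * 'b \<Rightarrow>\<^sub>0 'k) => 'z::ab_group_add"
  assumes r: "r : LL" and sz: "vector_space sz" and add: "!!p q. g (p + q) = g p + g q" and sc: "!!c p. g (pscale c p) = sz c (g p)"
    and BR: "!!r. r : BR ==> g r = 0"
  shows "g r = 0"
proof -
  interpret z: vector_space sz by fact
  have "pm.subspace {r. g r = 0}" using add[of 0 0] by (auto simp: pm.subspace_def add sc)
  thus ?thesis using r BR pm.span_minimal[of BR "{r. g r = 0}"] unfolding LL_eq by blast
qed

lemma LL_pmul_l:
  assumes "r : LL" "keys q <= cMN"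
  shows "pmul r q : LL"
proof -
  have "rL (pmul r q) = 0"
  proof (rule LL_vanish[OF assms(1) pm.vector_space_axioms, of "%r. rL (pmul r q)"])
    fix r assume "r : BR"
    thus "rL (pmul r q) = 0"
    proof (rule BR_cases[where sz = pscale and h = "%a b. lext pscale (%y. \<beta> a b (fst y) (snd y)) q"])
    qed (use assms(2) in \<open>auto simp: pmul_bilinear rL(1,2) rL_pmul\<close>,
      (use assms(2) in \<open>force simp: lext_def \<beta>_add \<beta>_smult pm.scale_right_distrib pm.scale_sum_right mult.commute
        simp flip: sum.distrib intro!: sum.cong\<close>)+)
  qed (simp_all add: pmul_bilinear rL(1,2))
  thus ?thesis by (simp add: rL(3))
qed

lemma LL_pmul_r:
  assumes "r : LL" "keys q <= cMN"
  shows "pmul q r : LL"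
proof -
  have "rL (pmul q r) = 0"
  proof (rule LL_vanish[OF assms(1) pm.vector_space_axioms, of "%r. rL (pmul q r)"])
    fix r assume "r : BR"
    thus "rL (pmul q r) = 0"
    proof (rule BR_cases[where sz = pscale and h = "%a b. lext pscale (%x. \<beta> (fst x) (snd x) a b) q"])
    qed (use assms(2) in \<open>auto simp: pmul_bilinear rL(1,2) rL_pmul\<close>,
      (use assms(2) in \<open>force simp: lext_def \<beta>_add \<beta>_smult pm.scale_right_distrib pm.scale_sum_right mult.commute
        simp flip: sum.distrib intro!: sum.cong\<close>)+)
  qed (simp_all add: pmul_bilinear rL(1,2))
  thus ?thesis by (simp add: rL(3))
qed

lemma rL_pmul_cong: "keys q <= cMN ==> rL p = rL p' ==> rL (pmul p q) = rL (pmul p' q)"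
  "keys q <= cMN ==> rL p = rL p' ==> rL (pmul q p) = rL (pmul q p')"
  using LL_pmul_l[of "p - p'" q] LL_pmul_r[of "p - p'" q] by (simp_all add: rL_eq pmul_diff)

definition tri1 :: "'a => 'b => 'a => 'b => 'a => 'b => ('a * 'b \<Rightarrow>\<^sub>0 'k)" where
  "tri1 a b c d f g = rL (pmul (pmul (sg a b) (sg c d)) (sg f g))"

definition tri2 :: "'a => 'b => 'a => 'b => 'a => 'b => ('a * 'b \<Rightarrow>\<^sub>0 'k)" where
  "tri2 a b c d f g = rL (pmul (sg a b) (pmul (sg c d) (sg f g)))"

lemma rL_sg_add:
  "a : car M ==> b : car N ==> b' : car N ==> rL (sg a (b \<oplus>[N] b')) = rL (sg a b + sg a b')"
  "a : car M ==> a' : car M ==> b : car N ==> rL (sg (a \<oplus>[M] a') b) = rL (sg a b + sg a' b)"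
  using t_bilinear(1,2) by (simp_all add: t_def rL)

lemma tri_add:
  assumes c: "a : car M" "b : car N" "c : car M" "d : car N" "f : car M" "g : car N"
  shows "b' : car N ==> tri1 a (b \<oplus>[N] b') c d f g = tri1 a b c d f g + tri1 a b' c d f g"
    "b' : car N ==> tri2 a (b \<oplus>[N] b') c d f g = tri2 a b c d f g + tri2 a b' c d f g"
    "c' : car M ==> tri1 a b (c \<oplus>[M] c') d f g = tri1 a b c d f g + tri1 a b c' d f g"
    "c' : car M ==> tri2 a b (c \<oplus>[M] c') d f g = tri2 a b c d f g + tri2 a b c' d f g"
    "d' : car N ==> tri1 a b c (d \<oplus>[N] d') f g = tri1 a b c d f g + tri1 a b c d' f g"
    "d' : car N ==> tri2 a b c (d \<oplus>[N] d') f g = tri2 a b c d f g + tri2 a b c d' f g"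
    "f' : car M ==> tri1 a b c d (f \<oplus>[M] f') g = tri1 a b c d f g + tri1 a b c d f' g"
    "f' : car M ==> tri2 a b c d (f \<oplus>[M] f') g = tri2 a b c d f g + tri2 a b c d f' g"
proof -
  note k = keys_sg[of _ _ 1] pmul_keys
  show "tri1 a (b \<oplus>[N] b') c d f g = tri1 a b c d f g + tri1 a b' c d f g" if "b' : car N"
    unfolding tri1_def rL(1)[symmetric] pmul_bilinear(1)[symmetric]
    by (intro rL_pmul_cong rL_sg_add k c that)
  show "tri2 a (b \<oplus>[N] b') c d f g = tri2 a b c d f g + tri2 a b' c d f g" if "b' : car N"
    unfolding tri2_def rL(1)[symmetric] pmul_bilinear(1)[symmetric]
    by (intro rL_pmul_cong rL_sg_add k c that)
  show "tri1 a b (c \<oplus>[M] c') d f g = tri1 a b c d f g + tri1 a b c' d f g" if "c' : car M"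
    unfolding tri1_def rL(1)[symmetric] pmul_bilinear(1,2)[symmetric]
    by (intro rL_pmul_cong(1), intro k c that, intro rL_pmul_cong(2) rL_sg_add k c that)
  show "tri2 a b (c \<oplus>[M] c') d f g = tri2 a b c d f g + tri2 a b c' d f g" if "c' : car M"
    unfolding tri2_def rL(1)[symmetric] pmul_bilinear(1,2)[symmetric]
    by (intro rL_pmul_cong(2), intro k c that, intro rL_pmul_cong(1) rL_sg_add k c that)
  show "tri1 a b c (d \<oplus>[N] d') f g = tri1 a b c d f g + tri1 a b c d' f g" if "d' : car N"
    unfolding tri1_def rL(1)[symmetric] pmul_bilinear(1,2)[symmetric]
    by (intro rL_pmul_cong(1), intro k c that, intro rL_pmul_cong(2) rL_sg_add k c that)
  show "tri2 a b c (d \<oplus>[N] d') f g = tri2 a b c d f g + tri2 a b c d' f g" if "d' : car N"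
    unfolding tri2_def rL(1)[symmetric] pmul_bilinear(1,2)[symmetric]
    by (intro rL_pmul_cong(2), intro k c that, intro rL_pmul_cong(1) rL_sg_add k c that)
  show "tri1 a b c d (f \<oplus>[M] f') g = tri1 a b c d f g + tri1 a b c d f' g" if "f' : car M"
    unfolding tri1_def rL(1)[symmetric] pmul_bilinear(2)[symmetric]
    by (intro rL_pmul_cong(2), intro k c that, intro rL_sg_add k c that)
  show "tri2 a b c d (f \<oplus>[M] f') g = tri2 a b c d f g + tri2 a b c d f' g" if "f' : car M"
    unfolding tri2_def rL(1)[symmetric] pmul_bilinear(2)[symmetric]
    by (rule rL_pmul_cong(2), intro k c that, rule rL_pmul_cong(2), intro k c that, intro rL_sg_add k c that)
qed

lemma rL_pmul_gr:
  assumes "a : car M" "b : grN i" "c : grM j" "d : car N"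
  shows "rL (pmul (sg a b) (sg c d)) = rL (pscale (\<chi> i j) (sg (a \<otimes>[M] c) (b \<otimes>[N] d)))"
  using \<beta>_gr[OF assms] by (simp only: pmul_sg rL_m1 rL(2) t_def)

text \<open>Signs depend only on the inner factors \<open>b\<close>, \<open>c\<close>,
  \<open>d\<close>, \<open>f\<close>, and only these are reduced to homogeneous elements. Both
  bracketings then carry \<open>\<chi> i j\<close>, \<open>\<chi> i l\<close> and
  \<open>\<chi> i' l\<close>: for the first product because \<open>\<chi>\<close> is multiplicative
  on the left, for the second because it is so on the right.\<close>

lemma tri_eq:
  assumes c: "a : car M" "b : car N" "c : car M" "d : car N" "f : car M" "g : car N"
  shows "tri1 a b c d f g = tri2 a b c d f g"
  using c(2)
proof (induction rule: N.homog_induct)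
  case (hom i b)
  note b = hom
  from c(3) show ?case
  proof (induction rule: M.homog_induct)
    case (hom j c)
    note c' = hom
    from c(4) show ?case
    proof (induction rule: N.homog_induct)
      case (hom i' d)
      note d = hom
      from c(5) show ?case
      proof (induction rule: M.homog_induct)
        case (hom l f)
        note f = hom
        note cl = c(1,6) b[THEN N.gr_closed] c'[THEN M.gr_closed] d[THEN N.gr_closed] f[THEN M.gr_closed]
        have "tri1 a b c d f g = rL (pmul (pscale (\<chi> i j) (sg (a \<otimes>[M] c) (b \<otimes>[N] d))) (sg f g))"
          unfolding tri1_def by (rule rL_pmul_cong(1)) (use cl rL_pmul_gr b c' in auto)
        also have "... = pscale (\<chi> i j) (rL (pscale (\<chi> (i + i') l) (sg (a \<otimes>[M] c \<otimes>[M] f) (b \<otimes>[N] d \<otimes>[N] g))))"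
          using rL_pmul_gr[of "a \<otimes>[M] c" "b \<otimes>[N] d" "i + i'" f l g] cl f N.gr_mult[OF b d] by (simp add: pmul_bilinear rL del: pscale_single)
        finally have 1: "tri1 a b c d f g = pscale (\<chi> i j * (\<chi> i l * \<chi> i' l)) (rL (sg (a \<otimes>[M] c \<otimes>[M] f) (b \<otimes>[N] d \<otimes>[N] g)))"
          by (simp add: rL(2) chi_add_l del: pscale_single)
        have "tri2 a b c d f g = rL (pmul (sg a b) (pscale (\<chi> i' l) (sg (c \<otimes>[M] f) (d \<otimes>[N] g))))"
          unfolding tri2_def by (rule rL_pmul_cong(2)) (use cl rL_pmul_gr d f in auto)
        also have "... = pscale (\<chi> i' l) (rL (pscale (\<chi> i (j + l)) (sg (a \<otimes>[M] (c \<otimes>[M] f)) (b \<otimes>[N] (d \<otimes>[N] g)))))"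
          using rL_pmul_gr[of a b i "c \<otimes>[M] f" "j + l" "d \<otimes>[N] g"] cl b M.gr_mult[OF c' f] by (simp add: pmul_bilinear rL del: pscale_single)
        finally have 2: "tri2 a b c d f g = pscale (\<chi> i' l * (\<chi> i j * \<chi> i l)) (rL (sg (a \<otimes>[M] (c \<otimes>[M] f)) (b \<otimes>[N] (d \<otimes>[N] g))))"
          by (simp add: rL(2) chi_add_r del: pscale_single)
        show ?case unfolding 1 2 using cl by (simp add: M.m_assoc N.m_assoc mult_ac)
      qed (use c b[THEN N.gr_closed] c'[THEN M.gr_closed] d[THEN N.gr_closed] in \<open>simp add: tri_add\<close>)
    qed (use c b[THEN N.gr_closed] c'[THEN M.gr_closed] in \<open>simp add: tri_add\<close>)
  qed (use c b[THEN N.gr_closed] in \<open>simp add: tri_add\<close>)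
qed (use c in \<open>simp add: tri_add\<close>)

lemma rL_one:
  assumes "c : car M" "d : car N"
  shows "rL (pmul (sg \<one>[M] \<one>[N]) (sg c d)) = rL (sg c d)" "rL (pmul (sg c d) (sg \<one>[M] \<one>[N])) = rL (sg c d)"
proof -
  show "rL (pmul (sg \<one>[M] \<one>[N]) (sg c d)) = rL (sg c d)" using assms(1)
  proof (induction rule: M.homog_induct)
    case (hom j c)
    thus ?case using rL_pmul_gr[OF M.one_closed N.gr_one hom assms(2)] M.gr_closed[OF hom] assms by simp
  next
    case (add c c')
    have "rL (pmul (sg \<one>[M] \<one>[N]) (sg (c \<oplus>[M] c') d)) = rL (pmul (sg \<one>[M] \<one>[N]) (sg c d + sg c' d))"
      using add assms by (intro rL_pmul_cong(2) rL_sg_add(2)) auto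
    thus ?case using add assms rL_sg_add(2)[of c c' d] by (simp add: pmul_bilinear rL)
  qed
  show "rL (pmul (sg c d) (sg \<one>[M] \<one>[N])) = rL (sg c d)" using assms(2)
  proof (induction rule: N.homog_induct)
    case (hom j d)
    thus ?case using rL_pmul_gr[OF assms(1) hom M.gr_one N.one_closed] N.gr_closed[OF hom] assms by simp
  next
    case (add d d')
    have "rL (pmul (sg c (d \<oplus>[N] d')) (sg \<one>[M] \<one>[N])) = rL (pmul (sg c d + sg c d') (sg \<one>[M] \<one>[N]))"
      using add assms by (intro rL_pmul_cong(1) rL_sg_add(1)) auto
    thus ?case using add assms rL_sg_add(1)[of c d d'] by (simp add: pmul_bilinear rL)
  qed
qed

lemma rL_pmul_assoc:
  assumes "keys p <= cMN" "keys q <= cMN" "keys r <= cMN"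
  shows "rL (pmul (pmul p q) r) = rL (pmul p (pmul q r))"
proof -
  have 1: "rL (pmul (pmul (sg a b) (sg c d)) r) - rL (pmul (sg a b) (pmul (sg c d) r)) = 0"
    if c: "a : car M" "b : car N" "c : car M" "d : car N" for a b c d
    by (rule pm_linear_zero_on[where S = cMN and p = r and g = "%r. rL (pmul (pmul (sg a b) (sg c d)) r) - rL (pmul (sg a b) (pmul (sg c d) r))"])
      (use tri_eq[OF c] assms(3) in \<open>auto simp: pmul_bilinear rL(1,2) tri1_def tri2_def pm.scale_right_diff_distrib\<close>)
  have 2: "rL (pmul (pmul (sg a b) q) r) - rL (pmul (sg a b) (pmul q r)) = 0"
    if c: "a : car M" "b : car N" for a b
    by (rule pm_linear_zero_on[where S = cMN and p = q and g = "%q. rL (pmul (pmul (sg a b) q) r) - rL (pmul (sg a b) (pmul q r))"])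
      (use 1[OF c] assms(2) in \<open>auto simp: pmul_bilinear rL(1,2) pm.scale_right_diff_distrib\<close>)
  have "rL (pmul (pmul p q) r) - rL (pmul p (pmul q r)) = 0"
    by (rule pm_linear_zero_on[where S = cMN and p = p and g = "%p. rL (pmul (pmul p q) r) - rL (pmul p (pmul q r))"])
      (use 2 assms(1) in \<open>auto simp: pmul_bilinear rL(1,2) pm.scale_right_diff_distrib\<close>)
  thus ?thesis by simp
qed

lemma LL_additive: "additive_subgroup LL PP"
proof (rule additive_subgroup.intro, rule P.add.subgroupI)
  show "LL <= car PP" using LL_keys by auto
  show "LL ~= {}" unfolding LL_eq using pm.span_zero by blast
  show "a \<oplus>[PP] b : LL" if "a : LL" "b : LL" for a b using that unfolding LL_eq by (simp add: pm.span_add)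
  show "\<ominus>\<^bsub>PP\<^esub> a : LL" if a: "a : LL" for a
  proof -
    have "\<ominus>\<^bsub>PP\<^esub> a = - a" using a LL_keys by (intro P.minus_equality) (auto simp: keys_uminus')
    thus ?thesis using a unfolding LL_eq by (simp add: pm.span_neg)
  qed
qed

lemma P_minus: "p : car PP ==> q : car PP ==> p \<ominus>[PP] q = p - q"
proof -
  assume "p : car PP" "q : car PP"
  hence "\<ominus>\<^bsub>PP\<^esub> q = - q" by (intro P.minus_equality) (auto simp: keys_uminus')
  thus ?thesis by (simp add: a_minus_def)
qed

sublocale LS: abelian_subgroup LL PP
  by (rule abelian_subgroupI3[OF LL_additive P.abelian_group_axioms])

lemma coset_eq_rL:
  assumes "keys p <= cMN" "keys q <= cMN"
  shows "LL +>[PP] p = LL +>[PP] q \<longleftrightarrow> rL p = rL q"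
  using assms P_minus[of p q] unfolding rL_eq
  by (metis LS.a_rcos_module LS.a_rcos_self LS.a_repr_independence' P.minus_eq P_simps(1) mem_Collect_eq)

sublocale PQ: prequot PP LL
proof (unfold_locales)
  show "LL +>[PP] \<one>[PP] \<otimes>[PP] x = LL +>[PP] x" if "x : car PP" for x
  proof -
    have "rL (pmul (sg \<one>[M] \<one>[N]) x) - rL x = 0"
      by (rule pm_linear_zero_on[where S = cMN and p = x and g = "%x. rL (pmul (sg \<one>[M] \<one>[N]) x) - rL x"])
        (use rL_one that in \<open>auto simp: pmul_bilinear rL(1,2) pm.scale_right_diff_distrib\<close>)
    thus ?thesis using that pmul_keys[of "sg \<one>[M] \<one>[N]" x] by (simp add: coset_eq_rL)
  qed
  show "LL +>[PP] x \<otimes>[PP] \<one>[PP] = LL +>[PP] x" if "x : car PP" for x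
  proof -
    have "rL (pmul x (sg \<one>[M] \<one>[N])) - rL x = 0"
      by (rule pm_linear_zero_on[where S = cMN and p = x and g = "%x. rL (pmul x (sg \<one>[M] \<one>[N])) - rL x"])
        (use rL_one that in \<open>auto simp: pmul_bilinear rL(1,2) pm.scale_right_diff_distrib\<close>)
    thus ?thesis using that pmul_keys[of x "sg \<one>[M] \<one>[N]"] by (simp add: coset_eq_rL)
  qed
qed (simp_all add: keys_scale pm.scale_left_distrib pm.scale_right_distrib pmul_keys pmul_bilinear
    LL_pmul_l LL_pmul_r coset_eq_rL rL_pmul_assoc, simp add: LL_eq pm.span_scale)

sublocale A: kalg AA
  unfolding AA_eq by (rule PQ.Q_kalg)

abbreviation tens :: "'a => 'b => ('a * 'b \<Rightarrow>\<^sub>0 'k) set" where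
  "tens == tensor_elem \<chi> M grM N grN"

lemma tens_eq: "tens a b = LL +>[PP] sg a b"
  by (simp add: tensor_elem_def Let_def)

lemma tens_closed [simp, intro]: "a : car M ==> b : car N ==> tens a b : car AA"
  unfolding AA_eq tens_eq by (rule PQ.Q_closed) simp

lemma AA_one: "\<one>[AA] = tens \<one>[M] \<one>[N]"
  unfolding AA_eq tens_eq by (simp add: PQ.Q_one)

lemma tens_add_l: "a : car M ==> a' : car M ==> b : car N ==> tens (a \<oplus>[M] a') b = tens a b \<oplus>[AA] tens a' b"
  unfolding AA_eq tens_eq by (subst PQ.Q_add) (simp_all add: coset_eq_rL keys_plus rL_sg_add)

lemma tens_add_r: "a : car M ==> b : car N ==> b' : car N ==> tens a (b \<oplus>[N] b') = tens a b \<oplus>[AA] tens a b'"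
  unfolding AA_eq tens_eq by (subst PQ.Q_add) (simp_all add: coset_eq_rL keys_plus rL_sg_add)

lemma tens_smult_l: "a : car M ==> b : car N ==> tens (c \<odot>[M] a) b = c \<odot>[AA] tens a b"
  unfolding AA_eq tens_eq using t_bilinear(3)[of a b c]
  by (subst PQ.Q_smult) (simp_all add: coset_eq_rL keys_scale rL(2) t_def del: pscale_single)

lemma tens_smult_r: "a : car M ==> b : car N ==> tens a (c \<odot>[N] b) = c \<odot>[AA] tens a b"
  unfolding AA_eq tens_eq using t_bilinear(4)[of a b c]
  by (subst PQ.Q_smult) (simp_all add: coset_eq_rL keys_scale rL(2) t_def del: pscale_single)

lemma tens_mult:
  assumes "a : car M" "b : grN i" "c : grM j" "d : car N"
  shows "tens a b \<otimes>[AA] tens c d = \<chi> i j \<odot>[AA] tens (a \<otimes>[M] c) (b \<otimes>[N] d)"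
proof -
  have cl: "b : car N" "c : car M" using assms N.gr_closed M.gr_closed by auto
  have "tens a b \<otimes>[AA] tens c d = LL +>[PP] pmul (sg a b) (sg c d)"
    unfolding AA_eq tens_eq using assms cl by (subst PQ.Q_mult) simp_all
  also have "... = LL +>[PP] pscale (\<chi> i j) (sg (a \<otimes>[M] c) (b \<otimes>[N] d))"
    using assms cl rL_pmul_gr[OF assms] pmul_keys[of "sg a b" "sg c d"]
    by (subst coset_eq_rL) (auto simp del: pscale_single intro!: keys_scale)
  also have "... = \<chi> i j \<odot>[AA] tens (a \<otimes>[M] c) (b \<otimes>[N] d)"
    unfolding AA_eq tens_eq using assms cl by (subst PQ.Q_smult) simp_all
  finally show ?thesis .
qed

lemma AA_induct [consumes 1, case_names tens add smult]:
  assumes x: "x : car AA" and tens: "!!a b. a : car M ==> b : car N ==> Q (tens a b)"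
    and add: "!!x y. x : car AA ==> y : car AA ==> Q x ==> Q y ==> Q (x \<oplus>[AA] y)"
    and smult: "!!c x. x : car AA ==> Q x ==> Q (c \<odot>[AA] x)"
  shows "Q x"
proof -
  obtain p where p: "keys p <= cMN" "x = LL +>[PP] p"
    using x unfolding AA_eq by (elim PQ.Q_elim) auto
  have 0: "Q (LL +>[PP] 0)"
    using smult[OF _ tens[OF M.one_closed N.one_closed], of 0] PQ.Q_zero unfolding AA_eq[symmetric] by simp
  have "Q (LL +>[PP] (SUM k:F. psing k (Poly_Mapping.lookup p k)))" if "F <= cMN" for F
    using that
  proof (induction F rule: fin_induct)
    case (insert k F)
    obtain a b where k: "k = (a, b)" "a : car M" "b : car N" using insert.prems by (cases k) auto
    let ?S = "SUM k:F. psing k (Poly_Mapping.lookup p k)"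
    have kS: "keys ?S <= cMN" using insert.prems by (intro keys_sum) auto
    have "LL +>[PP] (psing k (Poly_Mapping.lookup p k) + ?S) = Poly_Mapping.lookup p k \<odot>[AA] tens a b \<oplus>[AA] (LL +>[PP] ?S)"
      unfolding AA_eq tens_eq using k kS by (simp add: PQ.Q_smult PQ.Q_add)
    moreover have "LL +>[PP] ?S : car AA" unfolding AA_eq using kS by (intro PQ.Q_closed) simp
    ultimately show ?case using insert k by (simp add: add smult tens)
  qed (simp_all add: 0)
  from this[OF p(1)] show ?thesis unfolding p(2) poly_mapping_eq_sum_single[of p, symmetric] .
qed

lemma AA_lift:
  fixes h :: "'a => 'b => 'z::ab_group_add"
  assumes sz: "vector_space sz"
    and h1: "!!a a' b. a : car M ==> a' : car M ==> b : car N ==> h (a \<oplus>[M] a') b = h a b + h a' b"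
    and h2: "!!a b b'. a : car M ==> b : car N ==> b' : car N ==> h a (b \<oplus>[N] b') = h a b + h a b'"
    and h3: "!!a b c. a : car M ==> b : car N ==> h (c \<odot>[M] a) b = sz c (h a b)"
    and h4: "!!a b c. a : car M ==> b : car N ==> h a (c \<odot>[N] b) = sz c (h a b)"
  shows "EX vp. (ALL x:car AA. ALL y:car AA. vp (x \<oplus>[AA] y) = vp x + vp y) &
    (ALL c. ALL x:car AA. vp (c \<odot>[AA] x) = sz c (vp x)) & (ALL a:car M. ALL b:car N. vp (tens a b) = h a b)"
proof -
  interpret z: vector_space sz by fact
  define g where "g = lext sz (%x. h (fst x) (snd x))"
  have g: "g (p + q) = g p + g q" "g (pscale c p) = sz c (g p)" "g (sg a b) = h a b" for p q c a b
    by (simp_all add: g_def z.lext_add z.lext_scale)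
  have gL: "g r = 0" if "r : LL" for r
  proof (rule LL_vanish[OF that sz])
    fix r assume "r : BR"
    thus "g r = 0" by (rule BR_cases[where sz = sz and h = h]) (simp_all add: g h1 h2 h3 h4)
  qed (simp_all add: g)
  obtain vp where vp: "!!p. p : car PP ==> vp (LL +>[PP] p) = g p"
    by (rule PQ.Q_lift[of g]) (simp add: g(1), erule gL, rule that, assumption)
  have "vp (x \<oplus>[AA] y) = vp x + vp y" if "x : car AA" "y : car AA" for x y
    using that unfolding AA_eq by (elim PQ.Q_elim) (simp add: PQ.Q_add vp g keys_plus)
  moreover have "vp (c \<odot>[AA] x) = sz c (vp x)" if "x : car AA" for c x
    using that unfolding AA_eq by (elim PQ.Q_elim) (simp add: PQ.Q_smult vp g keys_scale)
  moreover have "vp (tens a b) = h a b" if "a : car M" "b : car N" for a b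
    using that unfolding tens_eq by (simp add: vp g)
  ultimately show ?thesis by blast
qed

section \<open>The tensor product as a graded algebra of operators\<close>

definition PhiA :: "('a * 'b \<Rightarrow>\<^sub>0 'k) set => (('a * 'b \<Rightarrow>\<^sub>0 'k) set, 'k) lend" where
  "PhiA = (SOME \<Phi>. embedding AA lscale \<Phi>)"

sublocale EA: embedding AA lscale PhiA
  unfolding PhiA_def by (rule A.embedding_exists, rule someI[where P = "embedding AA lscale"])

definition hcom :: "'i => 'a => 'b => (('a * 'b \<Rightarrow>\<^sub>0 'k) set, 'k) lend" where
  "hcom i a b = (SUM j:M.hs a. SUM l:N.hs b. if j + l = i then PhiA (tens (M.hc a j) (N.hc b l)) else 0)"

lemma tens_zero: "a : car M ==> tens a \<zero>[N] = \<zero>[AA]" "b : car N ==> tens \<zero>[M] b = \<zero>[AA]"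
  using tens_smult_r[of a "\<zero>[N]" 0] tens_smult_l[of "\<zero>[M]" b 0] by simp_all

lemma hcom_bilinear:
  assumes ab: "a : car M" "b : car N"
  shows "a' : car M ==> hcom i (a \<oplus>[M] a') b = hcom i a b + hcom i a' b"
    "b' : car N ==> hcom i a (b \<oplus>[N] b') = hcom i a b + hcom i a b'"
    "hcom i (c \<odot>[M] a) b = lscale c (hcom i a b)" "hcom i a (c \<odot>[N] b) = lscale c (hcom i a b)"
proof -
  let ?F = "%j a. SUM l:N.hs b. if j + l = i then PhiA (tens a (N.hc b l)) else 0"
  let ?G = "%j l b. if j + l = i then PhiA (tens (M.hc a j) b) else 0"
  show "hcom i (a \<oplus>[M] a') b = hcom i a b + hcom i a' b" if "a' : car M"
    unfolding hcom_def by (rule M.hsum_add[OF ab(1) that, of ?F])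
      (use ab in \<open>auto simp: tens_add_l EA.emb_add simp flip: sum.distrib intro!: sum.cong\<close>)
  show "hcom i (c \<odot>[M] a) b = lscale c (hcom i a b)"
    unfolding hcom_def by (rule M.hsum_smult[OF ab(1) EA.vector_space_axioms, of ?F])
      (use ab in \<open>auto simp: tens_zero EA.emb_zero tens_smult_l EA.emb_smult EA.scale_sum_right intro!: sum.cong sum.neutral\<close>)
  have "(SUM l:N.hs (b \<oplus>[N] b'). ?G j l (N.hc (b \<oplus>[N] b') l)) = (SUM l:N.hs b. ?G j l (N.hc b l)) + (SUM l:N.hs b'. ?G j l (N.hc b' l))"
    if "b' : car N" for j
    by (rule N.hsum_add[OF ab(2) that, of "?G j"]) (use ab in \<open>auto simp: tens_add_r EA.emb_add\<close>)
  thus "b' : car N ==> hcom i a (b \<oplus>[N] b') = hcom i a b + hcom i a b'"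
    unfolding hcom_def by (simp add: sum.distrib)
  have "(SUM l:N.hs (c \<odot>[N] b). ?G j l (N.hc (c \<odot>[N] b) l)) = lscale c (SUM l:N.hs b. ?G j l (N.hc b l))" for j
    by (rule N.hsum_smult[OF ab(2) EA.vector_space_axioms, of "?G j"])
      (use ab in \<open>auto simp: tens_zero EA.emb_zero tens_smult_r EA.emb_smult\<close>)
  thus "hcom i a (c \<odot>[N] b) = lscale c (hcom i a b)"
    unfolding hcom_def by (simp add: EA.scale_sum_right)
qed

lemma hcom_gr:
  assumes "a : grM j" "b : grN l"
  shows "hcom i a b = (if j + l = i then PhiA (tens a b) else 0)"
proof -
  have cl: "a : car M" "b : car N" using assms M.gr_closed N.gr_closed by auto
  have "hcom i a b = (SUM l:N.hs b. if j + l = i then PhiA (tens a (N.hc b l)) else 0)"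
    unfolding hcom_def
    by (rule M.hsum_gr[OF assms(1), of "%j a. SUM l:N.hs b. if j + l = i then PhiA (tens a (N.hc b l)) else 0"])
      (use cl in \<open>auto simp: tens_zero EA.emb_zero intro!: sum.neutral\<close>)
  also have "... = (if j + l = i then PhiA (tens a b) else 0)"
    by (rule N.hsum_gr[OF assms(2), of "%l b. if j + l = i then PhiA (tens a b) else 0"])
      (use cl in \<open>auto simp: tens_zero EA.emb_zero\<close>)
  finally show ?thesis .
qed

definition prA :: "'i => ('a * 'b \<Rightarrow>\<^sub>0 'k) set => (('a * 'b \<Rightarrow>\<^sub>0 'k) set, 'k) lend" where
  "prA i = (SOME vp. (ALL x:car AA. ALL y:car AA. vp (x \<oplus>[AA] y) = vp x + vp y) &
    (ALL c. ALL x:car AA. vp (c \<odot>[AA] x) = lscale c (vp x)) & (ALL a:car M. ALL b:car N. vp (tens a b) = hcom i a b))"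

lemma prA: "x : car AA ==> y : car AA ==> prA i (x \<oplus>[AA] y) = prA i x + prA i y"
  "x : car AA ==> prA i (c \<odot>[AA] x) = lscale c (prA i x)"
  "a : car M ==> b : car N ==> prA i (tens a b) = hcom i a b"
  using someI_ex[OF AA_lift[OF EA.vector_space_axioms, of "hcom i"]] unfolding prA_def[symmetric]
  by (simp_all add: hcom_bilinear)

abbreviation "grA == tensor_grading \<chi> M grM N grN"

definition htens :: "'i => ('a * 'b \<Rightarrow>\<^sub>0 'k) set set" where
  "htens i = {tens a b | a b j l. a : grM j & b : grN l & j + l = i}"

lemma grA_eq: "grA i = lin_span AA (htens i)"
  by (simp add: tensor_grading_def htens_def)

lemma htens_closed: "htens i <= car AA"
  using M.gr_closed N.gr_closed by (auto simp: htens_def)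

lemma tens_grA: "a : grM j ==> b : grN l ==> tens a b : grA (j + l)"
proof -
  assume ab: "a : grM j" "b : grN l"
  hence "tens a b : htens (j + l)" unfolding htens_def by blast
  thus ?thesis unfolding grA_eq using ab M.gr_closed N.gr_closed
    by (subst EA.lin_span_iff[OF htens_closed]) (blast intro: EA.span_base)
qed

sublocale AG: graded_alg AA lscale PhiA grA prA
proof unfold_locales
  show "grA i <= car AA" for i
    using EA.lin_span_iff[OF htens_closed] by (auto simp: grA_eq)
  show "EA.subspace (PhiA ` grA i)" for i
    unfolding grA_eq by (simp add: EA.subspace_image_lin_span[OF htens_closed])
  show "PhiA x : EA.span (\<Union>i. PhiA ` grA i)" if "x : car AA" for x
    using that
  proof (induction rule: AA_induct)
    case (tens a b)
    from tens(1) show ?case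
    proof (induction rule: M.homog_induct)
      case (hom j a)
      from tens(2) show ?case
      proof (induction rule: N.homog_induct)
        case (hom l b)
        thus ?case using tens_grA[OF \<open>a : grM j\<close> hom] by (intro EA.span_base) blast
      qed (use M.gr_closed[OF hom] in \<open>auto simp: tens_add_r EA.emb_add intro: EA.span_add\<close>)
    qed (use tens(2) in \<open>auto simp: tens_add_l EA.emb_add intro: EA.span_add\<close>)
  qed (auto simp: EA.emb_add EA.emb_smult intro: EA.span_add EA.span_scale)
  show "prA j x = (if j = i then PhiA x else 0)" if x: "x : grA i" for x i j
  proof -
    obtain c F where F: "finite F" "F <= htens i" "x = (\<Oplus>\<^bsub>AA\<^esub>y\<in>F. c y \<odot>[AA] y)" using x by (auto simp: grA_eq lin_span_def)
    have z: "prA j \<zero>[AA] = 0" using prA(1)[of "\<zero>[AA]" "\<zero>[AA]" j] by simp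
    from F(1,2) have "prA j (\<Oplus>\<^bsub>AA\<^esub>y\<in>F. c y \<odot>[AA] y) = (if j = i then PhiA (\<Oplus>\<^bsub>AA\<^esub>y\<in>F. c y \<odot>[AA] y) else 0)"
    proof (induction F)
      case (insert y F)
      have y: "y : car AA" "prA j y = (if j = i then PhiA y else 0)"
        using insert.prems htens_closed M.gr_closed N.gr_closed by (auto simp: htens_def prA hcom_gr)
      have cl: "c y \<odot>[AA] y : car AA" if "y : F" for y using that insert.prems htens_closed by auto
      have "(\<Oplus>\<^bsub>AA\<^esub>y\<in>insert y F. c y \<odot>[AA] y) = c y \<odot>[AA] y \<oplus>[AA] (\<Oplus>\<^bsub>AA\<^esub>y\<in>F. c y \<odot>[AA] y)"
        using insert y cl by (intro A.finsum_insert) auto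
      moreover have "(\<Oplus>\<^bsub>AA\<^esub>y\<in>F. c y \<odot>[AA] y) : car AA" using cl by (intro A.finsum_closed) auto
      ultimately show ?case using y insert by (simp add: prA EA.emb_add EA.emb_smult)
    qed (simp add: z EA.emb_zero)
    thus ?thesis using F(3) by simp
  qed
  show "x \<otimes>[AA] y : grA (i + j)" if xy: "x : grA i" "y : grA j" for x y i j
  proof -
    have "PhiA x : EA.span (PhiA ` htens i)" "PhiA y : EA.span (PhiA ` htens j)" "x : car AA" "y : car AA"
      using xy EA.lin_span_iff[OF htens_closed] by (auto simp: grA_eq)
    moreover have "a * b : EA.span (PhiA ` htens (i + j))" if "a : EA.span (PhiA ` htens i)" "b : EA.span (PhiA ` htens j)" for a b
      using that(1)
    proof (induction rule: EA.span_induct_alt)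
      case (step c a a')
      then obtain x y k l where a: "a = PhiA (tens x y)" "x : grM k" "y : grN l" "k + l = i" by (auto simp: htens_def)
      from that(2) have "a * b : EA.span (PhiA ` htens (i + j))"
      proof (induction rule: EA.span_induct_alt)
        case (step c b b')
        then obtain x' y' k' l' where b: "b = PhiA (tens x' y')" "x' : grM k'" "y' : grN l'" "k' + l' = j" by (auto simp: htens_def)
        have cl: "x : car M" "y : car N" "x' : car M" "y' : car N" using a b M.gr_closed N.gr_closed by auto
        have "tens (x \<otimes>[M] x') (y \<otimes>[N] y') : htens (i + j)"
        proof -
          have "(k + k') + (l + l') = i + j" by (simp add: add_ac flip: a(4) b(4))
          hence "tens (x \<otimes>[M] x') (y \<otimes>[N] y') = tens (x \<otimes>[M] x') (y \<otimes>[N] y') &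
              x \<otimes>[M] x' : grM (k + k') & y \<otimes>[N] y' : grN (l + l') & (k + k') + (l + l') = i + j"
            using M.gr_mult[OF a(2) b(2)] N.gr_mult[OF a(3) b(3)] by blast
          thus ?thesis unfolding htens_def by (intro CollectI exI)
        qed
        moreover have "a * b = lscale (\<chi> l k') (PhiA (tens (x \<otimes>[M] x') (y \<otimes>[N] y')))"
          unfolding a(1) b(1) using cl tens_mult[OF cl(1) a(3) b(2) cl(4)] by (simp add: EA.emb_smult flip: EA.emb_mult)
        ultimately have "a * b : EA.span (PhiA ` htens (i + j))" by (metis EA.span_base EA.span_scale imageI)
        thus ?case using step by (auto simp: distrib_left EA.scale_mult_right intro: EA.span_add EA.span_scale)
      qed (simp add: EA.span_zero)
      thus ?case using step by (auto simp: distrib_right EA.scale_mult_left intro: EA.span_add EA.span_scale)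
    qed (simp add: EA.span_zero)
    ultimately show ?thesis unfolding grA_eq EA.lin_span_iff[OF htens_closed] by (auto simp: EA.emb_mult)
  qed
  show "\<one>[AA] : grA 0"
    using tens_grA[OF M.gr_one N.gr_one] by (simp add: AA_one)
qed (simp_all add: prA)

end

section \<open>Dual bases and Clifford elements\<close>

lemma vector_space_field: "vector_space ((*) :: 'k::field => 'k => 'k)"
  by unfold_locales (auto simp: algebra_simps)

locale comm_factor =
  fixes eps :: "'c::ab_group_add => 'c => 'k::field"
  assumes comm_factor: "commutation_factor eps"
begin

lemma eps_inv [simp]: "eps a b * eps b a = 1"
  and eps_add_l: "eps (a + b) c = eps a c * eps b c"
  and eps_add_r: "eps a (b + c) = eps a b * eps a c"
  using comm_factor by (auto simp: commutation_factor_def)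

lemma eps_nz [simp]: "eps a b ~= 0"
  using eps_inv[of a b] by (metis mult_zero_left zero_neq_one)

lemma eps_0_l [simp]: "eps 0 a = 1"
  using eps_add_l[of 0 0 a] by simp

lemma eps_0_r [simp]: "eps a 0 = 1"
  using eps_add_r[of a 0 0] by simp

lemma eps_minus_l: "eps (- a) b = eps b a"
proof -
  have "eps (- a) b * eps a b = 1" using eps_add_l[of "- a" a b] by simp
  moreover have "eps b a * eps a b = 1" by simp
  ultimately show ?thesis by (metis eps_nz mult_cancel_right)
qed

lemma eps_minus_r: "eps a (- b) = eps b a"
  using eps_minus_l[of b a] eps_inv[of a "- b"] eps_inv[of a b] by (metis eps_nz mult_cancel_right mult.commute)

lemmas eps_rules = eps_add_l eps_add_r eps_minus_l eps_minus_r

lemma eps_diff: "eps (a - b) c = eps a c * eps c b" "eps a (b - c) = eps a b * eps c a"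
  using eps_add_l[of a "- b" c] eps_add_r[of a b "- c"] by (simp_all add: eps_minus_l eps_minus_r)

lemmas eps_all = eps_rules eps_diff

lemma eps_inv' [simp]: "eps a b * (eps b a * x) = x"
  by (simp flip: mult.assoc)

end

locale quad_space = based_space s B co + comm_factor eps
  for s :: "'k::field_char_0 => 'l::ab_group_add => 'l" and B co and eps :: "'c::ab_group_add => 'c => 'k" +
  fixes gr :: "'c => 'l set" and dg :: "'l => 'c" and form :: "'l => 'l => 'k" and du :: "'l => 'l"
  assumes gr_sub: "subspace (gr a)"
    and basis_gr: "b : B ==> b : gr (dg b)"
    and gr_co: "v : gr a ==> b : B ==> co v b ~= 0 ==> dg b = a"
    and form_bil: "bilinear_map s s (*) form"
    and form_deg: "v : gr a ==> w : gr c ==> a + c ~= 0 ==> form v w = 0"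
    and form_sym: "v : gr a ==> w : gr c ==> form v w = eps a c * form w v"
    and du_gr: "b : B ==> du b : gr (- dg b)"
    and du_form: "b : B ==> b' : B ==> form b (du b') = (if b = b' then 1 else 0)"
    and nondeg: "(!!b. b : B ==> form b v = 0) ==> v = 0"
begin

lemma form_add_l: "form (x + x') y = form x y + form x' y"
  and form_add_r: "form x (y + y') = form x y + form x y'"
  and form_scale_l: "form (s c x) y = c * form x y"
  and form_scale_r: "form x (s c y) = c * form x y"
  using form_bil by (auto simp: bilinear_map_def lin_iff)

lemma form_zero [simp]: "form 0 y = 0" "form x 0 = 0"
  using form_scale_l[of 0 0 y] form_scale_r[of x 0 0] by simp_all

lemma form_sum_l: "form (SUM i:A. f i) y = (SUM i:A. form (f i) y)"
  by (induction A rule: fin_induct) (auto simp: form_add_l)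

lemma form_sum_r: "form x (SUM i:A. f i) = (SUM i:A. form x (f i))"
  by (induction A rule: fin_induct) (auto simp: form_add_r)

lemma form_diff_r: "form x (y - y') = form x y - form x y'"
  using form_add_r[of x "y - y'" y'] by simp

lemma form_nz_deg: "v : gr a ==> w : gr c ==> form v w ~= 0 ==> a = - c"
  using form_deg[of v a w c] by (auto simp: eq_neg_iff_add_eq_0)

lemma co_form: "b : B ==> co v b = form v (du b)"
proof -
  assume b: "b : B"
  have "form v (du b) = (SUM c:B. co v c * form c (du b))"
    using arg_cong[OF co_expand[of v], of "%v. form v (du b)"] by (simp add: form_sum_l form_scale_l)
  also have "... = (SUM c:B. if c = b then co v c else 0)" using b by (intro sum.cong) (auto simp: du_form)
  finally show ?thesis using b finite_B by simp
qed

lemma expand_basis: "v = (SUM b:B. s (form v (du b)) b)"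
  using co_expand[of v] by (simp add: co_form cong: sum.cong)

lemma expand_dual: "v = (SUM b:B. s (form b v) (du b))"
proof -
  have "form b (v - (SUM b:B. s (form b v) (du b))) = 0" if b: "b : B" for b
  proof -
    have "form b (SUM b:B. s (form b v) (du b)) = (SUM c:B. if c = b then form c v else 0)"
      unfolding form_sum_r form_scale_r using b by (intro sum.cong) (auto simp: du_form)
    thus ?thesis using b finite_B by (simp add: form_diff_r)
  qed
  hence "v - (SUM b:B. s (form b v) (du b)) = 0" by (rule nondeg)
  thus ?thesis by simp
qed

lemma eps_self: "eps (- c) c = eps c c"
  by (simp add: eps_minus_l)

lemma form_dual_left: "b : B ==> w : gr c ==> form (du b) w = eps c c * form w (du b)"
proof -
  assume b: "b : B" and w: "w : gr c"
  show ?thesis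
  proof (cases "form w (du b) = 0")
    case True
    thus ?thesis using form_sym[OF du_gr[OF b] w] by simp
  next
    case False
    hence "dg b = c" using form_nz_deg[OF w du_gr[OF b]] by simp
    thus ?thesis using form_sym[OF du_gr[OF b] w] by (simp add: eps_self)
  qed
qed

end

lemma (in vector_space) linear_apply_sum:
  fixes F :: "'b => 'z::ab_group_add"
  assumes "lin scale sz F"
  shows "F (SUM i:A. scale (c i) (x i)) = (SUM i:A. sz (c i) (F (x i)))"
proof -
  have a: "F (x + y) = F x + F y" and m: "F (scale c x) = sz c (F x)" for x y c
    using assms by (simp_all add: lin_iff)
  interpret z: vector_space sz using assms by (simp add: Vector_Spaces.linear_def module_iff_vector_space module_hom_def module_pair_def Vector_Spaces.linear_iff_module_hom)
  show ?thesis by (induction A rule: fin_induct) (use a m m[of 0 0] in auto)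
qed

context quad_space
begin

lemma bil_expand:
  assumes "bilinear_map s s sz M"
  shows "(SUM i:A. sz (c i) (M (x i) y)) = M (SUM i:A. s (c i) (x i)) y"
    "(SUM i:A. sz (c i) (M y (x i))) = M y (SUM i:A. s (c i) (x i))"
  using assms linear_apply_sum[of sz "%x. M x y" c x A] linear_apply_sum[of sz "M y" c x A] by (simp_all add: bilinear_map_def)

lemma bil_basis: "bilinear_map s s sz M ==> M v y = (SUM c:B. sz (form v (du c)) (M c y))"
  using bil_expand(1)[of sz M "%c. form v (du c)" "%c. c" y B] by (simp only: expand_basis[of v, symmetric])

lemma bil_dual: "bilinear_map s s sz M ==> M v y = (SUM c:B. sz (form c v) (M (du c) y))"
  using bil_expand(1)[of sz M "%c. form c v" "%c. du c" y B] by (simp only: expand_dual[of v, symmetric])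

lemma bil_basis_r: "bilinear_map s s sz M ==> M y v = (SUM c:B. sz (form v (du c)) (M y c))"
  using bil_expand(2)[of sz M "%c. form v (du c)" y "%c. c" B] by (simp only: expand_basis[of v, symmetric])

lemma bil_vs: "bilinear_map s s sz M ==> vector_space sz"
  by (simp add: bilinear_map_def Vector_Spaces.linear_def module_iff_vector_space module_hom_def module_pair_def Vector_Spaces.linear_iff_module_hom)

text \<open>The tensor \<open>\<Sum>b. du b \<otimes> b\<close> is \<open>\<epsilon>\<close>-symmetric and invariant under \<open>\<epsilon>\<close>-skew operators.\<close>

lemma casimir_flip:
  assumes M: "bilinear_map s s sz M"
  shows "(SUM b:B. M (du b) b) = (SUM b:B. sz (eps (dg b) (dg b)) (M b (du b)))"
proof -
  interpret z: vector_space sz by (rule bil_vs[OF M])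
  have f: "form (du b) (du c) = eps (dg c) (dg c) * form (du c) (du b)" if "b : B" "c : B" for b c
    using form_dual_left[OF that(1) du_gr[OF that(2)]] by (simp add: eps_minus_l eps_minus_r)
  have "(SUM b:B. M (du b) b) = (SUM b:B. SUM c:B. sz (form (du b) (du c)) (M c b))"
    by (intro sum.cong refl bil_basis[OF M])
  also have "... = (SUM b:B. SUM c:B. sz (eps (dg c) (dg c)) (sz (form (du c) (du b)) (M c b)))"
    by (intro sum.cong refl) (subst f, simp_all)
  also have "... = (SUM c:B. SUM b:B. sz (eps (dg c) (dg c)) (sz (form (du c) (du b)) (M c b)))" by (rule sum.swap)
  also have "... = (SUM c:B. sz (eps (dg c) (dg c)) (M c (du c)))"
    by (simp only: bil_basis_r[OF M, of _ "du _"] z.scale_sum_right)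
  finally show ?thesis .
qed

abbreviation so :: "'c => ('l => 'l) => bool" where
  "so a f == f : so_eps eps s gr form a"

lemma so_linear: "so a f ==> lin s s f"
  and so_gr: "so a f ==> v : gr b ==> f v : gr (a + b)"
  and so_skew: "so a f ==> v : gr b ==> form (f v) w = - eps a b * form v (f w)"
  by (auto simp: so_eps_def eq_neg_iff_add_eq_0)

lemma so_skew': "so a f ==> v : gr b ==> form v (f w) = - eps b a * form (f v) w"
  using so_skew[of f a v b w] by simp

lemma casimir_invariant:
  assumes M: "bilinear_map s s sz M" and f: "so a f"
  shows "(SUM b:B. M (f (du b)) b) = - (SUM b:B. sz (eps (dg b) a) (M (du b) (f b)))"
proof -
  interpret z: vector_space sz by (rule bil_vs[OF M])
  have "(SUM b:B. M (f (du b)) b) = (SUM b:B. SUM c:B. sz (form c (f (du b))) (M (du c) b))"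
    by (intro sum.cong refl bil_dual[OF M])
  also have "... = (SUM b:B. SUM c:B. - sz (eps (dg c) a) (sz (form (f c) (du b)) (M (du c) b)))"
    using so_skew'[OF f basis_gr] by (intro sum.cong refl) simp
  also have "... = (SUM c:B. SUM b:B. - sz (eps (dg c) a) (sz (form (f c) (du b)) (M (du c) b)))" by (rule sum.swap)
  also have "... = - (SUM c:B. sz (eps (dg c) a) (M (du c) (f c)))"
    by (simp only: bil_basis_r[OF M, of _ "f _"] z.scale_sum_right sum_negf)
  finally show ?thesis .
qed

text \<open>The sum is the \<epsilon>-trace of \<open>f\<close>. For \<open>a\<close> nonzero the
  summands vanish by degree. For \<open>a = 0\<close> symmetry of the tensor of dual bases and
  skewness of \<open>f\<close> show that it equals its own negative.\<close>

lemma trace_so: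
  assumes f: "so a f"
  shows "(SUM b:B. eps (dg b) (dg b) * form b (f (du b))) = 0"
proof (cases "a = 0")
  case False
  have "form b (f (du b)) = 0" if "b : B" for b
    using form_nz_deg[OF basis_gr[OF that] so_gr[OF f du_gr[OF that]]] False by auto
  thus ?thesis by simp
next
  case True
  have M: "bilinear_map s s (*) (%x y. form (f x) y)"
    using so_linear[OF f] vector_space_axioms vector_space_field
    by (auto simp: bilinear_map_def lin_iff form_add_l form_scale_l form_add_r form_scale_r)
  have 1: "eps (dg b) (dg b) * form b (f (du b)) = form (f (du b)) b" if "b : B" for b
    using form_sym[OF basis_gr[OF that] so_gr[OF f du_gr[OF that]]] True by (simp add: eps_minus_r)
  have "(SUM b:B. form (f (du b)) b) = (SUM b:B. eps (dg b) (dg b) * form (f b) (du b))"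
    by (rule casimir_flip[OF M])
  also have "... = (SUM b:B. - (eps (dg b) (dg b) * form b (f (du b))))"
    using so_skew[OF f basis_gr] True by (intro sum.cong refl) simp
  also have "... = - (SUM b:B. form (f (du b)) b)" using 1 by (simp add: sum_negf)
  finally have "(SUM b:B. form (f (du b)) b) = 0" by (simp add: eq_neg_iff_add_eq_0 flip: mult_2)
  thus ?thesis using 1 by simp
qed

end

section \<open>Clifford relations in a ring and the lift of orthogonal operators\<close>

locale clifford_rep = quad_space s B co eps gr dg form du + r: typed_algebra sr
  for s :: "'k::field_char_0 => 'l::ab_group_add => 'l" and B co and eps :: "'c::ab_group_add => 'c => 'k" and gr dg form du
    and sr :: "'k => 'r::ring => 'r" +
  fixes th :: "'l => 'r" and ee :: 'r
  assumes th_linear: "lin s sr th"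
    and ee_th [simp]: "ee * th v = th v" "th v * ee = th v" and ee_ee [simp]: "ee * ee = ee"
    and th_rel: "v : gr a ==> w : gr b ==> th v * th w = sr (2 * form v w) ee - sr (eps a b) (th w * th v)"
begin

lemma th_add: "th (v + w) = th v + th w" and th_scale: "th (s c v) = sr c (th v)"
  using th_linear by (simp_all add: lin_iff)

lemma th_zero [simp]: "th 0 = 0" using th_scale[of 0 0] by simp

lemma th_diff: "th (v - w) = th v - th w" using th_add[of "v - w" w] by simp

lemma th_minus: "th (- v) = - th v" using th_diff[of 0 v] by simp

lemma th_sum: "th (SUM i:A. f i) = (SUM i:A. th (f i))"
  by (induction A rule: fin_induct) (auto simp: th_add)

lemmas r_simps = r.scale_mult_left r.scale_mult_right distrib_left distrib_right left_diff_distrib right_diff_distrib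
  r.scale_right_distrib r.scale_right_diff_distrib sum_distrib_left sum_distrib_right r.scale_sum_right

text \<open>The Clifford lift of an operator of \<open>so_eps\<close>; for
  \<open>f = action X x\<close> it is \<open>pi_star\<close>. The factor 1/4 makes the bracket with
  \<open>th v\<close> equal to \<open>th (f v)\<close>: two contractions contribute
  \<open>2 th (f v)\<close> each.\<close>

definition qq :: "('l => 'l) => 'r" where
  "qq f = sr (1/4) (SUM b:B. th (f (du b)) * th b)"

lemma th_expand: "(SUM b:B. sr (form b v) (th (du b))) = th v" "(SUM b:B. sr (form v (du b)) (th b)) = th v"
  using arg_cong[OF expand_dual[of v], of th] arg_cong[OF expand_basis[of v], of th] by (simp_all add: th_sum th_scale)

lemma th_rel': "v : gr a ==> w : gr b ==> th v * (th w * x) = sr (2 * form v w) (ee * x) - sr (eps a b) (th w * (th v * x))"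
  using th_rel[of v a w b] by (simp add: r_simps flip: mult.assoc)

text \<open>Move \<open>th v\<close> leftwards through both factors of each summand. Contracting
  with \<open>th e\<close> rebuilds \<open>f v\<close> from the expansion of \<open>v\<close>;
  contracting with \<open>th (f (du e))\<close> gives the same after skewness has moved
  \<open>f\<close> to \<open>v\<close>.\<close>

lemma qq_th:
  assumes f: "so a f" and v: "v : gr b"
  shows "qq f * th v = sr (eps a b) (th v * qq f) + th (f v)"
proof -
  have one: "(th (f (du e)) * th e) * th v = sr (eps a b) (th v * (th (f (du e)) * th e)) +
      (sr 2 (sr (form e v) (th (f (du e)))) + sr 2 (sr (form (f v) (du e)) (th e)))" if e: "e : B" for e
  proof -
    note fe = so_gr[OF f du_gr[OF e]]
    have 1: "(th (f (du e)) * th e) * th v = sr (2 * form e v) (th (f (du e))) - sr (eps (dg e) b) ((th (f (du e)) * th v) * th e)"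
      using th_rel[OF basis_gr[OF e] v] by (simp add: mult.assoc r_simps)
    have 2: "(th (f (du e)) * th v) * th e = sr (2 * form (f (du e)) v) (th e) - sr (eps (a - dg e) b) (th v * (th (f (du e)) * th e))"
      using th_rel[OF fe v] by (simp add: mult.assoc r_simps)
    have 3: "eps (dg e) b * eps (a - dg e) b = eps a b" by (simp add: eps_diff mult.commute mult.left_commute)
    \<comment> \<open>A nonzero value forces \<open>dg e = a + b\<close>, and with this degree all
      commutation factors cancel.\<close>
    have 4: "- (eps (dg e) b * form (f (du e)) v) = form (f v) (du e)"
    proof (cases "form (f v) (du e) = 0")
      case True
      thus ?thesis using so_skew[OF f du_gr[OF e], of v] form_dual_left[OF e so_gr[OF f v]] by simp
    next
      case False
      hence d: "dg e = a + b" using form_nz_deg[OF so_gr[OF f v] du_gr[OF e]] by simp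
      have "- (eps (dg e) b * form (f (du e)) v) = eps (a + b) b * (eps a (- (a + b)) * (eps (a + b) (a + b) * form (f v) (du e)))"
        using so_skew[OF f du_gr[OF e], of v] form_dual_left[OF e so_gr[OF f v]] d by simp
      also have "... = form (f v) (du e)"
        by (simp add: eps_all mult_ac)
      finally show ?thesis .
    qed
    have "(th (f (du e)) * th e) * th v = sr (2 * form e v) (th (f (du e))) + sr (2 * - (eps (dg e) b * form (f (du e)) v)) (th e)
       + sr (eps (dg e) b * eps (a - dg e) b) (th v * (th (f (du e)) * th e))"
      unfolding 1 2 by (simp add: r_simps mult_ac)
    thus ?thesis unfolding 3 4 by (simp add: add_ac)
  qed
  have fv: "f v = (SUM e:B. s (form e v) (f (du e)))"
    using linear_apply_sum[OF so_linear[OF f], of "%e. form e v" du B] by (simp only: expand_dual[of v, symmetric])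
  have L: "(SUM e:B. sr (form e v) (th (f (du e)))) = th (f v)"
    using arg_cong[OF fv, of th] by (simp add: th_sum th_scale)
  have "(SUM e:B. (th (f (du e)) * th e) * th v) = (SUM e:B. sr (eps a b) (th v * (th (f (du e)) * th e)) +
      (sr 2 (sr (form e v) (th (f (du e)))) + sr 2 (sr (form (f v) (du e)) (th e))))"
    by (rule sum.cong[OF refl one])
  also have "... = sr (eps a b) (th v * (SUM e:B. th (f (du e)) * th e)) + (sr 2 (th (f v)) + sr 2 (th (f v)))"
    by (simp only: sum.distrib sum_distrib_left r.scale_sum_right[symmetric] L th_expand)
  also have "... = sr (eps a b) (th v * (SUM e:B. th (f (du e)) * th e)) + sr 4 (th (f v))"
    by (simp flip: r.scale_left_distrib)
  finally have "(SUM e:B. th (f (du e)) * th e) * th v = sr (eps a b) (th v * (SUM e:B. th (f (du e)) * th e)) + sr 4 (th (f v))"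
    by (simp only: sum_distrib_right)
  thus ?thesis unfolding qq_def by (simp only: r.scale_mult_left r.scale_mult_right r.scale_right_distrib) (simp add: mult.commute)
qed

lemma qq_linear: "(!!b. b : B ==> f (du b) = g (du b) + s c (h (du b))) ==> qq f = qq g + sr c (qq h)"
  by (simp add: qq_def th_add th_scale r_simps sum.distrib mult.commute cong: sum.cong)

lemma qq_zero: "(!!b. b : B ==> f (du b) = 0) ==> qq f = 0"
  by (simp add: qq_def cong: sum.cong)

lemma qq_cong: "(!!b. b : B ==> f (du b) = g (du b)) ==> qq f = qq g"
  by (simp add: qq_def cong: sum.cong)

lemma bil_thth:
  assumes "lin s s f"
  shows "bilinear_map s s sr (%x y. th (f x) * th y)"
  using assms vector_space_axioms r.vector_space_axioms
  by (auto simp: bilinear_map_def lin_iff th_add th_scale r_simps)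

text \<open>Commute \<open>qq f\<close> through the two factors of \<open>qq g\<close> by
  \<open>qq_th\<close>. Invariance of the tensor of dual bases then moves \<open>f\<close> from the
  second factor into the first, where it completes the bracket of operators.\<close>

lemma qq_qq:
  assumes f: "so a f" and g: "so b g"
  shows "qq f * qq g = sr (eps a b) (qq g * qq f) + qq (%v. f (g v) - s (eps a b) (g (f v)))"
proof -
  have inv: "(SUM e:B. th (g (f (du e))) * th e) = - (SUM e:B. sr (eps (dg e) a) (th (g (du e)) * th (f e)))"
    by (rule casimir_invariant[OF bil_thth[OF so_linear[OF g]] f])
  have one: "qq f * (th (g (du e)) * th e) = sr (eps a b) (th (g (du e)) * th e * qq f) +
     (sr (eps a b) (sr (eps (dg e) a) (th (g (du e)) * th (f e))) + th (f (g (du e))) * th e)" if e: "e : B" for e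
  proof -
    have 1: "qq f * th (g (du e)) = sr (eps a (b - dg e)) (th (g (du e)) * qq f) + th (f (g (du e)))"
      using qq_th[OF f so_gr[OF g du_gr[OF e]]] by simp
    have 2: "qq f * th e = sr (eps a (dg e)) (th e * qq f) + th (f e)" by (rule qq_th[OF f basis_gr[OF e]])
    have "qq f * (th (g (du e)) * th e) = (qq f * th (g (du e))) * th e" by (simp add: mult.assoc)
    also have "... = sr (eps a (b - dg e)) (th (g (du e)) * (qq f * th e)) + th (f (g (du e))) * th e"
      unfolding 1 by (simp add: r_simps mult.assoc)
    finally show ?thesis unfolding 2 by (simp add: r_simps mult.assoc eps_diff)
  qed
  have "qq f * (SUM e:B. th (g (du e)) * th e) = sr (eps a b) ((SUM e:B. th (g (du e)) * th e) * qq f) +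
      (sr (eps a b) (SUM e:B. sr (eps (dg e) a) (th (g (du e)) * th (f e))) + (SUM e:B. th (f (g (du e))) * th e))"
    unfolding sum_distrib_left sum_distrib_right r.scale_sum_right sum.distrib[symmetric] by (rule sum.cong[OF refl one])
  also have "... = sr (eps a b) ((SUM e:B. th (g (du e)) * th e) * qq f) +
      (SUM e:B. th (f (g (du e)) - s (eps a b) (g (f (du e)))) * th e)"
    using inv by (simp add: th_diff th_scale left_diff_distrib sum_subtractf r.scale_mult_left flip: r.scale_sum_right)
  finally show ?thesis by (simp only: qq_def[of g] qq_def[of "%v. f (g v) - s (eps a b) (g (f v))"] r.scale_mult_left r.scale_mult_right r.scale_right_distrib)
      (simp add: mult.commute)
qed

definition thw :: "'l list => 'r" where
  "thw w = foldr (%b p. th b * p) w ee"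

lemma thw_simps [simp]: "thw [] = ee" "thw (b # w) = th b * thw w"
  by (simp_all add: thw_def)

lemma ee_thw [simp]: "ee * thw w = thw w" "thw w * ee = thw w"
  by (cases w, simp_all flip: mult.assoc) (induction w, simp_all add: mult.assoc)

lemma thw_append: "thw (u @ w) = thw u * thw w"
  by (induction u) (simp_all add: mult.assoc)

abbreviation wdg :: "'l list => 'c" where "wdg w == sum_list (map dg w)"

text \<open>The component of given parity and degree of the Clifford part, \<open>True\<close>
  meaning even. With this coding the parity of a product is \<open>p = q\<close>.\<close>

definition CC :: "bool => 'c => 'r set" where
  "CC p a = r.span {thw w | w. w : lists B & even (length w) = p & wdg w = a}"

lemma CC_subspace: "r.subspace (CC p a)" by (simp add: CC_def)

lemma CC_thw: "w : lists B ==> thw w : CC (even (length w)) (wdg w)"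
  unfolding CC_def by (rule r.span_base) blast

lemma CC_mult:
  assumes "x : CC p a" "y : CC q b"
  shows "x * y : CC (p = q) (a + b)"
  using assms(1) unfolding CC_def[of p a]
proof (induction rule: r.span_induct_alt)
  case (step c x x')
  then obtain u where u: "x = thw u" "u : lists B" "even (length u) = p" "wdg u = a" by auto
  from assms(2) have "x * y : CC (p = q) (a + b)" unfolding CC_def[of q b]
  proof (induction rule: r.span_induct_alt)
    case (step c y y')
    then obtain w where w: "y = thw w" "w : lists B" "even (length w) = q" "wdg w = b" by auto
    have "thw (u @ w) : CC (even (length (u @ w))) (wdg (u @ w))" using u w by (intro CC_thw) simp
    hence "x * y : CC (p = q) (a + b)" using u w by (simp add: thw_append)
    thus ?case using step CC_subspace by (simp add: r_simps r.subspace_add r.subspace_scale)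
  qed (simp add: r.subspace_0[OF CC_subspace])
  thus ?case using step CC_subspace by (simp add: r_simps r.subspace_add r.subspace_scale)
qed (simp add: r.subspace_0[OF CC_subspace])

lemma CC_th: "v : gr a ==> th v : CC False a"
proof -
  assume v: "v : gr a"
  have "sr (form v (du b)) (th b) : CC False a" if b: "b : B" for b
  proof (cases "form v (du b) = 0")
    case False
    hence "dg b = a" using gr_co[OF v b] co_form[OF b] by simp
    thus ?thesis using CC_thw[of "[b]"] b by (auto intro: r.subspace_scale[OF CC_subspace])
  qed (simp add: r.subspace_0[OF CC_subspace])
  hence "(SUM b:B. sr (form v (du b)) (th b)) : CC False a" by (rule r.subspace_sum[OF CC_subspace])
  thus ?thesis by (simp add: th_expand)
qed

lemma CC_qq: "so a f ==> qq f : CC True a"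
  unfolding qq_def
proof (intro r.subspace_scale[OF CC_subspace] r.subspace_sum[OF CC_subspace])
  fix b assume f: "so a f" and b: "b : B"
  show "th (f (du b)) * th b : CC True a"
    using CC_mult[OF CC_th[OF so_gr[OF f du_gr[OF b]]] CC_th[OF basis_gr[OF b]]] by simp
qed

text \<open>The bracket of \<open>th e\<close> with a Clifford word. By \<open>ad_Cons\<close> it is
  a skew derivation contracting \<open>e\<close> with the letters, twice the form at each, so it
  shortens words.\<close>

definition ad :: "'l => 'l list => 'r" where
  "ad e w = th e * thw w - sr ((- 1) ^ length w * eps (dg e) (wdg w)) (thw w * th e)"

lemma ad_Nil [simp]: "ad e [] = 0"
  by (simp add: ad_def)

lemma ad_Cons:
  assumes "e : B" "b : B"
  shows "ad e (b # w) = sr (2 * form e b) (thw w) - sr (eps (dg e) (dg b)) (th b * ad e w)"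
  using th_rel'[OF basis_gr[OF assms(1)] basis_gr[OF assms(2)], of "thw w"]
  by (simp add: ad_def r_simps eps_add_r mult_ac mult.assoc)

definition lower :: "bool => 'c => nat => 'r set" where
  "lower p a m = r.span {thw w | w. w : lists B & even (length w) = p & wdg w = a & length w < m}"

lemma lower_subspace: "r.subspace (lower p a m)" by (simp add: lower_def)

lemma lower_thw: "w : lists B ==> even (length w) = p ==> wdg w = a ==> length w < m ==> thw w : lower p a m"
  unfolding lower_def by (rule r.span_base) blast

lemma lower_th:
  assumes "b : B" "x : lower p a m"
  shows "th b * x : lower (\<not> p) (dg b + a) (Suc m)"
  using assms(2) unfolding lower_def[of p a]
proof (induction rule: r.span_induct_alt)
  case (step c x y)
  then obtain w where w: "x = thw w" "w : lists B" "even (length w) = p" "wdg w = a" "length w < m" by auto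
  have "th b * x : lower (\<not> p) (dg b + a) (Suc m)" using w assms(1) lower_thw[of "b # w"] by simp
  thus ?case using step lower_subspace by (simp add: r_simps r.subspace_add r.subspace_scale)
qed (simp add: r.subspace_0[OF lower_subspace])

lemma ad_lower:
  assumes e: "e : B"
  shows "w : lists B ==> ad e w : lower (odd (length w)) (dg e + wdg w) (length w)"
proof (induction w)
  case (Cons b w)
  hence b: "b : B" "w : lists B" by auto
  have "sr (2 * form e b) (thw w) : lower (odd (length (b # w))) (dg e + wdg (b # w)) (length (b # w))"
  proof (cases "form e b = 0")
    case False
    hence "dg e = - dg b" using form_nz_deg[OF basis_gr[OF e] basis_gr[OF b(1)]] by simp
    thus ?thesis using b by (intro r.subspace_scale[OF lower_subspace] lower_thw) auto
  qed (simp add: r.subspace_0[OF lower_subspace])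
  moreover have "th b * ad e w : lower (odd (length (b # w))) (dg e + wdg (b # w)) (length (b # w))"
    using lower_th[OF b(1) Cons.IH[OF b(2)]] by (simp add: add_ac)
  ultimately show ?case unfolding ad_Cons[OF e b(1)]
    by (metis r.subspace_diff[OF lower_subspace] r.subspace_scale[OF lower_subspace])
qed (simp add: r.subspace_0[OF lower_subspace])

text \<open>An Euler operator: contract with a basis vector, then multiply by the dual one. At each
  letter the expansion in the dual basis puts the removed letter back with factor 2; reordering
  costs only shorter words.\<close>

lemma number_operator:
  "w : lists B ==> (SUM e:B. th (du e) * ad e w) - sr (of_nat (2 * length w)) (thw w) : lower (even (length w)) (wdg w) (length w)"
proof (induction w)
  case (Cons b w)
  hence b: "b : B" "w : lists B" by auto
  have one: "th (du e) * ad e (b # w) = sr 2 (sr (form e b) (th (du e)) * thw w) + th b * (th (du e) * ad e w) - sr (2 * eps (dg e) (dg b) * form (du e) b) (ee * ad e w)"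
    if e: "e : B" for e
    unfolding ad_Cons[OF e b(1)] using th_rel'[OF du_gr[OF e] basis_gr[OF b(1)], of "ad e w"]
    by (simp add: r_simps eps_minus_l mult_ac)
  have ea: "ee * ad e w = ad e w" for e by (simp add: ad_def r_simps flip: mult.assoc)
  have "(SUM e:B. th (du e) * ad e (b # w)) = sr 2 (th b * thw w) + th b * (SUM e:B. th (du e) * ad e w) -
      (SUM e:B. sr (2 * eps (dg e) (dg b) * form (du e) b) (ad e w))"
    using one by (simp add: ea sum.distrib sum_subtractf th_expand flip: r.scale_sum_right sum_distrib_left sum_distrib_right)
  hence eq: "(SUM e:B. th (du e) * ad e (b # w)) - sr (of_nat (2 * length (b # w))) (thw (b # w)) =
     th b * ((SUM e:B. th (du e) * ad e w) - sr (of_nat (2 * length w)) (thw w)) - (SUM e:B. sr (2 * eps (dg e) (dg b) * form (du e) b) (ad e w))"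
    by (simp add: r_simps r.scale_left_distrib)
  have "th b * ((SUM e:B. th (du e) * ad e w) - sr (of_nat (2 * length w)) (thw w)) : lower (even (length (b # w))) (wdg (b # w)) (length (b # w))"
    using lower_th[OF b(1) Cons.IH[OF b(2)]] by simp
  moreover have "sr (2 * eps (dg e) (dg b) * form (du e) b) (ad e w) : lower (even (length (b # w))) (wdg (b # w)) (length (b # w))" if e: "e : B" for e
  proof (cases "form (du e) b = 0")
    case False
    hence d: "dg e = dg b" using form_nz_deg[OF du_gr[OF e] basis_gr[OF b(1)]] by simp
    have "lower (odd (length w)) (dg e + wdg w) (length w) <= lower (even (length (b # w))) (wdg (b # w)) (length (b # w))"
      unfolding lower_def d by (intro r.span_mono) auto
    thus ?thesis using ad_lower[OF e b(2)] by (intro r.subspace_scale[OF lower_subspace]) auto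
  qed (simp add: r.subspace_0[OF lower_subspace])
  ultimately show ?case unfolding eq by (intro r.subspace_diff[OF lower_subspace] r.subspace_sum[OF lower_subspace])
qed (simp add: r.subspace_0[OF lower_subspace])

text \<open>The number operator vanishes only on scalars modulo lower terms, and these are even.\<close>

lemma odd_centralizer_zero:
  assumes Y: "Y : CC False a" and z: "!!e. e : B ==> th e * Y + sr (eps (dg e) a) (Y * th e) = 0"
  shows "Y = 0"
proof -
  \<comment> \<open>On odd elements of degree \<open>a\<close> this is the number operator, and by
    the hypothesis \<open>z\<close> it kills \<open>Y\<close>.\<close>
  define NN where "NN c = (SUM e:B. th (du e) * (th e * c + sr (eps (dg e) a) (c * th e)))" for c
  have NN_lin: "NN (sr k c + c') = sr k (NN c) + NN c'" for k c c'
    by (simp add: NN_def r_simps sum.distrib mult_ac)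
  have N0: "NN 0 = 0" by (simp add: NN_def)
  have NNw: "NN (thw w) - sr (of_nat (2 * length w)) (thw w) : lower False a (length w)"
    if "w : lists B" "odd (length w)" "wdg w = a" for w
    using number_operator[OF that(1)] that by (simp add: NN_def ad_def)
  have mono: "lower False a m <= lower False a m'" if "m <= m'" for m m'
    unfolding lower_def using that by (intro r.span_mono) auto
  have step: "NN c - sr (of_nat (2 * m)) c : lower False a m" if c: "c : lower False a (Suc m)" for c m
    using c unfolding lower_def[of False a "Suc m"]
  proof (induction rule: r.span_induct_alt)
    case base
    thus ?case by (simp add: N0 r.subspace_0[OF lower_subspace])
  next
    case (step k c c')
    then obtain w where w: "c = thw w" "w : lists B" "odd (length w)" "wdg w = a" "length w < Suc m" by blast
    have "NN c - sr (of_nat (2 * m)) c : lower False a m"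
    proof (cases "length w = m")
      case True
      thus ?thesis using NNw[OF w(2-4)] w(1) by simp
    next
      case False
      hence c: "c : lower False a m" unfolding w(1) using w by (intro lower_thw) auto
      have "NN c - sr (of_nat (2 * length w)) c : lower False a m"
        using NNw[OF w(2-4)] mono[of "length w" m] w(5) unfolding w(1) by (auto simp: less_Suc_eq_le)
      hence "(NN c - sr (of_nat (2 * length w)) c) + sr (of_nat (2 * length w)) c - sr (of_nat (2 * m)) c : lower False a m"
        using c r.subspace_diff[OF lower_subspace] r.subspace_add[OF lower_subspace] r.subspace_scale[OF lower_subspace] by blast
      thus ?thesis by simp
    qed
    moreover have "NN (sr k c + c') - sr (of_nat (2 * m)) (sr k c + c') = sr k (NN c - sr (of_nat (2 * m)) c) + (NN c' - sr (of_nat (2 * m)) c')"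
      by (simp add: NN_lin r_simps mult_ac)
    ultimately show ?case using step by (simp add: r.subspace_add[OF lower_subspace] r.subspace_scale[OF lower_subspace])
  qed
  have NY: "NN Y = 0" unfolding NN_def using z by simp
  have fin: "Y = 0" if "Y : lower False a m" for m
    using that
  proof (induction m)
    case 0
    thus ?case by (simp add: lower_def)
  next
    case (Suc m)
    have "- sr (of_nat (2 * m)) Y : lower False a m" using step[OF Suc.prems] NY by simp
    hence m: "sr (of_nat (2 * m)) Y : lower False a m" using r.subspace_neg[OF lower_subspace] by fastforce
    show ?case
    proof (cases "m = 0")
      case True
      have "{thw w |w. w : lists B & even (length w) = False & wdg w = a & length w < Suc m} = {}" using True by auto
      hence "lower False a (Suc m) = {0}" unfolding lower_def by (simp only: r.span_empty)
      thus ?thesis using Suc.prems by simp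
    next
      case False
      have "sr (1 / of_nat (2 * m)) (sr (of_nat (2 * m)) Y) : lower False a m" by (rule r.subspace_scale[OF lower_subspace m])
      thus ?thesis using Suc.IH False by (simp del: of_nat_mult)
    qed
  qed
  have "EX m. Y : lower False a m" using Y unfolding CC_def
  proof (induction rule: r.span_induct_alt)
    case base
    thus ?case using r.subspace_0[OF lower_subspace] by blast
  next
    case (step k c c')
    then obtain w m where w: "c = thw w" "w : lists B" "odd (length w)" "wdg w = a" and m: "c' : lower False a m" by blast
    have "c : lower False a (Suc (length w) + m)" using w by (auto intro!: lower_thw)
    moreover have "c' : lower False a (Suc (length w) + m)" using m mono[of m "Suc (length w) + m"] by auto
    ultimately show ?case using r.subspace_add[OF lower_subspace] r.subspace_scale[OF lower_subspace] by blast
  qed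
  thus ?thesis using fin by blast
qed

end

section \<open>The cubic term of the Clifford algebra\<close>

locale cubic_clifford = clifford_rep s B co eps gr dg form du sr th ee
  for s :: "'k::field_char_0 => 'l::ab_group_add => 'l" and B co and eps :: "'c::ab_group_add => 'c => 'k" and gr dg form du
    and sr :: "'k => 'r::ring => 'r" and th ee +
  fixes phi :: "'l => 'l => 'l"
  assumes phi_bil: "bilinear_map s s s phi"
    and phi_gr: "v : gr a ==> w : gr b ==> phi v w : gr (a + b)"
    and phi_anti: "v : gr a ==> w : gr b ==> phi v w = - s (eps a b) (phi w v)"
    and phi_so: "v : gr a ==> phi v : so_eps eps s gr form a"
begin

definition psi :: 'r where
  "psi = sr (1/12) (SUM i:B. SUM j:B. SUM l:B. sr (form (du i) (phi (du j) (du l))) (th l * th j * th i))"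

lemma th_expand_dual_left: "w : gr c ==> (SUM i:B. sr (form (du i) w) (th i)) = sr (eps c c) (th w)"
proof -
  assume w: "w : gr c"
  have "(SUM i:B. sr (form (du i) w) (th i)) = sr (eps c c) (SUM i:B. sr (form w (du i)) (th i))"
    unfolding r.scale_sum_right using form_dual_left[OF _ w] by (intro sum.cong refl) simp
  thus ?thesis by (simp add: th_expand)
qed

abbreviation Pjl :: "'l => 'l => 'l" where "Pjl j l == phi (du j) (du l)"

lemma Pjl_gr: "j : B ==> l : B ==> Pjl j l : gr (- (dg j + dg l))"
  using phi_gr[OF du_gr du_gr] by fastforce

definition ejl :: "'l => 'l => 'k" where "ejl j l = eps (dg j + dg l) (dg j + dg l)"

text \<open>Summing over \<open>i\<close> turns the third factor into \<open>th (Pjl j l)\<close>.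
  The sign \<open>ejl\<close> appears because the dual vector stands on the left in the
  form.\<close>

lemma psi_eq: "psi = sr (1/12) (SUM j:B. SUM l:B. sr (ejl j l) (th l * (th j * th (Pjl j l))))"
proof -
  have "(SUM i:B. SUM j:B. SUM l:B. sr (form (du i) (Pjl j l)) (th l * th j * th i)) =
     (SUM j:B. SUM l:B. SUM i:B. sr (form (du i) (Pjl j l)) (th l * th j * th i))"
    by (subst sum.swap) (intro sum.cong refl sum.swap)
  also have "... = (SUM j:B. SUM l:B. sr (ejl j l) (th l * (th j * th (Pjl j l))))"
  proof (intro sum.cong refl)
    fix j l assume jl: "j : B" "l : B"
    have "(SUM i:B. sr (form (du i) (Pjl j l)) (th l * th j * th i)) = (th l * th j) * (SUM i:B. sr (form (du i) (Pjl j l)) (th i))"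
      by (simp add: r_simps)
    also have "... = sr (ejl j l) (th l * (th j * th (Pjl j l)))"
      unfolding th_expand_dual_left[OF Pjl_gr[OF jl]] by (simp add: r_simps ejl_def eps_all mult.assoc mult.commute mult.left_commute[where 'a='k])
    finally show "(SUM i:B. sr (form (du i) (Pjl j l)) (th l * th j * th i)) = sr (ejl j l) (th l * (th j * th (Pjl j l)))" .
  qed
  finally show ?thesis by (simp add: psi_def)
qed

lemma CC_psi: "psi : CC False 0"
  unfolding psi_eq
proof (intro r.subspace_scale[OF CC_subspace] r.subspace_sum[OF CC_subspace])
  fix j l assume jl: "j : B" "l : B"
  have "th l * (th j * th (Pjl j l)) : CC (False = (False = False)) (dg l + (dg j + - (dg j + dg l)))"
    by (intro CC_mult CC_th basis_gr jl Pjl_gr)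
  thus "th l * (th j * th (Pjl j l)) : CC False 0" by simp
qed

lemma scaled_trace:
  assumes f: "so b f" and c: "!!l. l : B ==> b = 0 ==> c l = k * eps (dg l) (dg l)"
  shows "(SUM l:B. sr (c l * form l (f (du l))) x) = 0"
proof -
  have "(SUM l:B. c l * form l (f (du l))) = k * (SUM l:B. eps (dg l) (dg l) * form l (f (du l)))"
    unfolding sum_distrib_left
  proof (intro sum.cong refl)
    fix l assume l: "l : B"
    show "c l * form l (f (du l)) = k * (eps (dg l) (dg l) * form l (f (du l)))"
      using c[OF l] form_nz_deg[OF basis_gr[OF l] so_gr[OF f du_gr[OF l]]] by (cases "form l (f (du l)) = 0") auto
  qed
  thus ?thesis using trace_so[OF f] by (simp flip: r.scale_sum_left)
qed

text \<open>Moving \<open>th v\<close> through three factors gives three contractions. Skewness and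
  antisymmetry of \<open>phi\<close> show that each contributes \<open>2 Z\<close>, where
  \<open>Z\<close> is the sum defining \<open>qq (phi v)\<close> without its 1/4. The total
  \<open>6 Z\<close>, times 1/12, is \<open>2 qq (phi v)\<close>: this is the origin of the constant
  1/12.\<close>

lemma psi_th:
  assumes v: "v : gr b"
  shows "psi * th v + th v * psi = sr 2 (qq (phi v))"
proof -
  define f where "f = phi v"
  have f: "so b f" unfolding f_def by (rule phi_so[OF v])
  let ?P = "(SUM j:B. SUM l:B. sr (ejl j l) (th l * (th j * th (Pjl j l))))"
  let ?s1 = "%j l. sr (ejl j l * (2 * form (Pjl j l) v)) (th l * th j)"
  let ?s2 = "%j l. sr (ejl j l * (2 * eps (- (dg j + dg l)) b * form j v)) (th l * th (Pjl j l))"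
  let ?s3 = "%j l. sr (ejl j l * (2 * eps (- dg l) b * form l v)) (th j * th (Pjl j l))"
  let ?e = "%l. sr (2 * eps (dg l) (dg l) * eps b (dg l) * 2 * form l (f (du l))) ee"
  let ?e' = "%j. sr (- 2 * eps (dg j) (dg j) * eps b (dg j) * 2 * form j (f (du j))) ee"
  define Z where "Z = (SUM e:B. th (f (du e)) * th e)"
  have phi_lin: "lin s s (%x. phi x y)" "lin s s (phi x)" for x y
    using phi_bil by (auto simp: bilinear_map_def)
  have trm: "(th l * (th j * th P)) * th v + th v * (th l * (th j * th P)) =
      sr (2 * form P v) (th l * th j) - sr (2 * eps dP b * form j v) (th l * th P) + sr (2 * eps (dg j + dP) b * form l v) (th j * th P)"
    if jl: "j : B" "l : B" and P: "P : gr dP" "dg l + (dg j + dP) = 0" for j l P dP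
  proof -
    \<comment> \<open>The three factors have total degree 0, so the commutation factors collected by
      moving \<open>th v\<close> to the front multiply to 1.\<close>
    have e1: "eps (dg l) b * eps (dg j + dP) b = 1" using P(2) by (metis eps_add_l eps_0_l)
    have "(th l * (th j * th P)) * th v = th l * (th j * (th P * th v))" by (simp add: mult.assoc)
    also have "... = sr (2 * form P v) (th l * th j) - sr (eps dP b) (th l * (th j * (th v * th P)))"
      unfolding th_rel[OF P(1) v] by (simp add: r_simps)
    also have "th j * (th v * th P) = sr (2 * form j v) (th P) - sr (eps (dg j) b) (th v * (th j * th P))"
      using th_rel'[OF basis_gr[OF jl(1)] v, of "th P"] by simp
    also have "th l * (sr (2 * form j v) (th P) - sr (eps (dg j) b) (th v * (th j * th P))) =
        sr (2 * form j v) (th l * th P) - sr (eps (dg j) b) (sr (2 * form l v) (th j * th P) - sr (eps (dg l) b) (th v * (th l * (th j * th P))))"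
      using th_rel'[OF basis_gr[OF jl(2)] v, of "th j * th P"] by (simp add: r_simps flip: mult.assoc)
    finally show ?thesis using e1 by (simp add: r_simps eps_add_l mult_ac)
  qed
  have "?P * th v + th v * ?P =
    (SUM j:B. SUM l:B. sr (ejl j l) ((th l * (th j * th (Pjl j l))) * th v + th v * (th l * (th j * th (Pjl j l)))))"
    by (simp only: sum_distrib_left sum_distrib_right sum.distrib[symmetric] r.scale_mult_left r.scale_mult_right r.scale_right_distrib)
  also have "... = (SUM j:B. SUM l:B. sr (ejl j l) (sr (2 * form (Pjl j l) v) (th l * th j) - sr (2 * eps (- (dg j + dg l)) b * form j v) (th l * th (Pjl j l))
       + sr (2 * eps (dg j + - (dg j + dg l)) b * form l v) (th j * th (Pjl j l))))"
    using trm[OF _ _ Pjl_gr] by (intro sum.cong refl) simp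
  also have "... = (SUM j:B. SUM l:B. ?s1 j l)
      - (SUM j:B. SUM l:B. ?s2 j l)
      + (SUM j:B. SUM l:B. ?s3 j l)"
    by (simp add: r.scale_right_distrib r.scale_right_diff_distrib sum.distrib sum_subtractf)
  also have "(SUM j:B. SUM l:B. ?s1 j l) = sr 2 Z"
    unfolding Z_def r.scale_sum_right
  proof (intro sum.cong refl)
    fix j assume j: "j : B"
    define w where "w = phi (du j) v"
    have w: "w : gr (b - dg j)" using phi_gr[OF du_gr[OF j] v] by (simp add: w_def)
    have l: "sr (ejl j l * (2 * form (Pjl j l) v)) (th l) = sr (- 2 * eps (dg j) b) (sr (form w (du l)) (th l))" if l: "l : B" for l
    proof -
      have 1: "form (Pjl j l) v = - eps (dg j) (dg l) * (eps (b - dg j) (b - dg j) * form w (du l))"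
        using so_skew[OF phi_so[OF du_gr[OF j]] du_gr[OF l], of v] form_dual_left[OF l w] by (simp add: w_def eps_minus_l eps_minus_r)
      show ?thesis
      proof (cases "form w (du l) = 0")
        case False
        hence d: "dg l = b - dg j" using form_nz_deg[OF w du_gr[OF l]] by simp
        have "ejl j l * (2 * form (Pjl j l) v) = - 2 * eps (dg j) b * form w (du l)"
          unfolding 1 d ejl_def by (simp add: eps_all mult_ac)
        thus ?thesis by (simp only: r.scale_scale)
      qed (simp add: 1)
    qed
    have "(SUM l:B. ?s1 j l) = (SUM l:B. sr (ejl j l * (2 * form (Pjl j l) v)) (th l)) * th j"
      by (simp add: r_simps)
    also have "(SUM l:B. sr (ejl j l * (2 * form (Pjl j l) v)) (th l)) = (SUM l:B. sr (- 2 * eps (dg j) b) (sr (form w (du l)) (th l)))"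
      by (rule sum.cong[OF refl l])
    also have "... = sr (- 2 * eps (dg j) b) (th w)"
      by (simp only: r.scale_sum_right[symmetric] th_expand)
    also have "sr (- 2 * eps (dg j) b) (th w) * th j = sr 2 (th (f (du j)) * th j)"
      using phi_anti[OF du_gr[OF j] v] by (simp add: w_def f_def th_minus th_scale r_simps eps_minus_l)
    finally show "(SUM l:B. ?s1 j l) = sr 2 (th (f (du j)) * th j)" .
  qed
  also have "(SUM j:B. SUM l:B. ?s2 j l) = - sr 2 Z"
  proof -
    \<comment> \<open>Here the two factors come out in the wrong order. The Clifford relation
      reverses them and leaves scalars, which add up to a multiple of the \<epsilon>-trace of the
      skew operator \<open>f\<close>, that is, to 0.\<close>
    have "(SUM j:B. ?s2 j l) =
        ?e l - sr 2 (th (f (du l)) * th l)" if l: "l : B" for l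
    proof -
      have "?s2 j l =
         sr (2 * eps (dg l) (dg l) * eps b (dg l)) (th l * th (s (form j v) (Pjl j l)))" if j: "j : B" for j
      proof (cases "form j v = 0")
        case False
        hence d: "dg j = - b" using form_nz_deg[OF basis_gr[OF j] v] by simp
        have "ejl j l * (2 * eps (- (dg j + dg l)) b * form j v) = 2 * eps (dg l) (dg l) * eps b (dg l) * form j v"
          unfolding d ejl_def by (simp add: eps_all mult_ac)
        thus ?thesis by (simp add: th_scale r_simps)
      qed (simp add: th_scale)
      hence "(SUM j:B. ?s2 j l) =
        sr (2 * eps (dg l) (dg l) * eps b (dg l)) (th l * th (SUM j:B. s (form j v) (Pjl j l)))"
        by (simp add: th_sum sum_distrib_left r.scale_sum_right)
      also have "(SUM j:B. s (form j v) (Pjl j l)) = f (du l)"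
        using linear_apply_sum[OF phi_lin(1)[of "du l"], of "%j. form j v" du B] by (simp only: expand_dual[of v, symmetric] f_def)
      finally show ?thesis using th_rel[OF basis_gr[OF l] so_gr[OF f du_gr[OF l]]]
        by (simp add: r_simps eps_all mult_ac)
    qed
    hence "(SUM l:B. SUM j:B. ?s2 j l) =
        (SUM l:B. ?e l) - sr 2 Z"
      by (simp add: Z_def sum_subtractf r.scale_sum_right)
    moreover have "(SUM l:B. ?e l) = 0"
      by (rule scaled_trace[OF f, where k = 4]) simp
    ultimately show ?thesis by (subst sum.swap) simp
  qed
  also have "(SUM j:B. SUM l:B. ?s3 j l) = sr 2 Z"
  proof -
    have "(SUM l:B. ?s3 j l) =
        ?e' j + sr 2 (th (f (du j)) * th j)" if j: "j : B" for j
    proof -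
      have "?s3 j l =
         sr (2 * eps (dg j) (dg j)) (th j * th (s (form l v) (Pjl j l)))" if l: "l : B" for l
      proof (cases "form l v = 0")
        case False
        hence d: "dg l = - b" using form_nz_deg[OF basis_gr[OF l] v] by simp
        have "ejl j l * (2 * eps (- dg l) b * form l v) = 2 * eps (dg j) (dg j) * form l v"
          unfolding d ejl_def by (simp add: eps_all mult_ac)
        thus ?thesis by (simp add: th_scale r_simps)
      qed (simp add: th_scale)
      hence "(SUM l:B. ?s3 j l) =
        sr (2 * eps (dg j) (dg j)) (th j * th (SUM l:B. s (form l v) (Pjl j l)))"
        by (simp add: th_sum sum_distrib_left r.scale_sum_right)
      also have "(SUM l:B. s (form l v) (Pjl j l)) = phi (du j) v"
        using linear_apply_sum[OF phi_lin(2)[of "du j"], of "%j. form j v" du B] by (simp only: expand_dual[of v, symmetric])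
      also have "... = - s (eps b (dg j)) (f (du j))" using phi_anti[OF du_gr[OF j] v] by (simp add: f_def eps_minus_l)
      finally show ?thesis using th_rel[OF basis_gr[OF j] so_gr[OF f du_gr[OF j]]]
        by (simp add: r_simps th_minus th_scale eps_all mult_ac)
    qed
    hence "(SUM j:B. SUM l:B. ?s3 j l) =
        (SUM j:B. ?e' j) + sr 2 Z"
      by (simp add: Z_def sum.distrib sum_subtractf sum_negf r.scale_sum_right)
    moreover have "(SUM j:B. ?e' j) = 0"
      by (rule scaled_trace[OF f, where k = "- 4"]) simp
    ultimately show ?thesis by simp
  qed
  finally have "?P * th v + th v * ?P = sr 6 Z"
    by (simp flip: r.scale_left_distrib)
  thus ?thesis
    unfolding psi_eq qq_def f_def[symmetric] Z_def[symmetric] r.scale_mult_left r.scale_mult_right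
    by (simp flip: r.scale_right_distrib)
qed

lemma psi_th': "v : gr b ==> psi * th v = sr 2 (qq (phi v)) - th v * psi"
  using psi_th by (simp add: eq_diff_eq)

text \<open>By \<open>psi_th\<close> and the derivation property, the commutator of
  \<open>qq f\<close> and \<open>psi\<close> anticommutes up to sign with every \<open>th v\<close>.
  It is odd, so \<open>odd_centralizer_zero\<close> applies and no cubic expression has to be
  expanded.\<close>

lemma qq_psi:
  assumes f: "so a f" and der: "!!b v w. v : gr b ==> f (phi v w) = phi (f v) w + s (eps a b) (phi v (f w))"
  shows "qq f * psi = psi * qq f"
proof -
  define Y where "Y = qq f * psi - psi * qq f"
  have "qq f * psi : CC (True = False) (a + 0)" "psi * qq f : CC (False = True) (0 + a)"
    by (intro CC_mult CC_qq[OF f] CC_psi)+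
  hence Y: "Y : CC False a" unfolding Y_def by (simp add: r.subspace_diff[OF CC_subspace])
  have "Y * th v + sr (eps a b) (th v * Y) = 0" if v: "v : gr b" for v b
  proof -
    have "qq f * qq (phi v) = sr (eps a b) (qq (phi v) * qq f) + qq (phi (f v))"
      using qq_qq[OF f phi_so[OF v]] der[OF v] by simp
    moreover have "psi * (th v * x) = sr 2 (qq (phi v) * x) - th v * (psi * x)" for x
      using psi_th'[OF v] by (simp add: r_simps flip: mult.assoc)
    moreover have "qq f * (th v * x) = sr (eps a b) (th v * (qq f * x)) + th (f v) * x" for x
      using qq_th[OF f v] by (simp add: r_simps flip: mult.assoc)
    ultimately show ?thesis
      unfolding Y_def using psi_th'[OF v] psi_th'[OF so_gr[OF f v]] qq_th[OF f v]
      by (simp add: r_simps mult.assoc)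
  qed
  hence *: "Y * th e = - sr (eps a (dg e)) (th e * Y)" if "e : B" for e
    using basis_gr[OF that] by (simp add: eq_neg_iff_add_eq_0)
  have "Y = 0"
    by (rule odd_centralizer_zero[OF Y]) (simp add: *)
  thus ?thesis by (simp add: Y_def)
qed

end

section \<open>The square of the cubic Dirac operator\<close>

text \<open>Images of the generators of both tensor factors in a ring: \<open>XX\<close> represents
  \<open>\<gg> \<oplus> V\<close>, \<open>th\<close> the Clifford algebra, and \<open>XX_th\<close>
  is the sign rule of the graded tensor product. What follows about D depends only on these
  relations, not on how the algebra is realized.\<close>

locale dirac_rep = cubic_clifford s B co eps gr dg form du sr th ee phi + G: quad_space sg Bg cog eps gg dgg formg dug
  for sg :: "'k::field_char_0 => 'g::ab_group_add => 'g" and Bg cog and gg :: "'c::ab_group_add => 'g set" and dgg formg dug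
    and s :: "'k => 'v::ab_group_add => 'v" and B co and eps :: "'c => 'c => 'k" and gr dg form du
    and sr :: "'k => 'r::ring => 'r" and th ee phi +
  fixes brg :: "'g => 'g => 'g" and act :: "'g => 'v => 'v" and mu :: "'v => 'v => 'g"
    and tb :: "'g * 'v => 'g * 'v => 'g * 'v" and XX :: "'g * 'v => 'r"
  assumes quad: "quadratic_colour_lie_algebra eps sg gg brg formg"
    and rep: "orthogonal_representation eps sg gg brg s gr form act"
    and act_phi: "x : gg a ==> v : gr b ==> act x (phi v w) = phi (act x v) w + s (eps a b) (phi v (act x w))"
    and mu: "formg x (mu v w) = form (act x v) w"
    and tilde: "colour_lie_algebra eps (dsum_scale sg s) (dsum_grading gg gr) tb"
    and tb_gg: "tb (x, 0) (y, 0) = (brg x y, 0)"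
    and tb_gV: "tb (x, 0) (0, v) = (0, act x v)"
    and tb_VV: "tb (0, v) (0, w) = (mu v w, phi v w)"
    and XX_linear: "lin (dsum_scale sg s) sr XX"
    and XX_ee [simp]: "XX p * ee = XX p" "ee * XX p = XX p"
    and XX_rel: "p : dsum_grading gg gr a ==> q : dsum_grading gg gr b ==>
      XX p * XX q = sr (eps a b) (XX q * XX p) + XX (tb p q)"
    and XX_th: "v : gr a ==> p : dsum_grading gg gr b ==> th v * XX p = sr (eps a b) (XX p * th v)"
begin

abbreviation st where "st == dsum_scale sg s"
abbreviation gt where "gt == dsum_grading gg gr"
abbreviation Xg where "Xg x == XX (x, 0)"
abbreviation Xv where "Xv v == XX (0, v)"
abbreviation pis where "pis x == qq (act x)"
definition Dl where "Dl x = Xg x + pis x"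

lemma gt_g: "x : gg a ==> (x, 0) : gt a" and gt_v: "v : gr a ==> (0, v) : gt a"
  using subspace_0[OF gr_sub] G.subspace_0[OF G.gr_sub] by (auto simp: dsum_grading_def)

lemma act_add: "act (x + y) v = act x v + act y v" and act_scale: "act (sg c x) v = s c (act x v)"
  using rep by (auto simp: orthogonal_representation_def lin_iff)

lemma act_zero [simp]: "act 0 v = 0" using act_scale[of 0 0] by simp

lemma act_so: "x : gg a ==> so a (act x)"
  using rep by (auto simp: orthogonal_representation_def)

lemma act_gr: "x : gg a ==> v : gr b ==> act x v : gr (a + b)"
  by (rule so_gr[OF act_so])

lemma act_br: "x : gg a ==> y : gg b ==> act (brg x y) v = act x (act y v) - s (eps a b) (act y (act x v))"
  using rep by (auto simp: orthogonal_representation_def)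

lemma brg_gr: "x : gg a ==> y : gg b ==> brg x y : gg (a + b)"
  using quad unfolding quadratic_colour_lie_algebra_def colour_lie_algebra_def by blast

lemma brg_linear: "lin sg sg (brg x)"
proof -
  have "bilinear_map sg sg sg brg" using quad unfolding quadratic_colour_lie_algebra_def colour_lie_algebra_def by blast
  thus ?thesis by (simp add: bilinear_map_def)
qed

lemma brg_so:
  assumes x: "x : gg a"
  shows "brg x : so_eps eps sg gg formg a"
proof -
  have "formg (brg x y) z = - eps a b * formg y (brg x z)" if "y : gg b" for b y z
    using quad x that unfolding quadratic_colour_lie_algebra_def by blast
  thus ?thesis using brg_linear brg_gr[OF x] by (simp add: so_eps_def)
qed

lemma XX_add: "XX (p + q) = XX p + XX q" and XX_scale: "XX (st c p) = sr c (XX p)"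
  using XX_linear unfolding lin_iff by blast+

lemma Xg_add: "Xg (x + y) = Xg x + Xg y" and Xg_scale: "Xg (sg c x) = sr c (Xg x)"
  and Xv_add: "Xv (v + w) = Xv v + Xv w" and Xv_scale: "Xv (s c v) = sr c (Xv v)"
  using XX_add[of "(x, 0)" "(y, 0)"] XX_scale[of c "(x, 0)"] XX_add[of "(0, v)" "(0, w)"] XX_scale[of c "(0, v)"]
  by (simp_all add: dsum_scale_def)

lemma XX_zero [simp]: "XX (0, 0) = 0" using Xg_scale[of 0 0] by simp

lemma XX_split: "XX (x, v) = Xg x + Xv v"
  using XX_add[of "(x, 0)" "(0, v)"] by simp

lemma Xv_sum: "Xv (SUM i:A. f i) = (SUM i:A. Xv (f i))"
  by (induction A rule: fin_induct) (auto simp: Xv_add)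

lemma pis_add: "pis (x + y) = pis x + pis y"
  using qq_linear[of "act (x + y)" "act x" 1 "act y"] by (simp add: act_add)

lemma pis_scale: "pis (sg c x) = sr c (pis x)"
  using qq_linear[of "act (sg c x)" "%_. 0" c "act x"] qq_zero[of "%_. 0"] by (simp add: act_scale)

lemma linear_Xg: "lin sg sr Xg" and linear_Xv: "lin s sr Xv"
  and linear_pis: "lin sg sr (%x. pis x)" and linear_Dl: "lin sg sr Dl"
  and linear_th_act: "lin sg sr (%x. th (act x v))"
  using G.vector_space_axioms vector_space_axioms r.vector_space_axioms
  by (auto simp: lin_iff Dl_def Xg_add Xg_scale Xv_add Xv_scale pis_add pis_scale r.scale_right_distrib
     act_add act_scale th_add th_scale)

lemma bil_mult:
  assumes "lin s1 sr F" "lin s2 sr F'"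
  shows "bilinear_map s1 s2 sr (%x y. F x * F' y)"
  using assms by (auto simp: bilinear_map_def lin_iff r_simps)

lemma CC_XX:
  assumes c: "c : CC q a" and p: "p : gt b"
  shows "c * XX p = sr (eps a b) (XX p * c)"
  using c unfolding CC_def
proof (induction rule: r.span_induct_alt)
  case (step k x y)
  then obtain w where w: "x = thw w" "w : lists B" "wdg w = a" by blast
  have "thw w * XX p = sr (eps (wdg w) b) (XX p * thw w)" using w(2)
  proof (induction w)
    case (Cons e w)
    hence IH: "thw w * XX p = sr (eps (wdg w) b) (XX p * thw w)" and e: "e : B" by auto
    have "thw (e # w) * XX p = th e * (thw w * XX p)" by (simp add: mult.assoc)
    also have "... = sr (eps (wdg w) b) ((th e * XX p) * thw w)" unfolding IH by (simp add: r_simps mult.assoc)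
    finally show ?case unfolding XX_th[OF basis_gr[OF e] p] by (simp add: r_simps mult.assoc eps_add_l mult_ac)
  qed simp
  thus ?case using step w by (simp add: r_simps mult_ac)
qed simp

lemma CC_XX': "c : CC q a ==> p : gt b ==> XX p * c = sr (eps b a) (c * XX p)"
  using CC_XX[of c q a p b] by simp

lemma ee_CC: "c : CC q a ==> ee * c = c" "c : CC q a ==> c * ee = c"
proof -
  assume c: "c : CC q a"
  show "ee * c = c" using c unfolding CC_def by (induction rule: r.span_induct_alt) (auto simp: r_simps)
  show "c * ee = c" using c unfolding CC_def by (induction rule: r.span_induct_alt) (auto simp: r_simps)
qed

lemma ee_qq [simp]: "ee * qq f = qq f" "qq f * ee = qq f"
  by (simp_all add: qq_def r_simps mult.assoc) (simp flip: mult.assoc)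

lemma Dl_th:
  assumes x: "x : gg a" and v: "v : gr b"
  shows "Dl x * th v = sr (eps a b) (th v * Dl x) + th (act x v)"
  using qq_th[OF act_so[OF x] v] CC_XX'[OF CC_th[OF v] gt_g[OF x]]
  by (simp add: Dl_def r_simps)

lemma Dl_XX:
  assumes x: "x : gg a" and p: "p : gt b"
  shows "Dl x * XX p = sr (eps a b) (XX p * Dl x) + XX (tb (x, 0) p)"
  using XX_rel[OF gt_g[OF x] p] CC_XX[OF CC_qq[OF act_so[OF x]] p]
  by (simp add: Dl_def r_simps)

lemma Dl_Dl:
  assumes x: "x : gg a" and y: "y : gg b"
  shows "Dl x * Dl y = sr (eps a b) (Dl y * Dl x) + Dl (brg x y)"
proof -
  have "qq (act (brg x y)) = qq (%v. act x (act y v) - s (eps a b) (act y (act x v)))"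
    by (rule qq_cong) (rule act_br[OF x y])
  thus ?thesis
    using XX_rel[OF gt_g[OF x] gt_g[OF y]] CC_XX'[OF CC_qq[OF act_so[OF y]] gt_g[OF x]] CC_XX[OF CC_qq[OF act_so[OF x]] gt_g[OF y]]
      qq_qq[OF act_so[OF x] act_so[OF y]]
    by (simp add: Dl_def r_simps tb_gg)
qed

definition SS :: 'r where "SS = (SUM e:B. Xv (du e) * th e)"
definition DD :: 'r where "DD = SS + psi"
text \<open>The value of \<Delta> at the quadratic Casimir element of \<open>\<gg>\<close>.\<close>

definition Cas :: 'r where "Cas = (SUM k:Bg. Dl (dug k) * Dl k)"

lemma Dl_SS:
  assumes x: "x : gg a"
  shows "Dl x * SS = SS * Dl x"
proof -
  have one: "Dl x * (Xv (du e) * th e) = (Xv (du e) * th e) * Dl x + (Xv (act x (du e)) * th e + sr (eps (dg e) a) (Xv (du e) * th (act x e)))"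
    if e: "e : B" for e
  proof -
    have "Dl x * (Xv (du e) * th e) = (Dl x * Xv (du e)) * th e" by (simp add: mult.assoc)
    also have "... = sr (eps (dg e) a) (Xv (du e) * (Dl x * th e)) + Xv (act x (du e)) * th e"
      unfolding Dl_XX[OF x gt_v[OF du_gr[OF e]]] by (simp add: r_simps mult.assoc tb_gV eps_minus_r)
    finally show ?thesis unfolding Dl_th[OF x basis_gr[OF e]] by (simp add: r_simps mult.assoc add_ac)
  qed
  have "Dl x * SS = SS * Dl x + ((SUM e:B. Xv (act x (du e)) * th e) + (SUM e:B. sr (eps (dg e) a) (Xv (du e) * th (act x e))))"
    unfolding SS_def sum_distrib_left sum_distrib_right sum.distrib[symmetric] by (rule sum.cong[OF refl one])
  thus ?thesis using casimir_invariant[OF bil_mult[OF linear_Xv th_linear] act_so[OF x]] by simp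
qed

lemma Dl_DD:
  assumes x: "x : gg a"
  shows "Dl x * DD = DD * Dl x"
proof -
  have "qq (act x) * psi = psi * qq (act x)" using qq_psi[OF act_so[OF x]] act_phi[OF x] by blast
  hence "Dl x * psi = psi * Dl x" using CC_XX'[OF CC_psi gt_g[OF x]] by (simp add: Dl_def r_simps)
  thus ?thesis using Dl_SS[OF x] by (simp add: DD_def r_simps)
qed

text \<open>The contraction of the linear part of D with \<open>v\<close> rebuilds \<open>v\<close>
  in the enveloping factor; the cubic part contributes by \<open>psi_th\<close>. Read backwards, the
  identity expresses \<open>Xv v\<close> through D and Clifford elements, so centrality statements
  need to be tested only on the latter and on \<open>Dl\<close>.\<close>

lemma DD_th:
  assumes v: "v : gr b"
  shows "DD * th v = sr 2 (Xv v) + sr 2 (qq (phi v)) - th v * DD"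
proof -
  have one: "(Xv (du e) * th e) * th v = sr 2 (Xv (s (form e v) (du e))) - th v * (Xv (du e) * th e)" if e: "e : B" for e
  proof -
    have "th v * (Xv (du e) * th e) = sr (eps (dg e) b) (Xv (du e) * (th v * th e))"
      using XX_th[OF v gt_v[OF du_gr[OF e]]] by (simp add: r_simps eps_minus_r flip: mult.assoc)
    thus ?thesis using th_rel[OF basis_gr[OF e] v] by (simp add: Xv_scale r_simps mult.assoc)
  qed
  have "SS * th v = sr 2 (Xv (SUM e:B. s (form e v) (du e))) - th v * SS"
    unfolding SS_def sum_distrib_left sum_distrib_right Xv_sum r.scale_sum_right sum_subtractf[symmetric] by (rule sum.cong[OF refl one])
  thus ?thesis using psi_th'[OF v] by (simp add: DD_def r_simps expand_dual[of v, symmetric])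
qed

lemma DD_XX:
  assumes p: "p : gt b"
  shows "DD * XX p = XX p * DD + (SUM e:B. sr (eps (dg e) b) (XX (tb (0, du e) p) * th e))"
proof -
  have one: "(Xv (du e) * th e) * XX p = XX p * (Xv (du e) * th e) + sr (eps (dg e) b) (XX (tb (0, du e) p) * th e)" if e: "e : B" for e
  proof -
    have "(Xv (du e) * th e) * XX p = sr (eps (dg e) b) ((Xv (du e) * XX p) * th e)"
      using XX_th[OF basis_gr[OF e] p] by (simp add: r_simps mult.assoc)
    also have "... = XX p * (Xv (du e) * th e) + sr (eps (dg e) b) (XX (tb (0, du e) p) * th e)"
      unfolding XX_rel[OF gt_v[OF du_gr[OF e]] p] by (simp add: r_simps mult.assoc eps_minus_l)
    finally show ?thesis .
  qed
  have "SS * XX p = XX p * SS + (SUM e:B. sr (eps (dg e) b) (XX (tb (0, du e) p) * th e))"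
    unfolding SS_def sum_distrib_left sum_distrib_right sum.distrib[symmetric] by (rule sum.cong[OF refl one])
  thus ?thesis using CC_XX[OF CC_psi p] by (simp add: DD_def r_simps)
qed

lemma mu_expand: "mu v w = (SUM k:Bg. sg (form (act k v) w) (dug k))"
  using G.expand_dual[of "mu v w"] by (simp add: mu)

lemma DD_qq_phi:
  assumes v: "v : gr b"
  shows "DD * qq (phi v) = qq (phi v) * DD + (SUM e:B. Xv (phi v (du e)) * th e) + (psi * qq (phi v) - qq (phi v) * psi)"
proof -
  have one: "(Xv (du e) * th e) * qq (phi v) = qq (phi v) * (Xv (du e) * th e) - sr (eps (dg e) b) (Xv (du e) * th (phi v e))" if e: "e : B" for e
  proof -
    have "qq (phi v) * (Xv (du e) * th e) = sr (eps (dg e) b) (Xv (du e) * (qq (phi v) * th e))"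
      using CC_XX[OF CC_qq[OF phi_so[OF v]] gt_v[OF du_gr[OF e]]] by (simp add: r_simps eps_minus_r flip: mult.assoc)
    thus ?thesis unfolding qq_th[OF phi_so[OF v] basis_gr[OF e]] by (simp add: r_simps mult.assoc)
  qed
  have "SS * qq (phi v) = qq (phi v) * SS - (SUM e:B. sr (eps (dg e) b) (Xv (du e) * th (phi v e)))"
    unfolding SS_def sum_distrib_left sum_distrib_right sum_subtractf[symmetric] by (rule sum.cong[OF refl one])
  also have "(SUM e:B. sr (eps (dg e) b) (Xv (du e) * th (phi v e))) = - (SUM e:B. Xv (phi v (du e)) * th e)"
    using casimir_invariant[OF bil_mult[OF linear_Xv th_linear] phi_so[OF v]] by simp
  finally show ?thesis by (simp add: DD_def r_simps)
qed

text \<open>Expanding the moment map in the dual basis of \<open>\<gg>\<close> exchanges a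
  contraction over \<open>V\<close> for one over \<open>\<gg>\<close>. The sign reflects that
  \<open>act k\<close> is skew.\<close>

lemma moment_contract:
  assumes v: "v : gr b" and F: "lin sg sr F"
  shows "(SUM e:B. sr (eps (dg e) b) (F (mu (du e) v) * th e)) = - (SUM k:Bg. F (dug k) * th (act k v))"
proof -
  let ?A = "%e k. sr (eps (dg e) b) (sr (form (act k (du e)) v) (F (dug k)) * th e)"
  let ?B = "%e k. F (dug k) * sr (form (act k v) (du e)) (th e)"
  have F_mu: "F (mu u v) = (SUM k:Bg. sr (form (act k u) v) (F (dug k)))" for u
    using G.linear_apply_sum[OF F] by (simp add: mu_expand)
  have one: "?A e k = - (?B e k)"
    if e: "e : B" and k: "k : Bg" for e k
  proof -
    note f = act_so[OF G.basis_gr[OF k]]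
    have "eps (dg e) b * form (act k (du e)) v = - form (act k v) (du e)"
    proof (cases "form (act k v) (du e) = 0")
      case True
      thus ?thesis using so_skew[OF f du_gr[OF e], of v] form_dual_left[OF e so_gr[OF f v]] by simp
    next
      case False
      hence d: "dg e = dgg k + b" using form_nz_deg[OF so_gr[OF f v] du_gr[OF e]] by simp
      show ?thesis using so_skew[OF f du_gr[OF e], of v] form_dual_left[OF e so_gr[OF f v]] d by (simp add: eps_all mult_ac)
    qed
    thus ?thesis by (simp add: r_simps)
  qed
  have "(SUM e:B. sr (eps (dg e) b) (F (mu (du e) v) * th e)) =
      (SUM e:B. SUM k:Bg. ?A e k)"
    by (simp only: F_mu sum_distrib_right r.scale_sum_right)
  also have "... = (SUM e:B. SUM k:Bg. - (?B e k))"
    by (intro sum.cong refl one)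
  also have "... = (SUM k:Bg. SUM e:B. - (?B e k))" by (rule sum.swap)
  also have "... = - (SUM k:Bg. F (dug k) * th (act k v))"
    by (simp only: sum_negf sum_distrib_left[symmetric] th_expand)
  finally show ?thesis .
qed

text \<open>What remains of the commutator of \<open>RR\<close> with \<open>th v\<close> after all
  terms with \<open>Xg\<close> have cancelled. It is an odd element of the Clifford algebra.\<close>

definition Yv :: "'c => 'v => 'r" where
  "Yv b v = sr 2 (psi * qq (phi v) - qq (phi v) * psi) +
     (SUM k:Bg. sr (eps (dgg k) b) (th (act (dug k) v) * pis k) + pis (dug k) * th (act k v))"

text \<open>The commutator of D^2 with \<open>th v\<close> is that of D with the anticommutator of D
  and \<open>th v\<close>, which \<open>DD_th\<close> provides. The terms
  \<open>Xv (phi v (du e)) * th e\<close> coming from \<open>Xv v\<close> and from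
  \<open>qq (phi v)\<close> cancel.\<close>

lemma DD2_th:
  assumes v: "v : gr b"
  shows "DD * (DD * th v) = th v * (DD * DD) - sr 2 (SUM k:Bg. Xg (dug k) * th (act k v)) + sr 2 (psi * qq (phi v) - qq (phi v) * psi)"
proof -
  have "(SUM e:B. sr (eps (dg e) b) (Xv (phi (du e) v) * th e)) = (SUM e:B. - (Xv (phi v (du e)) * th e))"
  proof (rule sum.cong[OF refl])
    fix e assume e: "e : B"
    show "sr (eps (dg e) b) (Xv (phi (du e) v) * th e) = - (Xv (phi v (du e)) * th e)"
      using phi_anti[OF du_gr[OF e] v] Xv_scale[of "- eps b (dg e)" "phi v (du e)"]
      by (simp add: eps_minus_l r_simps)
  qed
  moreover have "XX (tb (0, du e) (0, v)) = Xg (mu (du e) v) + Xv (phi (du e) v)" for e unfolding tb_VV by (rule XX_split)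
  ultimately have Xv: "DD * Xv v = Xv v * DD - (SUM k:Bg. Xg (dug k) * th (act k v)) - (SUM e:B. Xv (phi v (du e)) * th e)"
    using DD_XX[OF gt_v[OF v]] moment_contract[OF v linear_Xg]
    by (simp add: distrib_right r.scale_right_distrib sum.distrib sum_negf)
  have "DD * (DD * th v) = sr 2 (DD * Xv v) + sr 2 (DD * qq (phi v)) - (sr 2 (Xv v) + sr 2 (qq (phi v)) - th v * DD) * DD"
    unfolding DD_th[OF v, symmetric] by (simp add: DD_th[OF v] r_simps flip: mult.assoc)
  thus ?thesis unfolding Xv DD_qq_phi[OF v] by (simp add: r_simps mult.assoc)
qed

text \<open>Each of the two factors \<open>Dl\<close> acts on \<open>th v\<close> once. The two sums
  with \<open>Xg\<close> agree by \<open>casimir_flip\<close>, whence the coefficient 2, which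
  compensates the -2 in \<open>DD2_th\<close>.\<close>

lemma Cas_th:
  assumes v: "v : gr b"
  shows "Cas * th v = th v * Cas + sr 2 (SUM k:Bg. Xg (dug k) * th (act k v)) +
    (SUM k:Bg. sr (eps (dgg k) b) (th (act (dug k) v) * pis k) + pis (dug k) * th (act k v))"
proof -
  have one: "(Dl (dug k) * Dl k) * th v = th v * (Dl (dug k) * Dl k) +
      (sr (eps (dgg k) (dgg k)) (Xg k * th (act (dug k) v)) + Xg (dug k) * th (act k v) +
       (sr (eps (dgg k) b) (th (act (dug k) v) * pis k) + pis (dug k) * th (act k v)))" if k: "k : Bg" for k
  proof -
    note x = G.basis_gr[OF k] and y = G.du_gr[OF k]
    have "(Dl (dug k) * Dl k) * th v = sr (eps (dgg k) b) ((Dl (dug k) * th v) * Dl k) + Dl (dug k) * th (act k v)"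
      using Dl_th[OF x v] by (simp add: r_simps mult.assoc)
    also have "... = th v * (Dl (dug k) * Dl k) + (sr (eps (dgg k) b) (th (act (dug k) v) * Dl k) + Dl (dug k) * th (act k v))"
      unfolding Dl_th[OF y v] by (simp add: r_simps mult.assoc eps_minus_l)
    also have "th (act (dug k) v) * Dl k = sr (eps (b - dgg k) (dgg k)) (Xg k * th (act (dug k) v)) + th (act (dug k) v) * pis k"
      using XX_th[OF act_gr[OF y v] gt_g[OF x]] by (simp add: Dl_def r_simps)
    finally have eq: "Dl (dug k) * Dl k * th v = th v * (Dl (dug k) * Dl k) + (sr (eps (dgg k) b)
        (sr (eps (b - dgg k) (dgg k)) (Xg k * th (act (dug k) v)) + th (act (dug k) v) * pis k) + Dl (dug k) * th (act k v))" .
    have "eps (dgg k) b * eps (b - dgg k) (dgg k) = eps (dgg k) (dgg k)" by (simp add: eps_all)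
    thus ?thesis unfolding eq by (simp add: r_simps Dl_def[of "dug k"])
  qed
  have flip: "(SUM k:Bg. sr (eps (dgg k) (dgg k)) (Xg k * th (act (dug k) v))) = (SUM k:Bg. Xg (dug k) * th (act k v))"
    using G.casimir_flip[OF bil_mult[OF linear_Xg linear_th_act[of v]]] by simp
  have "Cas * th v = th v * Cas + ((SUM k:Bg. sr (eps (dgg k) (dgg k)) (Xg k * th (act (dug k) v))) + (SUM k:Bg. Xg (dug k) * th (act k v)) +
     (SUM k:Bg. sr (eps (dgg k) b) (th (act (dug k) v) * pis k) + pis (dug k) * th (act k v)))"
    unfolding Cas_def sum_distrib_left sum_distrib_right sum.distrib[symmetric] by (rule sum.cong[OF refl one])
  thus ?thesis unfolding flip using r.scale_left_distrib[of 1 1] by (simp add: add_ac)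
qed

lemma tb_bilinear: "bilinear_map st st st tb"
  using tilde by (simp add: colour_lie_algebra_def)

lemma tb_scale_r: "tb x (st c y) = st c (tb x y)" and tb_scale_l: "tb (st c y) x = st c (tb y x)"
  using tb_bilinear unfolding bilinear_map_def lin_iff by blast+

lemma tb_add_r: "tb x (y + y') = tb x y + tb x y'" and tb_add_l: "tb (y + y') x = tb y x + tb y' x"
  using tb_bilinear unfolding bilinear_map_def lin_iff by blast+

lemma tilde_jacobi:
  assumes "p : gt a" "q : gt b" "t : gt c"
  shows "tb p (tb q t) = tb (tb p q) t + st (eps a b) (tb q (tb p t))"
proof -
  interpret T: graded_space st gt using tilde by (simp add: colour_lie_algebra_def)
  have tgr: "tb x y : gt (i + j)" if "x : gt i" "y : gt j" for x y i j
    using tilde that unfolding colour_lie_algebra_def by blast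
  have anti: "tb x y = - st (eps i j) (tb y x)" if "x : gt i" "y : gt j" for x y i j
    using tilde that unfolding colour_lie_algebra_def by blast
  have jac: "st (eps c a) (tb p (tb q t)) + st (eps a b) (tb q (tb t p)) + st (eps b c) (tb t (tb p q)) = 0"
    using tilde assms unfolding colour_lie_algebra_def by blast
  have m: "tb x (- y) = - tb x y" for x y using tb_scale_r[of x "- 1" y] by simp
  have 1: "tb q (tb t p) = - st (eps c a) (tb q (tb p t))" unfolding anti[OF assms(3,1)] by (simp add: tb_scale_r m)
  have 2: "tb t (tb p q) = - st (eps c (a + b)) (tb (tb p q) t)" by (rule anti[OF assms(3) tgr[OF assms(1,2)]])
  have e: "eps a c * (eps b c * eps c (a + b)) = 1" by (simp flip: eps_add_l mult.assoc)
  have "st (eps a c) (st (eps c a) (tb p (tb q t)) + st (eps a b) (tb q (tb t p)) + st (eps b c) (tb t (tb p q))) =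
     tb p (tb q t) - st (eps a b) (tb q (tb p t)) - tb (tb p q) t"
    unfolding 1 2 using e by (simp add: T.scale_right_distrib T.scale_right_diff_distrib mult.assoc mult.left_commute)
  hence "tb p (tb q t) - st (eps a b) (tb q (tb p t)) - tb (tb p q) t = 0"
    unfolding jac by simp
  thus ?thesis by (simp add: algebra_simps)
qed

lemma tb_Vg: "v : gr a ==> x : gg b ==> tb (0, v) (x, 0) = (0, - s (eps a b) (act x v))"
proof -
  assume v: "v : gr a" and x: "x : gg b"
  have "tb (0, v) (x, 0) = - st (eps a b) (tb (x, 0) (0, v))"
    using tilde gt_v[OF v] gt_g[OF x] unfolding colour_lie_algebra_def by blast
  thus ?thesis by (simp add: tb_gV dsum_scale_def)
qed

lemma mu_gr: "v : gr a ==> w : gr b ==> mu v w : gg (a + b)"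
proof -
  assume v: "v : gr a" and w: "w : gr b"
  have "tb (0, v) (0, w) : gt (a + b)"
    using tilde gt_v[OF v] gt_v[OF w] unfolding colour_lie_algebra_def by blast
  thus ?thesis by (simp add: tb_VV dsum_grading_def)
qed

text \<open>The \<open>V\<close>-component of the Jacobi identity for three elements of
  \<open>V\<close>: the joint condition on \<open>phi\<close> and the moment map that makes
  \<open>Yv\<close> vanish.\<close>

lemma jacobi_VVV:
  assumes v: "v : gr a" and w: "w : gr b" and u: "u : gr c"
  shows "phi v (phi w u) - s (eps a b) (phi w (phi v u)) =
    act (mu v w) u + phi (phi v w) u + (s (eps a (b + c)) (act (mu w u) v) - s (eps b c) (act (mu v u) w))"
proof -
  have 1: "snd (tb (0, x) (y, z)) = - s (eps i j) (act y x) + phi x z" if "x : gr i" "y : gg j" for x y z i j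
    using tb_add_r[of "(0, x)" "(y, 0)" "(0, z)"] tb_Vg[OF that] by (simp add: tb_VV)
  have 2: "snd (tb (y, z) (0, x)) = act y x + phi z x" for x y z
    using tb_add_l[of "(y, 0)" "(0, z)" "(0, x)"] by (simp add: tb_VV tb_gV)
  have "snd (tb (0, v) (tb (0, w) (0, u))) = snd (tb (tb (0, v) (0, w)) (0, u)) + s (eps a b) (snd (tb (0, w) (tb (0, v) (0, u))))"
    using arg_cong[OF tilde_jacobi[OF gt_v[OF v] gt_v[OF w] gt_v[OF u]], of snd] by (simp add: dsum_scale_def)
  hence "- s (eps a (b + c)) (act (mu w u) v) + phi v (phi w u) =
     act (mu v w) u + phi (phi v w) u + (s (eps a b) (- s (eps b (a + c)) (act (mu v u) w) + phi w (phi v u)))"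
    by (simp only: tb_VV 1[OF v mu_gr[OF w u]] 1[OF w mu_gr[OF v u]] 2)
  thus ?thesis by (simp add: eps_add_r scale_right_distrib algebra_simps)
qed

lemma CC_Yv:
  assumes v: "v : gr b"
  shows "Yv b v : CC False b"
proof -
  have 1: "psi * qq (phi v) : CC False b" "qq (phi v) * psi : CC False b"
    using CC_mult[OF CC_psi CC_qq[OF phi_so[OF v]]] CC_mult[OF CC_qq[OF phi_so[OF v]] CC_psi] by simp_all
  have 2: "sr (eps (dgg k) b) (th (act (dug k) v) * pis k) + pis (dug k) * th (act k v) : CC False b" if k: "k : Bg" for k
  proof -
    note x = G.basis_gr[OF k] and y = G.du_gr[OF k]
    have "th (act (dug k) v) * pis k : CC False b" "pis (dug k) * th (act k v) : CC False b"
      using CC_mult[OF CC_th[OF act_gr[OF y v]] CC_qq[OF act_so[OF x]]] CC_mult[OF CC_qq[OF act_so[OF y]] CC_th[OF act_gr[OF x v]]] by simp_all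
    thus ?thesis by (intro r.subspace_add[OF CC_subspace] r.subspace_scale[OF CC_subspace])
  qed
  have "sr 2 (psi * qq (phi v) - qq (phi v) * psi) : CC False b"
    by (intro r.subspace_scale[OF CC_subspace] r.subspace_diff[OF CC_subspace] 1)
  moreover have "(SUM k:Bg. sr (eps (dgg k) b) (th (act (dug k) v) * pis k) + pis (dug k) * th (act k v)) : CC False b"
    by (rule r.subspace_sum[OF CC_subspace 2])
  ultimately show ?thesis unfolding Yv_def by (rule r.subspace_add[OF CC_subspace])
qed

lemma moment_contract_right:
  assumes v: "v : gr b" and w: "w : gr c" and F: "lin sg sr F"
    and f: "!!k e. k : Bg ==> e : B ==> dg e = dgg k + c ==> f e = f' k"
  shows "(SUM e:B. sr (f e) (F (mu w (du e)) * th e)) = (SUM k:Bg. sr (f' k) (F (dug k) * th (act k w)))"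
proof -
  let ?A = "%e k. sr (f e) (sr (form (act k w) (du e)) (F (dug k)) * th e)"
  let ?B = "%e k. sr (f' k) (F (dug k) * sr (form (act k w) (du e)) (th e))"
  have F_mu: "F (mu w u) = (SUM k:Bg. sr (form (act k w) u) (F (dug k)))" for u
    using G.linear_apply_sum[OF F] by (simp add: mu_expand)
  have one: "?A e k = ?B e k"
    if e: "e : B" and k: "k : Bg" for e k
  proof (cases "form (act k w) (du e) = 0")
    case False
    hence "dg e = dgg k + c" using form_nz_deg[OF act_gr[OF G.basis_gr[OF k] w] du_gr[OF e]] by simp
    thus ?thesis using f[OF k e] by (simp add: r_simps)
  qed simp
  have "(SUM e:B. sr (f e) (F (mu w (du e)) * th e)) =
      (SUM e:B. SUM k:Bg. ?A e k)"
    by (simp only: F_mu sum_distrib_right r.scale_sum_right)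
  also have "... = (SUM e:B. SUM k:Bg. ?B e k)"
    by (intro sum.cong refl one)
  also have "... = (SUM k:Bg. SUM e:B. ?B e k)" by (rule sum.swap)
  also have "... = (SUM k:Bg. sr (f' k) (F (dug k) * th (act k w)))"
    by (simp only: r.scale_sum_right[symmetric] sum_distrib_left[symmetric] th_expand)
  finally show ?thesis .
qed

text \<open>The anticommutator of \<open>Yv b v\<close> with \<open>th w\<close> is a combination of
  \<open>qq\<close> terms and the quadratic sums \<open>P\<close> and \<open>Q\<close>. The part of
  \<open>C\<close> yields \<open>4 qq (phi (phi v w)) - 4 qq f\<close>, the Casimir part yields
  \<open>4 pis (mu v w) + (P - Q)\<close>, and by the Jacobi identity these are opposite to each
  other.\<close>

lemma Yv_th:
  assumes v: "v : gr b" and w: "w : gr c"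
  shows "Yv b v * th w + sr (eps b c) (th w * Yv b v) = 0"
proof -
  let ?m = "%k. sr (2 * (eps (dgg k) (b + c) * form (act (dug k) v) w)) (pis k)"
  let ?m' = "%k. sr (2 * form (act k v) w) (pis (dug k))"
  let ?p = "%k. sr (eps (dgg k) b) (th (act (dug k) v) * th (act k w))"
  let ?q = "%k. sr (eps (dgg k + b) c) (th (act (dug k) w) * th (act k v))"
  let ?x = "%e. sr (eps b (c - dg e)) (th (act (mu w (du e)) v) * th e)"
  let ?y = "%e. sr (eps (dg e) c) (th (act (mu v (du e)) w) * th e)"
  let ?u = "%k. th (act (dug k) v) * pis k"
  define C where "C = psi * qq (phi v) - qq (phi v) * psi"
  define f where "f u = phi v (phi w u) - s (eps b c) (phi w (phi v u))" for u
  define z where "z k = sr (eps (dgg k) b) (?u k) + pis (dug k) * th (act k v)" for k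
  have C: "C * th w + sr (eps b c) (th w * C) = sr 2 (qq (phi (phi v w))) - sr 2 (qq f)"
  proof -
    have q: "qq (phi v) * th w = sr (eps b c) (th w * qq (phi v)) + th (phi v w)" by (rule qq_th[OF phi_so[OF v] w])
    have q': "qq (phi v) * (th w * x) = sr (eps b c) (th w * (qq (phi v) * x)) + th (phi v w) * x" for x
      using q by (simp add: r_simps flip: mult.assoc)
    have p: "psi * th u = sr 2 (qq (phi u)) - th u * psi" if "u : gr i" for u i by (rule psi_th'[OF that])
    have p': "psi * (th w * x) = sr 2 (qq (phi w) * x) - th w * (psi * x)" for x
      using p[OF w] by (simp add: r_simps flip: mult.assoc)
    have qq: "qq (phi v) * qq (phi w) = sr (eps b c) (qq (phi w) * qq (phi v)) + qq f"
      using qq_qq[OF phi_so[OF v] phi_so[OF w]] by (simp add: f_def[abs_def])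
    show ?thesis unfolding C_def
      by (simp add: r_simps mult.assoc q q' p[OF w] p' p[OF phi_gr[OF v w]] qq mult.left_commute[where 'a='k])
  qed
  have z: "z k * th w + sr (eps b c) (th w * z k) =
      ?m k + ?m' k +
      (?p k - ?q k)"
    if k: "k : Bg" for k
  proof -
    note x = G.basis_gr[OF k] and y = G.du_gr[OF k]
    have 1: "th (act (dug k) v) * pis k * th w + sr (eps b c) (th w * (?u k)) =
        sr (2 * (eps (dgg k) c * form (act (dug k) v) w)) (pis k) + th (act (dug k) v) * th (act k w)"
    proof -
      have "th (act (dug k) v) * pis k * th w = sr (eps (dgg k) c) ((th (act (dug k) v) * th w) * pis k) + th (act (dug k) v) * th (act k w)"
        using qq_th[OF act_so[OF x] w] by (simp add: mult.assoc r_simps)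
      also have "th (act (dug k) v) * th w = sr (2 * form (act (dug k) v) w) ee - sr (eps (b - dgg k) c) (th w * th (act (dug k) v))"
        using th_rel[OF act_gr[OF y v] w] by simp
      finally show ?thesis by (simp add: r_simps mult.assoc eps_diff mult.left_commute[where 'a='k] mult.commute[where 'a='k])
    qed
    have 2: "pis (dug k) * th (act k v) * th w + sr (eps b c) (th w * (pis (dug k) * th (act k v))) =
        ?m' k - ?q k"
    proof -
      have "pis (dug k) * th (act k v) * th w = ?m' k - sr (eps (dgg k + b) c) ((pis (dug k) * th w) * th (act k v))"
        using th_rel[OF act_gr[OF x v] w] by (simp add: mult.assoc r_simps)
      also have "pis (dug k) * th w = sr (eps (- dgg k) c) (th w * pis (dug k)) + th (act (dug k) w)"
        by (rule qq_th[OF act_so[OF y] w])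
      finally show ?thesis by (simp add: r_simps mult.assoc eps_all mult.left_commute[where 'a='k] mult.commute[where 'a='k])
    qed
    have "z k * th w + sr (eps b c) (th w * z k) = sr (eps (dgg k) b) (th (act (dug k) v) * pis k * th w + sr (eps b c) (th w * (?u k)))
      + (pis (dug k) * th (act k v) * th w + sr (eps b c) (th w * (pis (dug k) * th (act k v))))"
      unfolding z_def by (simp add: r_simps mult.assoc mult.commute[where 'a='k])
    thus ?thesis unfolding 1 2 by (simp add: r_simps eps_add_r mult_ac)
  qed
  have A: "(SUM k:Bg. ?m' k) = sr 2 (pis (mu v w))"
    by (simp only: mu_expand G.linear_apply_sum[OF linear_pis] r.scale_sum_right r.scale_scale)
  \<comment> \<open>A nonzero summand forces \<open>dgg k = b + c\<close>. The commutation factor is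
    then the one in \<open>casimir_flip\<close>, and the sum agrees with that of
    \<open>A\<close>.\<close>
  have A': "(SUM k:Bg. ?m k) = sr 2 (pis (mu v w))"
  proof -
    have M: "bilinear_map sg sg sr (%y x. sr (form (act x v) w) (pis y))"
      using G.vector_space_axioms r.vector_space_axioms
      by (auto simp: bilinear_map_def lin_iff pis_add pis_scale act_add act_scale form_add_l form_scale_l r_simps r.scale_left_distrib mult_ac)
    have "?m k = sr 2 (sr (eps (dgg k) (dgg k)) (sr (form (act (dug k) v) w) (pis k)))"
      if k: "k : Bg" for k
    proof (cases "form (act (dug k) v) w = 0")
      case False
      hence "- dgg k + b = - c" using form_nz_deg[OF act_gr[OF G.du_gr[OF k] v] w] by simp
      hence "b + c = dgg k" by (simp add: algebra_simps)
      thus ?thesis by simp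
    qed simp
    hence "(SUM k:Bg. ?m k) =
        sr 2 (SUM k:Bg. sr (eps (dgg k) (dgg k)) (sr (form (act (dug k) v) w) (pis k)))"
      unfolding r.scale_sum_right by (rule sum.cong[OF refl])
    also have "... = sr 2 (SUM k:Bg. sr (form (act k v) w) (pis (dug k)))" using G.casimir_flip[OF M] by simp
    finally show ?thesis using A by (simp add: r.scale_sum_right)
  qed
  define g where "g u = phi (phi v w) u + act (mu v w) u" for u
  define P where "P = (SUM k:Bg. ?p k)"
  define Q where "Q = (SUM k:Bg. ?q k)"
  \<comment> \<open>The Jacobi identity at \<open>u = du e\<close>, multiplied by
    \<open>th e\<close> and summed over the basis. The factors 4 in \<open>F\<close> undo the 1/4 in
    \<open>qq\<close>.\<close>
  have "(SUM e:B. th (f (du e)) * th e) = (SUM e:B. th (act (mu v w) (du e)) * th e) + (SUM e:B. th (phi (phi v w) (du e)) * th e) +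
      ((SUM e:B. ?x e) - (SUM e:B. ?y e))"
    unfolding sum.distrib[symmetric] sum_subtractf[symmetric]
  proof (rule sum.cong[OF refl])
    fix e assume e: "e : B"
    show "th (f (du e)) * th e = th (act (mu v w) (du e)) * th e + th (phi (phi v w) (du e)) * th e +
      (?x e - ?y e)"
      using jacobi_VVV[OF v w du_gr[OF e]] by (simp add: f_def th_add th_diff th_scale r_simps eps_minus_r)
  qed
  also have "(SUM e:B. ?x e) = P"
    unfolding P_def by (rule moment_contract_right[OF v w linear_th_act]) (simp add: eps_minus_r)
  also have "(SUM e:B. ?y e) = Q"
    unfolding Q_def by (rule moment_contract_right[OF w v linear_th_act]) simp
  finally have F: "sr 4 (qq f) = sr 4 (pis (mu v w)) + sr 4 (qq (phi (phi v w))) + (P - Q)"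
    by (simp add: qq_def)
  have Y: "Yv b v = sr 2 C + (SUM k:Bg. z k)" by (simp add: Yv_def C_def z_def)
  have "Yv b v * th w + sr (eps b c) (th w * Yv b v) = sr 2 (C * th w + sr (eps b c) (th w * C)) + (SUM k:Bg. z k * th w + sr (eps b c) (th w * z k))"
    unfolding Y by (simp add: r_simps sum.distrib mult_ac)
  also have "(SUM k:Bg. z k * th w + sr (eps b c) (th w * z k)) =
      (SUM k:Bg. ?m k) + (SUM k:Bg. ?m' k) + (P - Q)"
    unfolding P_def Q_def sum.distrib[symmetric] sum_subtractf[symmetric] by (rule sum.cong[OF refl z])
  finally show ?thesis unfolding C A A' using F r.scale_left_distrib[of 2 2] by (simp add: r_simps)
qed

lemma Yv_zero: "v : gr b ==> Yv b v = 0"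
proof -
  assume v: "v : gr b"
  have *: "Yv b v * th e = - sr (eps b (dg e)) (th e * Yv b v)" if "e : B" for e
    using Yv_th[OF v basis_gr[OF that]] by (simp add: eq_neg_iff_add_eq_0)
  show ?thesis by (rule odd_centralizer_zero[OF CC_Yv[OF v]]) (simp add: *)
qed

section \<open>Centrality of the square corrected by the Casimir element\<close>

definition RR :: 'r where "RR = DD * DD + Cas"

lemma RR_th: "v : gr b ==> RR * th v = th v * RR"
  using DD2_th Cas_th[of v b] Yv_zero[of v b] by (simp add: RR_def Yv_def r_simps mult.assoc)

lemma Dl_Cas:
  assumes x: "x : gg a"
  shows "Dl x * Cas = Cas * Dl x"
proof -
  have one: "Dl x * (Dl (dug k) * Dl k) = (Dl (dug k) * Dl k) * Dl x + (Dl (brg x (dug k)) * Dl k + sr (eps (dgg k) a) (Dl (dug k) * Dl (brg x k)))"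
    if k: "k : Bg" for k
  proof -
    have "Dl x * (Dl (dug k) * Dl k) = (Dl x * Dl (dug k)) * Dl k" by (simp add: mult.assoc)
    also have "... = sr (eps (dgg k) a) (Dl (dug k) * (Dl x * Dl k)) + Dl (brg x (dug k)) * Dl k"
      unfolding Dl_Dl[OF x G.du_gr[OF k]] by (simp add: r_simps mult.assoc eps_minus_r)
    finally show ?thesis unfolding Dl_Dl[OF x G.basis_gr[OF k]] by (simp add: r_simps mult.assoc add_ac)
  qed
  have "Dl x * Cas = Cas * Dl x + ((SUM k:Bg. Dl (brg x (dug k)) * Dl k) + (SUM k:Bg. sr (eps (dgg k) a) (Dl (dug k) * Dl (brg x k))))"
    unfolding Cas_def sum_distrib_left sum_distrib_right sum.distrib[symmetric] by (rule sum.cong[OF refl one])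
  thus ?thesis using G.casimir_invariant[OF bil_mult[OF linear_Dl linear_Dl] brg_so[OF x]] by simp
qed

lemma DD_Cas: "DD * Cas = Cas * DD"
proof -
  have "DD * (Dl (dug k) * Dl k) = (Dl (dug k) * Dl k) * DD" if "k : Bg" for k
    using Dl_DD[OF G.basis_gr[OF that]] Dl_DD[OF G.du_gr[OF that]] by (metis mult.assoc)
  thus ?thesis unfolding Cas_def sum_distrib_left sum_distrib_right by (rule sum.cong[OF refl])
qed

text \<open>A subalgebra without a claim about the unit. It contains \<open>th v\<close>, D and
  \<open>Dl x\<close>, hence \<open>Xv v\<close> by \<open>DD_th\<close> and \<open>Xg x\<close> as
  the difference of \<open>Dl x\<close> and a Clifford element, so all generators.\<close>

definition commutant :: "'r set" where "commutant = {a. RR * a = a * RR}"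

lemma commutant_subspace: "r.subspace commutant"
  by (auto simp: commutant_def r.subspace_def r_simps)

lemma commutant_mult: "a : commutant ==> b : commutant ==> a * b : commutant"
  by (simp add: commutant_def) (metis mult.assoc)

lemma commutant_Dl: "x : gg a ==> Dl x : commutant"
proof -
  assume x: "x : gg a"
  have "Dl x * (DD * y) = DD * (Dl x * y)" for y using Dl_DD[OF x] by (simp flip: mult.assoc)
  thus ?thesis using Dl_DD[OF x] Dl_Cas[OF x] by (simp add: commutant_def RR_def r_simps mult.assoc)
qed

lemma commutant_DD: "DD : commutant"
  using DD_Cas by (simp add: commutant_def RR_def r_simps mult.assoc)

lemma commutant_th: "v : gr b ==> th v : commutant"
  using RR_th[of v b] by (simp add: commutant_def)

lemma commutant_qq: "so a f ==> qq f : commutant"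
  unfolding qq_def
proof (intro r.subspace_scale[OF commutant_subspace] r.subspace_sum[OF commutant_subspace])
  fix b assume f: "so a f" and b: "b : B"
  show "th (f (du b)) * th b : commutant"
    by (rule commutant_mult[OF commutant_th[OF so_gr[OF f du_gr[OF b]]] commutant_th[OF basis_gr[OF b]]])
qed

lemma commutant_Xv: "v : gr b ==> Xv v : commutant"
proof -
  assume v: "v : gr b"
  have "Xv v = sr (1/2) (DD * th v + th v * DD) - qq (phi v)"
    unfolding DD_th[OF v] by (simp add: r_simps)
  also have "... : commutant"
    by (intro r.subspace_diff[OF commutant_subspace] r.subspace_scale[OF commutant_subspace] r.subspace_add[OF commutant_subspace]
      commutant_mult commutant_DD commutant_th[OF v] commutant_qq[OF phi_so[OF v]])
  finally show ?thesis .
qed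

lemma commutant_XX: "p : gt a ==> XX p : commutant"
proof -
  assume "p : gt a"
  then obtain x v where p: "p = (x, v)" "x : gg a" "v : gr a" by (auto simp: dsum_grading_def)
  have "Dl x - qq (act x) : commutant"
    by (intro r.subspace_diff[OF commutant_subspace] commutant_Dl[OF p(2)] commutant_qq[OF act_so[OF p(2)]])
  hence "Xg x : commutant" by (simp add: Dl_def)
  thus ?thesis unfolding p(1) XX_split[of x v] by (intro r.subspace_add[OF commutant_subspace] commutant_Xv[OF p(3)])
qed

end

section \<open>The contracting homotopy\<close>

context pbw
begin

lemma psub_linear:
  assumes "lin sz sz L"
  shows "L (psub dl d F w) = psub dl d (%w. L (F w)) w"
proof -
  have a: "L (x + y) = L x + L y" and m: "L (sz c x) = sz c (L x)" for x y c
    using assms by (simp_all add: lin_iff)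
  have sm: "L (SUM i:X. f i) = (SUM i:X. L (f i))" for X and f :: "'l => 'z"
    by (induction X rule: fin_induct) (use a m[of 0 0] in auto)
  show ?thesis by (induction w arbitrary: F) (use m[of 0 0] in \<open>simp_all add: psub_Cons a m sm\<close>)
qed

lemma psub_add: "psub dl d (%w. F w + F' w) w = psub dl d F w + psub dl d F' w"
  by (induction w arbitrary: F F') (simp_all add: psub_Cons z.scale_right_distrib sum.distrib add_ac)

lemma psub_cong:
  "w : lists B ==> (!!v. v : lists B ==> F v = F' v) ==> psub dl d F w = psub dl d F' w"
proof (induction w arbitrary: F F')
  case (Cons b w)
  hence "psub dl d (%w'. F (b # w')) w = psub dl d (%w'. F' (b # w')) w" by (intro Cons.IH) auto
  moreover have "(SUM c:B. sz (co (dl b) c) (F (c # w))) = (SUM c:B. sz (co (dl b) c) (F' (c # w)))"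
    using Cons.prems by (intro sum.cong refl) auto
  ultimately show ?case by (simp add: psub_Cons)
qed simp

end

context dirac_rep
begin

definition Bt :: "('g * 'v) set" where "Bt = (%x. (x, 0)) ` Bg \<union> (%v. (0, v)) ` B"
text \<open>The test on the second component identifies the origin of a basis vector, because
  members of \<open>B\<close> are nonzero.\<close>

definition cot :: "'g * 'v => 'g * 'v => 'k" where
  "cot p b = (if snd b = 0 then cog (fst p) (fst b) else co (snd p) (snd b))"
definition dgt :: "'g * 'v => 'c" where
  "dgt b = (if snd b = 0 then dgg (fst b) else dg (snd b))"

lemma B_nz: "b : B ==> b ~= 0"
  using co_basis[of b b] co_zero[of b] by auto

lemma Bt_cases:
  assumes "b : Bt"
  obtains (g) x where "b = (x, 0)" "x : Bg" | (v) v where "b = (0, v)" "v : B" "v ~= 0"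
  using assms B_nz unfolding Bt_def by blast

lemma sum_Bt: "(SUM b:Bt. F b) = (SUM x:Bg. F (x, 0)) + (SUM v:B. F (0, v))"
proof -
  have "(%x. (x, 0)) ` Bg \<inter> (%v. (0, v)) ` B = {}" using B_nz by auto
  hence "(SUM b:Bt. F b) = (SUM b:(%x. (x, 0)) ` Bg. F b) + (SUM b:(%v. (0, v)) ` B. F b)"
    unfolding Bt_def using finite_B G.finite_B by (intro sum.union_disjoint) auto
  thus ?thesis by (simp add: sum.reindex inj_on_def)
qed

lemma sum_cot: "(SUM b:Bt. sz (cot p b) (F b)) = (SUM x:Bg. sz (cog (fst p) x) (F (x, 0))) + (SUM v:B. sz (co (snd p) v) (F (0, v)))"
  unfolding sum_Bt cot_def using B_nz by (simp cong: sum.cong)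

lemma basis_gt: "b : Bt ==> b : gt (dgt b)"
  by (erule Bt_cases) (auto simp: dgt_def gt_g gt_v G.basis_gr basis_gr)

lemma gt_cot: "p : gt a ==> b : Bt ==> cot p b ~= 0 ==> dgt b = a"
  by (erule Bt_cases) (auto simp: dgt_def cot_def dsum_grading_def intro: G.gr_co gr_co)

lemma sum_pair: "(SUM i:X. (f i, g i)) = (sum f X, sum g X)"
  by (induction X rule: fin_induct) (auto simp: zero_prod_def)

sublocale T0: lie_basis st Bt cot dgt eps tb
proof -
  interpret T: graded_space st gt using tilde by (simp add: colour_lie_algebra_def)
  show "lie_basis st Bt cot dgt eps tb"
  proof unfold_locales
    show "finite Bt" using finite_B G.finite_B by (simp add: Bt_def)
    show "cot (v + w) b = cot v b + cot w b" for v w b by (simp add: cot_def co_add G.co_add)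
    show "cot (st c v) b = c * cot v b" for c v b by (simp add: cot_def dsum_scale_def co_scale G.co_scale)
    show "cot b b' = (if b = b' then 1 else 0)" if "b : Bt" "b' : Bt" for b b'
      using that by (elim Bt_cases) (auto simp: cot_def co_basis G.co_basis)
    show "v = (SUM b:Bt. st (cot v b) b)" for v
      using co_expand[of "snd v"] G.co_expand[of "fst v"]
      by (cases v) (simp add: sum_cot dsum_scale_def sum_pair)
    show "commutation_factor eps" by (rule comm_factor)
    show "bilinear_map st st st tb" by (rule tb_bilinear)
    show "dgt b = dgt x + dgt y" if "x : Bt" "y : Bt" "b : Bt" "cot (tb x y) b ~= 0" for x y b
    proof -
      have "tb x y : gt (dgt x + dgt y)"
        using tilde basis_gt[OF that(1)] basis_gt[OF that(2)] unfolding colour_lie_algebra_def by blast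
      thus ?thesis using that gt_cot by blast
    qed
    show "tb x y = - st (eps (dgt x) (dgt y)) (tb y x)" if "x : Bt" "y : Bt" for x y
      using tilde basis_gt[OF that(1)] basis_gt[OF that(2)] unfolding colour_lie_algebra_def by blast
    show "tb x (tb y z) = tb (tb x y) z + st (eps (dgt x) (dgt y)) (tb y (tb x z))" if "x : Bt" "y : Bt" "z : Bt" for x y z
      using tilde_jacobi basis_gt that by blast
  qed
qed

definition Xw :: "('g * 'v) list => 'r" where
  "Xw w = foldr (%b p. XX b * p) w ee"

lemma Xw_simps [simp]: "Xw [] = ee" "Xw (b # w) = XX b * Xw w"
  by (simp_all add: Xw_def)

lemma ee_Xw [simp]: "ee * Xw w = Xw w" "Xw w * ee = Xw w"
  by (cases w, simp_all flip: mult.assoc) (induction w, simp_all add: mult.assoc)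

lemma Xw_append: "Xw (u @ w) = Xw u * Xw w"
  by (induction u) (simp_all add: mult.assoc)

text \<open>A Koszul-type derivation on words: letters of \<open>V\<close> are replaced by their
  Clifford generators one at a time, and letters of \<open>\<gg>\<close> contribute
  \<open>th 0 = 0\<close>. It does not respect the relations of the enveloping algebra; averaging it
  with \<open>pbw\<close> gives \<open>HH\<close>, which does.\<close>

primrec KK :: "('g * 'v) list => 'r" where
  "KK [] = 0"
| "KK (b # w) = th (snd b) * Xw w + XX b * KK w"

lemma KK_append: "KK (u @ w) = KK u * Xw w + Xw u * KK w"
proof (induction u)
  case Nil
  have "ee * KK w = KK w" by (cases w) (simp_all add: r_simps flip: mult.assoc)
  thus ?case by simp
qed (simp add: Xw_append r_simps mult.assoc)

sublocale T: pbw st Bt cot dgt eps tb sr KK ..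

lemma XX_expand: "(SUM b:Bt. sr (cot p b) (XX b)) = XX p"
  using T0.linear_apply_sum[OF XX_linear, of "cot p" "%b. b" Bt] by (simp only: T0.co_expand[of p, symmetric])

lemma th_snd_linear: "lin st sr (%p. th (snd p))"
  using XX_linear by (auto simp: lin_iff th_add th_scale dsum_scale_def)

lemma th_snd_expand: "(SUM b:Bt. sr (cot p b) (th (snd b))) = th (snd p)"
  using T0.linear_apply_sum[OF th_snd_linear, of "cot p" "%b. b" Bt] by (simp only: T0.co_expand[of p, symmetric])

abbreviation twd :: "('g * 'v) list => 'c" where "twd w == sum_list (map dgt w)"

definition mon :: "('g * 'v) list => 'v list => 'r" where "mon w u = Xw w * thw u"

lemma CC_Xw: "c : CC q a ==> w : lists Bt ==> c * Xw w = sr (eps a (twd w)) (Xw w * c)"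
proof (induction w)
  case Nil
  thus ?case using ee_CC by simp
next
  case (Cons b w)
  hence b: "b : Bt" "w : lists Bt" and IH: "c * Xw w = sr (eps a (twd w)) (Xw w * c)" by auto
  have "c * Xw (b # w) = (c * XX b) * Xw w" by (simp add: mult.assoc)
  also have "... = sr (eps a (dgt b)) (XX b * (c * Xw w))"
    unfolding CC_XX[OF Cons.prems(1) basis_gt[OF b(1)]] by (simp add: r_simps mult.assoc)
  finally show ?case unfolding IH by (simp add: r_simps mult.assoc eps_add_r)
qed

lemma mon_mult:
  assumes "u : lists B" "w' : lists Bt"
  shows "mon w u * mon w' u' = sr (eps (wdg u) (twd w')) (mon (w @ w') (u @ u'))"
proof -
  have "mon w u * mon w' u' = Xw w * ((thw u * Xw w') * thw u')" by (simp add: mon_def mult.assoc)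
  thus ?thesis unfolding CC_Xw[OF CC_thw[OF assms(1)] assms(2)]
    by (simp add: mon_def r_simps mult.assoc Xw_append thw_append)
qed

text \<open>The algebra, its homogeneous components, its filtrations and the part with enveloping
  letters from \<open>\<gg>\<close> are all of this form for suitable \<open>P\<close>, so one
  product rule \<open>ms_mult\<close> serves them all. The monomials are only known to span.\<close>

definition ms :: "(('g * 'v) list => 'v list => bool) => 'r set" where
  "ms P = r.span {mon w u | w u. w : lists Bt & u : lists B & P w u}"

lemma ms_subspace: "r.subspace (ms P)" by (simp add: ms_def)

lemmas ms_add = r.subspace_add[OF ms_subspace]
lemmas ms_diff = r.subspace_diff[OF ms_subspace]
lemmas ms_scale = r.subspace_scale[OF ms_subspace]
lemmas ms_sum = r.subspace_sum[OF ms_subspace]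
lemmas ms_0 = r.subspace_0[OF ms_subspace]

lemma ms_mon: "w : lists Bt ==> u : lists B ==> P w u ==> mon w u : ms P"
  unfolding ms_def by (rule r.span_base) blast

lemma ms_mono: "(!!w u. w : lists Bt ==> u : lists B ==> P w u ==> P' w u) ==> ms P <= ms P'"
  unfolding ms_def by (intro r.span_mono) blast

lemma ms_induct [consumes 1, case_names subspace mon]:
  assumes "a : ms P" "r.subspace {a. Q a}" "!!w u. w : lists Bt ==> u : lists B ==> P w u ==> Q (mon w u)"
  shows "Q a"
proof -
  have "a : {a. Q a}"
    using assms(1) unfolding ms_def by (rule r.span_induct[where P = "%x. x : {a. Q a}"]) (use assms(2,3) in auto)
  thus ?thesis by simp
qed

lemma linear_vimage_subspace:
  "lin sr sr F ==> r.subspace X ==> r.subspace {a. F a : X}"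
  using lin_iff[of sr sr F] r.scale_zero_left[of 0]
  by (auto simp: r.subspace_def) (metis r.scale_zero_left)

lemma linear_mult_right: "lin sr sr (%x. x * c)" and linear_mult_left: "lin sr sr (%x. c * x)"
  using r.vector_space_axioms by (auto simp: lin_iff r_simps)

lemma ms_mult:
  assumes P: "!!w u w' u'. w : lists Bt ==> u : lists B ==> w' : lists Bt ==> u' : lists B ==> P w u ==> P' w' u' ==> Q (w @ w') (u @ u')"
    and a: "a : ms P" and b: "b : ms P'"
  shows "a * b : ms Q"
  using a
proof (induction rule: ms_induct)
  case subspace
  thus ?case by (rule linear_vimage_subspace[OF linear_mult_right ms_subspace])
next
  case wu: (mon w u)
  from b show ?case
  proof (induction rule: ms_induct)
    case subspace
    thus ?case by (rule linear_vimage_subspace[OF linear_mult_left ms_subspace])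
  next
    case (mon w' u')
    thus ?case using wu P unfolding mon_mult[OF wu(2) mon(1)] by (intro ms_scale ms_mon) auto
  qed
qed

abbreviation AA :: "'r set" where "AA == ms (%w u. True)"
abbreviation hom :: "bool => 'c => 'r set" where
  "hom q a == ms (%w u. even (length u) = q & twd w + wdg u = a)"
text \<open>The bound is strict: \<open>Gs (Suc n)\<close> is filtration degree n,
  \<open>Gs 0\<close> is zero, and Clifford elements lie in \<open>Gs (Suc 0)\<close>, their letters
  not being counted. This explains the shift in \<open>Gs_mult\<close>.\<close>

abbreviation Gs :: "nat => 'r set" where "Gs n == ms (%w u. length w < n)"
abbreviation Cl :: "'r set" where "Cl == r.span (thw ` lists B)"

lemma ms_AA: "ms P <= AA" by (rule ms_mono) simp

lemma AA_mult: "a : AA ==> b : AA ==> a * b : AA" by (rule ms_mult[of "%_ _. True" "%_ _. True"]) auto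

lemma hom_mult: "a : hom q i ==> b : hom q' j ==> a * b : hom (q = q') (i + j)"
  by (rule ms_mult[of "%w u. even (length u) = q & twd w + wdg u = i" "%w u. even (length u) = q' & twd w + wdg u = j"]) auto

lemma Gs_mult: "a : Gs k ==> b : Gs (Suc l) ==> a * b : Gs (k + l)" "b : Gs (Suc l) ==> a : Gs k ==> b * a : Gs (k + l)"
  by (rule ms_mult[of "%w u. length w < k" "%w u. length w < Suc l"], auto)
    (rule ms_mult[of "%w u. length w < Suc l" "%w u. length w < k"], auto)

lemma Gs_mono: "k <= l ==> Gs k <= Gs l" by (rule ms_mono) simp

lemma Gs_mult': "a : Gs k ==> b : Gs (Suc l) ==> k + l <= n ==> a * b : Gs n" "b : Gs (Suc l) ==> a : Gs k ==> k + l <= n ==> b * a : Gs n"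
  using Gs_mult Gs_mono by blast+

lemma Xw_ms: "w : lists Bt ==> P w [] ==> Xw w : ms P"
  using ms_mon[of w "[]" P] by (simp add: mon_def)

lemma thw_ms: "u : lists B ==> P [] u ==> thw u : ms P"
  using ms_mon[of "[]" u P] by (simp add: mon_def)

lemma CC_hom: "c : CC q a ==> c : hom q a"
proof -
  have "CC q a <= hom q a" unfolding CC_def by (rule r.span_minimal[OF _ ms_subspace]) (auto intro!: thw_ms)
  thus "c : CC q a ==> c : hom q a" by blast
qed

lemma CC_Cl: "c : CC q a ==> c : Cl"
proof -
  have "CC q a <= Cl" unfolding CC_def by (rule r.span_mono) auto
  thus "c : CC q a ==> c : Cl" by blast
qed

lemma Cl_Gs: "c : Cl ==> c : Gs (Suc 0)"
proof -
  have "Cl <= Gs (Suc 0)" by (rule r.span_minimal[OF _ ms_subspace]) (auto intro!: thw_ms)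
  thus "c : Cl ==> c : Gs (Suc 0)" by blast
qed

lemma Cl_mult: "a : Cl ==> b : Cl ==> a * b : Cl"
proof (induction rule: r.span_induct_alt)
  case base
  thus ?case by (simp add: r.span_zero)
next
  case (step k x y)
  then obtain u where u: "x = thw u" "u : lists B" by blast
  from step.prems have "x * b : Cl"
  proof (induction rule: r.span_induct_alt)
    case (step k x' y')
    then obtain v where v: "x' = thw v" "v : lists B" by blast
    have "thw (u @ v) : Cl" using u v by (intro r.span_base) auto
    thus ?case using step u v by (simp add: thw_append r_simps r.span_add r.span_scale)
  qed (simp add: r.span_zero)
  thus ?case using step by (simp add: r_simps r.span_add r.span_scale)
qed

lemma CC_Gs: "c : CC q a ==> c : Gs (Suc 0)" by (rule Cl_Gs[OF CC_Cl])

lemma ms_XX: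
  assumes "!!b. b : Bt ==> cot p b ~= 0 ==> P [b] []"
  shows "XX p : ms P"
proof -
  have "sr (cot p b) (XX b) : ms P" if "b : Bt" for b
    using assms[OF that] Xw_ms[of "[b]" P] that by (cases "cot p b = 0") (auto intro: ms_scale ms_0)
  hence "(SUM b:Bt. sr (cot p b) (XX b)) : ms P" by (rule ms_sum)
  thus ?thesis by (simp add: XX_expand)
qed

lemma XX_hom: "p : gt a ==> XX p : hom True a"
  by (rule ms_XX) (simp add: gt_cot)

lemma XX_Gs: "XX p : Gs (Suc (Suc 0))" by (rule ms_XX) simp

lemma th_Cl: "th v : Cl"
proof -
  have "sr (form v (du b)) (th b) : Cl" if "b : B" for b
  proof (rule r.span_scale)
    have "thw [b] : Cl" using that by (intro r.span_base imageI) auto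
    thus "th b : Cl" by simp
  qed
  hence "(SUM b:B. sr (form v (du b)) (th b)) : Cl" by (rule r.span_sum)
  thus ?thesis by (simp add: th_expand)
qed

lemma th_Gs: "th v : Gs (Suc 0)" by (rule Cl_Gs[OF th_Cl])

lemma qq_Cl: "qq f : Cl"
  unfolding qq_def by (intro r.span_scale r.span_sum Cl_mult th_Cl)

lemma Dl_hom: "x : gg a ==> Dl x : hom True a"
  unfolding Dl_def by (intro ms_add XX_hom gt_g CC_hom CC_qq act_so)

lemma DD_hom: "DD : hom False 0"
  unfolding DD_def SS_def
proof (intro ms_add ms_sum CC_hom[OF CC_psi])
  fix e assume "e : B"
  thus "Xv (du e) * th e : hom False 0"
    using hom_mult[OF XX_hom[OF gt_v[OF du_gr]] CC_hom[OF CC_th[OF basis_gr]], of e e] by simp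
qed

lemma DD_Gs: "DD : Gs (Suc (Suc 0))"
  unfolding DD_def SS_def
proof (intro ms_add ms_sum)
  fix e show "Xv (du e) * th e : Gs (Suc (Suc 0))" by (rule Gs_mult'(1)[OF XX_Gs th_Gs]) simp
  show "psi : Gs (Suc (Suc 0))" using CC_Gs[OF CC_psi] Gs_mono[of "Suc 0" "Suc (Suc 0)"] by auto
qed

text \<open>A map compatible with the relations would also show the term
  \<open>Xw u * th (snd (tb x y)) * Xw v\<close>. All terms here, and the missing one, have lower
  filtration than the two words, which is the hypothesis of \<open>D_filtration\<close>.\<close>

lemma KK_rel:
  assumes "u : lists Bt" "v : lists Bt" "x : Bt" "y : Bt"
  shows "KK (u @ x # y # v) - sr (eps (dgt x) (dgt y)) (KK (u @ y # x # v)) =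
    KK u * (XX (tb x y) * Xw v) + Xw u * (XX (tb x y) * KK v)"
proof -
  have X: "XX x * XX y = sr (eps (dgt x) (dgt y)) (XX y * XX x) + XX (tb x y)"
    by (rule XX_rel[OF basis_gt[OF assms(3)] basis_gt[OF assms(4)]])
  have sx: "snd x : gr (dgt x)" "snd y : gr (dgt y)" using basis_gt[OF assms(3)] basis_gt[OF assms(4)] by (auto simp: dsum_grading_def)
  have 1: "th (snd x) * XX y = sr (eps (dgt x) (dgt y)) (XX y * th (snd x))" by (rule XX_th[OF sx(1) basis_gt[OF assms(4)]])
  have 2: "th (snd y) * XX x = sr (eps (dgt y) (dgt x)) (XX x * th (snd y))" by (rule XX_th[OF sx(2) basis_gt[OF assms(3)]])
  have X': "XX x * (XX y * z) = sr (eps (dgt x) (dgt y)) (XX y * (XX x * z)) + XX (tb x y) * z" for z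
    using X by (simp add: r_simps flip: mult.assoc)
  have r1: "th (snd x) * (XX y * z) = sr (eps (dgt x) (dgt y)) (XX y * (th (snd x) * z))" for z
    using 1 by (simp add: r_simps flip: mult.assoc)
  have r2: "th (snd y) * (XX x * z) = sr (eps (dgt y) (dgt x)) (XX x * (th (snd y) * z))" for z
    using 2 by (simp add: r_simps flip: mult.assoc)
  show ?thesis by (simp add: KK_append r_simps mult.assoc X' r1 r2)
qed

lemma KK_hom: "w : lists Bt ==> KK w : hom False (twd w)"
proof (induction w)
  case Nil
  thus ?case by (simp add: ms_0)
next
  case (Cons b w)
  hence b: "b : Bt" "w : lists Bt" by auto
  have s: "snd b : gr (dgt b)" using basis_gt[OF b(1)] by (auto simp: dsum_grading_def)
  have "Xw w : hom True (twd w)" using b by (intro Xw_ms) auto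
  hence "th (snd b) * Xw w : hom (False = True) (dgt b + twd w)" by (rule hom_mult[OF CC_hom[OF CC_th[OF s]]])
  moreover have "XX b * KK w : hom (True = False) (dgt b + twd w)"
    by (rule hom_mult[OF XX_hom[OF basis_gt[OF b(1)]] Cons.IH]) (use b in auto)
  ultimately show ?case by (auto intro: ms_add)
qed

lemma KK_Gs: "w : lists Bt ==> KK w : Gs (length w)"
proof (induction w)
  case Nil
  thus ?case by (simp add: ms_0)
next
  case (Cons b w)
  hence b: "b : Bt" "w : lists Bt" and IH: "KK w : Gs (length w)" by auto
  have "Xw w : Gs (Suc (length w))" using b by (intro Xw_ms) auto
  hence "th (snd b) * Xw w : Gs (length (b # w))" by (rule Gs_mult'(2)[OF th_Gs]) simp
  moreover have "XX b * KK w : Gs (length (b # w))" by (rule Gs_mult'(2)[OF XX_Gs IH]) simp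
  ultimately show ?case by (auto intro: ms_add)
qed

lemma Xw_Gs: "w : lists Bt ==> Xw w : Gs (Suc (length w))"
  by (rule Xw_ms) simp_all

abbreviation HH :: "('g * 'v) list => 'r" where "HH == T.D"

lemma HH_Gs:
  assumes w: "w : lists Bt"
  shows "HH w : Gs (length w)" "HH w - KK w : Gs (length w - 1)"
proof -
  have K2: "KK (u @ x # y # v) - sr (T.chi x y) (KK (u @ y # x # v)) : Gs (Suc (length u + length v))"
    if "u : lists Bt" "v : lists Bt" "x : Bt" "y : Bt" for u x y v
    unfolding KK_rel[OF that]
  proof (rule ms_add)
    have "XX (tb x y) * Xw v : Gs (Suc (Suc (length v)))" by (rule Gs_mult'(1)[OF XX_Gs Xw_Gs[OF that(2)]]) simp
    thus "KK u * (XX (tb x y) * Xw v) : Gs (Suc (length u + length v))" by (rule Gs_mult'(1)[OF KK_Gs[OF that(1)]]) simp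
    have "XX (tb x y) * KK v : Gs (Suc (length v))" by (rule Gs_mult'(2)[OF XX_Gs KK_Gs[OF that(2)]]) simp
    thus "Xw u * (XX (tb x y) * KK v) : Gs (Suc (length u + length v))" by (rule Gs_mult'(2)[OF Xw_Gs[OF that(1)]]) simp
  qed
  note fil = T.D_filtration[where Z = Gs, OF ms_subspace Gs_mono[OF le_SucI[OF order_refl]] KK_Gs K2 w]
  show "HH w : Gs (length w)" by (rule fil(1))
  \<comment> \<open>For the empty word the subtraction is truncated; there both \<open>HH\<close>
    and \<open>KK\<close> vanish.\<close>
  show "HH w - KK w : Gs (length w - 1)"
  proof (cases w)
    case Nil
    hence "HH w = 0" using fil(1) by (simp add: ms_def)
    thus ?thesis using Nil by (simp add: ms_0)
  next
    case (Cons b v)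
    thus ?thesis using fil(2)[of "length v"] by simp
  qed
qed

lemma HH_hom: "w : lists Bt ==> HH w : hom False (twd w)"
proof (rule T.D_mem)
  fix u x y v b assume "x : Bt" "y : Bt" "b : Bt" "cot (tb x y) b ~= 0"
  hence "dgt b = dgt x + dgt y" by (rule T0.br_dg)
  thus "hom False (twd (u @ b # v)) <= hom False (twd (u @ x # y # v))" by (simp add: add_ac)
next
  fix w assume "w : lists Bt"
  thus "KK w : hom False (twd w)" by (rule KK_hom)
qed (simp_all add: ms_subspace add.left_commute)

abbreviation Btg :: "('g * 'v) set" where "Btg == (%x. (x, 0)) ` Bg"

text \<open>A word in \<open>\<gg>\<close> has no letter to be replaced, and sorting keeps it in
  \<open>\<gg>\<close> because \<open>\<gg>\<close> is a subalgebra.\<close>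

lemma HH_g: "w : lists Btg ==> HH w = 0"
proof -
  assume w: "w : lists Btg"
  have sub: "lists Btg <= lists Bt" unfolding Bt_def by (rule lists_mono) auto
  have K0: "KK v = 0" if "v : lists Btg" for v using that by (induction v) auto
  \<comment> \<open>The whole space is allowed for words with a letter of \<open>V\<close>, so that
    \<open>D_mem\<close> claims nothing there.\<close>
  have "HH w : (if w : lists Btg then {0} else UNIV)"
  proof (rule T.D_mem)
    fix u x y v b assume b: "x : Bt" "y : Bt" "b : Bt" "cot (tb x y) b ~= 0"
    have "b : Btg" if "x : Btg" "y : Btg"
    proof -
      have "snd (tb x y) = 0" using that tb_gg by auto
      thus ?thesis using b(3,4) by (elim Bt_cases) (auto simp: cot_def)
    qed
    thus "(if u @ b # v : lists Btg then {0} else UNIV) <= (if u @ x # y # v : lists Btg then {0} else (UNIV :: 'r set))" by auto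
  qed (use w sub in \<open>auto simp: K0\<close>)
  thus ?thesis using w by simp
qed

end

section \<open>Cohomology of the Dirac differential\<close>

text \<open>\<open>kap\<close> is the parity involution, \<open>tau c\<close> the twist by
  \<open>eps c\<close> of the degree, and \<open>hh\<close> the homotopy. As the monomials need not
  be independent, the existence of linear maps with these values is an assumption here; the concrete
  algebra provides it. The maps carry meaning on \<open>AA\<close> only.\<close>

locale dirac_alg = dirac_rep sg Bg cog gg dgg formg dug s B co eps gr dg form du sr th ee phi brg act mu tb XX
  for sg :: "'k::field_char_0 => 'g::ab_group_add => 'g" and Bg cog and gg :: "'c::ab_group_add => 'g set" and dgg formg dug
    and s :: "'k => 'v::ab_group_add => 'v" and B co and eps :: "'c => 'c => 'k" and gr dg form du
    and sr :: "'k => 'r::ring => 'r" and th ee phi brg act mu tb XX +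
  fixes kap :: "'r => 'r" and tau :: "'c => 'r => 'r" and hh :: "'r => 'r"
  assumes kap_linear: "lin sr sr kap"
    and kap_mon: "w : lists Bt ==> u : lists B ==> kap (mon w u) = sr ((- 1) ^ length u) (mon w u)"
    and tau_linear: "lin sr sr (tau c)"
    and tau_mon: "w : lists Bt ==> u : lists B ==> tau c (mon w u) = sr (eps c (twd w + wdg u)) (mon w u)"
    and hh_linear: "lin sr sr hh"
    and hh_mon: "w : lists Bt ==> u : lists B ==> hh (mon w u) = HH w * thw u"
begin

lemma lin_rules:
  "kap (x + y) = kap x + kap y" "kap (sr c x) = sr c (kap x)"
  "tau e (x + y) = tau e x + tau e y" "tau e (sr c x) = sr c (tau e x)"
  "hh (x + y) = hh x + hh y" "hh (sr c x) = sr c (hh x)"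
  using kap_linear tau_linear hh_linear by (simp_all add: lin_iff)

lemma linear_diff: "lin sr sr F ==> F (x - y) = F x - F y"
  and linear_0: "lin sr sr F ==> F 0 = 0"
  and linear_sum: "lin sr sr F ==> F (SUM i:X. f i) = (SUM i:X. F (f i))"
proof -
  assume F: "lin sr sr F"
  hence a: "F (x + y) = F x + F y" and m: "F (sr c x) = sr c (F x)" for x y c by (simp_all add: lin_iff)
  show "F (x - y) = F x - F y" using a[of "x - y" y] by simp
  show z: "F 0 = 0" using m[of 0 0] by simp
  show "F (SUM i:X. f i) = (SUM i:X. F (f i))"
    by (induction X rule: fin_induct) (auto simp: a z)
qed

lemmas more_rules = linear_diff[OF kap_linear] linear_diff[OF tau_linear] linear_diff[OF hh_linear]
  linear_0[OF kap_linear] linear_0[OF tau_linear] linear_0[OF hh_linear]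

lemma linear_eqI:
  "(!!x y. F (x + y) = F x + F y) ==> (!!c x. F (sr c x) = sr c (F x)) ==> lin sr sr F"
  using r.vector_space_axioms by (auto simp: lin_iff)

lemma eq_subspace:
  assumes "lin sr sr F" "lin sr sr F'"
  shows "r.subspace {a. F a = F' a}"
  using assms linear_0[OF assms(1)] linear_0[OF assms(2)] by (auto simp: r.subspace_def lin_iff)

lemma ms_eq:
  assumes "a : ms P" "lin sr sr F" "lin sr sr F'"
    and "!!w u. w : lists Bt ==> u : lists B ==> P w u ==> F (mon w u) = F' (mon w u)"
  shows "F a = F' a"
  using assms(1) by (rule ms_induct) (use eq_subspace[OF assms(2,3)] assms(4) in auto)

lemma ms_image:
  assumes "a : ms P" "lin sr sr F" "r.subspace X"
    and "!!w u. w : lists Bt ==> u : lists B ==> P w u ==> F (mon w u) : X"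
  shows "F a : X"
  using assms(1) by (rule ms_induct) (use linear_vimage_subspace[OF assms(2,3)] assms(4) in auto)

lemma kap_ms: "a : ms P ==> kap a : ms P"
  by (erule ms_image[OF _ kap_linear ms_subspace]) (auto simp: kap_mon intro: ms_scale ms_mon)

lemma tau_ms: "a : ms P ==> tau c a : ms P"
  by (erule ms_image[OF _ tau_linear ms_subspace]) (auto simp: tau_mon intro: ms_scale ms_mon)

lemma kap_hom: "a : hom q i ==> kap a = (if q then a else - a)"
proof -
  assume a: "a : hom q i"
  have "kap a = sr (if q then 1 else - 1) a"
    by (rule ms_eq[OF a kap_linear r.linear_scale_self]) (auto simp: kap_mon)
  thus ?thesis by (cases q) simp_all
qed

lemma tau_hom: "a : hom q i ==> tau c a = sr (eps c i) a"
  by (erule ms_eq[OF _ tau_linear r.linear_scale_self]) (auto simp: tau_mon)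

lemma kap_mult: "a : AA ==> b : AA ==> kap (a * b) = kap a * kap b"
proof (rule ms_eq[of a _ "%a. kap (a * b)" "%a. kap a * kap b"])
  fix w u assume b: "b : AA" and wu: "w : lists Bt" "u : lists B"
  from b show "kap (mon w u * b) = kap (mon w u) * kap b"
  proof (rule ms_eq[of b _ "%b. kap (mon w u * b)" "%b. kap (mon w u) * kap b"])
    fix w' u' assume wu': "w' : lists Bt" "u' : lists B"
    show "kap (mon w u * mon w' u') = kap (mon w u) * kap (mon w' u')"
      using wu wu' by (simp add: mon_mult lin_rules kap_mon r_simps power_add mult_ac)
  qed (auto intro!: linear_eqI simp: lin_rules r_simps)
qed (auto intro!: linear_eqI simp: lin_rules r_simps)

lemma tau_mult: "a : AA ==> b : AA ==> tau c (a * b) = tau c a * tau c b"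
proof (rule ms_eq[of a _ "%a. tau c (a * b)" "%a. tau c a * tau c b"])
  fix w u assume b: "b : AA" and wu: "w : lists Bt" "u : lists B"
  from b show "tau c (mon w u * b) = tau c (mon w u) * tau c b"
  proof (rule ms_eq[of b _ "%b. tau c (mon w u * b)" "%b. tau c (mon w u) * tau c b"])
    fix w' u' assume wu': "w' : lists Bt" "u' : lists B"
    show "tau c (mon w u * mon w' u') = tau c (mon w u) * tau c (mon w' u')"
      using wu wu' by (simp add: mon_mult lin_rules tau_mon r_simps eps_add_r mult_ac)
  qed (auto intro!: linear_eqI simp: lin_rules r_simps)
qed (auto intro!: linear_eqI simp: lin_rules r_simps)

lemma kap_kap: "a : AA ==> kap (kap a) = a"
  by (erule ms_eq[of _ _ "%a. kap (kap a)" "%a. a"]) (auto intro!: linear_eqI simp: lin_rules kap_mon simp flip: power_mult_distrib)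

lemma tau_tau: "a : AA ==> tau (- c) (tau c a) = a"
  by (erule ms_eq[of _ _ "%a. tau (- c) (tau c a)" "%a. a"]) (auto intro!: linear_eqI simp: lin_rules tau_mon eps_minus_l)

lemma kap_tau: "a : AA ==> kap (tau c a) = tau c (kap a)"
  by (erule ms_eq[of _ _ "%a. kap (tau c a)" "%a. tau c (kap a)"])
    (auto intro!: linear_eqI simp: lin_rules tau_mon kap_mon mult.commute)

lemma hom_AA: "a : ms P ==> a : AA" using ms_AA by blast

lemma kap_DD: "kap DD = - DD" using kap_hom[OF DD_hom] by simp
lemma tau_DD: "tau c DD = DD" using tau_hom[OF DD_hom] by simp
lemma kap_Dl: "x : gg a ==> kap (Dl x) = Dl x" using kap_hom[OF Dl_hom] by simp
lemma tau_Dl: "x : gg a ==> tau c (Dl x) = sr (eps c a) (Dl x)" using tau_hom[OF Dl_hom] by simp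

text \<open>D is odd and of degree 0 in the grading group, so its bracket involves only the parity
  sign, carried by \<open>kap\<close>.\<close>

definition dd :: "'r => 'r" where "dd a = DD * a - kap a * DD"

lemma dd_linear: "lin sr sr dd"
  by (rule linear_eqI) (auto simp: dd_def lin_rules r_simps)

lemma dd_rules: "dd (- x) = - dd x" "dd (x + y) = dd x + dd y" "dd (sr c x) = sr c (dd x)" "dd (x - y) = dd x - dd y" "dd 0 = 0"
  using dd_linear linear_diff[OF dd_linear, of 0 x] linear_diff[OF dd_linear] linear_0[OF dd_linear] by (simp_all add: lin_iff)

lemma dd_mult: "a : AA ==> b : AA ==> dd (a * b) = dd a * b + kap a * dd b"
  by (simp add: dd_def kap_mult r_simps mult.assoc)

lemma dd_AA: "a : AA ==> dd a : AA"
  unfolding dd_def by (intro ms_diff AA_mult hom_AA[OF DD_hom] kap_ms)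

lemma dd_Gs: "a : Gs k ==> dd a : Gs (Suc k)"
  unfolding dd_def using Gs_mult'[OF _ DD_Gs, of a k "Suc k"] Gs_mult'[OF _ DD_Gs, of "kap a" k "Suc k"] Gs_mult'(2)[OF DD_Gs, of a k "Suc k"] kap_ms
  by (intro ms_diff) auto

lemma dd_dd: "a : AA ==> dd (dd a) = DD * DD * a - a * (DD * DD)"
proof -
  assume a: "a : AA"
  have "kap (dd a) = - (DD * kap a) + a * DD"
    unfolding dd_def more_rules using a kap_ms[OF a]
    by (simp add: kap_mult hom_AA[OF DD_hom] kap_DD kap_kap)
  thus ?thesis by (simp add: dd_def[of "dd a"]) (simp add: dd_def r_simps mult.assoc)
qed

definition invs :: "'r set" where
  "invs = {a : AA. ALL c. ALL x:gg c. Dl x * a = tau c a * Dl x}"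

lemma inv_subspace: "r.subspace invs"
  using ms_0 ms_add ms_scale by (auto simp: r.subspace_def invs_def lin_rules more_rules r_simps)

lemmas inv_add = r.subspace_add[OF inv_subspace]
lemmas inv_scale = r.subspace_scale[OF inv_subspace]
lemmas inv_diff = r.subspace_diff[OF inv_subspace]

lemma inv_AA: "a : invs ==> a : AA" by (simp add: invs_def)

lemma inv_dd: "a : invs ==> dd a : invs"
  unfolding invs_def
proof (intro CollectI conjI allI ballI)
  assume "a : {a : AA. ALL c. ALL x:gg c. Dl x * a = tau c a * Dl x}"
  hence a: "a : AA" and i: "!!c x. x : gg c ==> Dl x * a = tau c a * Dl x" by auto
  show "dd a : AA" by (rule dd_AA[OF a])
  fix c x assume x: "x : gg c"
  have "kap (Dl x * a) = kap (tau c a * Dl x)" using i[OF x] by simp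
  hence k: "Dl x * kap a = kap (tau c a) * Dl x"
    using kap_mult[OF hom_AA[OF Dl_hom[OF x]] a] kap_mult[OF tau_ms[OF a] hom_AA[OF Dl_hom[OF x]]] kap_Dl[OF x] by simp
  have t: "tau c (dd a) = DD * tau c a - kap (tau c a) * DD"
    unfolding dd_def more_rules using a kap_ms[OF a]
    by (simp add: tau_mult hom_AA[OF DD_hom] tau_DD kap_tau)
  have "Dl x * dd a = (Dl x * DD) * a - (Dl x * kap a) * DD" by (simp add: dd_def r_simps mult.assoc)
  also have "... = DD * (Dl x * a) - kap (tau c a) * (Dl x * DD)" unfolding k Dl_DD[OF x] by (simp add: mult.assoc Dl_DD[OF x])
  also have "... = tau c (dd a) * Dl x" unfolding i[OF x] Dl_DD[OF x] t by (simp add: r_simps mult.assoc Dl_DD[OF x])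
  finally show "Dl x * dd a = tau c (dd a) * Dl x" .
qed

lemma AA_commutant: "a : AA ==> a : commutant"
proof (erule ms_induct)
  fix w u assume wu: "w : lists Bt" "u : lists B"
  have "DD * ee = DD" "ee * DD = DD"
    using ee_CC[OF CC_psi] by (simp_all add: DD_def SS_def r_simps mult.assoc) (simp flip: mult.assoc)
  moreover have "ee * Dl x = Dl x" "Dl x * ee = Dl x" for x by (simp_all add: Dl_def r_simps)
  ultimately have "RR * ee = ee * RR" by (simp add: RR_def Cas_def r_simps mult.assoc) (simp flip: mult.assoc)
  hence ee: "ee : commutant" by (simp add: commutant_def)
  have "Xw w : commutant" using wu(1)
    by (induction w) (auto simp: ee intro: commutant_mult commutant_XX basis_gt)
  moreover have "thw u : commutant" using wu(2)
    by (induction u) (auto simp: ee intro: commutant_mult commutant_th basis_gr)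
  ultimately show "mon w u : commutant" unfolding mon_def by (rule commutant_mult)
qed (simp add: commutant_subspace)

text \<open>The square of d is the commutator with D^2, and D^2 is \<open>RR - Cas\<close> with
  \<open>RR\<close> central. \<open>Cas\<close> commutes with an invariant because the twists
  produced by \<open>Dl k\<close> and by its dual partner are inverse to each other.\<close>

lemma dd_dd_inv: "a : invs ==> dd (dd a) = 0"
proof -
  assume a: "a : invs"
  hence aA: "a : AA" by (rule inv_AA)
  have i: "Dl x * b = tau c b * Dl x" if "x : gg c" "b : invs" for c x b using that by (simp add: invs_def)
  have "Dl (dug k) * Dl k * a = a * (Dl (dug k) * Dl k)" if k: "k : Bg" for k
  proof -
    have "kap (tau c b) = kap (tau c b)" for c b ..
    have t: "tau (dgg k) a : AA" by (rule tau_ms[OF aA])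
    have 1: "Dl k * a = tau (dgg k) a * Dl k" by (rule i[OF G.basis_gr[OF k] a])
    have 2: "Dl (dug k) * a = tau (- dgg k) a * Dl (dug k)" by (rule i[OF G.du_gr[OF k] a])
    have "tau (dgg k) (Dl (dug k) * a) = tau (dgg k) (tau (- dgg k) a * Dl (dug k))" using 2 by simp
    hence "sr (eps (dgg k) (- dgg k)) (Dl (dug k) * tau (dgg k) a) = sr (eps (dgg k) (- dgg k)) (a * Dl (dug k))"
      using aA tau_tau[OF aA, of "- dgg k"] tau_mult[OF hom_AA[OF Dl_hom[OF G.du_gr[OF k]]] aA]
        tau_mult[OF tau_ms[OF aA] hom_AA[OF Dl_hom[OF G.du_gr[OF k]]]] tau_Dl[OF G.du_gr[OF k]]
      by (simp add: r_simps)
    hence "Dl (dug k) * tau (dgg k) a = a * Dl (dug k)" by simp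
    thus ?thesis using 1 by (metis mult.assoc)
  qed
  hence C: "Cas * a = a * Cas" unfolding Cas_def sum_distrib_left sum_distrib_right by (rule sum.cong[OF refl])
  have "RR * a = a * RR" using AA_commutant[OF aA] by (simp add: commutant_def)
  thus ?thesis using C by (simp add: dd_dd[OF aA] RR_def r_simps)
qed

text \<open>The bracket of D with a generator involves only brackets in
  \<open>\<gg> \<oplus> V\<close>, so d does not raise the filtration degree of enveloping
  words.\<close>

lemma dd_XX: "dd (XX b) : Gs (Suc (Suc 0))" if "b : Bt"
proof -
  have "kap (XX b) = XX b" using kap_hom[OF XX_hom[OF basis_gt[OF that]]] by simp
  hence "dd (XX b) = (SUM e:B. sr (eps (dg e) (dgt b)) (XX (tb (0, du e) b) * th e))"
    using DD_XX[OF basis_gt[OF that]] by (simp add: dd_def)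
  also have "... : Gs (Suc (Suc 0))"
  proof (intro ms_sum ms_scale)
    fix e show "XX (tb (0, du e) b) * th e : Gs (Suc (Suc 0))" by (rule Gs_mult'(1)[OF XX_Gs th_Gs]) simp
  qed
  finally show ?thesis .
qed

lemma XX_AA: "XX p : AA" by (rule hom_AA[OF XX_Gs])
lemma th_AA: "th v : AA" by (rule hom_AA[OF th_Gs])
lemma Xw_AA: "w : lists Bt ==> Xw w : AA" by (rule hom_AA[OF Xw_Gs])
lemma thw_AA: "u : lists B ==> thw u : AA" by (rule thw_ms) simp_all
lemma KK_AA: "w : lists Bt ==> KK w : AA" by (rule hom_AA[OF KK_Gs])
lemma HH_AA: "w : lists Bt ==> HH w : AA" by (rule hom_AA[OF HH_hom])

lemma kap_Xw: "w : lists Bt ==> kap (Xw w) = Xw w" using kap_mon[of w "[]"] by (simp add: mon_def)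
lemma tau_Xw: "w : lists Bt ==> tau c (Xw w) = sr (eps c (twd w)) (Xw w)" using tau_mon[of w "[]"] by (simp add: mon_def)
lemma kap_thw: "u : lists B ==> kap (thw u) = sr ((- 1) ^ length u) (thw u)" using kap_mon[of "[]" u] by (simp add: mon_def)
lemma kap_HH: "w : lists Bt ==> kap (HH w) = - HH w" using kap_hom[OF HH_hom] by simp
lemma tau_HH: "w : lists Bt ==> tau c (HH w) = sr (eps c (twd w)) (HH w)" by (rule tau_hom[OF HH_hom])
lemma kap_XX: "b : Bt ==> kap (XX b) = XX b" using kap_hom[OF XX_hom[OF basis_gt]] by simp
lemma kap_th: "v : gr a ==> kap (th v) = - th v" using kap_hom[OF CC_hom[OF CC_th]] by simp

lemma dd_Xw: "w : lists Bt ==> dd (Xw w) : Gs (Suc (length w))"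
proof (induction w)
  case Nil
  have "kap ee = ee" using kap_Xw[of "[]"] by simp
  moreover have "DD * ee = DD" "ee * DD = DD"
    using ee_CC[OF CC_psi] by (simp_all add: DD_def SS_def r_simps mult.assoc) (simp flip: mult.assoc)
  ultimately show ?case by (simp add: dd_def ms_0)
next
  case (Cons b w)
  hence b: "b : Bt" "w : lists Bt" and IH: "dd (Xw w) : Gs (Suc (length w))" by auto
  have "dd (Xw (b # w)) = dd (XX b) * Xw w + XX b * dd (Xw w)"
    using dd_mult[OF XX_AA Xw_AA[OF b(2)]] kap_XX[OF b(1)] by simp
  moreover have "dd (XX b) * Xw w : Gs (Suc (length (b # w)))" by (rule Gs_mult'(1)[OF dd_XX[OF b(1)] Xw_Gs[OF b(2)]]) simp
  moreover have "XX b * dd (Xw w) : Gs (Suc (length (b # w)))" by (rule Gs_mult'(2)[OF XX_Gs IH]) simp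
  ultimately show ?case by (simp only: ms_add)
qed

definition nV :: "('g * 'v) list => nat" where "nV w = length (filter (%b. snd b ~= 0) w)"

text \<open>The leading term of \<open>dd (th v)\<close> is \<open>2 Xv v\<close>, so d puts each
  replaced letter back with factor 2. There is one such term for each of the \<open>nV w\<close>
  letters from \<open>V\<close>; d of the other letters costs only lower terms.\<close>

lemma dd_KK: "w : lists Bt ==> dd (KK w) - sr (of_nat (2 * nV w)) (Xw w) : Gs (length w)"
proof (induction w)
  case Nil
  thus ?case by (simp add: dd_rules nV_def ms_0)
next
  case (Cons b w)
  hence b: "b : Bt" "w : lists Bt" and IH: "dd (KK w) - sr (of_nat (2 * nV w)) (Xw w) : Gs (length w)" by auto
  have sb: "snd b : gr (dgt b)" using basis_gt[OF b(1)] by (auto simp: dsum_grading_def)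
  have dth: "dd (th (snd b)) = sr (2 * (if snd b = 0 then 0 else 1)) (XX b) + sr 2 (qq (phi (snd b)))"
  proof -
    have "dd (th (snd b)) = sr 2 (Xv (snd b)) + sr 2 (qq (phi (snd b)))"
      using DD_th[OF sb] kap_th[OF sb] by (simp add: dd_def)
    thus ?thesis using b(1) by (auto elim: Bt_cases)
  qed
  have "dd (KK (b # w)) = dd (th (snd b)) * Xw w - th (snd b) * dd (Xw w) + (dd (XX b) * KK w + XX b * dd (KK w))"
    using dd_mult[OF th_AA Xw_AA[OF b(2)], of "snd b"] dd_mult[OF XX_AA KK_AA[OF b(2)], of b] kap_th[OF sb] kap_XX[OF b(1)]
    by (simp add: dd_rules)
  hence "dd (KK (b # w)) - sr (of_nat (2 * nV (b # w))) (Xw (b # w)) =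
     sr 2 (qq (phi (snd b)) * Xw w) - th (snd b) * dd (Xw w) + (dd (XX b) * KK w + XX b * (dd (KK w) - sr (of_nat (2 * nV w)) (Xw w)))"
    unfolding dth by (auto simp: nV_def r_simps r.scale_left_distrib)
  also have "... : Gs (length (b # w))"
  proof (intro ms_add ms_diff ms_scale)
    show "qq (phi (snd b)) * Xw w : Gs (length (b # w))" by (rule Gs_mult'(2)[OF Cl_Gs[OF qq_Cl] Xw_Gs[OF b(2)]]) simp
    show "th (snd b) * dd (Xw w) : Gs (length (b # w))" by (rule Gs_mult'(2)[OF th_Gs dd_Xw[OF b(2)]]) simp
    show "dd (XX b) * KK w : Gs (length (b # w))" by (rule Gs_mult'(2)[OF dd_XX[OF b(1)] KK_Gs[OF b(2)]]) simp
    show "XX b * (dd (KK w) - sr (of_nat (2 * nV w)) (Xw w)) : Gs (length (b # w))" by (rule Gs_mult'(2)[OF XX_Gs IH]) simp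
  qed
  finally show ?case .
qed

lemma hh_Gs: "a : Gs (Suc k) ==> hh a : Gs k"
proof (erule ms_image[OF _ hh_linear ms_subspace])
  fix w u assume w: "w : lists Bt" "u : lists B" "length w < Suc k"
  have "HH w * thw u : Gs (length w)" by (rule Gs_mult'(1)[OF HH_Gs(1)[OF w(1)] CC_Gs[OF CC_thw[OF w(2)]]]) simp
  thus "hh (mon w u) : Gs k" using w Gs_mono[of "length w" k] by (auto simp: hh_mon)
qed

lemma hh_Cl:
  assumes w: "w : lists Bt" and c: "c : Cl"
  shows "hh (Xw w * c) = HH w * c"
  using c
proof (induction rule: r.span_induct_alt)
  case base
  thus ?case by (simp add: more_rules)
next
  case (step k x y)
  then obtain u where u: "x = thw u" "u : lists B" by blast
  have "hh (Xw w * x) = HH w * x" using hh_mon[OF w u(2)] by (simp add: mon_def u)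
  thus ?case using step by (simp add: lin_rules r_simps)
qed

text \<open>The leading part of \<open>hh\<close> on the longer word is \<open>KK\<close>, which
  either replaces a letter of \<open>w\<close> or the new last letter. The latter is a general
  vector \<open>p\<close>, since dual vectors need not be basis vectors.\<close>

lemma hh_insert:
  assumes w: "w : lists Bt" and c: "c : Cl"
  shows "hh (Xw w * XX p * c) - (KK w * XX p + Xw w * th (snd p)) * c : Gs (length w)"
proof -
  have one: "hh (Xw w * XX b * c) - (KK w * XX b + Xw w * th (snd b)) * c : Gs (length w)" if b: "b : Bt" for b
  proof -
    have wb: "w @ [b] : lists Bt" using w b by simp
    have "Xw w * XX b * c = Xw (w @ [b]) * c" by (simp add: Xw_append)
    moreover have "KK w * XX b + Xw w * th (snd b) = KK (w @ [b])" by (simp add: KK_append)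
    ultimately have "hh (Xw w * XX b * c) - (KK w * XX b + Xw w * th (snd b)) * c = (HH (w @ [b]) - KK (w @ [b])) * c"
      using hh_Cl[OF wb c] by (simp add: r_simps)
    also have "... : Gs (length w)" by (rule Gs_mult'(1)[OF HH_Gs(2)[OF wb] Cl_Gs[OF c]]) simp
    finally show ?thesis .
  qed
  have 1: "Xw w * XX p * c = (SUM b:Bt. sr (cot p b) (Xw w * XX b * c))"
    unfolding XX_expand[of p, symmetric] by (simp add: r_simps)
  have 2: "(KK w * XX p + Xw w * th (snd p)) * c = (SUM b:Bt. sr (cot p b) ((KK w * XX b + Xw w * th (snd b)) * c))"
    unfolding XX_expand[of p, symmetric] th_snd_expand[of p, symmetric] by (simp add: r_simps sum.distrib)
  have "hh (Xw w * XX p * c) - (KK w * XX p + Xw w * th (snd p)) * c =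
     (SUM b:Bt. sr (cot p b) (hh (Xw w * XX b * c) - (KK w * XX b + Xw w * th (snd b)) * c))"
    unfolding 1 2 linear_sum[OF hh_linear] by (simp add: lin_rules r.scale_right_diff_distrib sum_subtractf)
  also have "... : Gs (length w)" by (intro ms_sum ms_scale one)
  finally show ?thesis .
qed

section \<open>The operator d h + h d\<close>

definition TT :: "'r => 'r" where "TT a = dd (hh a) + hh (dd a)"

lemma TT_rules: "TT (x + y) = TT x + TT y" "TT (sr c x) = sr c (TT x)" "TT (x - y) = TT x - TT y" "TT 0 = 0"
  by (simp_all add: TT_def dd_rules lin_rules more_rules r_simps)

text \<open>Lower terms of \<open>TT\<close> either have a shorter enveloping word, with a Clifford
  word of any length, or an enveloping word of the same length and a shorter Clifford word. Hence
  the lexicographic order.\<close>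

abbreviation Lx :: "nat => nat => 'r set" where
  "Lx n m == ms (%w u. length w < n \<or> length w = n & length u < m)"

lemma ad_Cl: "u : lists B ==> ad e u : Cl"
  unfolding ad_def by (intro r.span_diff r.span_scale Cl_mult th_Cl r.span_base imageI)

lemma psi_Cl: "psi : Cl" by (rule CC_Cl[OF CC_psi])

lemma thw_Cl: "u : lists B ==> thw u : Cl" by (intro r.span_base imageI)

lemma dd_thw:
  assumes u: "u : lists B"
  shows "dd (thw u) = (SUM e:B. Xv (du e) * ad e u) + (psi * thw u - sr ((- 1) ^ length u) (thw u * psi))"
proof -
  have "(Xv (du e) * th e) * thw u - sr ((- 1) ^ length u) (thw u * (Xv (du e) * th e)) = Xv (du e) * ad e u" if e: "e : B" for e
  proof -
    have "thw u * (Xv (du e) * th e) = sr (eps (dg e) (wdg u)) (Xv (du e) * (thw u * th e))"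
      using CC_XX[OF CC_thw[OF u] gt_v[OF du_gr[OF e]]] by (simp add: r_simps eps_minus_r flip: mult.assoc)
    thus ?thesis by (simp add: ad_def r_simps mult.assoc)
  qed
  hence "SS * thw u - sr ((- 1) ^ length u) (thw u * SS) = (SUM e:B. Xv (du e) * ad e u)"
    by (simp add: SS_def sum_distrib_left sum_distrib_right r.scale_sum_right sum_subtractf[symmetric])
  thus ?thesis by (simp add: dd_def kap_thw[OF u] DD_def r_simps)
qed

text \<open>Applying \<open>hh\<close> and then d replaces letters of \<open>w\<close> and puts them
  back, which contributes \<open>2 nV w\<close> by \<open>dd_KK\<close>. In the other order d trades
  a Clifford letter for a new letter \<open>du e\<close> of the enveloping word and
  \<open>hh\<close> turns it back: this is the number operator, contributing
  \<open>2 length u\<close>.\<close>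

lemma TT_mon:
  assumes w: "w : lists Bt" and u: "u : lists B"
  shows "TT (mon w u) - sr (of_nat (2 * (nV w + length u))) (mon w u) : Lx (length w) (length u)"
proof -
  let ?h = "%e. hh (Xw w * Xv (du e) * ad e u) - (KK w * Xv (du e) + Xw w * th (snd (0::'g, du e))) * ad e u"
  let ?d = "(dd (KK w) - sr (of_nat (2 * nV w)) (Xw w)) * thw u"
  let ?k = "%e. (HH w - KK w) * (Xv (du e) * ad e u)"
  let ?Y = "dd (HH w - KK w) * thw u + ?d - (SUM e:B. ?k e) + hh (dd (Xw w) * thw u) + (SUM e:B. ?h e)"
  define n where "n = length w"
  define Z where "Z = psi * thw u - sr ((- 1) ^ length u) (thw u * psi)"
  have Z: "Z : Cl" unfolding Z_def by (intro r.span_diff r.span_scale Cl_mult psi_Cl thw_Cl[OF u])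
  define N where "N = (SUM e:B. th (du e) * ad e u)"
  have GL: "Gs n <= Lx n (length u)" by (rule ms_mono) simp
  \<comment> \<open>\<open>HH w\<close> is odd, so its product with \<open>dd (thw u)\<close> enters
    here with a minus sign. Against \<open>2\<close> the part with \<open>Z\<close> cancels, and the
    part with new letters leaves \<open>HH w - KK w\<close> and the terms of
    \<open>hh_insert\<close>.\<close>
  have 1: "dd (hh (mon w u)) = dd (HH w) * thw u - HH w * ((SUM e:B. Xv (du e) * ad e u) + Z)"
    using dd_mult[OF HH_AA[OF w] thw_AA[OF u]] by (simp add: hh_mon[OF w u] kap_HH[OF w] dd_thw[OF u] Z_def)
  have 2: "hh (dd (mon w u)) = hh (dd (Xw w) * thw u) + (SUM e:B. hh (Xw w * Xv (du e) * ad e u)) + HH w * Z"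
    using dd_mult[OF Xw_AA[OF w] thw_AA[OF u]] hh_Cl[OF w Z]
    by (simp add: mon_def kap_Xw[OF w] dd_thw[OF u] Z_def[symmetric] distrib_left lin_rules sum_distrib_left linear_sum[OF hh_linear] mult.assoc)
  have "TT (mon w u) - sr (of_nat (2 * (nV w + length u))) (mon w u) =
     (?Y)
      + Xw w * (N - sr (of_nat (2 * length u)) (thw u))"
    unfolding TT_def 1 2 N_def
    by (simp add: dd_rules mon_def r_simps sum_subtractf sum.distrib r.scale_left_distrib mult.assoc)
  also have "... : Lx n (length u)"
  proof (rule ms_add)
    have HK: "HH w - KK w : Gs (length w - 1)" by (rule HH_Gs(2)[OF w])
    have "?Y : Gs n"
    proof -
      have tG: "thw u : Gs (Suc 0)" by (rule Cl_Gs[OF thw_Cl[OF u]])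
      have A: "?d : Gs n"
        unfolding n_def by (rule Gs_mult'(1)[OF dd_KK[OF w] tG]) simp
      have B: "dd (HH w - KK w) * thw u : Gs n"
      proof (cases w)
        case Nil
        hence "HH w - KK w = 0" using HK by (simp add: ms_def)
        thus ?thesis by (simp add: dd_rules ms_0)
      next
        case (Cons b v)
        thus ?thesis unfolding n_def by (intro Gs_mult'(1)[OF dd_Gs[OF HK] tG]) simp
      qed
      have C: "hh (dd (Xw w) * thw u) : Gs n"
        unfolding n_def by (intro hh_Gs Gs_mult'(1)[OF dd_Xw[OF w] tG]) simp
      have D: "?k e : Gs n" for e
      proof (cases w)
        case Nil
        hence "HH w - KK w = 0" using HK by (simp add: ms_def)
        thus ?thesis by (simp add: ms_0)
      next
        case (Cons b v)
        have "Xv (du e) * ad e u : Gs (Suc (Suc 0))" by (rule Gs_mult'(1)[OF XX_Gs Cl_Gs[OF ad_Cl[OF u]]]) simp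
        with HK show ?thesis unfolding n_def by (rule Gs_mult'(1)) (simp add: Cons)
      qed
      have E: "?h e : Gs n" for e
        unfolding n_def by (rule hh_insert[OF w ad_Cl[OF u]])
      show ?thesis by (rule ms_add[OF ms_add[OF ms_diff[OF ms_add[OF B A] ms_sum[OF D]] C] ms_sum[OF E]])
    qed
    thus "?Y : Lx n (length u)"
      using GL by blast
    have "N - sr (of_nat (2 * length u)) (thw u) : lower (even (length u)) (wdg u) (length u)"
      unfolding N_def by (rule number_operator[OF u])
    thus "Xw w * (N - sr (of_nat (2 * length u)) (thw u)) : Lx n (length u)"
      unfolding lower_def
    proof (induction rule: r.span_induct_alt)
      case base
      thus ?case by (simp add: ms_0)
    next
      case (step c x y)
      then obtain v where v: "x = thw v" "v : lists B" "length v < length u" by blast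
      have "Xw w * x : Lx n (length u)"
        using ms_mon[OF w v(2), of "%w v. length w < n \<or> length w = n & length v < length u"] v(1,3) by (simp add: mon_def n_def)
      thus ?case using step by (simp add: r_simps ms_add ms_scale)
    qed
  qed
  finally show ?thesis by (simp add: n_def)
qed

section \<open>Equivariance of the homotopy under the diagonal action\<close>

definition adx :: "'c => 'g => 'r => 'r" where "adx c x a = Dl x * a - tau c a * Dl x"

lemma adx_linear: "lin sr sr (adx c x)"
  by (rule linear_eqI) (auto simp: adx_def lin_rules r_simps)

lemma adx_rules: "adx c x (a + b) = adx c x a + adx c x b" "adx c x (sr k a) = sr k (adx c x a)" "adx c x 0 = 0"
  by (simp_all add: adx_def lin_rules more_rules r_simps)

lemma adx_mult: "a : AA ==> b : AA ==> adx c x (a * b) = adx c x a * b + tau c a * adx c x b"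
  by (simp add: adx_def tau_mult r_simps mult.assoc)

context
  fixes c x assumes x: "x : gg c"
begin

lemma tau_th: "v : gr b ==> tau c (th v) = sr (eps c b) (th v)" by (rule tau_hom[OF CC_hom[OF CC_th]])
lemma tau_XX: "p : gt b ==> tau c (XX p) = sr (eps c b) (XX p)" by (rule tau_hom[OF XX_hom])

lemma adx_th: "v : gr b ==> adx c x (th v) = th (act x v)"
  using Dl_th[OF x] tau_th by (simp add: adx_def r_simps)

lemma adx_XX: "p : gt b ==> adx c x (XX p) = XX (tb (x, 0) p)"
  using Dl_XX[OF x] tau_XX by (simp add: adx_def r_simps)

lemma adx_ee: "adx c x ee = 0"
  using tau_Xw[of "[]" c] by (simp add: adx_def) (simp add: Dl_def r_simps)

lemma adx_thw: "u : lists B ==> adx c x (thw u) : Cl"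
proof (induction u)
  case Nil
  thus ?case by (simp add: adx_ee r.span_zero)
next
  case (Cons b u)
  hence b: "b : B" "u : lists B" and IH: "adx c x (thw u) : Cl" by auto
  have "adx c x (thw (b # u)) = th (act x b) * thw u + sr (eps c (dg b)) (th b * adx c x (thw u))"
    using adx_mult[OF th_AA thw_AA[OF b(2)]] adx_th[OF basis_gr[OF b(1)]] tau_th[OF basis_gr[OF b(1)]] by (simp add: r_simps)
  thus ?case using b IH by (simp only:) (intro r.span_add r.span_scale Cl_mult th_Cl thw_Cl)
qed

abbreviation delta where "delta == tb (x, 0)"

lemma snd_delta: "snd (delta p) = act x (snd p)"
  using tb_add_r[of "(x, 0)" "(fst p, 0)" "(0, snd p)"] by (simp add: tb_gg tb_gV)

lemma adx_Xw: "w : lists Bt ==> adx c x (Xw w) = T.psub delta c Xw w"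
proof (induction w)
  case Nil
  thus ?case by (simp add: adx_ee)
next
  case (Cons b w)
  hence b: "b : Bt" "w : lists Bt" and IH: "adx c x (Xw w) = T.psub delta c Xw w" by auto
  have "(SUM b':Bt. sr (cot (delta b) b') (XX b' * Xw w)) = XX (delta b) * Xw w"
    unfolding XX_expand[of "delta b", symmetric] by (simp add: r_simps)
  moreover have "T.psub delta c (%w'. XX b * Xw w') w = XX b * T.psub delta c Xw w"
    by (rule T.psub_linear[OF linear_mult_left, symmetric])
  ultimately show ?case
    using adx_mult[OF XX_AA Xw_AA[OF b(2)]] adx_XX[OF basis_gt[OF b(1)]] tau_XX[OF basis_gt[OF b(1)]] IH
    by (simp add: T.psub_Cons r_simps)
qed

lemma adx_KK: "w : lists Bt ==> adx c x (KK w) = T.psub delta c KK w"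
proof (induction w)
  case Nil
  thus ?case by (simp add: adx_rules)
next
  case (Cons b w)
  hence b: "b : Bt" "w : lists Bt" and IH: "adx c x (KK w) = T.psub delta c KK w" by auto
  have sb: "snd b : gr (dgt b)" using basis_gt[OF b(1)] by (auto simp: dsum_grading_def)
  have "(SUM b':Bt. sr (cot (delta b) b') (th (snd b') * Xw w + XX b' * KK w)) = th (act x (snd b)) * Xw w + XX (delta b) * KK w"
    unfolding XX_expand[of "delta b", symmetric] snd_delta[symmetric] th_snd_expand[of "delta b", symmetric]
    by (simp add: r_simps sum.distrib)
  moreover have "T.psub delta c (%w'. th (snd b) * Xw w' + XX b * KK w') w = th (snd b) * T.psub delta c Xw w + XX b * T.psub delta c KK w"
    by (simp only: T.psub_add T.psub_linear[OF linear_mult_left])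
  ultimately show ?case
    using adx_mult[OF XX_AA KK_AA[OF b(2)], of c x b] adx_mult[OF th_AA Xw_AA[OF b(2)], of c x "snd b"] adx_XX[OF basis_gt[OF b(1)]]
      tau_XX[OF basis_gt[OF b(1)]] IH adx_th[OF sb] tau_th[OF sb] adx_Xw[OF b(2)]
    by (simp add: T.psub_Cons r_simps adx_rules)
qed

lemma adx_HH: "w : lists Bt ==> adx c x (HH w) = T.psub delta c HH w"
proof (rule T.D_equivariant[OF adx_linear _ _ _ adx_KK])
  show "lin st st delta" using tb_bilinear by (simp add: bilinear_map_def)
  fix a b assume ab: "a : Bt" "b : Bt"
  have "delta a : gt (c + dgt a)"
    using tilde gt_g[OF x] basis_gt[OF ab(1)] unfolding colour_lie_algebra_def by blast
  thus "dgt b = c + dgt a" if "cot (delta a) b ~= 0" using gt_cot ab that by blast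
  show "delta (tb a b) = tb (delta a) b + st (eps c (dgt a)) (tb a (delta b))"
    by (rule tilde_jacobi[OF gt_g[OF x] basis_gt[OF ab(1)] basis_gt[OF ab(2)]])
qed

text \<open>On the enveloping word the action is a substitution, with which \<open>HH\<close>
  commutes by \<open>D_equivariant\<close>. The Clifford part stays in the Clifford algebra, over
  which \<open>hh\<close> is linear by \<open>hh_Cl\<close>.\<close>

lemma hh_adx:
  assumes "a : AA"
  shows "hh (adx c x a) = adx c x (hh a)"
  using assms
proof (rule ms_eq)
  fix w u assume wu: "w : lists Bt" "u : lists B"
  have "hh (adx c x (mon w u)) = hh (T.psub delta c Xw w * thw u) + sr (eps c (twd w)) (hh (Xw w * adx c x (thw u)))"
    using adx_mult[OF Xw_AA[OF wu(1)] thw_AA[OF wu(2)]] by (simp add: mon_def adx_Xw wu tau_Xw r_simps lin_rules)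
  also have "hh (T.psub delta c Xw w * thw u) = T.psub delta c (%w. hh (Xw w * thw u)) w"
    by (rule T.psub_linear[of "%y. hh (y * thw u)"]) (auto intro!: linear_eqI simp: lin_rules r_simps)
  also have "... = T.psub delta c (%w. HH w * thw u) w"
    using wu by (intro T.psub_cong) (simp_all add: hh_mon flip: mon_def)
  also have "... = adx c x (HH w) * thw u"
    unfolding adx_HH[OF wu(1)] by (rule T.psub_linear[OF linear_mult_right, symmetric])
  also have "hh (Xw w * adx c x (thw u)) = HH w * adx c x (thw u)" by (rule hh_Cl[OF wu(1) adx_thw[OF wu(2)]])
  also have "adx c x (HH w) * thw u + sr (eps c (twd w)) (HH w * adx c x (thw u)) = adx c x (hh (mon w u))"
    using adx_mult[OF HH_AA[OF wu(1)] thw_AA[OF wu(2)]] by (simp add: hh_mon wu tau_HH r_simps)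
  finally show "hh (adx c x (mon w u)) = adx c x (hh (mon w u))" .
qed (auto intro!: linear_eqI simp: lin_rules adx_rules)

end

lemma hh_AA: "a : AA ==> hh a : AA"
  by (erule ms_image[OF _ hh_linear ms_subspace]) (auto simp: hh_mon intro: AA_mult HH_AA thw_AA)

lemma hh_inv: "a : invs ==> hh a : invs"
proof -
  assume a: "a : invs"
  have "adx c x (hh a) = 0" if x: "x : gg c" for c x
    using hh_adx[OF x inv_AA[OF a]] a x by (simp add: invs_def adx_def more_rules)
  thus ?thesis using hh_AA[OF inv_AA[OF a]] by (simp add: invs_def adx_def)
qed

section \<open>Diagonal words and products of shifted operators\<close>

definition Dlw :: "'g list => 'r" where "Dlw w = foldr (%b p. Dl b * p) w ee"

lemma Dlw_simps [simp]: "Dlw [] = ee" "Dlw (b # w) = Dl b * Dlw w" by (simp_all add: Dlw_def)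

text \<open>This is \<Delta>(U(\<open>\<gg>\<close>)), given by a spanning set;
  \<open>psi_image\<close> makes the identification.\<close>

definition WW :: "'r set" where "WW = r.span (Dlw ` lists Bg)"

lemma WW_subspace: "r.subspace WW" by (simp add: WW_def)

abbreviation Ug :: "'r set" where "Ug == ms (%w u. w : lists Btg)"

lemma Dlw_Ug: "w : lists Bg ==> Dlw w : Ug"
proof (induction w)
  case Nil
  thus ?case using Xw_ms[of "[]" "%w u. w : lists Btg"] by simp
next
  case (Cons b w)
  hence b: "b : Bg" and IH: "Dlw w : Ug" by auto
  have bt: "(b, 0) : Bt" using b by (simp add: Bt_def)
  have "Xg b : Ug" using Xw_ms[of "[(b, 0)]" "%w u. w : lists Btg"] bt b by simp
  moreover have "pis b : Ug"
  proof -
    have "Cl <= Ug" by (rule r.span_minimal[OF _ ms_subspace]) (auto intro!: thw_ms)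
    thus ?thesis using qq_Cl by blast
  qed
  ultimately have "Dl b : Ug" unfolding Dl_def by (rule ms_add)
  thus ?case unfolding Dlw_simps using IH by (rule ms_mult[rotated]) auto
qed

lemma hh_WW: "a : WW ==> hh a = 0"
proof -
  have "hh a = 0" if "a : Ug" for a
    using that by (rule ms_eq[of a _ hh "%_. 0"]) (auto intro!: linear_eqI simp: hh_linear hh_mon HH_g)
  thus "a : WW ==> hh a = 0"
    using r.span_minimal[OF _ ms_subspace, of "Dlw ` lists Bg" "%w u. w : lists Btg"] Dlw_Ug unfolding WW_def by blast
qed

lemma WW_AA: "a : WW ==> a : AA"
  using r.span_minimal[OF _ ms_subspace, of "Dlw ` lists Bg" "%w u. w : lists Btg"] Dlw_Ug ms_AA unfolding WW_def by blast

lemma dd_WW: "a : WW ==> dd a = 0"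
  unfolding WW_def
proof (induction rule: r.span_induct_alt)
  case base
  thus ?case by (simp add: dd_rules)
next
  case (step k y z)
  then obtain w where w: "y = Dlw w" "w : lists Bg" by blast
  have "dd (Dlw w) = 0" using w(2)
  proof (induction w)
    case Nil
    have "kap ee = ee" using kap_Xw[of "[]"] by simp
    moreover have "DD * ee = DD" "ee * DD = DD"
      using ee_CC[OF CC_psi] by (simp_all add: DD_def SS_def r_simps mult.assoc) (simp flip: mult.assoc)
    ultimately show ?case by (simp add: dd_def)
  next
    case (Cons b w)
    hence b: "b : Bg" "w : lists Bg" by auto
    have "Dlw w : AA" using Dlw_Ug[OF b(2)] ms_AA by blast
    moreover have "dd (Dl b) = 0" using kap_Dl[OF G.basis_gr[OF b(1)]] Dl_DD[OF G.basis_gr[OF b(1)]] by (simp add: dd_def)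
    ultimately show ?case using dd_mult[OF hom_AA[OF Dl_hom[OF G.basis_gr[OF b(1)]]]] Cons by simp
  qed
  thus ?case using step w by (simp add: dd_rules)
qed

lemma TT_WW: "a : WW ==> TT a = 0"
  by (simp add: TT_def hh_WW dd_WW dd_rules more_rules)

text \<open>\<open>Dl b\<close> and \<open>Xg b\<close> differ by a Clifford element, which does not
  count for the filtration.\<close>

lemma Dlw_leading: "w : lists Bg ==> Xw (map (%x. (x, 0)) w) - Dlw w : Gs (length w)"
proof (induction w)
  case Nil
  thus ?case by (simp add: ms_0)
next
  case (Cons b w)
  hence b: "b : Bg" "w : lists Bg" and IH: "Xw (map (%x. (x, 0)) w) - Dlw w : Gs (length w)" by auto
  define Y where "Y = Xw (map (%x. (x, 0)) w)"
  have wB: "map (%x. (x, 0)) w : lists Bt" using b(2) by (auto simp: Bt_def)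
  have Y: "Y : Gs (Suc (length w))" unfolding Y_def using Xw_Gs[OF wB] by simp
  have "Gs (length w) <= Gs (Suc (length w))" by (rule Gs_mono) simp
  hence "Y - (Y - Dlw w) : Gs (Suc (length w))" by (rule ms_diff[OF Y subsetD]) (use IH in \<open>simp add: Y_def\<close>)
  hence W: "Dlw w : Gs (Suc (length w))" by simp
  have "Xw (map (%x. (x, 0)) (b # w)) - Dlw (b # w) = Xg b * (Y - Dlw w) - pis b * Dlw w"
    by (simp add: Y_def Dl_def r_simps)
  also have "... : Gs (length (b # w))"
  proof (rule ms_diff)
    show "Xg b * (Y - Dlw w) : Gs (length (b # w))" using IH unfolding Y_def[symmetric] by (rule Gs_mult'(2)[OF XX_Gs]) simp
    show "pis b * Dlw w : Gs (length (b # w))" by (rule Gs_mult'(2)[OF Cl_Gs[OF qq_Cl] W]) simp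
  qed
  finally show ?case .
qed

primrec pT :: "nat list => 'r => 'r" where
  "pT [] a = a"
| "pT (k # ks) a = pT ks (TT a - sr (of_nat k) a)"

lemma pT_rules: "pT ks (a + b) = pT ks a + pT ks b" "pT ks (sr c a) = sr c (pT ks a)" "pT ks (a - b) = pT ks a - pT ks b"
proof -
  show a: "pT ks (a + b) = pT ks a + pT ks b" for a b
  proof (induction ks arbitrary: a b)
    case (Cons k ks)
    have "TT (a + b) - sr (of_nat k) (a + b) = (TT a - sr (of_nat k) a) + (TT b - sr (of_nat k) b)" by (simp add: TT_rules r_simps)
    thus ?case using Cons.IH[of "TT a - sr (of_nat k) a" "TT b - sr (of_nat k) b"] by (simp only: pT.simps)
  qed simp
  show "pT ks (sr c a) = sr c (pT ks a)"
  proof (induction ks arbitrary: a)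
    case (Cons k ks)
    have "TT (sr c a) - sr (of_nat k) (sr c a) = sr c (TT a - sr (of_nat k) a)" by (simp add: TT_rules r_simps mult.commute)
    thus ?case using Cons.IH[of "TT a - sr (of_nat k) a"] by (simp only: pT.simps)
  qed simp
  show "pT ks (a - b) = pT ks a - pT ks b" using a[of "a - b" b] by simp
qed

lemma pT_TT: "pT ks (TT a) = TT (pT ks a)"
  by (induction ks arbitrary: a) (simp_all add: TT_rules flip: TT_rules)

lemma pT_append: "pT (ks @ ls) a = pT ls (pT ks a)"
  by (induction ks arbitrary: a) simp_all

lemma pT_commute: "pT ls (pT ks a) = pT ks (pT ls a)"
  by (induction ks arbitrary: a) (simp_all add: pT_rules pT_TT)

lemma pT_WW: "a : WW ==> pT ks a : WW"
  by (induction ks arbitrary: a)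
    (simp_all add: TT_WW r.subspace_neg[OF WW_subspace] r.subspace_scale[OF WW_subspace])

text \<open>With 0 excluded, the product of the \<open>TT - k\<close> acts by a nonzero scalar on
  \<open>WW\<close>, where \<open>TT\<close> is zero, and on cocycles modulo coboundaries.\<close>

definition good :: "'r => bool" where "good a \<longleftrightarrow> (EX ks. 0 ~: set ks & pT ks a : WW)"

lemma good_subspace: "r.subspace {a. good a}"
  unfolding r.subspace_def
proof (intro conjI ballI allI)
  show "0 : {a. good a}" unfolding good_def using r.subspace_0[OF WW_subspace] by (auto intro!: exI[of _ "[]"])
  fix a c assume "a : {a. good a}"
  thus "sr c a : {a. good a}" unfolding good_def using r.subspace_scale[OF WW_subspace] by (auto simp: pT_rules)
next
  fix a b assume "a : {a. good a}" "b : {a. good a}"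
  then obtain ks ls where ks: "0 ~: set ks" "pT ks a : WW" and ls: "0 ~: set ls" "pT ls b : WW" unfolding good_def by auto
  have "pT (ks @ ls) a : WW" unfolding pT_append by (rule pT_WW[OF ks(2)])
  moreover have "pT (ks @ ls) b : WW" unfolding pT_append pT_commute[of ls ks] by (rule pT_WW[OF ls(2)])
  ultimately have "pT (ks @ ls) (a + b) : WW" unfolding pT_rules by (rule r.subspace_add[OF WW_subspace])
  thus "a + b : {a. good a}" unfolding good_def using ks ls by (intro CollectI exI[of _ "ks @ ls"]) auto
qed

text \<open>Lexicographic induction on the two lengths. If a letter of \<open>V\<close> or a
  Clifford letter occurs, one factor \<open>TT - 2 (nV w + length u)\<close> moves the monomial into
  lower terms, and the number subtracted is positive. Otherwise the monomial is a word in
  \<open>\<gg>\<close> and differs from an element of \<open>WW\<close> by lower terms.\<close>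

lemma good_AA: "a : AA ==> good a"
proof (erule ms_induct)
  fix w u assume "w : lists Bt" "u : lists B"
  thus "good (mon w u)"
  proof (induction "(length w, length u)" arbitrary: w u rule: wf_induct_rule[OF wf_lex_prod[OF wf_less_than wf_less_than]])
    \<comment> \<open>Both components of the order are needed: a shorter enveloping word may come
      with a longer Clifford word.\<close>
    case (1 w u)
    have low: "good a" if "a : Lx (length w) (length u)" for a
      using that by (rule ms_induct) (use good_subspace 1 in auto)
    show ?case
    proof (cases "nV w + length u = 0")
      case False
      have "good (TT (mon w u) - sr (of_nat (2 * (nV w + length u))) (mon w u))" by (rule low[OF TT_mon[OF 1(2,3)]])
      then obtain ks where "0 ~: set ks" "pT ks (TT (mon w u) - sr (of_nat (2 * (nV w + length u))) (mon w u)) : WW"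
        unfolding good_def by blast
      thus ?thesis unfolding good_def using False by (intro exI[of _ "(2 * (nV w + length u)) # ks"]) auto
    next
      case True
      hence u: "u = []" and nV: "filter (%b. snd b ~= 0) w = []" by (auto simp: nV_def)
      define v where "v = map fst w"
      have wb: "b = (fst b, 0) & fst b : Bg" if "b : set w" for b
      proof -
        have "b : Bt" "snd b = 0" using that nV 1(2) by (auto simp: filter_empty_conv)
        thus ?thesis by (auto elim!: Bt_cases)
      qed
      have "map (%b. (fst b, 0)) w = w" by (rule map_idI) (metis wb)
      moreover have "v : lists Bg" unfolding v_def using wb by fastforce
      ultimately have w: "w = map (%x. (x, 0)) v" "v : lists Bg" by (simp_all add: v_def o_def)
      have "mon w u - Dlw v : Gs (length w)" using Dlw_leading[OF w(2)] w(1) u by (simp add: mon_def)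
      moreover have "Gs (length w) <= Lx (length w) (length u)" by (rule ms_mono) simp
      ultimately have "good (mon w u - Dlw v)" using low by blast
      moreover have "good (Dlw v)" unfolding good_def WW_def using w(2) by (intro exI[of _ "[]"]) (auto intro: r.span_base)
      ultimately have "good ((mon w u - Dlw v) + Dlw v)" using r.subspace_add[OF good_subspace] by blast
      thus ?thesis by simp
    qed
  qed
qed (rule good_subspace)

lemma dd_TT: "b : invs ==> dd (TT b) = TT (dd b)"
  by (simp add: TT_def dd_rules dd_dd_inv hh_inv inv_dd more_rules)

lemma TT_inv: "b : invs ==> TT b : invs"
  unfolding TT_def by (intro inv_add inv_dd hh_inv)

text \<open>On a cocycle \<open>TT a = dd (hh a)\<close>, so each factor \<open>TT - k\<close> acts
  as the scalar \<open>-k\<close> up to a coboundary of an invariant. The scalar \<open>c\<close> is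
  the product of these.\<close>

lemma pT_cocycle:
  "a : invs ==> dd a = 0 ==> 0 ~: set ks ==> EX c b. c ~= 0 & b : invs & pT ks a = sr c a + dd b"
proof (induction ks arbitrary: a)
  case Nil
  thus ?case using r.subspace_0[OF inv_subspace] by (intro exI[of _ 1] exI[of _ 0]) (simp add: dd_rules)
next
  case (Cons k ks)
  define a' where "a' = TT a - sr (of_nat k) a"
  have T: "TT a = dd (hh a)" using Cons.prems by (simp add: TT_def more_rules)
  have "a' : invs" unfolding a'_def using Cons.prems by (intro inv_diff inv_scale TT_inv)
  moreover have "dd a' = 0" unfolding a'_def T using Cons.prems by (simp add: dd_rules dd_dd_inv hh_inv)
  ultimately obtain c b where cb: "c ~= 0" "b : invs" "pT ks a' = sr c a' + dd b" using Cons by (metis list.set_intros(2))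
  have "pT (k # ks) a = sr (- (c * of_nat k)) a + dd (sr c (hh a) + b)"
    using cb by (simp add: a'_def T dd_rules r_simps)
  moreover have "- (c * of_nat k) ~= 0" using cb(1) Cons.prems(3) by simp
  moreover have "sr c (hh a) + b : invs" using cb Cons.prems by (intro inv_add inv_scale hh_inv)
  ultimately show ?case by blast
qed

theorem cocycle_decomposition:
  assumes a: "a : invs" and da: "dd a = 0"
  obtains u b where "u : WW" "u : invs" "b : invs" "a = u + dd b"
proof -
  obtain ks where ks: "0 ~: set ks" "pT ks a : WW" using good_AA[OF inv_AA[OF a]] unfolding good_def by blast
  obtain c b where cb: "c ~= 0" "b : invs" "pT ks a = sr c a + dd b" using pT_cocycle[OF a da ks(1)] by blast
  have "a = sr (inverse c) (pT ks a) + dd (sr (- inverse c) b)" using cb by (simp add: dd_rules r_simps)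
  moreover have "sr (inverse c) (pT ks a) : invs" unfolding cb(3) using a cb by (intro inv_scale inv_add inv_dd)
  moreover have "sr (inverse c) (pT ks a) : WW" by (rule r.subspace_scale[OF WW_subspace ks(2)])
  moreover have "sr (- inverse c) b : invs" by (rule inv_scale[OF cb(2)])
  ultimately show thesis using that by blast
qed

text \<open>Choose a product of factors sending \<open>b\<close> into \<open>WW\<close>. It commutes
  with d on invariants, and d vanishes on \<open>WW\<close>, so it kills \<open>dd b\<close>. But on
  \<open>dd b\<close>, assumed to lie in \<open>WW\<close>, it is a nonzero scalar.\<close>

theorem coboundary_meets_zero:
  assumes u: "dd b : WW" and b: "b : invs"
  shows "dd b = 0"
proof -
  obtain ks where ks: "0 ~: set ks" "pT ks b : WW" using good_AA[OF inv_AA[OF b]] unfolding good_def by blast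
  have comm: "dd (pT ks b) = pT ks (dd b)" using b
  proof (induction ks arbitrary: b)
    case (Cons k ks)
    have "TT b - sr (of_nat k) b : invs" using Cons.prems by (intro inv_diff inv_scale TT_inv)
    thus ?case using Cons by (simp add: dd_rules dd_TT)
  qed simp
  have "EX c. c ~= 0 & pT ks y = sr c y" if "y : WW" for y using ks(1) that
  proof (induction ks arbitrary: y)
    case Nil
    thus ?case by (intro exI[of _ 1]) simp
  next
    case (Cons k ks)
    have "- sr (of_nat k) y : WW" using Cons.prems r.subspace_neg[OF WW_subspace r.subspace_scale[OF WW_subspace]] by blast
    hence "EX c. c ~= 0 & pT ks (- sr (of_nat k) y) = sr c (- sr (of_nat k) y)" by (intro Cons.IH) (use Cons.prems in auto)
    then obtain c where "c ~= 0" "pT ks (- sr (of_nat k) y) = sr c (- sr (of_nat k) y)" by blast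
    thus ?case using Cons.prems TT_WW[of y] by (intro exI[of _ "- (c * of_nat k)"]) auto
  qed
  then obtain c where "c ~= 0" "pT ks (dd b) = sr c (dd b)" using u by blast
  moreover have "dd (pT ks b) = 0" by (rule dd_WW[OF ks(2)])
  ultimately show ?thesis using comm by simp
qed

end

section \<open>Homogeneous bases and linear extensions\<close>

context graded_space
begin

lemma homog_decomp_hcomp: "homog_decomp gr v (hcomp gr v)"
  unfolding hcomp_def by (rule theI'[OF ex1_homog_decomp])

lemma hcomp_unique: "homog_decomp gr v f ==> hcomp gr v = f"
  using homog_decomp_hcomp[of v] ex1_homog_decomp[of v] by blast

lemma hcomp_gr: "hcomp gr v a : gr a"
  and finite_hcomp: "finite {a. hcomp gr v a ~= 0}"
  and sum_hcomp: "v = (SUM a | hcomp gr v a ~= 0. hcomp gr v a)"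
  using homog_decomp_hcomp[of v] by (auto simp: homog_decomp_def)

lemma hcomp_of_gr:
  assumes v: "v : gr a"
  shows "hcomp gr v = (%b. if b = a then v else 0)"
proof (rule hcomp_unique)
  have "{b. (if b = a then v else 0) ~= 0} = (if v = 0 then {} else {a})" by auto
  thus "homog_decomp gr v (%b. if b = a then v else 0)"
    using v subspace_0[OF subspace_gr] by (auto simp: homog_decomp_def)
qed

lemma hcomp_zero: "hcomp gr 0 = (%b. 0)"
  by (rule hcomp_unique) (simp add: homog_decomp_def subspace_0[OF subspace_gr])

lemma homogeneous_basis_exists:
  assumes "finite_dim"
  obtains E where "homogeneous_basis E"
proof -
  obtain S where S: "finite S" "span S = UNIV" using assms by (auto simp: finite_dim_def)
  define H where "H = (\<Union>v\<in>S. hcomp gr v ` {a. hcomp gr v a ~= 0})"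
  obtain E where E: "E <= H" "independent E" "H <= span E" using maximal_independent_subset[of H] by metis
  have "v : span H" if "v : S" for v
  proof -
    have "hcomp gr v a : span H" if "hcomp gr v a ~= 0" for a
      using that \<open>v : S\<close> by (intro span_base) (auto simp: H_def)
    hence "(SUM a | hcomp gr v a ~= 0. hcomp gr v a) : span H" by (intro span_sum) auto
    thus ?thesis using sum_hcomp[of v] by simp
  qed
  hence "span S <= span E" using E(3) by (metis span_minimal span_mono span_span subsetI subspace_span order_trans)
  moreover have "ALL e:E. EX a. e : gr a" using E(1) hcomp_gr unfolding H_def by blast
  ultimately have "homogeneous_basis E" using E S by (auto simp: homogeneous_basis_def)
  thus thesis by (rule that)
qed

end

text \<open>Links the definite descriptions of the statement with the interface
  \<open>quad_space\<close>: in finite dimension nondegeneracy supplies dual vectors, and uniqueness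
  makes them homogeneous.\<close>

lemma quad_space_homogeneous_basis:
  fixes s :: "'k::field_char_0 => 'l::ab_group_add => 'l" and eps :: "'c::ab_group_add => 'c => 'k"
  assumes gs: "graded_space s gr" and fd: "graded_space.finite_dim s" and hb: "graded_space.homogeneous_basis s gr E"
    and nd: "nondegenerate_eps_symmetric_form eps s gr form" and cf: "commutation_factor eps"
  shows "quad_space s E (module.representation s E) eps gr (%b. SOME a. b : gr a) form (dual_vector form E)"
proof -
  interpret graded_space s gr by (rule gs)
  interpret cf: comm_factor eps by unfold_locales (rule cf)
  define dg where "dg b = (SOME a. b : gr a)" for b
  have ind: "independent E" and sp: "span E = UNIV" and hom: "!!e. e : E ==> e : gr (dg e)"
    using hb unfolding homogeneous_basis_def dg_def by (auto intro: someI)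
  obtain S where "finite S" "span S = UNIV" using fd by (auto simp: finite_dim_def)
  hence finE: "finite E" using independent_span_bound[of S E] ind by auto
  let ?r = "representation E"
  have r_sum: "(SUM b:E. s (?r v b) b) = v" for v
    using sum_representation_eq[OF ind, of v E] finE sp by simp
  have bs: "based_space s E ?r"
  proof unfold_locales
    show "?r (v + w) b = ?r v b + ?r w b" for v w b using representation_add[OF ind] sp by simp
    show "?r (s c v) b = c * ?r v b" for c v b using representation_scale[OF ind] sp by simp
    show "?r b b' = (if b = b' then 1 else 0)" if "b : E" for b b' using representation_basis[OF ind that] by simp
    show "v = (SUM b:E. s (?r v b) b)" for v by (rule r_sum[symmetric])
  qed (rule finE)
  interpret b: based_space s E ?r by (rule bs)
  have bil: "bilinear_map s s (*) form" and fdeg: "!!a b v w. v : gr a ==> w : gr b ==> a + b ~= 0 ==> form v w = 0"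
    and sym: "!!a b v w. v : gr a ==> w : gr b ==> form v w = eps a b * form w v"
    and nd0: "!!v. (!!w. form v w = 0) ==> v = 0"
    using nd unfolding nondegenerate_eps_symmetric_form_def by blast+
  have fl: "form (x + x') y = form x y + form x' y" "form x (y + y') = form x y + form x y'"
    "form (s c x) y = c * form x y" "form x (s c y) = c * form x y" for x x' y y' c
    using bil by (auto simp: bilinear_map_def lin_iff)
  have f0: "form 0 y = 0" "form y 0 = 0" for y using fl(3)[of 0 0 y] fl(4)[of y 0 0] by simp_all
  have fsum: "form (SUM i:A. f i) y = (SUM i:A. form (f i) y)" "form y (SUM i:A. f i) = (SUM i:A. form y (f i))" for A y and f :: "'i => 'l"
    by (induction A rule: fin_induct) (auto simp: fl f0)
  have gr_co: "dg b = a" if v: "v : gr a" and b: "b : E" "?r v b ~= 0" for v a b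
  proof -
    \<comment> \<open>Grouping the basis expansion by degree is a homogeneous decomposition of
      \<open>v\<close>; by uniqueness it is concentrated in degree \<open>a\<close>.\<close>
    define f where "f c = (SUM e | e : E & dg e = c. s (?r v e) e)" for c
    have rf: "?r (f c) e = (if e : E & dg e = c then ?r v e else 0)" if "e : E" for c e
    proof -
      have "?r (f c) e = (SUM e' | e' : E & dg e' = c. ?r v e' * ?r e' e)" by (simp add: f_def b.co_sum b.co_scale)
      also have "... = (SUM e' | e' : E & dg e' = c. if e' = e then ?r v e' else 0)" using that by (intro sum.cong refl) (auto simp: b.co_basis)
      also have "... = (if e : E & dg e = c then ?r v e else 0)" using finE by simp
      finally show ?thesis .
    qed
    have fgr: "f c : gr c" for c unfolding f_def
      by (intro subspace_sum[OF subspace_gr] subspace_scale[OF subspace_gr]) (use hom in auto)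
    have sub: "{c. f c ~= 0} <= dg ` E"
    proof
      fix c assume "c : {c. f c ~= 0}"
      hence "{e. e : E & dg e = c} ~= {}" unfolding f_def by (metis (mono_tags, lifting) mem_Collect_eq sum.empty)
      thus "c : dg ` E" by auto
    qed
    have "v = (SUM c:dg ` E. f c)"
      using sum.image_gen[OF finE, of "%e. s (?r v e) e" dg] r_sum[of v] by (simp add: f_def)
    also have "... = (SUM c | f c ~= 0. f c)" using finE sub by (intro sum.mono_neutral_right) auto
    finally have "homog_decomp gr v f" using fgr finite_subset[OF sub] finE by (simp add: homog_decomp_def)
    hence fe: "f = (%c. if c = a then v else 0)" using hcomp_unique hcomp_of_gr[OF v] by metis
    show ?thesis
    proof (rule ccontr)
      assume "dg b ~= a"
      hence "f (dg b) = 0" using fe by simp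
      thus False using rf[OF b(1), of "dg b"] b by simp
    qed
  qed
  \<comment> \<open>Nondegeneracy is given for the left argument and needed for the right one.
    \<epsilon>-symmetry relates them only on homogeneous elements, so both vectors are split into
    components.\<close>
  have nondeg: "v = 0" if z: "!!b. b : E ==> form b v = 0" for v
  proof (rule nd0)
    have all: "form x v = 0" for x
      using arg_cong[OF r_sum[of x], of "%x. form x v"] z by (simp add: fsum fl)
    have hc: "form x (hcomp gr v a) = 0" for x a
    proof -
      have "form (hcomp gr x c) (hcomp gr v a) = 0" for c
      proof (cases "c + a = 0")
        case False
        thus ?thesis using fdeg[OF hcomp_gr hcomp_gr] by blast
      next
        case True
        have "form (hcomp gr x c) v = (SUM d | hcomp gr v d ~= 0. form (hcomp gr x c) (hcomp gr v d))"
          by (subst sum_hcomp[of v]) (simp add: fsum)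
        also have "... = (SUM d | hcomp gr v d ~= 0. if d = a then form (hcomp gr x c) (hcomp gr v d) else 0)"
          using True fdeg[OF hcomp_gr hcomp_gr] by (intro sum.cong refl) (auto simp: add_eq_0_iff)
        also have "... = form (hcomp gr x c) (hcomp gr v a)" using finite_hcomp[of v] by (auto simp: f0)
        finally show ?thesis using all by simp
      qed
      thus ?thesis by (subst sum_hcomp[of x]) (simp add: fsum)
    qed
    fix w
    have "form (hcomp gr v a) (hcomp gr w c) = 0" for a c using sym[OF hcomp_gr hcomp_gr] hc by simp
    thus "form v w = 0" by (subst sum_hcomp[of v], subst sum_hcomp[of w]) (simp add: fsum)
  qed
  \<comment> \<open>Injective by \<open>nondeg\<close>, hence surjective in finite dimension; the
    preimages of the basis vectors are the dual vectors.\<close>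
  define L where "L v = (SUM b:E. s (form b v) b)" for v
  have rL: "?r (L v) b = form b v" if "b : E" for v b
  proof -
    have "?r (L v) b = (SUM e:E. if e = b then form e v else 0)" unfolding L_def b.co_sum b.co_scale using that
      by (intro sum.cong refl) (auto simp: b.co_basis)
    thus ?thesis using that finE by simp
  qed
  have L_lin: "lin s s L"
    using vector_space_axioms by (auto simp: lin_iff L_def fl scale_left_distrib sum.distrib scale_sum_right)
  interpret fd: finite_dimensional_vector_space s E by unfold_locales (use finE ind sp in auto)
  have "inj L"
  proof (rule injI)
    fix x y assume "L x = L y"
    have d: "form b (x - y) = form b x - form b y" for b using fl(2)[of b "x - y" y] by simp
    have "x - y = 0" by (rule nondeg) (metis d \<open>L x = L y\<close> rL diff_self)
    thus "x = y" by simp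
  qed
  hence "surj L" using L_lin by (intro fd.linear_inj_imp_surj)
  hence ex: "EX w. ALL e':E. form e' w = (if e' = e then 1 else 0)" if "e : E" for e
  proof -
    obtain w where "L w = e" using \<open>surj L\<close> by (metis surj_def)
    hence "form e' w = (if e' = e then 1 else 0)" if "e' : E" for e'
      using rL[OF that, of w] b.co_basis[OF \<open>e : E\<close> that] by auto
    thus ?thesis by blast
  qed
  have uniq: "w = w'" if "ALL e':E. form e' w = (if e' = e then 1 else 0)" "ALL e':E. form e' w' = (if e' = e then 1 else 0)" for w w' e
  proof -
    have d: "form b (w - w') = form b w - form b w'" for b using fl(2)[of b "w - w'" w'] by simp
    have "w - w' = 0" by (rule nondeg) (use that d in simp)
    thus ?thesis by simp
  qed
  have du: "form e' (dual_vector form E e) = (if e' = e then 1 else 0)" if "e : E" "e' : E" for e e'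
  proof -
    have "EX! w. ALL e':E. form e' w = (if e' = e then 1 else 0)" using ex[OF that(1)] uniq by blast
    from theI'[OF this] show ?thesis using that(2) unfolding dual_vector_def by blast
  qed
  have du_gr: "dual_vector form E e : gr (- dg e)" if e: "e : E" for e
  proof -
    \<comment> \<open>This component pairs with the basis exactly as the dual vector does, so it is
      the dual vector.\<close>
    define w where "w = hcomp gr (dual_vector form E e) (- dg e)"
    have "form e' w = (if e' = e then 1 else 0)" if e': "e' : E" for e'
    proof (cases "dg e' = dg e")
      case False
      hence "dg e' + - dg e ~= 0" by simp
      thus ?thesis using fdeg[OF hom[OF e'] hcomp_gr] False unfolding w_def by auto
    next
      case True
      let ?d = "dual_vector form E e"
      have "form e' ?d = (SUM c | hcomp gr ?d c ~= 0. form e' (hcomp gr ?d c))"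
        by (subst sum_hcomp[of ?d]) (simp add: fsum)
      also have "... = (SUM c | hcomp gr ?d c ~= 0. if c = - dg e then form e' (hcomp gr ?d c) else 0)"
        using True fdeg[OF hom[OF e'] hcomp_gr] by (intro sum.cong refl) (auto simp: add_eq_0_iff)
      also have "... = form e' w" using finite_hcomp[of ?d] by (auto simp: w_def f0)
      finally show ?thesis using du[OF e e'] by simp
    qed
    hence "dual_vector form E e = w" using uniq[of "dual_vector form E e" e w] du[OF e] by auto
    thus ?thesis using hcomp_gr unfolding w_def by metis
  qed
  show ?thesis unfolding dg_def[symmetric]
  proof (unfold_locales)
    show "subspace (gr a)" for a by (rule subspace_gr)
    show "b : E ==> b : gr (dg b)" for b by (rule hom)
    show "v : gr a ==> b : E ==> ?r v b ~= 0 ==> dg b = a" for v a b by (rule gr_co)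
    show "b : E ==> b' : E ==> form b (dual_vector form E b') = (if b = b' then 1 else 0)" for b b' by (rule du)
    show "b : E ==> dual_vector form E b : gr (- dg b)" for b by (rule du_gr)
    show "(!!b. b : E ==> form b v = 0) ==> v = 0" for v by (rule nondeg)
  qed (use bil fdeg sym in blast)+
qed

lemma (in kalg) lin_span_induct [consumes 2, case_names zero add smult base]:
  assumes x: "x : lin_span M S" and S: "S <= car M" and z: "P \<zero>"
    and add: "!!x y. x : car M ==> y : car M ==> P x ==> P y ==> P (x \<oplus> y)"
    and sm: "!!c x. x : car M ==> P x ==> P (c \<odot>[M] x)"
    and b: "!!x. x : S ==> P x"
  shows "P x"
proof -
  obtain c F where F: "x = (\<Oplus>y\<in>F. c y \<odot>[M] y)" "finite F" "F <= S" using x by (auto simp: lin_span_def)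
  have "P (\<Oplus>y\<in>F. c y \<odot>[M] y)" using F(2,3)
  proof (induction rule: finite_induct)
    case (insert y F)
    hence "(\<Oplus>y\<in>insert y F. c y \<odot>[M] y) = c y \<odot>[M] y \<oplus> (\<Oplus>y\<in>F. c y \<odot>[M] y)" using S by (intro finsum_insert) auto
    moreover have "(\<Oplus>y\<in>F. c y \<odot>[M] y) : car M" using insert S by (intro finsum_closed) auto
    moreover have "y : car M" "P (c y \<odot>[M] y)" using insert S b sm by auto
    ultimately show ?case using insert add by simp
  qed (simp add: z)
  thus ?thesis by (simp add: F(1))
qed

context embedding
begin

text \<open>Compose with a linear projection of the ring type onto the embedded carrier. Maps
  defined on a record thus become linear maps of the ring, as \<open>dirac_alg\<close>
  expects.\<close>

lemma extend_linear:
  fixes f :: "'a => 'z::ab_group_add"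
  assumes sz: "vector_space sz"
    and add: "!!x y. x : car M ==> y : car M ==> f (x \<oplus> y) = f x + f y"
    and sm: "!!c x. x : car M ==> f (c \<odot>[M] x) = sz c (f x)"
  obtains F where "lin scale sz F" "!!x. x : car M ==> F (\<Phi> x) = f x"
proof -
  obtain r where r: "lin scale scale r" "!!x. r x = 0 \<longleftrightarrow> x : \<Phi> ` car M" "!!x. x - r x : \<Phi> ` car M"
    by (rule exists_projection_along[OF subspace_image_carrier]) blast
  define p where "p x = inv_into (car M) \<Phi> (x - r x)" for x
  have p: "p x : car M" "\<Phi> (p x) = x - r x" for x
    using r(3)[of x] by (auto simp: p_def inv_into_into f_inv_into_f)
  have rr: "r (x + y) = r x + r y" "r (scale c x) = scale c (r x)" for x y c using r(1) by (simp_all add: lin_iff)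
  have "p (x + y) = p x \<oplus> p y" for x y
    using p[of x] p[of y] p[of "x + y"] emb_eq[of "p (x + y)" "p x \<oplus> p y"] by (simp add: emb_add rr)
  moreover have "p (scale c x) = c \<odot>[M] p x" for c x
    using p[of x] p[of "scale c x"] emb_eq[of "p (scale c x)" "c \<odot>[M] p x"] by (simp add: emb_smult rr scale_right_diff_distrib)
  ultimately have "lin scale sz (%x. f (p x))"
    using vector_space_axioms sz p(1) add sm by (auto simp: lin_iff)
  moreover have "f (p (\<Phi> x)) = f x" if "x : car M" for x
    using p[of "\<Phi> x"] r(2)[of "\<Phi> x"] that emb_eq[of "p (\<Phi> x)" x] by auto
  ultimately show thesis by (rule that)
qed

end

context graded_alg
begin

text \<open>Scaling every homogeneous component by a character-like \<open>\<chi>\<close>. The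
  choices for parity and for \<open>eps c\<close> give \<open>kap\<close> and
  \<open>tau c\<close>.\<close>

lemma twist_exists:
  obtains F where "lin scale scale F" "!!x i. x : gr i ==> F (\<Phi> x) = scale (\<chi> i) (\<Phi> x)"
    "!!x. x : car M ==> F (\<Phi> x) = (SUM i:hs x. scale (\<chi> i) (pr i x))"
proof -
  define f where "f x = (SUM i:hs x. scale (\<chi> i) (\<Phi> (hc x i)))" for x
  have 1: "f (x \<oplus> y) = f x + f y" if "x : car M" "y : car M" for x y
    unfolding f_def using that by (rule hsum_add[where F = "%i x. scale (\<chi> i) (\<Phi> x)"]) (simp add: emb_add scale_right_distrib)
  have 2: "f (c \<odot>[M] x) = scale c (f x)" if "x : car M" for c x
    unfolding f_def using that
    by (rule hsum_smult[where F = "%i x. scale (\<chi> i) (\<Phi> x)", OF _ vector_space_axioms]) (simp_all add: emb_zero emb_smult mult.commute)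
  obtain F where F: "lin scale scale F" "!!x. x : car M ==> F (\<Phi> x) = f x"
    by (rule extend_linear[OF vector_space_axioms 1 2]) (assumption+, rule that)
  have "F (\<Phi> x) = scale (\<chi> i) (\<Phi> x)" if "x : gr i" for x i
    using F(2)[OF gr_closed[OF that]] hsum_gr[OF that, of "%i x. scale (\<chi> i) (\<Phi> x)"] by (simp add: f_def emb_zero)
  moreover have "F (\<Phi> x) = (SUM i:hs x. scale (\<chi> i) (pr i x))" if "x : car M" for x
    using F(2)[OF that] emb_hc[OF that] by (simp add: f_def)
  ultimately show thesis using F(1) that by blast
qed

text \<open>With a homogeneous left argument the twisted flip is the twist of \<open>y\<close>
  followed by multiplication by \<open>x\<close>. This turns the brackets of the statement into the
  formulas for \<open>dd\<close> and \<open>invs\<close>.\<close>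

lemma flip_homog_left:
  assumes x: "x : gr i" and y: "y : car M"
  shows "\<Phi> (twisted_flip \<chi> M gr x y) = (SUM j:hs y. scale (\<chi> i j) (pr j y)) * \<Phi> x"
proof -
  have "\<Phi> (twisted_flip \<chi> M gr x y) = (SUM i:hs x. SUM j:hs y. scale (\<chi> i j) (pr j y * \<Phi> (hc x i)))"
    using emb_twisted_flip[OF gr_closed[OF x] y] emb_hc[OF gr_closed[OF x]] by simp
  also have "... = (SUM j:hs y. scale (\<chi> i j) (pr j y * \<Phi> x))"
    by (rule hsum_gr[OF x, of "%i x. SUM j:hs y. scale (\<chi> i j) (pr j y * \<Phi> x)"]) (simp add: emb_zero)
  finally show ?thesis by (simp add: sum_distrib_right scale_mult_left)
qed

lemma flip_add_left:
  assumes "x : car M" "x' : car M" "y : car M"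
  shows "\<Phi> (twisted_flip \<chi> M gr (x \<oplus> x') y) = \<Phi> (twisted_flip \<chi> M gr x y) + \<Phi> (twisted_flip \<chi> M gr x' y)"
proof -
  have eq: "\<Phi> (twisted_flip \<chi> M gr x y) = (SUM i:hs x. SUM j:hs y. scale (\<chi> i j) (pr j y * \<Phi> (hc x i)))" if "x : car M" for x
    using emb_twisted_flip[OF that assms(3)] emb_hc[OF that] by simp
  show ?thesis unfolding eq[OF assms(1)] eq[OF assms(2)] eq[OF add.m_closed[OF assms(1,2)]]
    by (rule hsum_add[OF assms(1,2), of "%i x. SUM j:hs y. scale (\<chi> i j) (pr j y * \<Phi> x)"])
      (simp add: emb_add distrib_left scale_right_distrib sum.distrib)
qed

lemma flip_add_right:
  assumes "x : car M" "y : car M" "y' : car M"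
  shows "\<Phi> (twisted_flip \<chi> M gr x (y \<oplus> y')) = \<Phi> (twisted_flip \<chi> M gr x y) + \<Phi> (twisted_flip \<chi> M gr x y')"
proof -
  have eq: "\<Phi> (twisted_flip \<chi> M gr x y) = (SUM j:hs y. SUM i:hs x. scale (\<chi> i j) (\<Phi> (hc y j) * pr i x))" if "y : car M" for y
    using emb_twisted_flip[OF assms(1) that] emb_hc[OF that] by (subst sum.swap) simp
  show ?thesis unfolding eq[OF assms(2)] eq[OF assms(3)] eq[OF add.m_closed[OF assms(2,3)]]
    by (rule hsum_add[OF assms(2,3), of "%j y. SUM i:hs x. scale (\<chi> i j) (\<Phi> y * pr i x)"])
      (simp add: emb_add distrib_right scale_right_distrib sum.distrib)
qed

lemma emb_bracket:
  assumes "x : car M" "y : car M"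
  shows "\<Phi> (colour_bracket \<chi> M gr x y) = \<Phi> x * \<Phi> y - \<Phi> (twisted_flip \<chi> M gr x y)"
    and "colour_bracket \<chi> M gr x y : car M"
  using assms twisted_flip_closed by (simp_all add: colour_bracket_def emb_minus emb_mult)

end

section \<open>The Dirac algebra of a representation of colour Lie type\<close>

locale dirac_setting =
  fixes X :: "('k::field_char_0, 'c::ab_group_add, 'g::ab_group_add, 'v::ab_group_add) colour_rep"
    and E :: "'v set"
  assumes cf: "commutation_factor (eps X)"
    and quad: "quadratic_colour_lie_algebra (eps X) (g_scale X) (g_grading X) (g_bracket X) (g_form X)"
    and fd_g: "graded_space.finite_dim (g_scale X)"
    and rep: "orthogonal_representation (eps X) (g_scale X) (g_grading X) (g_bracket X)
           (V_scale X) (V_grading X) (V_form X) (action X)"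
    and fd_V: "graded_space.finite_dim (V_scale X)"
    and lie_type: "colour_lie_type (eps X) (g_scale X) (g_grading X) (g_bracket X) (g_form X)
           (V_scale X) (V_grading X) (V_form X) (action X) (V_mult X)"
    and hb: "graded_space.homogeneous_basis (V_scale X) (V_grading X) E"
begin

abbreviation "ep == eps X"
abbreviation "sg == g_scale X"
abbreviation "gg == g_grading X"
abbreviation "br == g_bracket X"
abbreviation "fg == g_form X"
abbreviation "vs == V_scale X"
abbreviation "gv == V_grading X"
abbreviation "fv == V_form X"
abbreviation "ac == action X"
abbreviation "ph == V_mult X"

definition Bg :: "'g set" where "Bg = (SOME B. graded_space.homogeneous_basis sg gg B)"
abbreviation "cog == module.representation sg Bg"
abbreviation "dgg == (%b. SOME a. b : gg a)"
abbreviation "dug == dual_vector fg Bg"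
abbreviation "coV == module.representation vs E"
abbreviation "dgV == (%b. SOME a. b : gv a)"
abbreviation "duV == dual_vector fv E"

lemma graded_g: "graded_space sg gg" and graded_V: "graded_space vs gv"
  using quad rep unfolding quadratic_colour_lie_algebra_def colour_lie_algebra_def orthogonal_representation_def by blast+

lemma nondeg_g: "nondegenerate_eps_symmetric_form ep sg gg fg" and nondeg_V: "nondegenerate_eps_symmetric_form ep vs gv fv"
  and br_bil: "bilinear_map sg sg sg br"
  using quad rep unfolding quadratic_colour_lie_algebra_def colour_lie_algebra_def orthogonal_representation_def by blast+

lemma hb_g: "graded_space.homogeneous_basis sg gg Bg"
proof -
  interpret graded_space sg gg by (rule graded_g)
  show ?thesis unfolding Bg_def by (rule homogeneous_basis_exists[OF fd_g]) (rule someI)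
qed

sublocale V: quad_space vs E coV ep gv dgV fv duV
  by (rule quad_space_homogeneous_basis[OF graded_V fd_V hb nondeg_V cf])

sublocale G: quad_space sg Bg cog ep gg dgg fg dug
  by (rule quad_space_homogeneous_basis[OF graded_g fd_g hb_g nondeg_g cf])

abbreviation "mu == moment_map fg fv ac"
abbreviation "tb == tilde_bracket X"
abbreviation "st == dsum_scale sg vs"
abbreviation "gt == dsum_grading gg gv"

lemma ac_add: "ac (x + y) v = ac x v + ac y v" and ac_scale: "ac (sg c x) v = vs c (ac x v)"
  using rep unfolding orthogonal_representation_def lin_iff by blast+

lemma mu_eq: "fg x (mu v w) = fv (ac x v) w"
proof -
  \<comment> \<open>The expansion in the dual basis is the witness for the definite description of
    the moment map; nondegeneracy makes it unique.\<close>
  define u where "u = (SUM k:Bg. sg (fv (ac k v) w) (dug k))"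
  have u: "fg x u = fv (ac x v) w" for x
  proof -
    have "lin sg (*) (%x. fv (ac x v) w)"
      using G.vector_space_axioms vector_space_field
      by (auto simp: lin_iff ac_add ac_scale V.form_add_l V.form_scale_l)
    from G.linear_apply_sum[OF this, of "%k. fg x (dug k)" "%k. k" Bg]
    have "fv (ac x v) w = (SUM k:Bg. fg x (dug k) * fv (ac k v) w)" by (simp only: G.expand_basis[of x, symmetric])
    thus ?thesis by (simp add: u_def G.form_sum_r G.form_scale_r mult.commute)
  qed
  have "mu v w = u" unfolding moment_map_def
  proof (rule the_equality)
    fix u' assume u': "ALL x. fg x u' = fv (ac x v) w"
    have "u' - u = 0" by (rule G.nondeg) (simp add: G.form_diff_r u u')
    thus "u' = u" by simp
  qed (simp add: u)
  thus ?thesis by (simp add: u)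
qed

text \<open>Linearity of \<open>ac x\<close> is part of \<open>so_eps\<close> and so is given for
  homogeneous \<open>x\<close> only; a general \<open>x\<close> is split into components.\<close>

lemma ac_zero: "ac x 0 = 0" "ac 0 v = 0"
proof -
  interpret g: graded_space sg gg by (rule graded_g)
  show "ac 0 v = 0" using ac_scale[of 0 0 v] by simp
  have z: "ac x 0 = 0" if "x : gg a" for x a
  proof -
    have "ac x : so_eps ep vs gv fv a" using rep that unfolding orthogonal_representation_def by blast
    hence "ALL c v. ac x (vs c v) = vs c (ac x v)" unfolding so_eps_def lin_iff by blast
    hence "ac x (vs 0 0) = vs 0 (ac x 0)" by blast
    thus ?thesis by simp
  qed
  have "ac (SUM i:A. f i) 0 = (SUM i:A. ac (f i) 0)" for A and f :: "'c => 'g"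
    by (induction A rule: fin_induct) (use ac_scale[of 0 0 0] ac_add in auto)
  thus "ac x 0 = 0" using z[OF g.hcomp_gr] by (subst g.sum_hcomp[of x]) simp
qed

lemma mu_zero: "mu 0 w = 0" "mu v 0 = 0"
  using G.nondeg[of "mu 0 w"] G.nondeg[of "mu v 0"] by (simp_all add: mu_eq ac_zero)

lemma ph_bil: "bilinear_map vs vs vs ph"
  using lie_type unfolding colour_lie_type_def by blast

lemma ph_zero: "ph 0 w = 0" "ph v 0 = 0"
proof -
  have "ph (vs 0 0) w = vs 0 (ph 0 w)" "ph v (vs 0 0) = vs 0 (ph v 0)"
    using ph_bil unfolding bilinear_map_def lin_iff by blast+
  thus "ph 0 w = 0" "ph v 0 = 0" by simp_all
qed

lemma br_zero: "br 0 y = 0" "br x 0 = 0"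
proof -
  have "br (sg 0 0) y = sg 0 (br 0 y)" "br x (sg 0 0) = sg 0 (br x 0)"
    using br_bil unfolding bilinear_map_def lin_iff by blast+
  thus "br 0 y = 0" "br x 0 = 0" by simp_all
qed

lemma tb_gg: "tb (x, 0) (y, 0) = (br x y, 0)" and tb_gV: "tb (x, 0) (0, v) = (0, ac x v)" and tb_VV: "tb (0, v) (0, w) = (mu v w, ph v w)"
proof -
  interpret v: graded_space vs gv by (rule graded_V)
  interpret g: graded_space sg gg by (rule graded_g)
  show "tb (x, 0) (y, 0) = (br x y, 0)" "tb (x, 0) (0, v) = (0, ac x v)" "tb (0, v) (0, w) = (mu v w, ph v w)"
    by (simp_all add: tilde_bracket_def dsum_bracket_def v.hcomp_zero g.hcomp_zero mu_zero ph_zero br_zero ac_zero)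
qed

lemma tilde: "colour_lie_algebra ep st gt tb"
  using lie_type unfolding colour_lie_type_def quadratic_colour_lie_algebra_def tilde_bracket_def by blast

lemma ph_so: "v : gv a ==> ph v : so_eps ep vs gv fv a"
proof -
  assume v: "v : gv a"
  have "fv (ph v u) w = - ep a b * fv u (ph v w)" if "u : gv b" for b u w
    using lie_type v that unfolding colour_lie_type_def by blast
  moreover have "ph v u : gv (a + b)" if "u : gv b" for b u
    using lie_type v that unfolding colour_lie_type_def by blast
  ultimately show ?thesis using ph_bil by (simp add: so_eps_def bilinear_map_def)
qed

lemma dirac_repI:
  fixes sr :: "'k => 'r::ring => 'r"
  assumes "typed_algebra sr" and "lin vs sr th"
    and "!!v. ee * th v = th v" "!!v. th v * ee = th v" "ee * ee = ee"
    and "!!a b v w. v : gv a ==> w : gv b ==> th v * th w = sr (2 * fv v w) ee - sr (ep a b) (th w * th v)"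
    and "lin st sr XX" and "!!p. XX p * ee = XX p" "!!p. ee * XX p = XX p"
    and "!!a b p q. p : gt a ==> q : gt b ==> XX p * XX q = sr (ep a b) (XX q * XX p) + XX (tb p q)"
    and "!!a b v p. v : gv a ==> p : gt b ==> th v * XX p = sr (ep a b) (XX p * th v)"
  shows "dirac_rep sg Bg cog gg dgg fg dug vs E coV ep gv dgV fv duV sr th ee ph br ac mu tb XX"
proof -
  interpret typed_algebra sr by fact
  have th: "th (x + y) = th x + th y" "th (vs c x) = sr c (th x)" for x y c
    using assms(2) unfolding lin_iff by blast+
  have XX: "XX (p + q) = XX p + XX q" "XX (st c p) = sr c (XX p)" for p q c
    using assms(7) unfolding lin_iff by blast+
  interpret T: graded_space st gt using tilde unfolding colour_lie_algebra_def by blast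
  have phi: "!!a b v w. v : gv a ==> w : gv b ==> ph v w : gv (a + b)"
    "!!a b v w. v : gv a ==> w : gv b ==> ph v w = - vs (ep a b) (ph w v)"
    "!!x a v b w. x : gg a ==> v : gv b ==> ac x (ph v w) = ph (ac x v) w + vs (ep a b) (ph v (ac x w))"
    using lie_type unfolding colour_lie_type_def by blast+
  show ?thesis
    by unfold_locales (rule assms th XX ph_bil phi ph_so quad rep mu_eq tilde tb_gg tb_gV tb_VV; assumption)+
qed

abbreviation Bt :: "('g * 'v) set" where "Bt == dirac_rep.Bt Bg E"
abbreviation cot :: "'g * 'v => 'g * 'v => 'k" where "cot == dirac_rep.cot cog coV"
abbreviation dgt :: "'g * 'v => 'c" where "dgt == dirac_rep.dgt dgg dgV"

text \<open>The zero maps into any operator ring satisfy the relations. Interpreting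
  \<open>dirac_rep\<close> with them yields the facts on the basis \<open>Bt\<close>, which do not
  mention the ring, before the enveloping and Clifford algebras are available.\<close>

lemma dirac_rep_zero:
  "dirac_rep sg Bg cog gg dgg fg dug vs E coV ep gv dgV fv duV (lscale :: 'k => (unit, 'k) lend => _) (%_. 0) 0 ph br ac mu tb (%_. 0)"
proof -
  interpret L: typed_algebra "lscale :: 'k => (unit, 'k) lend => _" by (rule typed_algebra_lscale)
  interpret T: graded_space st gt using tilde unfolding colour_lie_algebra_def by blast
  show ?thesis
    by (rule dirac_repI)
      (simp_all add: L.typed_algebra_axioms lin_iff V.vector_space_axioms L.vector_space_axioms T.vector_space_axioms)
qed

sublocale T0: lie_basis st Bt cot dgt ep tb
proof -
  interpret Z: dirac_rep sg Bg cog gg dgg fg dug vs E coV ep gv dgV fv duV "lscale :: 'k => (unit, 'k) lend => _" "%_. 0" 0 ph br ac mu tb "%_. 0"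
    by (rule dirac_rep_zero)
  show "lie_basis st Bt cot dgt ep tb" by (rule Z.T0.lie_basis_axioms)
qed

lemma basis_gt: "b : Bt ==> b : gt (dgt b)" and gt_cot: "p : gt a ==> b : Bt ==> cot p b ~= 0 ==> dgt b = a"
proof -
  interpret Z: dirac_rep sg Bg cog gg dgg fg dug vs E coV ep gv dgV fv duV "lscale :: 'k => (unit, 'k) lend => _" "%_. 0" 0 ph br ac mu tb "%_. 0"
    by (rule dirac_rep_zero)
  show "b : Bt ==> b : gt (dgt b)" by (rule Z.basis_gt)
  show "p : gt a ==> b : Bt ==> cot p b ~= 0 ==> dgt b = a" by (rule Z.gt_cot)
qed

lemma br_gr: "x : gg a ==> y : gg b ==> br x y : gg (a + b)"
  using quad unfolding quadratic_colour_lie_algebra_def colour_lie_algebra_def by blast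

lemma bil_zero: "vector_space s ==> bilinear_map s s (*) (%_ _. 0 :: 'k)"
  using vector_space_field by (auto simp: bilinear_map_def lin_iff)

sublocale UG: presented sg Bg cog gg dgg ep br "%_ _. 0"
proof unfold_locales
  show "dgg b = dgg x + dgg y" if "x : Bg" "y : Bg" "b : Bg" "cog (br x y) b ~= 0" for x y b
    using G.gr_co[OF br_gr[OF G.basis_gr[OF that(1)] G.basis_gr[OF that(2)]] that(3,4)] .
qed (auto intro: G.basis_gr G.gr_co br_bil bil_zero G.vector_space_axioms)

sublocale UT: presented st Bt cot gt dgt ep tb "%_ _. 0"
  by unfold_locales (auto intro: basis_gt gt_cot T0.br_bilinear bil_zero T0.vector_space_axioms T0.br_dg)

abbreviation DmC :: "bit \<times> 'c => 'v set" where "DmC == %(p, a). if p = 1 then gv a else {}"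

lemma bit_cases: "p = 0 \<or> p = (1 :: bit)" by (cases p) auto

text \<open>All generators have parity 1, so \<open>super_eps\<close> supplies the minus sign that
  brings the Clifford relation into the common form.\<close>

sublocale CT: presented vs E coV DmC "%b. (1, dgV b)" "super_eps ep" "%_ _. 0" "%v w. 2 * fv v w"
proof unfold_locales
  show "bilinear_map vs vs vs (%_ _. 0)"
    using V.vector_space_axioms by (auto simp: bilinear_map_def lin_iff)
  show "bilinear_map vs vs (*) (%v w. 2 * fv v w)"
    using V.vector_space_axioms vector_space_field
    by (auto simp: bilinear_map_def lin_iff V.form_add_l V.form_add_r V.form_scale_l V.form_scale_r distrib_left)
  show "(1, dgV x) + (1, dgV y) = (0 :: bit \<times> 'c)" if "x : E" "y : E" "2 * fv x y ~= 0" for x y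
    using V.form_nz_deg[OF V.basis_gr[OF that(1)] V.basis_gr[OF that(2)]] that(3) by (simp add: zero_prod_def)
qed (auto intro: V.basis_gr V.gr_co split: if_splits)

lemma env_g_eq: "env_g X = UG.QQ" and env_g_gen_eq: "env_g_gen X = UG.iQ" and env_g_grading_eq: "env_g_grading X = UG.grQ"
proof -
  have "enveloping_ideal ep sg gg br = UG.II"
  proof -
    have z: "UG.iT z \<oplus>[UG.TT] 0 \<odot>[UG.TT] \<one>[UG.TT] = UG.iT z" for z by (simp add: UG.iT_eq UG.cT_hom)
    show ?thesis unfolding enveloping_ideal_def Let_def UG.rels_def z ..
  qed
  thus 1: "env_g X = UG.QQ" and 2: "env_g_gen X = UG.iQ"
    unfolding env_g_def enveloping_algebra_def env_g_gen_def enveloping_gen_def[abs_def] UG.iQ_def[abs_def] by simp_all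
  show "env_g_grading X = UG.grQ"
    unfolding env_g_grading_def enveloping_grading_def UG.grQ_def 1[unfolded env_g_def] 2[unfolded env_g_gen_def] ..
qed

lemma env_tilde_eq: "env_tilde X = UT.QQ" and env_tilde_gen_eq: "env_tilde_gen X = UT.iQ"
  and env_tilde_grading_eq: "env_tilde_grading X = (%(p, a). if p = 0 then UT.grQ a else {\<zero>[UT.QQ]})"
proof -
  have s: "tilde_scale X = st" "tilde_grading X = gt" by (simp_all add: tilde_scale_def tilde_grading_def)
  have "enveloping_ideal ep st gt tb = UT.II"
  proof -
    have z: "UT.iT z \<oplus>[UT.TT] 0 \<odot>[UT.TT] \<one>[UT.TT] = UT.iT z" for z by (simp add: UT.iT_eq UT.cT_hom)
    show ?thesis unfolding enveloping_ideal_def Let_def UT.rels_def z ..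
  qed
  thus 1: "env_tilde X = UT.QQ" and 2: "env_tilde_gen X = UT.iQ"
    unfolding env_tilde_def enveloping_algebra_def env_tilde_gen_def enveloping_gen_def[abs_def] UT.iQ_def[abs_def] s by simp_all
  have g: "enveloping_grading ep st gt tb = UT.grQ"
    unfolding enveloping_grading_def UT.grQ_def 1[unfolded env_tilde_def s] 2[unfolded env_tilde_gen_def s] ..
  show "env_tilde_grading X = (%(p, a). if p = 0 then UT.grQ a else {\<zero>[UT.QQ]})"
    unfolding env_tilde_grading_def 1 s g ..
qed

lemma cliff_eq: "cliff X = CT.QQ" and cliff_gen_eq: "cliff_gen X = CT.iQ" and cliff_grading_eq: "cliff_grading X = CT.grQ"
proof -
  let ?R = "%a b x y. (CT.iT x \<otimes>[CT.TT] CT.iT y \<oplus>[CT.TT] ep a b \<odot>[CT.TT] (CT.iT y \<otimes>[CT.TT] CT.iT x)) \<ominus>[CT.TT] (2 * fv x y) \<odot>[CT.TT] \<one>[CT.TT]"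
  have i0: "CT.iT 0 = CT.cT 0"
  proof -
    have "free_gen (0 + 0) - free_gen 0 - free_gen 0 : CT.linrels" unfolding CT.linrels_def by blast
    from CT.cT_linrels[OF this] have "CT.cT (- free_gen 0) = CT.cT 0" by simp
    hence "CT.cT 0 \<ominus>[CT.TT] CT.cT (- free_gen 0) = CT.cT 0 \<ominus>[CT.TT] CT.cT 0" by simp
    thus ?thesis unfolding CT.cT_minus by (simp add: CT.iT_eq)
  qed
  have eq: "(CT.iT x \<otimes>[CT.TT] CT.iT y \<ominus>[CT.TT] super_eps ep (1, a) (1, b) \<odot>[CT.TT] (CT.iT y \<otimes>[CT.TT] CT.iT x)) \<ominus>[CT.TT]
      (CT.iT 0 \<oplus>[CT.TT] (2 * fv x y) \<odot>[CT.TT] \<one>[CT.TT]) =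
      ?R a b x y" for a b x y
    unfolding i0 by (simp add: CT.iT_eq CT.cT_hom CT.cT_minus super_eps_def)
  have "CT.rels = {?R a b x y | a b x y.
       x : gv a & y : gv b}" (is "_ = ?S")
  proof (intro equalityI subsetI)
    fix z assume "z : CT.rels"
    then obtain i j x y where z: "z = (CT.iT x \<otimes>[CT.TT] CT.iT y \<ominus>[CT.TT] super_eps ep i j \<odot>[CT.TT] (CT.iT y \<otimes>[CT.TT] CT.iT x)) \<ominus>[CT.TT]
      (CT.iT 0 \<oplus>[CT.TT] (2 * fv x y) \<odot>[CT.TT] \<one>[CT.TT])" and xy: "x : DmC i" "y : DmC j"
      unfolding CT.rels_def by blast
    obtain a b where ab: "i = (1, a)" "j = (1, b)" "x : gv a" "y : gv b" using xy by (cases i; cases j) (auto split: if_splits)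
    show "z : ?S" unfolding z ab(1,2) eq using ab by blast
  next
    fix z assume "z : ?S"
    then obtain a b x y where z: "z = ?R a b x y"
      and xy: "x : gv a" "y : gv b" by blast
    have "x : DmC (1, a)" "y : DmC (1, b)" using xy by simp_all
    thus "z : CT.rels" unfolding z eq[symmetric] CT.rels_def by blast
  qed
  hence "clifford_ideal ep vs gv fv = CT.II" by (simp add: clifford_ideal_def Let_def)
  thus 1: "cliff X = CT.QQ" and 2: "cliff_gen X = CT.iQ"
    unfolding cliff_def clifford_algebra_def cliff_gen_def clifford_gen_def[abs_def] CT.iQ_def[abs_def] by simp_all
  show "cliff_grading X = CT.grQ"
    unfolding cliff_grading_def clifford_grading_def CT.grQ_def 1[unfolded cliff_def] 2[unfolded cliff_gen_def] ..
qed

abbreviation grB :: "bit \<times> 'c => ('k, 'g * 'v) tquot set" where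
  "grB == %(p, a). if p = 0 then UT.grQ a else {\<zero>[UT.QQ]}"

definition prB :: "bit \<times> 'c => ('k, 'g * 'v) tquot => (('k, 'g * 'v) tquot, 'k) lend" where
  "prB i x = (if fst i = 0 then UT.prQ (snd i) x else 0)"

lemma graded_B: "graded_alg UT.QQ lscale UT.PhiQ grB prB"
proof unfold_locales
  show "grB i <= car UT.QQ" for i using UT.G.gr_carrier by (auto split: prod.splits)
  show "UT.E.subspace (UT.PhiQ ` grB i)" for i
    using UT.G.gr_subspace by (auto split: prod.splits simp: UT.E.emb_zero UT.E.subspace_single_0)
  show "UT.PhiQ x : UT.E.span (\<Union>i. UT.PhiQ ` grB i)" if "x : car UT.QQ" for x
  proof -
    have "UT.grQ a = grB (0, a)" for a by simp
    hence "(\<Union>a. UT.PhiQ ` UT.grQ a) <= (\<Union>i. UT.PhiQ ` grB i)" by blast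
    thus ?thesis using UT.G.gr_span[OF that] UT.E.span_mono by blast
  qed
  show "prB i (x \<oplus>[UT.QQ] y) = prB i x + prB i y" if "x : car UT.QQ" "y : car UT.QQ" for x y i
    using that by (simp add: prB_def UT.G.pr_add)
  show "prB i (c \<odot>[UT.QQ] x) = lscale c (prB i x)" if "x : car UT.QQ" for x c i
    using that by (simp add: prB_def UT.G.pr_smult)
  show "prB j x = (if j = i then UT.PhiQ x else 0)" if "x : grB i" for x i j
    using that UT.G.pr_gr UT.G.pr_zero by (auto simp: prB_def UT.E.emb_zero prod_eq_iff split: prod.splits if_splits)
  show "x \<otimes>[UT.QQ] y : grB (i + j)" if "x : grB i" "y : grB j" for x y i j
  proof (cases "fst i = 0 & fst j = 0")
    case True
    thus ?thesis using that UT.G.gr_mult by (auto split: prod.splits)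
  next
    case False
    hence "x = \<zero>[UT.QQ] \<or> y = \<zero>[UT.QQ]" "x : car UT.QQ" "y : car UT.QQ"
      using that UT.G.gr_carrier by (auto split: prod.splits if_splits)
    hence "x \<otimes>[UT.QQ] y = \<zero>[UT.QQ]" by auto
    thus ?thesis using UT.G.gr_zero by (auto split: prod.splits)
  qed
  show "\<one>[UT.QQ] : grB 0" using UT.G.gr_one by (simp add: zero_prod_def)
qed

lemma super_eps_add: "super_eps ep (i + j) l = super_eps ep i l * super_eps ep j l"
  "super_eps ep i (j + l) = super_eps ep i j * super_eps ep i l"
  "super_eps ep 0 l = 1" "super_eps ep i 0 = 1"
proof -
  obtain p a q b r c where ijl: "i = (p, a)" "j = (q, b)" "l = (r, c)" by (cases i, cases j, cases l) auto
  show "super_eps ep (i + j) l = super_eps ep i l * super_eps ep j l"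
    "super_eps ep i (j + l) = super_eps ep i j * super_eps ep i l"
    unfolding ijl using bit_cases[of p] bit_cases[of q] bit_cases[of r]
    by (auto simp: super_eps_def V.eps_add_l V.eps_add_r)
  show "super_eps ep 0 l = 1" "super_eps ep i 0 = 1" unfolding ijl by (auto simp: super_eps_def zero_prod_def)
qed

sublocale TP: tensor UT.QQ lscale UT.PhiQ grB prB CT.QQ lscale CT.PhiQ CT.grQ CT.prQ "super_eps ep"
  by (intro tensor.intro tensor_axioms.intro graded_B CT.G.graded_alg_axioms super_eps_add)

lemma dirac_algebra_eq: "dirac_algebra X = TP.AA" and dirac_tensor_eq: "dirac_tensor X = TP.tens"
  and dirac_grading_eq: "dirac_grading X = TP.grA"
  unfolding dirac_algebra_def dirac_tensor_def dirac_grading_def env_tilde_eq env_tilde_grading_eq cliff_eq cliff_grading_eq by (rule refl)+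

end

lemma (in abelian_group) additive_finsum:
  fixes f :: "'a => 'z::ab_group_add"
  assumes add: "!!x y. x : car G ==> y : car G ==> f (x \<oplus> y) = f x + f y"
    and g: "!!i. i : A ==> g i : car G"
  shows "f (\<Oplus>i\<in>A. g i) = (SUM i:A. f (g i))"
proof -
  have z: "f \<zero> = 0" using add[of \<zero> \<zero>] by simp
  show ?thesis using g
    by (induction A rule: fin_induct) (auto simp: z add finsum_infinite finsum_closed Pi_def)
qed

section \<open>The concrete operators on the Dirac algebra\<close>

context dirac_setting
begin

abbreviation "Phi == TP.PhiA"
abbreviation "oU == \<one>[UT.QQ]"
abbreviation "oC == \<one>[CT.QQ]"

type_synonym ('a, 'b, 'd) dend = "((('a, 'b * 'd) tquot \<times> ('a, 'd) tquot \<Rightarrow>\<^sub>0 'a) set, 'a) lend"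

definition XX :: "'g * 'v => ('k, 'g, 'v) dend" where "XX p = Phi (TP.tens (UT.iQ p) oC)"
definition jC :: "('k, 'v) tquot => ('k, 'g, 'v) dend" where "jC b = Phi (TP.tens oU b)"
definition th :: "'v => ('k, 'g, 'v) dend" where "th v = jC (CT.iQ v)"
definition ee :: "('k, 'g, 'v) dend" where "ee = Phi \<one>[TP.AA]"

lemma oU_gr: "oU : grB 0" and oC_gr: "oC : CT.grQ 0"
  by (rule TP.M.gr_one, rule CT.G.gr_one)

lemma gr_UT: "a : UT.grQ i ==> a : grB (0, i)" by simp

lemma ee_Phi: "a : car TP.AA ==> ee * Phi a = Phi a" "a : car TP.AA ==> Phi a * ee = Phi a"
  unfolding ee_def by (rule TP.EA.emb_one_mult; assumption)+

lemma jC_add: "b : car CT.QQ ==> b' : car CT.QQ ==> jC (b \<oplus>[CT.QQ] b') = jC b + jC b'"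
  by (simp add: jC_def TP.tens_add_r TP.EA.emb_add)

lemma jC_smult: "b : car CT.QQ ==> jC (c \<odot>[CT.QQ] b) = lscale c (jC b)"
  by (simp add: jC_def TP.tens_smult_r TP.EA.emb_smult)

lemma jC_one: "jC oC = ee"
  by (simp add: jC_def ee_def TP.AA_one)

lemma tens_jC:
  assumes a: "a : car UT.QQ" and b: "b : car CT.QQ" and d: "d : car CT.QQ"
  shows "Phi (TP.tens a b) * jC d = Phi (TP.tens a (b \<otimes>[CT.QQ] d))"
  using b
proof (induction rule: CT.G.homog_induct)
  case (hom i b)
  hence "b : car CT.QQ" by (rule CT.G.gr_closed)
  thus ?case using TP.tens_mult[OF a hom oU_gr d] a d by (simp add: jC_def flip: TP.EA.emb_mult)
next
  case (add b b')
  thus ?case using a d by (simp add: TP.tens_add_r TP.EA.emb_add distrib_right CT.Q.l_distr)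
qed

lemma jC_mult: "b : car CT.QQ ==> d : car CT.QQ ==> jC (b \<otimes>[CT.QQ] d) = jC b * jC d"
  using tens_jC[of oU b d] by (simp add: jC_def)

lemma jC_finsum: "(!!i. i : A ==> g i : car CT.QQ) ==> jC (\<Oplus>\<^bsub>CT.QQ\<^esub>i\<in>A. g i) = (SUM i:A. jC (g i))"
  by (rule CT.Q.additive_finsum[OF jC_add])

lemma tens_split: "a : car UT.QQ ==> b : car CT.QQ ==> Phi (TP.tens a b) = Phi (TP.tens a oC) * jC b"
  using tens_jC[of a oC b] by simp

lemma iU_mult: "a : car UT.QQ ==> c : UT.grQ i ==> Phi (TP.tens a oC) * Phi (TP.tens c oC) = Phi (TP.tens (a \<otimes>[UT.QQ] c) oC)"
proof -
  assume a: "a : car UT.QQ" and c: "c : UT.grQ i"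
  have "c : car UT.QQ" using c by (rule UT.G.gr_closed)
  thus ?thesis using TP.tens_mult[OF a oC_gr gr_UT[OF c] CT.Q.one_closed] a by (simp flip: TP.EA.emb_mult)
qed

lemma super_eps_simps: "super_eps ep (1, a) (1, b) = - ep a b" "super_eps ep (1, a) (0, b) = ep a b"
  "super_eps ep (0, c) j = ep c (snd j)" "super_eps ep (1, 0) j = (if fst j = 1 then - 1 else 1)"
  by (simp_all add: super_eps_def split: prod.splits)

lemma lin_eq: "typed_algebra (lscale :: 'k => ('k, 'g, 'v) dend => _)" by (rule typed_algebra_lscale)

sublocale DR: dirac_rep sg Bg cog gg dgg fg dug vs E coV ep gv dgV fv duV "lscale :: 'k => ('k, 'g, 'v) dend => _" th ee ph br ac mu tb XX
proof (rule dirac_repI)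
  show "typed_algebra (lscale :: 'k => ('k, 'g, 'v) dend => _)" by (rule lin_eq)
  show "lin vs lscale th"
    using V.vector_space_axioms TP.EA.vector_space_axioms
    by (auto simp: lin_iff th_def CT.iQ_add CT.iQ_scale jC_add jC_smult)
  show "lin st lscale XX"
    unfolding lin_iff XX_def
    using T0.vector_space_axioms TP.EA.vector_space_axioms
    by (simp only: UT.iQ_add UT.iQ_scale TP.tens_add_l TP.tens_smult_l TP.EA.emb_add TP.EA.emb_smult UT.iQ_closed CT.Q.one_closed TP.tens_closed simp_thms)
  show "ee * th v = th v" "th v * ee = th v" "XX p * ee = XX p" "ee * XX p = XX p" for v p
    by (simp_all add: th_def jC_def XX_def ee_Phi)
  show "ee * ee = ee" using ee_Phi(1)[OF TP.A.one_closed] by (simp add: ee_def)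
  show "th v * th w = lscale (2 * fv v w) ee - lscale (ep a b) (th w * th v)" if v: "v : gv a" and w: "w : gv b" for a b v w
  proof -
    have "v : DmC (1, a)" "w : DmC (1, b)" using v w by simp_all
    note r = CT.iQ_rel[OF this]
    have "CT.iQ 0 = \<zero>[CT.QQ]" using CT.iQ_scale[of 0 0] by simp
    thus ?thesis unfolding th_def jC_mult[OF CT.iQ_closed CT.iQ_closed, symmetric] r
      by (simp add: jC_add jC_smult jC_one super_eps_simps)
  qed
  show "XX p * XX q = lscale (ep a b) (XX q * XX p) + XX (tb p q)" if p: "p : gt a" and q: "q : gt b" for a b p q
    using UT.iQ_rel[OF p q] iU_mult[OF UT.iQ_closed UT.iQ_gr[OF q], of p] iU_mult[OF UT.iQ_closed UT.iQ_gr[OF p], of q]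
    by (simp add: XX_def TP.tens_add_l TP.tens_smult_l TP.EA.emb_add TP.EA.emb_smult)
  show "th v * XX p = lscale (ep a b) (XX p * th v)" if v: "v : gv a" and p: "p : gt b" for a b v p
  proof -
    have v': "CT.iQ v : CT.grQ (1, a)" by (rule CT.iQ_gr) (use v in simp)
    have "th v * XX p = lscale (ep a b) (Phi (TP.tens (UT.iQ p) (CT.iQ v)))"
      using TP.tens_mult[OF UT.Q.one_closed v' gr_UT[OF UT.iQ_gr[OF p]] CT.Q.one_closed]
      by (simp add: th_def jC_def XX_def super_eps_simps flip: TP.EA.emb_mult TP.EA.emb_smult)
    also have "Phi (TP.tens (UT.iQ p) (CT.iQ v)) = XX p * th v" unfolding XX_def th_def by (rule tens_split) simp_all
    finally show ?thesis .
  qed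
qed

lemma Xw_eq: "w : lists Bt ==> DR.Xw w = Phi (TP.tens (UT.mon w) oC)"
proof (induction w)
  case Nil
  show ?case unfolding DR.Xw_simps UT.mon_simps TP.AA_one[symmetric] by (rule ee_def)
next
  case (Cons b w)
  hence w: "w : lists Bt" and IH: "DR.Xw w = Phi (TP.tens (UT.mon w) oC)" by auto
  show ?case unfolding DR.Xw_simps UT.mon_simps IH unfolding XX_def
    by (rule iU_mult[OF UT.iQ_closed UT.homons_grQ[OF UT.basis_mon_homons[OF w]]])
qed

lemma thw_eq: "DR.thw u = jC (CT.mon u)"
  by (induction u) (simp_all add: jC_one jC_mult flip: th_def)

lemma mon_eq: "w : lists Bt ==> DR.mon w u = Phi (TP.tens (UT.mon w) (CT.mon u))"
  using tens_split[of "UT.mon w" "CT.mon u"] by (simp add: DR.mon_def Xw_eq thw_eq)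

lemma Phi_subspace: "TP.EA.subspace (Phi ` car TP.AA)" by (rule TP.EA.subspace_image_carrier)

lemma AA_eq: "DR.AA = Phi ` car TP.AA"
proof
  show "DR.AA <= Phi ` car TP.AA" unfolding DR.ms_def
  proof (rule TP.EA.span_minimal[OF _ Phi_subspace], rule subsetI)
    fix x assume "x : {DR.mon w u |w u. w : lists Bt & u : lists E & True}"
    then obtain w u where x: "x = DR.mon w u" "w : lists Bt" by blast
    show "x : Phi ` car TP.AA" unfolding x(1) mon_eq[OF x(2)] by simp
  qed
  have ab: "Phi (TP.tens a b) : DR.AA" if "a : car UT.QQ" "b : car CT.QQ" for a b
    using that(1)
  proof (induction rule: UT.carrier_induct)
    case w: (mon w)
    from that(2) show ?case
    proof (induction rule: CT.carrier_induct)
      case (mon u)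
      thus ?case using DR.ms_mon[OF w mon, of "%_ _. True"] mon_eq[OF w] by simp
    next
      case (add b b')
      thus ?case by (simp add: TP.tens_add_r TP.EA.emb_add DR.ms_add)
    next
      case (smult c b)
      thus ?case by (simp add: TP.tens_smult_r TP.EA.emb_smult DR.ms_scale)
    qed
  next
    case (add a a')
    thus ?case using that(2) by (simp add: TP.tens_add_l TP.EA.emb_add DR.ms_add)
  next
    case (smult c a)
    thus ?case using that(2) by (simp add: TP.tens_smult_l TP.EA.emb_smult DR.ms_scale)
  qed
  have "Phi x : DR.AA" if "x : car TP.AA" for x
    using that
  proof (induction rule: TP.AA_induct)
    case (tens a b)
    thus ?case by (rule ab)
  next
    case (add x y)
    thus ?case by (simp add: TP.EA.emb_add DR.ms_add)
  next
    case (smult c x)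
    thus ?case by (simp add: TP.EA.emb_smult DR.ms_scale)
  qed
  thus "Phi ` car TP.AA <= DR.AA" by blast
qed

lemma wdC: "CT.wd u = (if even (length u) then 0 else 1, sum_list (map dgV u))"
  by (induction u) (auto simp: zero_prod_def)

lemma mon_grA:
  assumes "w : lists Bt" "u : lists E"
  shows "TP.tens (UT.mon w) (CT.mon u) : TP.grA (if even (length u) then 0 else 1, sum_list (map dgt w) + sum_list (map dgV u))"
  using TP.tens_grA[OF gr_UT[OF UT.homons_grQ[OF UT.basis_mon_homons[OF assms(1)]]] CT.homons_grQ[OF CT.basis_mon_homons[OF assms(2)]]]
  by (auto simp: wdC)

definition is_twist :: "(bit \<times> 'c => 'k) => (('k, 'g, 'v) dend => ('k, 'g, 'v) dend) => bool" where
  "is_twist \<chi> F \<longleftrightarrow> lin lscale lscale F & (ALL i. ALL x:TP.grA i. F (Phi x) = lscale (\<chi> i) (Phi x)) &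
    (ALL x:car TP.AA. F (Phi x) = (SUM i:TP.AG.hs x. lscale (\<chi> i) (TP.prA i x)))"

definition kap where "kap = (SOME F. is_twist (%i. if fst i = 1 then - 1 else 1) F)"
definition tau where "tau c = (SOME F. is_twist (%i. ep c (snd i)) F)"

lemma is_twist_ex: "EX F. is_twist \<chi> F"
  unfolding is_twist_def by (rule TP.AG.twist_exists[of \<chi>]) blast

lemma kap: "is_twist (%i. if fst i = 1 then - 1 else 1) kap" and tau: "is_twist (%i. ep c (snd i)) (tau c)"
  unfolding kap_def tau_def by (rule someI_ex[OF is_twist_ex])+

text \<open>By \<open>D_rel\<close> the function \<open>HH\<close> respects the relations of the
  enveloping algebra and defines a linear map on it. Multiplying its values by Clifford elements on
  the right is bilinear, so the map extends to the tensor product.\<close>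

lemma hh_exists: "EX F. lin lscale lscale F & (ALL w:lists Bt. ALL u:lists E. F (DR.mon w u) = DR.HH w * DR.thw u)"
proof -
  have rel: "DR.HH (u @ x # y # v) = lscale (ep (dgt x) (dgt y)) (DR.HH (u @ y # x # v)) +
        (SUM b:Bt. lscale (cot (tb x y) b) (DR.HH (u @ b # v))) + lscale 0 (DR.HH (u @ v))"
    if "u : lists Bt" "v : lists Bt" "x : Bt" "y : Bt" for u v x y
    using DR.T.D_rel[OF that] by (simp add: DR.T.ins_def)
  obtain f where f: "!!a b. a : car UT.QQ ==> b : car UT.QQ ==> f (a \<oplus>[UT.QQ] b) = f a + f b"
    "!!c a. a : car UT.QQ ==> f (c \<odot>[UT.QQ] a) = lscale c (f a)" "!!w. f (UT.mon w) = T0.extD lscale DR.HH w"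
    by (rule UT.linear_ext[of lscale DR.HH, OF TP.EA.vector_space_axioms rel]) (assumption+, rule that)
  interpret bt: based_target st Bt cot "lscale :: 'k => ('k, 'g, 'v) dend => _" by unfold_locales
  have fm: "f (UT.mon w) = DR.HH w" if "w : lists Bt" for w using f(3) bt.extD_basis[OF that] by simp
  obtain vp where p: "!!x y. x : car TP.AA ==> y : car TP.AA ==> vp (x \<oplus>[TP.AA] y) = vp x + vp y"
    "!!c x. x : car TP.AA ==> vp (c \<odot>[TP.AA] x) = lscale c (vp x)"
    "!!a b. a : car UT.QQ ==> b : car CT.QQ ==> vp (TP.tens a b) = f a * jC b"
  proof -
    have "EX vp. (ALL x:car TP.AA. ALL y:car TP.AA. vp (x \<oplus>[TP.AA] y) = vp x + vp y) &
      (ALL c. ALL x:car TP.AA. vp (c \<odot>[TP.AA] x) = lscale c (vp x)) &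
      (ALL a:car UT.QQ. ALL b:car CT.QQ. vp (TP.tens a b) = f a * jC b)"
      by (rule TP.AA_lift[of lscale "%a b. f a * jC b", OF TP.EA.vector_space_axioms])
        (simp_all add: f jC_add jC_smult DR.r_simps)
    thus thesis using that by blast
  qed
  obtain F where F: "lin lscale lscale F" "!!x. x : car TP.AA ==> F (Phi x) = vp x"
    by (rule TP.EA.extend_linear[of lscale vp, OF TP.EA.vector_space_axioms p(1,2)]) (assumption+, rule that)
  have "F (DR.mon w u) = DR.HH w * DR.thw u" if "w : lists Bt" for w u
    using that by (simp add: mon_eq F(2) p(3) fm thw_eq)
  thus ?thesis using F(1) by blast
qed

definition hh where "hh = (SOME F. lin lscale lscale F & (ALL w:lists Bt. ALL u:lists E. F (DR.mon w u) = DR.HH w * DR.thw u))"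

sublocale DA: dirac_alg sg Bg cog gg dgg fg dug vs E coV ep gv dgV fv duV "lscale :: 'k => ('k, 'g, 'v) dend => _" th ee ph br ac mu tb XX kap tau hh
proof (unfold_locales)
  have h: "lin lscale lscale hh & (ALL w:lists Bt. ALL u:lists E. hh (DR.mon w u) = DR.HH w * DR.thw u)"
    unfolding hh_def by (rule someI_ex[OF hh_exists])
  thus "hh (DR.mon w u) = DR.HH w * DR.thw u" if "w : lists Bt" "u : lists E" for w u using that by blast
  show "kap (DR.mon w u) = lscale ((- 1) ^ length u) (DR.mon w u)" if "w : lists Bt" "u : lists E" for w u
    using kap mon_grA[OF that] unfolding is_twist_def mon_eq[OF that(1)] by fastforce
  show "tau c (DR.mon w u) = lscale (ep c (DR.twd w + DR.wdg u)) (DR.mon w u)" if "w : lists Bt" "u : lists E" for w u c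
    using tau[of c] mon_grA[OF that] unfolding is_twist_def mon_eq[OF that(1)] by fastforce
  show "hh (x + y) = hh x + hh y" "hh (lscale c x) = lscale c (hh x)" for x y c using h unfolding lin_iff by blast+
  show "kap (x + y) = kap x + kap y" "kap (lscale c x) = lscale c (kap x)" for x y c
    using kap unfolding is_twist_def lin_iff by blast+
  show "tau a (x + y) = tau a x + tau a y" "tau a (lscale c x) = lscale c (tau a x)" for x y c a
    using tau[of a] unfolding is_twist_def lin_iff by blast+
qed

lemma Dl_eq: "Phi (Delta_gen X E x) = DR.Dl x" and Delta_gen_closed: "Delta_gen X E x : car TP.AA"
proof -
  let ?p = "(\<Oplus>\<^bsub>CT.QQ\<^esub>e\<in>E. CT.iQ (ac x (duV e)) \<otimes>[CT.QQ] CT.iQ e)"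
  have p: "?p : car CT.QQ" by (intro CT.Q.finsum_closed) auto
  have ps: "pi_star X E x = (1 / 4) \<odot>[CT.QQ] ?p" by (simp add: pi_star_def cliff_eq cliff_gen_eq)
  have "jC (pi_star X E x) = DR.qq (ac x)"
    using p unfolding ps DR.qq_def by (simp add: jC_smult jC_finsum jC_mult flip: th_def)
  moreover have "pi_star X E x : car CT.QQ" using p by (simp add: ps)
  ultimately show "Phi (Delta_gen X E x) = DR.Dl x" "Delta_gen X E x : car TP.AA"
    by (simp_all add: Delta_gen_def dirac_tensor_eq dirac_algebra_eq env_tilde_eq env_tilde_gen_eq cliff_eq TP.EA.emb_add DR.Dl_def
      flip: XX_def jC_def)
qed

lemma DD_eq: "Phi (cubic_dirac X E) = DR.DD" and cubic_dirac_closed: "cubic_dirac X E : car TP.AA"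
proof -
  let ?t = "%i j l. fv (duV i) (ph (duV j) (duV l)) \<odot>[CT.QQ] (CT.iQ l \<otimes>[CT.QQ] CT.iQ j \<otimes>[CT.QQ] CT.iQ i)"
  have t: "?t i j l : car CT.QQ" for i j l by simp
  have t1: "(\<Oplus>\<^bsub>CT.QQ\<^esub>l\<in>E. ?t i j l) : car CT.QQ" for i j by (intro CT.Q.finsum_closed) (use t in auto)
  have t2: "(\<Oplus>\<^bsub>CT.QQ\<^esub>j\<in>E. \<Oplus>\<^bsub>CT.QQ\<^esub>l\<in>E. ?t i j l) : car CT.QQ" for i by (intro CT.Q.finsum_closed) (use t1 in auto)
  have t3: "(\<Oplus>\<^bsub>CT.QQ\<^esub>i\<in>E. \<Oplus>\<^bsub>CT.QQ\<^esub>j\<in>E. \<Oplus>\<^bsub>CT.QQ\<^esub>l\<in>E. ?t i j l) : car CT.QQ" by (intro CT.Q.finsum_closed) (use t2 in auto)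
  have ct: "cubic_term X E = (1 / 12) \<odot>[CT.QQ] (\<Oplus>\<^bsub>CT.QQ\<^esub>i\<in>E. \<Oplus>\<^bsub>CT.QQ\<^esub>j\<in>E. \<Oplus>\<^bsub>CT.QQ\<^esub>l\<in>E. ?t i j l)"
    by (simp add: cubic_term_def Let_def cliff_eq cliff_gen_eq)
  have jt: "jC (?t i j l) = lscale (fv (duV i) (ph (duV j) (duV l))) (th l * th j * th i)" for i j l
    by (simp add: jC_smult jC_mult flip: th_def)
  have "jC (cubic_term X E) = DR.psi"
    unfolding ct DR.psi_def jC_smult[OF t3] jC_finsum[OF t2] jC_finsum[OF t1] jC_finsum[OF t] jt ..
  moreover have "cubic_term X E : car CT.QQ" using t3 by (simp add: ct)
  moreover have s: "TP.tens (UT.iQ (0, duV e)) (CT.iQ e) : car TP.AA" for e by simp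
  moreover have "(\<Oplus>\<^bsub>TP.AA\<^esub>e\<in>E. TP.tens (UT.iQ (0, duV e)) (CT.iQ e)) : car TP.AA" by (intro TP.A.finsum_closed) (use s in auto)
  moreover have "Phi (TP.tens (UT.iQ (0, duV e)) (CT.iQ e)) = XX (0, duV e) * th e" for e
    using tens_split[of "UT.iQ (0, duV e)" "CT.iQ e"] by (simp add: XX_def th_def)
  ultimately show "Phi (cubic_dirac X E) = DR.DD" "cubic_dirac X E : car TP.AA"
    by (simp_all add: cubic_dirac_def dirac_tensor_eq dirac_algebra_eq env_tilde_eq env_tilde_gen_eq cliff_gen_eq TP.EA.emb_add
      TP.EA.emb_finsum DR.DD_def DR.SS_def flip: jC_def)
qed

lemma hom_grA: "DR.hom q a <= Phi ` TP.grA (if q then 0 else 1, a)"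
  unfolding DR.ms_def
proof (rule TP.EA.span_minimal[OF _ TP.AG.gr_subspace], rule subsetI)
  fix x assume "x : {DR.mon w u |w u. w : lists Bt & u : lists E & even (length u) = q & DR.twd w + DR.wdg u = a}"
  then obtain w u where x: "x = DR.mon w u" "w : lists Bt" "u : lists E" "even (length u) = q" "DR.twd w + DR.wdg u = a" by blast
  show "x : Phi ` TP.grA (if q then 0 else 1, a)"
    unfolding x(1) mon_eq[OF x(2)] using mon_grA[OF x(2,3)] unfolding x(4,5) by (rule imageI)
qed

lemma Delta_gen_gr: "x : gg c ==> Delta_gen X E x : TP.grA (0, c)"
  using hom_grA[of True c] DR.Dl_hom[of x c] TP.AG.gr_iff[OF Delta_gen_closed[of x], of "(0, c)"] by (auto simp: Dl_eq)

lemma cubic_dirac_gr: "cubic_dirac X E : TP.grA (1, 0)"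
  using hom_grA[of False 0] DR.DD_hom TP.AG.gr_iff[OF cubic_dirac_closed, of "(1, 0)"] by (auto simp: DD_eq)

lemma bracket_closed: "a : car TP.AA ==> b : car TP.AA ==> dirac_bracket X a b : car TP.AA"
  unfolding dirac_bracket_def dirac_algebra_eq dirac_grading_eq by (rule TP.AG.emb_bracket(2))

lemma bracket_Dl:
  assumes a: "a : car TP.AA" and x: "x : gg c"
  shows "Phi (dirac_bracket X (Delta_gen X E x) a) = DR.Dl x * Phi a - tau c (Phi a) * DR.Dl x"
proof -
  have "(SUM j:TP.AG.hs a. lscale (super_eps ep (0, c) j) (TP.prA j a)) = tau c (Phi a)"
    using tau[of c] a unfolding is_twist_def super_eps_simps by simp
  thus ?thesis unfolding dirac_bracket_def dirac_algebra_eq dirac_grading_eq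
    TP.AG.emb_bracket(1)[OF Delta_gen_closed a] TP.AG.flip_homog_left[OF Delta_gen_gr[OF x] a] by (simp add: Dl_eq)
qed

lemma dirac_diff_eq:
  assumes a: "a : car TP.AA"
  shows "Phi (dirac_diff X E a) = DA.dd (Phi a)" and "dirac_diff X E a : car TP.AA"
proof -
  have "(SUM j:TP.AG.hs a. lscale (super_eps ep (1, 0) j) (TP.prA j a)) = kap (Phi a)"
    using kap a unfolding is_twist_def super_eps_simps by simp
  thus "Phi (dirac_diff X E a) = DA.dd (Phi a)"
    unfolding dirac_diff_def dirac_bracket_def dirac_algebra_eq dirac_grading_eq DA.dd_def
    TP.AG.emb_bracket(1)[OF cubic_dirac_closed a] TP.AG.flip_homog_left[OF cubic_dirac_gr a] by (simp add: DD_eq)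
  show "dirac_diff X E a : car TP.AA" unfolding dirac_diff_def by (rule bracket_closed[OF cubic_dirac_closed a])
qed

lemma Delta_gen_add: "Delta_gen X E (x + y) = Delta_gen X E x \<oplus>[TP.AA] Delta_gen X E y"
proof -
  have "DR.Dl (x + y) = DR.Dl x + DR.Dl y" using DR.linear_Dl by (simp add: lin_iff)
  thus ?thesis
    using TP.EA.emb_eq[of "Delta_gen X E (x + y)" "Delta_gen X E x \<oplus>[TP.AA] Delta_gen X E y"] Delta_gen_closed
    by (simp add: TP.EA.emb_add Dl_eq)
qed

lemma invariants_iff: "a : invariants X E \<longleftrightarrow> a : car TP.AA & Phi a : DA.invs"
proof (intro iffI conjI)
  assume "a : invariants X E"
  hence a: "a : car TP.AA" and z: "!!x. dirac_bracket X (Delta_gen X E x) a = \<zero>[TP.AA]"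
    by (auto simp: invariants_def dirac_algebra_eq)
  show "a : car TP.AA" by fact
  have "DR.Dl x * Phi a = tau c (Phi a) * DR.Dl x" if "x : gg c" for x c
    using bracket_Dl[OF a that] z[of x] by (simp add: TP.EA.emb_zero)
  thus "Phi a : DA.invs" using a by (simp add: DA.invs_def AA_eq)
next
  assume "a : car TP.AA & Phi a : DA.invs"
  hence a: "a : car TP.AA" and i: "Phi a : DA.invs" by auto
  interpret g: graded_space sg gg by (rule graded_g)
  let ?L = "%x. Phi (dirac_bracket X (Delta_gen X E x) a)"
  \<comment> \<open>Invariance is defined with all \<open>x\<close>, \<open>invs\<close> with
    homogeneous \<open>x\<close>; additivity in \<open>x\<close> bridges the difference.\<close>
  have add: "?L (x + y) = ?L x + ?L y" for x y
    unfolding dirac_bracket_def dirac_algebra_eq dirac_grading_eq Delta_gen_add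
    using Delta_gen_closed a by (simp add: TP.AG.emb_bracket TP.AG.flip_add_left TP.EA.emb_add distrib_right)
  have z: "?L x = 0" if "x : gg c" for x c using bracket_Dl[OF a that] i that by (simp add: DA.invs_def)
  have "?L (SUM i:A. f i) = (SUM i:A. ?L (f i))" for A and f :: "'c => 'g"
    by (induction A rule: fin_induct) (use add z[OF G.subspace_0[OF G.gr_sub]] in auto)
  hence "?L x = 0" for x using z[OF g.hcomp_gr] by (subst g.sum_hcomp[of x]) simp
  hence "dirac_bracket X (Delta_gen X E x) a = \<zero>[TP.AA]" for x
    using TP.EA.emb_eq_zero[OF bracket_closed[OF Delta_gen_closed a]] by simp
  thus "a : invariants X E" using a by (simp add: invariants_def dirac_algebra_eq)
qed

end

lemma (in pbw) D_Nil: "D [] = K []"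
proof -
  have "labs 0 = {[]}" by (auto simp: labs_def)
  thus ?thesis by (simp add: D_def avg_def)
qed

context dirac_alg
begin

lemma tau_compose: "a : AA ==> tau e (tau f a) = tau (e + f) a"
  by (erule ms_eq[of _ _ "%a. tau e (tau f a)"]) (auto intro!: linear_eqI simp: lin_rules tau_mon eps_add_l mult.commute)

lemma tau_zero: "a : AA ==> tau 0 a = a"
  by (erule ms_eq[of _ _ _ "%a. a"]) (auto intro!: linear_eqI simp: lin_rules tau_mon)

lemma tau_invs: "a : invs ==> tau e a : invs"
proof -
  assume a: "a : invs"
  have aA: "a : AA" by (rule inv_AA[OF a])
  have "Dl x * tau e a = tau c (tau e a) * Dl x" if x: "x : gg c" for x c
  proof -
    have d: "Dl x : AA" by (rule hom_AA[OF Dl_hom[OF x]])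
    have "tau e (Dl x * a) = tau e (tau c a * Dl x)" using a x by (simp add: invs_def)
    hence "sr (eps e c) (Dl x * tau e a) = sr (eps e c) (tau e (tau c a) * Dl x)"
      by (simp add: tau_mult[OF d aA] tau_mult[OF tau_ms[OF aA] d] tau_Dl[OF x] r_simps)
    thus ?thesis by (simp add: tau_compose[OF aA] add.commute)
  qed
  thus ?thesis using tau_ms[OF aA] by (simp add: invs_def)
qed

lemma invs_Dl: "a : invs ==> x : gg c ==> a * Dl x = Dl x * tau (- c) a"
  using tau_invs[of a "- c"] tau_compose[OF inv_AA, of a c "- c"] tau_zero[OF inv_AA, of a] by (simp add: invs_def)

text \<open>\<open>eps_centre\<close> puts the central element on the left, \<open>invs\<close> puts
  the invariant on the right; twisting by \<open>tau\<close> passes from one convention to the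
  other.\<close>

lemma invsI:
  assumes a: "a : AA" and e: "!!c x. x : gg c ==> a * Dl x = Dl x * tau (- c) a"
  shows "a : invs"
proof -
  have "Dl x * a = tau c a * Dl x" if x: "x : gg c" for x c
  proof -
    have d: "Dl x : AA" by (rule hom_AA[OF Dl_hom[OF x]])
    have "tau c (a * Dl x) = tau c (Dl x * tau (- c) a)" using e[OF x] by simp
    thus ?thesis
      by (simp add: tau_mult[OF d tau_ms[OF a]] tau_mult[OF a d] tau_Dl[OF x] r_simps tau_compose[OF a] tau_zero[OF a])
  qed
  thus ?thesis using a by (simp add: invs_def)
qed

end

section \<open>The morphism \<Delta> and the \<epsilon>-centre\<close>

context dirac_setting
begin

definition is_psi :: "(('k, 'g) tquot => ('k, 'g, 'v) dend) => bool" where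
  "is_psi f \<longleftrightarrow> (ALL a:car UG.QQ. ALL b:car UG.QQ. f (a \<oplus>[UG.QQ] b) = f a + f b & f (a \<otimes>[UG.QQ] b) = f a * f b) &
    (ALL c. ALL a:car UG.QQ. f (c \<odot>[UG.QQ] a) = lscale c (f a)) & f \<one>[UG.QQ] = ee & (ALL x. f (UG.iQ x) = DR.Dl x)"

text \<open>The morphism \<Delta> followed by the embedding of the Dirac algebra, see
  \<open>Delta_eq\<close>.\<close>

definition psiU where "psiU = (SOME f. is_psi f)"

lemma psiU: "is_psi psiU"
proof -
  have e: "ee * DR.Dl v = DR.Dl v" "DR.Dl v * ee = DR.Dl v" for v
    using ee_Phi[OF Delta_gen_closed[of v]] by (simp_all add: Dl_eq)
  have rel: "DR.Dl x * DR.Dl y = lscale (ep (dgg x) (dgg y)) (DR.Dl y * DR.Dl x) + DR.Dl (br x y) + lscale 0 ee"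
    if "x : Bg" "y : Bg" for x y
    using DR.Dl_Dl[OF G.basis_gr[OF that(1)] G.basis_gr[OF that(2)]] by simp
  have "EX f. is_psi f"
    by (rule UG.hom_ext[OF lin_eq DR.linear_Dl e DR.ee_ee rel]) (assumption+, unfold is_psi_def, blast)
  thus ?thesis unfolding psiU_def by (rule someI_ex)
qed

lemma psi_add: "a : car UG.QQ ==> b : car UG.QQ ==> psiU (a \<oplus>[UG.QQ] b) = psiU a + psiU b"
  and psi_mult: "a : car UG.QQ ==> b : car UG.QQ ==> psiU (a \<otimes>[UG.QQ] b) = psiU a * psiU b"
  and psi_smult: "a : car UG.QQ ==> psiU (c \<odot>[UG.QQ] a) = lscale c (psiU a)"
  and psi_one: "psiU \<one>[UG.QQ] = ee" and psi_iQ: "psiU (UG.iQ x) = DR.Dl x"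
  using psiU unfolding is_psi_def by blast+

lemma psi_zero: "psiU \<zero>[UG.QQ] = 0"
  using psi_add[of "\<zero>[UG.QQ]" "\<zero>[UG.QQ]"] by simp

lemma psi_mon: "psiU (UG.mon w) = DA.Dlw w"
  by (induction w) (simp_all add: psi_one psi_mult psi_iQ)

lemma psi_image: "psiU ` car UG.QQ = DA.WW"
proof
  have "psiU x : DA.WW" if "x : car UG.QQ" for x using that
  proof (induction rule: UG.carrier_induct)
    case (mon w)
    thus ?case unfolding psi_mon DA.WW_def by (intro TP.EA.span_base imageI)
  qed (auto simp: psi_add psi_smult TP.EA.subspace_add[OF DA.WW_subspace] TP.EA.subspace_scale[OF DA.WW_subspace])
  thus "psiU ` car UG.QQ <= DA.WW" by blast
  show "DA.WW <= psiU ` car UG.QQ" unfolding DA.WW_def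
  proof (rule TP.EA.span_minimal)
    show "DA.Dlw ` lists Bg <= psiU ` car UG.QQ" unfolding psi_mon[symmetric] by auto
    show "TP.EA.subspace (psiU ` car UG.QQ)" unfolding TP.EA.subspace_def
      by (auto simp flip: psi_add psi_smult psi_zero)
  qed
qed

lemma psi_AA: "x : car UG.QQ ==> psiU x : DR.AA"
  using psi_image DA.WW_AA by blast

text \<open>The definite description of \<open>Delta\<close> is met by pulling \<open>psiU\<close>
  back through the injective \<open>Phi\<close>. Uniqueness holds because the generators determine a
  morphism on the carrier and extensionality fixes it elsewhere.\<close>

lemma Delta_eq:
  assumes x: "x : car UG.QQ"
  shows "Delta X E x : car TP.AA" "Phi (Delta X E x) = psiU x"
proof -
  define h0 where "h0 = restrict (%x. inv_into (car TP.AA) Phi (psiU x)) (car UG.QQ)"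
  have h0: "h0 x : car TP.AA" "Phi (h0 x) = psiU x" if "x : car UG.QQ" for x
    using psi_AA[OF that] that unfolding AA_eq by (auto simp: h0_def inv_into_into f_inv_into_f)
  have "Delta X E = h0" unfolding Delta_def env_g_eq env_g_gen_eq dirac_algebra_eq
  proof (rule the_equality)
    have "h0 : ring_hom UG.QQ TP.AA"
    proof (rule ring_hom_memI)
      fix x y assume xy: "x : car UG.QQ" "y : car UG.QQ"
      show "h0 x : car TP.AA" by (rule h0(1)[OF xy(1)])
      show "h0 (x \<otimes>[UG.QQ] y) = h0 x \<otimes>[TP.AA] h0 y"
        using xy h0 TP.EA.emb_eq[of "h0 (x \<otimes>[UG.QQ] y)" "h0 x \<otimes>[TP.AA] h0 y"] by (simp add: TP.EA.emb_mult psi_mult)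
      show "h0 (x \<oplus>[UG.QQ] y) = h0 x \<oplus>[TP.AA] h0 y"
        using xy h0 TP.EA.emb_eq[of "h0 (x \<oplus>[UG.QQ] y)" "h0 x \<oplus>[TP.AA] h0 y"] by (simp add: TP.EA.emb_add psi_add)
    next
      show "h0 \<one>[UG.QQ] = \<one>[TP.AA]"
        using h0[OF UG.Q.one_closed] TP.EA.emb_eq[of "h0 \<one>[UG.QQ]" "\<one>[TP.AA]"] by (simp add: psi_one ee_def)
    qed
    moreover have "h0 (c \<odot>[UG.QQ] x) = c \<odot>[TP.AA] h0 x" if "x : car UG.QQ" for c x
      using that h0 TP.EA.emb_eq[of "h0 (c \<odot>[UG.QQ] x)" "c \<odot>[TP.AA] h0 x"] by (simp add: TP.EA.emb_smult psi_smult)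
    moreover have "h0 (UG.iQ x) = Delta_gen X E x" for x
      using h0[OF UG.iQ_closed, of x] TP.EA.emb_eq[of "h0 (UG.iQ x)" "Delta_gen X E x"] Delta_gen_closed[of x] by (simp add: psi_iQ Dl_eq)
    ultimately show "h0 : alg_hom UG.QQ TP.AA & h0 : extensional (car UG.QQ) & (ALL x. h0 (UG.iQ x) = Delta_gen X E x)"
      by (simp add: alg_hom_def h0_def)
  next
    fix h assume h: "h : alg_hom UG.QQ TP.AA & h : extensional (car UG.QQ) & (ALL x. h (UG.iQ x) = Delta_gen X E x)"
    hence rh: "h : ring_hom UG.QQ TP.AA" and sm: "!!c x. x : car UG.QQ ==> h (c \<odot>[UG.QQ] x) = c \<odot>[TP.AA] h x"
      and ext: "h : extensional (car UG.QQ)" and gen: "!!x. h (UG.iQ x) = Delta_gen X E x" by (auto simp: alg_hom_def)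
    have hc: "h x : car TP.AA" if "x : car UG.QQ" for x by (rule ring_hom_closed[OF rh that])
    have "Phi (h x) = psiU x" if "x : car UG.QQ" for x using that
    proof (induction rule: UG.carrier_induct)
      case (mon w)
      show ?case
      proof (induction w)
        case Nil
        thus ?case using ring_hom_one[OF rh] by (simp add: psi_one ee_def)
      next
        case (Cons v w)
        thus ?case using ring_hom_mult[OF rh UG.iQ_closed UG.mon_closed] hc[OF UG.mon_closed] Delta_gen_closed
          by (simp add: gen TP.EA.emb_mult Dl_eq psi_mult psi_iQ)
      qed
    next
      case (add x y)
      thus ?case using ring_hom_add[OF rh add(1,2)] hc by (simp add: TP.EA.emb_add psi_add)
    next
      case (smult c x)
      thus ?case using sm hc by (simp add: TP.EA.emb_smult psi_smult)
    qed
    hence "h x = h0 x" if "x : car UG.QQ" for x using that hc h0 TP.EA.emb_eq by metis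
    thus "h = h0" using ext by (intro extensionalityI[of h "car UG.QQ"]) (auto simp: h0_def)
  qed
  thus "Delta X E x : car TP.AA" "Phi (Delta X E x) = psiU x" using h0[OF x] by simp_all
qed

lemma psi_gr:
  assumes y: "y : UG.grQ i"
  shows "psiU y : DR.hom True i"
  using y[unfolded UG.grQ_eq] UG.homons_closed
proof (induction rule: UG.Q.lin_span_induct)
  case zero
  thus ?case by (simp add: psi_zero DR.ms_0)
next
  case (base x)
  then obtain vs ds where v: "x = UG.mon vs" "list_all2 (%v d. v : gg d) vs ds" "sum_list ds = i" unfolding UG.homons_def by blast
  have "DA.Dlw vs : DR.hom True (sum_list ds)" using v(2)
  proof (induction rule: list_all2_induct)
    case Nil
    thus ?case using DR.Xw_ms[of "[]"] by simp
  next
    case (Cons v vs d ds)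
    thus ?case using DR.hom_mult[OF DR.Dl_hom[OF Cons(1)] Cons(3)] by simp
  qed
  thus ?case using v by (simp add: psi_mon)
qed (simp_all add: psi_add psi_smult DR.ms_add DR.ms_scale)

lemma psi_finsum: "(!!i. i : A ==> g i : car UG.QQ) ==> psiU (\<Oplus>\<^bsub>UG.QQ\<^esub>i\<in>A. g i) = (SUM i:A. psiU (g i))"
  by (rule UG.Q.additive_finsum[OF psi_add])

lemma psi_flip:
  assumes x: "x : car UG.QQ" and y: "y : UG.grQ d"
  shows "psiU (twisted_flip ep UG.QQ UG.grQ x y) = psiU y * tau (- d) (psiU x)"
proof -
  have yc: "y : car UG.QQ" using y by (rule UG.G.gr_closed)
  have hx: "UG.G.hc x i : car UG.QQ" for i using x by simp
  have hy: "UG.G.hc y i : car UG.QQ" for i using yc by simp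
  have "psiU (twisted_flip ep UG.QQ UG.grQ x y) = (SUM i:UG.G.hs x. SUM j:UG.G.hs y. lscale (ep i j) (psiU (UG.G.hc y j) * psiU (UG.G.hc x i)))"
    unfolding twisted_flip_def using hx hy
    by (simp add: psi_finsum psi_smult psi_mult UG.Q.finsum_closed Pi_def)
  also have "... = (SUM i:UG.G.hs x. lscale (ep i d) (psiU y * psiU (UG.G.hc x i)))"
    by (intro sum.cong refl UG.G.hsum_gr[OF y, of "%j y. lscale (ep _ j) (psiU y * psiU (UG.G.hc x _))"]) (simp add: psi_zero)
  also have "... = psiU y * (SUM i:UG.G.hs x. lscale (ep i d) (psiU (UG.G.hc x i)))"
    by (simp add: DR.r_simps)
  also have "(SUM i:UG.G.hs x. lscale (ep i d) (psiU (UG.G.hc x i))) = (SUM i:UG.G.hs x. tau (- d) (psiU (UG.G.hc x i)))"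
    using DA.tau_hom[OF psi_gr[OF UG.G.hc_gr[OF x]]] by (simp add: V.eps_minus_l)
  also have "... = tau (- d) (psiU (\<Oplus>\<^bsub>UG.QQ\<^esub>i\<in>UG.G.hs x. UG.G.hc x i))"
    by (simp only: psi_finsum[OF hx] DA.linear_sum[OF DA.tau_linear])
  also have "(\<Oplus>\<^bsub>UG.QQ\<^esub>i\<in>UG.G.hs x. UG.G.hc x i) = x" by (rule UG.G.decompose[OF x, symmetric])
  finally show ?thesis .
qed

lemma invs_psi:
  assumes a: "a : DA.invs" and y: "y : UG.grQ d"
  shows "a * psiU y = psiU y * tau (- d) a"
  using y[unfolded UG.grQ_eq] UG.homons_closed
proof (induction rule: UG.Q.lin_span_induct)
  case zero
  thus ?case by (simp add: psi_zero)
next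
  case (base y)
  then obtain vs ds where v: "y = UG.mon vs" "list_all2 (%v d. v : gg d) vs ds" "sum_list ds = d" unfolding UG.homons_def by blast
  have "a * DA.Dlw vs = DA.Dlw vs * tau (- sum_list ds) a" using v(2) a
  proof (induction arbitrary: a rule: list_all2_induct)
    case Nil
    have "a : DR.AA" using Nil by (rule DA.inv_AA)
    thus ?case using ee_Phi unfolding AA_eq DA.tau_zero[OF DA.inv_AA[OF Nil]] by (auto simp: DA.tau_zero[OF DA.inv_AA[OF Nil]])
  next
    case (Cons v vs d ds)
    have t: "tau (- d) a : DA.invs" by (rule DA.tau_invs[OF Cons.prems])
    have "a * DA.Dlw (v # vs) = (a * DR.Dl v) * DA.Dlw vs" by (simp add: mult.assoc)
    also have "... = DR.Dl v * (tau (- d) a * DA.Dlw vs)" unfolding DA.invs_Dl[OF Cons.prems Cons(1)] by (simp add: mult.assoc)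
    also have "... = DR.Dl v * (DA.Dlw vs * tau (- sum_list ds) (tau (- d) a))" unfolding Cons.IH[OF t] ..
    finally show ?case by (simp add: mult.assoc DA.tau_compose[OF DA.inv_AA[OF Cons.prems]] add.commute)
  qed
  thus ?case using v by (simp add: psi_mon)
qed (simp_all add: psi_add psi_smult DR.r_simps)

section \<open>Injectivity of \<Delta>\<close>

abbreviation PhiG :: "('k, 'g) tquot => (('k, 'g) tquot, 'k) lend" where "PhiG == UG.PhiQ"

definition Fil :: "nat => (('k, 'g) tquot, 'k) lend set" where
  "Fil n = UG.E.span {PhiG (UG.mon w) | w. w : lists Bg & length w < n}"

lemma Fil_subspace: "UG.E.subspace (Fil n)" by (simp add: Fil_def)

lemma Fil_mono: "m <= n ==> Fil m <= Fil n"
  unfolding Fil_def by (intro UG.E.span_mono) auto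

lemma Fil_mon: "w : lists Bg ==> length w < n ==> PhiG (UG.mon w) : Fil n"
  unfolding Fil_def by (rule UG.E.span_base) blast

text \<open>The leading term of a linear map from the enveloping algebra of
  \<open>\<gg> \<oplus> V\<close> back to that of \<open>\<gg>\<close>: words in
  \<open>\<gg>\<close> are kept, words with a letter of \<open>V\<close> are discarded.\<close>

definition Kg :: "('g * 'v) list => (('k, 'g) tquot, 'k) lend" where
  "Kg w = (if w : lists DR.Btg then PhiG (UG.mon (map fst w)) else 0)"

sublocale PG: pbw st Bt cot dgt ep tb "lscale :: 'k => (('k, 'g) tquot, 'k) lend => _" Kg
  by unfold_locales

lemma map_fst_Btg: "w : lists DR.Btg ==> map fst w : lists Bg"
  by (induction w) auto

lemma PG_filtration:
  assumes w: "w : lists Bt"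
  shows "PG.D w : Fil (Suc (length w))" "PG.D w - Kg w : Fil (length w)"
proof -
  have K: "Kg w : Fil (Suc (length w))" for w
    using Fil_mon[OF map_fst_Btg, of w "Suc (length w)"] UG.E.subspace_0[OF Fil_subspace] by (simp add: Kg_def)
  have K2: "Kg (u @ x # y # v) - lscale (PG.chi x y) (Kg (u @ y # x # v)) : Fil (Suc (Suc (length u + length v)))"
    if "u : lists Bt" "v : lists Bt" "x : Bt" "y : Bt" for u x y v
  proof (cases "u @ x # y # v : lists DR.Btg")
    case True
    then obtain x' y' where xy: "x = (x', 0)" "y = (y', 0)" "x' : Bg" "y' : Bg" by auto
    have uv: "map fst u : lists Bg" "map fst v : lists Bg" using True map_fst_Btg[of u] map_fst_Btg[of v] by simp_all
    have dgt: "dgt x = dgg x'" "dgt y = dgg y'" by (simp_all add: xy DR.dgt_def)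
    have sw: "u @ y # x # v : lists DR.Btg" using True by auto
    have "Kg (u @ x # y # v) - lscale (PG.chi x y) (Kg (u @ y # x # v)) = PhiG (UG.mon (map fst u @ br x' y' # map fst v))"
      unfolding dgt Kg_def using True sw UG.emb_mon_rel[OF G.basis_gr[OF xy(3)] G.basis_gr[OF xy(4)], of "map fst u" "map fst v"]
      by (simp add: xy)
    also have "... = (SUM b:Bg. lscale (cog (br x' y') b) (PhiG (UG.mon (map fst u @ b # map fst v))))"
      by (rule UG.emb_mon_insert)
    also have "... : Fil (Suc (Suc (length u + length v)))"
      by (intro UG.E.subspace_sum[OF Fil_subspace] UG.E.subspace_scale[OF Fil_subspace] Fil_mon) (use uv in auto)
    finally show ?thesis .
  next
    case False
    hence "u @ y # x # v ~: lists DR.Btg" by auto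
    with False have "Kg (u @ x # y # v) = 0" "Kg (u @ y # x # v) = 0" unfolding Kg_def by (simp_all only: if_False)
    thus ?thesis using UG.E.subspace_0[OF Fil_subspace] by simp
  qed
  \<comment> \<open>\<open>Fil\<close> bounds lengths strictly, hence the shift by one.\<close>
  note fil = PG.D_filtration[where Z = "%n. Fil (Suc n)", OF Fil_subspace Fil_mono[OF le_SucI[OF order_refl]] K K2 w]
  show "PG.D w : Fil (Suc (length w))" by (rule fil(1))
  show "PG.D w - Kg w : Fil (length w)"
  proof (cases w)
    case Nil
    thus ?thesis using UG.E.subspace_0[OF Fil_subspace] by (simp add: PG.D_Nil)
  next
    case (Cons b v)
    thus ?thesis using fil(2)[of "length v"] by simp
  qed
qed

lemma cliff_functional:
  assumes "oC ~= \<zero>[CT.QQ]"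
  obtains \<rho> where "!!a b. a : car CT.QQ ==> b : car CT.QQ ==> \<rho> (a \<oplus>[CT.QQ] b) = \<rho> a + (\<rho> b :: 'k)"
    "!!c a. a : car CT.QQ ==> \<rho> (c \<odot>[CT.QQ] a) = c * \<rho> a" "\<rho> oC = 1"
proof -
  interpret f: vector_space "(*) :: 'k => 'k => 'k" by (rule vector_space_field)
  interpret p: vector_space_pair "lscale :: 'k => (('k, 'v) tquot, 'k) lend => _" "(*) :: 'k => 'k => 'k" by unfold_locales
  have "CT.PhiQ oC ~= 0" using assms CT.E.emb_eq_zero by simp
  hence "CT.E.independent {CT.PhiQ oC}" by (simp add: CT.E.dependent_single)
  then obtain g where g: "lin lscale (*) g" "ALL x:{CT.PhiQ oC}. g x = 1"
    using p.linear_independent_extend[of "{CT.PhiQ oC}" "%_. 1"] by blast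
  thus thesis
    by (intro that[of "%a. g (CT.PhiQ a)"]) (auto simp: CT.E.emb_add CT.E.emb_smult lin_iff)
qed

text \<open>A linear map back to the enveloping algebra of \<open>\<gg>\<close>, obtained from the
  symmetrization of the enveloping algebra of \<open>\<gg> \<oplus> V\<close>, is a left inverse of \<open>\<Delta>\<close> up to terms
  of lower filtration degree.\<close>

lemma psi_inj:
  assumes nz: "oC ~= \<zero>[CT.QQ]" and x: "x : car UG.QQ" and z: "psiU x = 0"
  shows "x = \<zero>[UG.QQ]"
proof -
  obtain \<rho> where r: "!!a b. a : car CT.QQ ==> b : car CT.QQ ==> \<rho> (a \<oplus>[CT.QQ] b) = \<rho> a + (\<rho> b :: 'k)"
    "!!c a. a : car CT.QQ ==> \<rho> (c \<odot>[CT.QQ] a) = c * \<rho> a" "\<rho> oC = 1"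
    by (rule cliff_functional[OF nz]) (rule that)
  have rel: "PG.D (u @ x # y # v) = lscale (ep (dgt x) (dgt y)) (PG.D (u @ y # x # v)) +
        (SUM b:Bt. lscale (cot (tb x y) b) (PG.D (u @ b # v))) + lscale 0 (PG.D (u @ v))"
    if "u : lists Bt" "v : lists Bt" "x : Bt" "y : Bt" for u v x y
    using PG.D_rel[OF that] by simp
  obtain f where f: "!!a b. a : car UT.QQ ==> b : car UT.QQ ==> f (a \<oplus>[UT.QQ] b) = f a + f b"
    "!!c a. a : car UT.QQ ==> f (c \<odot>[UT.QQ] a) = lscale c (f a)" "!!w. f (UT.mon w) = T0.extD lscale PG.D w"
    by (rule UT.linear_ext[of lscale PG.D, OF UG.E.vector_space_axioms rel]) (assumption+, rule that)
  interpret bt: based_target st Bt cot "lscale :: 'k => (('k, 'g) tquot, 'k) lend => _" by unfold_locales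
  have fm: "f (UT.mon w) = PG.D w" if "w : lists Bt" for w using f(3) bt.extD_basis[OF that] by simp
  obtain vp where p: "!!x y. x : car TP.AA ==> y : car TP.AA ==> vp (x \<oplus>[TP.AA] y) = vp x + vp y"
    "!!c x. x : car TP.AA ==> vp (c \<odot>[TP.AA] x) = lscale c (vp x)"
    "!!a b. a : car UT.QQ ==> b : car CT.QQ ==> vp (TP.tens a b) = lscale (\<rho> b) (f a)"
  proof -
    have "EX vp. (ALL x:car TP.AA. ALL y:car TP.AA. vp (x \<oplus>[TP.AA] y) = vp x + vp y) &
      (ALL c. ALL x:car TP.AA. vp (c \<odot>[TP.AA] x) = lscale c (vp x)) &
      (ALL a:car UT.QQ. ALL b:car CT.QQ. vp (TP.tens a b) = lscale (\<rho> b) (f a))"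
      by (rule TP.AA_lift[of lscale "%a b. lscale (\<rho> b) (f a)", OF UG.E.vector_space_axioms])
        (simp_all add: f r UG.E.scale_right_distrib UG.E.scale_left_distrib mult.commute)
    thus thesis using that by blast
  qed
  obtain F where F: "lin lscale lscale F" "!!x. x : car TP.AA ==> F (Phi x) = vp x"
    by (rule TP.EA.extend_linear[of lscale vp, OF UG.E.vector_space_axioms p(1,2)]) (assumption+, rule that)
  have Fl: "F (x + y) = F x + F y" "F (lscale c x) = lscale c (F x)" for x y c
    using F(1) by (simp_all add: lin_iff)
  have F0: "F 0 = 0" using Fl(2)[of 0 0] by simp
  have Fd: "F (x - y) = F x - F y" for x y using Fl(1)[of "x - y" y] by simp
  have Fm: "F (DR.mon w u) = lscale (\<rho> (CT.mon u)) (PG.D w)" if "w : lists Bt" for w u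
    using that by (simp add: mon_eq F(2) p(3) fm)
  have FG: "F a : Fil n" if "a : DR.Gs n" for a n
    using that
  proof (induction rule: DR.ms_induct)
    case subspace
    show ?case unfolding TP.EA.subspace_def
      using UG.E.subspace_0[OF Fil_subspace] UG.E.subspace_add[OF Fil_subspace] UG.E.subspace_scale[OF Fil_subspace] by (simp add: Fl F0)
  next
    case (mon w u)
    hence "PG.D w : Fil n" using PG_filtration(1)[OF mon(1)] Fil_mono[of "Suc (length w)" n] by auto
    thus ?case unfolding Fm[OF mon(1)] by (rule UG.E.subspace_scale[OF Fil_subspace])
  qed
  \<comment> \<open>Two comparisons of leading terms: \<open>Dlw w\<close> with the plain word in
    \<open>\<gg>\<close>, and \<open>PG.D\<close> with \<open>Kg\<close> on that word. The
    functional \<open>\<rho>\<close> is 1 on the unit, so no scalar appears.\<close>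
  have lead: "F (DA.Dlw w) - PhiG (UG.mon w) : Fil (length w)" if w: "w : lists Bg" for w
  proof -
    define W where "W = map (%x. (x, 0 :: 'v)) w"
    have WB: "W : lists DR.Btg" "W : lists Bt" using w by (auto simp: W_def DR.Bt_def)
    have K: "Kg W = PhiG (UG.mon w)" using WB(1) by (simp add: Kg_def W_def o_def)
    have "DR.Xw W = DR.mon W []" by (simp add: DR.mon_def)
    hence "F (DR.Xw W) = PG.D W" using Fm[OF WB(2), of "[]"] r(3) by simp
    moreover have "F (DR.Xw W - DA.Dlw w) : Fil (length w)" using FG[OF DA.Dlw_leading[OF w]] by (simp add: W_def)
    moreover have "PG.D W - Kg W : Fil (length w)" using PG_filtration(2)[OF WB(2)] by (simp add: W_def)
    ultimately have "(PG.D W - Kg W) - (PG.D W - F (DA.Dlw w)) : Fil (length w)"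
      using UG.E.subspace_diff[OF Fil_subspace] by (simp only: Fd)
    thus ?thesis by (simp add: K)
  qed
  obtain P where P: "lin lscale lscale P" "!!x. x : car UG.QQ ==> P (PhiG x) = psiU x"
    by (rule UG.E.extend_linear[of lscale psiU, OF TP.EA.vector_space_axioms psi_add psi_smult]) (assumption+, rule that)
  have Pl: "P (x + y) = P x + P y" "P (lscale c x) = lscale c (P x)" for x y c
    using P(1) by (simp_all add: lin_iff)
  have P0: "P 0 = 0" using Pl(2)[of 0 0] by simp
  \<comment> \<open>\<open>F\<close> after \<open>P\<close> is the identity up to lower filtration.
    An element with \<open>P\<close>-image 0 therefore drops through all filtration steps to
    0.\<close>
  have step: "F (P y) - y : Fil n" if "y : Fil (Suc n)" for y n
    using that unfolding Fil_def[of "Suc n"]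
  proof (induction rule: UG.E.span_induct_alt)
    case base
    thus ?case using UG.E.subspace_0[OF Fil_subspace] by (simp add: P0 F0)
  next
    case (step c a b)
    then obtain w where w: "a = PhiG (UG.mon w)" "w : lists Bg" "length w < Suc n" by blast
    have "F (P a) - a : Fil n"
      using lead[OF w(2)] Fil_mono[of "length w" n] w by (auto simp: P(2) psi_mon)
    moreover have "F (P (lscale c a + b)) - (lscale c a + b) = lscale c (F (P a) - a) + (F (P b) - b)"
      by (simp add: Pl Fl UG.E.scale_right_diff_distrib)
    ultimately show ?case
      using step UG.E.subspace_add[OF Fil_subspace] UG.E.subspace_scale[OF Fil_subspace] by (simp only:)
  qed
  have "EX n. PhiG x : Fil n" using UG.carrier_span[OF x]
  proof (induction rule: UG.E.span_induct_alt)
    case base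
    thus ?case using UG.E.subspace_0[OF Fil_subspace] by blast
  next
    case (step c a b)
    then obtain w n where w: "a = PhiG (UG.mon w)" "w : lists Bg" and n: "b : Fil n" by blast
    have "a : Fil (Suc (length w) + n)" unfolding w(1) using w by (intro Fil_mon) auto
    moreover have "b : Fil (Suc (length w) + n)" using n Fil_mono[of n "Suc (length w) + n"] by auto
    ultimately show ?case using UG.E.subspace_add[OF Fil_subspace] UG.E.subspace_scale[OF Fil_subspace] by blast
  qed
  then obtain n where "PhiG x : Fil n" by blast
  hence "PhiG x = 0"
  proof (induction n)
    case 0
    thus ?case by (simp add: Fil_def)
  next
    case (Suc n)
    have "- PhiG x : Fil n" using step[OF Suc.prems] by (simp add: P(2)[OF x] z F0)
    hence "PhiG x : Fil n" using UG.E.subspace_neg[OF Fil_subspace] by fastforce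
    thus ?case by (rule Suc.IH)
  qed
  thus ?thesis using UG.E.emb_eq_zero[OF x] by simp
qed

lemma trivial_case:
  assumes "oC = \<zero>[CT.QQ]" and "a : DR.AA"
  shows "a = 0"
proof -
  have "Phi x = 0" if "x : car TP.AA" for x using that
  proof (induction rule: TP.AA_induct)
    case (tens a b)
    have "b = b \<otimes>[CT.QQ] oC" using tens by simp
    hence "b = \<zero>[CT.QQ]" using tens assms(1) by simp
    thus ?case using tens by (simp add: TP.tens_zero TP.EA.emb_zero)
  qed (simp_all add: TP.EA.emb_add TP.EA.emb_smult)
  thus ?thesis using assms(2) unfolding AA_eq by blast
qed

text \<open>Being central in \<open>U(\<gg>)\<close> is tested on generators after applying
  \<open>psiU\<close>, where it reads as invariance. Injectivity carries the identities
  back.\<close>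

lemma centre_iff:
  assumes nz: "oC ~= \<zero>[CT.QQ]" and x: "x : car UG.QQ"
  shows "x : eps_centre ep UG.QQ UG.grQ \<longleftrightarrow> psiU x : DA.invs"
proof
  assume c: "x : eps_centre ep UG.QQ UG.grQ"
  show "psiU x : DA.invs"
  proof (rule DA.invsI[OF psi_AA[OF x]])
    fix c z assume z: "z : gg c"
    have "x \<otimes>[UG.QQ] UG.iQ z = twisted_flip ep UG.QQ UG.grQ x (UG.iQ z)" using c by (simp add: eps_centre_def)
    hence "psiU (x \<otimes>[UG.QQ] UG.iQ z) = psiU (twisted_flip ep UG.QQ UG.grQ x (UG.iQ z))" by (rule arg_cong)
    thus "psiU x * DR.Dl z = DR.Dl z * tau (- c) (psiU x)"
      unfolding psi_flip[OF x UG.iQ_gr[OF z]] psi_mult[OF x UG.iQ_closed] psi_iQ .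
  qed
next
  assume i: "psiU x : DA.invs"
  have inj: "a = b" if "a : car UG.QQ" "b : car UG.QQ" "psiU a = psiU b" for a b
  proof -
    have "psiU (a \<ominus>[UG.QQ] b) + psiU b = psiU a" using that(1,2) by (simp flip: psi_add add: UG.Q.minus_eq UG.Q.a_assoc UG.Q.l_neg)
    hence "a \<ominus>[UG.QQ] b = \<zero>[UG.QQ]" using that by (intro psi_inj[OF nz]) simp_all
    thus ?thesis using UG.E.emb_minus[OF that(1,2)] UG.E.emb_eq[OF that(1,2)] by (simp add: UG.E.emb_zero)
  qed
  have hom: "x \<otimes>[UG.QQ] y = twisted_flip ep UG.QQ UG.grQ x y" if y: "y : UG.grQ d" for y d
  proof -
    have yc: "y : car UG.QQ" using y by (rule UG.G.gr_closed)
    show ?thesis using invs_psi[OF i y] x yc UG.G.twisted_flip_closed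
      by (intro inj) (simp_all add: psi_flip[OF x y] psi_mult)
  qed
  have "x \<otimes>[UG.QQ] y = twisted_flip ep UG.QQ UG.grQ x y" if "y : car UG.QQ" for y using that
  proof (induction rule: UG.G.homog_induct)
    case (hom i y)
    thus ?case by (rule \<open>!!y d. y : UG.grQ d ==> x \<otimes>[UG.QQ] y = twisted_flip ep UG.QQ UG.grQ x y\<close>)
  next
    case (add y y')
    have "PhiG (x \<otimes>[UG.QQ] (y \<oplus>[UG.QQ] y')) = PhiG (twisted_flip ep UG.QQ UG.grQ x (y \<oplus>[UG.QQ] y'))"
      unfolding UG.G.flip_add_right[OF x add(1,2)] add(3,4)[symmetric] using x add(1,2) by (simp add: UG.Q.r_distr UG.E.emb_add)
    thus ?case using UG.E.emb_eq x add(1,2) UG.G.twisted_flip_closed by simp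
  qed
  thus "x : eps_centre ep UG.QQ UG.grQ" using x by (simp add: eps_centre_def)
qed

lemma centre_image: "Phi ` centre_Delta X E = DA.WW \<inter> DA.invs" and centre_closed: "centre_Delta X E <= car TP.AA"
proof -
  have cd: "centre_Delta X E = Delta X E ` eps_centre ep UG.QQ UG.grQ"
    by (simp add: centre_Delta_def env_g_eq env_g_grading_eq)
  have sub: "eps_centre ep UG.QQ UG.grQ <= car UG.QQ" by (auto simp: eps_centre_def)
  thus "centre_Delta X E <= car TP.AA" unfolding cd using Delta_eq(1) by blast
  have im: "Phi ` centre_Delta X E = psiU ` eps_centre ep UG.QQ UG.grQ"
    unfolding cd image_image using sub Delta_eq(2) by (intro image_cong) auto
  show "Phi ` centre_Delta X E = DA.WW \<inter> DA.invs"
  proof (cases "oC = \<zero>[CT.QQ]")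
    case False
    have "psiU ` eps_centre ep UG.QQ UG.grQ = psiU ` car UG.QQ \<inter> DA.invs"
      using centre_iff[OF False] sub by blast
    thus ?thesis unfolding im psi_image .
  next
    case True
    have "\<zero>[UG.QQ] : eps_centre ep UG.QQ UG.grQ"
    proof -
      have "\<zero>[UG.QQ] \<otimes>[UG.QQ] y = twisted_flip ep UG.QQ UG.grQ \<zero>[UG.QQ] y" if y: "y : car UG.QQ" for y
        using UG.G.flip_homog_left[OF UG.G.gr_zero[of 0] y, of ep] y UG.E.emb_eq_zero[OF UG.G.twisted_flip_closed[OF UG.Q.zero_closed y]]
        by (simp add: UG.E.emb_zero)
      thus ?thesis by (simp add: eps_centre_def)
    qed
    hence "0 : psiU ` eps_centre ep UG.QQ UG.grQ" using psi_zero by force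
    moreover have "psiU ` eps_centre ep UG.QQ UG.grQ <= {0}" using trivial_case[OF True psi_AA] sub by blast
    moreover have "DA.WW \<inter> DA.invs <= {0}" using trivial_case[OF True DA.WW_AA] by blast
    moreover have "0 : DA.WW \<inter> DA.invs" using TP.EA.subspace_0[OF DA.WW_subspace] TP.EA.subspace_0[OF DA.inv_subspace] by blast
    ultimately have "psiU ` eps_centre ep UG.QQ UG.grQ = {0}" "DA.WW \<inter> DA.invs = {0}" by (simp_all only: subset_singleton_iff) (metis empty_iff)+
    thus ?thesis unfolding im by simp
  qed
qed

lemma invs_Phi: "b : DA.invs ==> EX a:invariants X E. Phi a = b"
  using DA.inv_AA[of b] unfolding AA_eq by (auto simp: invariants_iff)

theorem cohomology:
  "ker_diff X E = centre_Delta X E <+>\<^bsub>dirac_algebra X\<^esub> im_diff X E & centre_Delta X E \<inter> im_diff X E = {\<zero>\<^bsub>dirac_algebra X\<^esub>}"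
  unfolding dirac_algebra_eq
proof
  have sa: "a : centre_Delta X E <+>\<^bsub>TP.AA\<^esub> im_diff X E \<longleftrightarrow> (EX c:centre_Delta X E. EX b:invariants X E. a = c \<oplus>[TP.AA] dirac_diff X E b)" for a
    by (auto simp: set_add_def' im_diff_def)
  have ker: "a : ker_diff X E \<longleftrightarrow> a : car TP.AA & Phi a : DA.invs & DA.dd (Phi a) = 0" for a
    using dirac_diff_eq[of a] TP.EA.emb_eq_zero[of "dirac_diff X E a"] by (auto simp: ker_diff_def invariants_iff dirac_algebra_eq)
  show "ker_diff X E = centre_Delta X E <+>\<^bsub>TP.AA\<^esub> im_diff X E"
  proof (intro equalityI subsetI)
    fix a assume "a : ker_diff X E"
    hence a: "a : car TP.AA" "Phi a : DA.invs" "DA.dd (Phi a) = 0" by (auto simp: ker)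
    obtain u b where u: "u : DA.WW" "u : DA.invs" "b : DA.invs" "Phi a = u + DA.dd b"
      by (rule DA.cocycle_decomposition[OF a(2,3)]) (rule that)
    have "u : Phi ` centre_Delta X E" using u(1,2) by (simp add: centre_image)
    then obtain c where c: "c : centre_Delta X E" "u = Phi c" by blast
    obtain b' where b': "b' : invariants X E" "Phi b' = b" using invs_Phi[OF u(3)] by blast
    have cc: "c : car TP.AA" "b' : car TP.AA" using c centre_closed b' invariants_iff by blast+
    have "a = c \<oplus>[TP.AA] dirac_diff X E b'"
      using TP.EA.emb_eq[of a "c \<oplus>[TP.AA] dirac_diff X E b'"] a cc dirac_diff_eq[OF cc(2)] u(4) c(2) b'(2) by (simp add: TP.EA.emb_add)
    thus "a : centre_Delta X E <+>\<^bsub>TP.AA\<^esub> im_diff X E" using sa c b' by blast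
  next
    fix a assume "a : centre_Delta X E <+>\<^bsub>TP.AA\<^esub> im_diff X E"
    then obtain c b where c: "c : centre_Delta X E" and b: "b : invariants X E" and a: "a = c \<oplus>[TP.AA] dirac_diff X E b"
      using sa by blast
    have cc: "c : car TP.AA" "b : car TP.AA" using c centre_closed b invariants_iff by blast+
    have "Phi c : DA.WW \<inter> DA.invs" using c centre_image by blast
    hence w: "Phi c : DA.WW" "Phi c : DA.invs" by auto
    have bi: "Phi b : DA.invs" using b invariants_iff by blast
    have "Phi a = Phi c + DA.dd (Phi b)" using cc dirac_diff_eq[OF cc(2)] by (simp add: a TP.EA.emb_add)
    moreover have "Phi c + DA.dd (Phi b) : DA.invs" by (intro DA.inv_add w DA.inv_dd bi)
    moreover have "DA.dd (Phi c + DA.dd (Phi b)) = 0" by (simp add: DA.dd_rules DA.dd_WW[OF w(1)] DA.dd_dd_inv[OF bi])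
    ultimately show "a : ker_diff X E" using cc dirac_diff_eq[OF cc(2)] by (simp add: ker a)
  qed
  show "centre_Delta X E \<inter> im_diff X E = {\<zero>[TP.AA]}"
  proof (intro equalityI subsetI)
    fix z assume "z : centre_Delta X E \<inter> im_diff X E"
    then obtain b where z: "z : centre_Delta X E" and b: "b : invariants X E" "z = dirac_diff X E b" by (auto simp: im_diff_def)
    have bc: "b : car TP.AA" "Phi b : DA.invs" using b invariants_iff by blast+
    have "Phi z : DA.WW" using z centre_image by blast
    hence "DA.dd (Phi b) : DA.WW" by (simp add: b(2) dirac_diff_eq(1)[OF bc(1)])
    hence "Phi z = 0" using DA.coboundary_meets_zero[OF _ bc(2)] dirac_diff_eq(1)[OF bc(1)] b(2) by simp
    thus "z : {\<zero>[TP.AA]}" using TP.EA.emb_eq_zero[of z] z centre_closed by auto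
  next
    fix z assume "z : {\<zero>[TP.AA]}"
    hence z: "z = \<zero>[TP.AA]" by simp
    have "0 : DA.WW \<inter> DA.invs" using TP.EA.subspace_0[OF DA.WW_subspace] TP.EA.subspace_0[OF DA.inv_subspace] by blast
    hence "0 : Phi ` centre_Delta X E" by (simp add: centre_image)
    hence 1: "z : centre_Delta X E" using z TP.EA.emb_eq_zero centre_closed by auto
    have 2: "\<zero>[TP.AA] : invariants X E" using TP.EA.subspace_0[OF DA.inv_subspace] by (simp add: invariants_iff TP.EA.emb_zero)
    have "dirac_diff X E \<zero>[TP.AA] = z"
      using dirac_diff_eq[OF TP.A.zero_closed] TP.EA.emb_eq_zero z by (simp add: TP.EA.emb_zero DA.dd_rules)
    thus "z : centre_Delta X E \<inter> im_diff X E" using 1 2 by (auto simp: im_diff_def)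
  qed
qed

end

theorem theorem3:
  fixes X :: "('k::field_char_0, 'c::ab_group_add, 'g::ab_group_add, 'v::ab_group_add) colour_rep"
    and E :: "'v set"
  assumes "commutation_factor (eps X)"
    and "quadratic_colour_lie_algebra (eps X) (g_scale X) (g_grading X) (g_bracket X) (g_form X)"
    and "graded_space.finite_dim (g_scale X)"
    and "orthogonal_representation (eps X) (g_scale X) (g_grading X) (g_bracket X)
           (V_scale X) (V_grading X) (V_form X) (action X)"
    and "graded_space.finite_dim (V_scale X)"
    and "vector_space.dim (V_scale X) (UNIV :: 'v set) \<ge> 2"
    and "colour_lie_type (eps X) (g_scale X) (g_grading X) (g_bracket X) (g_form X)
           (V_scale X) (V_grading X) (V_form X) (action X) (V_mult X)"
    and "graded_space.homogeneous_basis (V_scale X) (V_grading X) E"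
  shows "ker_diff X E = centre_Delta X E <+>\<^bsub>dirac_algebra X\<^esub> im_diff X E \<and>
    centre_Delta X E \<inter> im_diff X E = {\<zero>\<^bsub>dirac_algebra X\<^esub>}"
proof -
  interpret dirac_setting X E by (rule dirac_setting.intro[OF assms(1-5,7,8)])
  show ?thesis by (rule cohomology)
qed

end
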